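(* Let $i\colon\mathcal{B}\to\mathcal{A}$ be a non-split expansion of abelian categories. The functor $i$ induces a bijection $$\Sigma_0(\mathcal{B})\smallsetminus\{\bar S\}\xrightarrow{\ \sim\ }\Sigma_0(\mathcal{A})\smallsetminus\{S_\lambda,S_\rho\},$$ and for each pair $U,V\in\Sigma_0(\mathcal{B})\smallsetminus\{\bar S\}$ the following identities hold: $$\delta_{iU,iV}=\delta_{U,V},\quad \delta_{iU,S_\lambda}=\delta_{U,\bar S},\quad \delta_{S_\rho,iV}=\delta_{\bar S,V},\quad \delta_{S_\rho,S_\lambda}=\delta_{\bar S,\bar S},\quad \delta_{S_\lambda,S_\rho}=(1,1).$$
   Context: Perpendicular categories: for a class $\mathcal{C}$ of objects in an abelian category $\mathcal{A}$, $\mathcal{C}^\perp$ (resp. ${}^\perp\mathcal{C}$) is the full subcategory of all $A\in\mathcal{A}$ with $\operatorname{Hom}_{\mathcal{A}}(C,A)=0=\operatorname{Ext}^1_{\mathcal{A}}(C,A)$ (resp. $\operatorname{Hom}_{\mathcal{A}}(A,C)=0=\operatorname{Ext}^1_{\mathcal{A}}(A,C)$) for all $C\in\mathcal{C}$. $\operatorname{Ext}^n$ denotes Yoneda Ext. Expansions: a fully faithful exact functor $i\colon\mathcal{B}\to\mathcal{A}$ between abelian categories (with $\mathcal{B}$ identified with its essential image in $\mathcal{A}$) is a left expansion if (E1) it admits an exact left adjoint; (E2) ${}^\perp\mathcal{B}$ is equivalent to $\operatorname{mod}\Delta$, the category of finitely generated right $\Delta$-modules, for some division ring $\Delta$; (E3)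 $\operatorname{Ext}^2_{\mathcal{A}}(A,B)=0$ for all $A,B\in{}^\perp\mathcal{B}$. It is a right expansion if the dual conditions hold: it admits an exact right adjoint, $\mathcal{B}^\perp$ is equivalent to $\operatorname{mod}\Delta$ for some division ring $\Delta$, and $\operatorname{Ext}^2_{\mathcal{A}}(A,B)=0$ for all $A,B\in\mathcal{B}^\perp$. It is an expansion if it is both. An expansion is split if $\mathcal{B}^\perp={}^\perp\mathcal{B}$, and non-split otherwise. Notation: $i_\lambda$ and $i_\rho$ denote the left and right adjoint of $i$; $S_\lambda$ is an indecomposable object of ${}^\perp\mathcal{B}$ and $S_\rho$ an indecomposable object of $\mathcal{B}^\perp$ (each unique up to isomorphism; both are simple in $\mathcal{A}$); $\bar S=i_\lambda(S_\rho)$, which is a simple object of $\mathcal{B}$ when the expansion is non-split. Ext-quiver: $\Sigma_0(\mathcal{A})$ is a fixed set of representatives of the isomorphism classes of simple objects in $\mathcal{A}$ (simple objects are identified with their representatives). For a simple object $S$, $\Delta(S)$ denotes its endomorphism division ring. For simple $S,T$, the valuation is $\delta_{S,T}=(s,t)$ with $s=\dim_{\Delta(S)}\operatorname{Ext}^1_{\mathcal{A}}(S,T)$ and $t=\dim_{\Delta(T)^{\mathrm{op}}}\operatorname{Ext}^1_{\mathcal{A}}(S,T)$; $\delta_{S,T}=(0,0)$ if $\operatorname{Ext}^1_{\mathcal{A}}(S,T)=0$. The same notation is used for $\mathcal{B}$. *)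

theory Defs
  imports "HOL-Algebra.Module"
begin

section \<open>Categories\<close>

record ('o, 'm) category =
  Obj :: "'o set"
  Arr :: "'m set"
  src :: "'m \<Rightarrow> 'o"
  tgt :: "'m \<Rightarrow> 'o"
  ident :: "'o \<Rightarrow> 'm"
  cmp :: "'m \<Rightarrow> 'm \<Rightarrow> 'm"  (infixr \<open>\<cdot>\<index>\<close> 75)

definition Hom :: "('o, 'm, 'x) category_scheme \<Rightarrow> 'o \<Rightarrow> 'o \<Rightarrow> 'm set" where
  "Hom C X Y = {f \<in> Arr C. src C f = X \<and> tgt C f = Y}"

locale category =
  fixes C :: "('o, 'm, 'x) category_scheme" (structure)
  assumes src_in: "f \<in> Arr C \<Longrightarrow> src C f \<in> Obj C"
    and tgt_in: "f \<in> Arr C \<Longrightarrow> tgt C f \<in> Obj C"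
    and ident_in: "X \<in> Obj C \<Longrightarrow> ident C X \<in> Hom C X X"
    and cmp_in: "\<lbrakk>f \<in> Hom C X Y; g \<in> Hom C Y Z\<rbrakk> \<Longrightarrow> g \<cdot> f \<in> Hom C X Z"
    and cmp_assoc: "\<lbrakk>f \<in> Hom C W X; g \<in> Hom C X Y; h \<in> Hom C Y Z\<rbrakk>
      \<Longrightarrow> (h \<cdot> g) \<cdot> f = h \<cdot> (g \<cdot> f)"
    and ident_left: "f \<in> Hom C X Y \<Longrightarrow> ident C Y \<cdot> f = f"
    and ident_right: "f \<in> Hom C X Y \<Longrightarrow> f \<cdot> ident C X = f"

definition iso_arr :: "('o, 'm, 'x) category_scheme \<Rightarrow> 'm \<Rightarrow> bool" where
  "iso_arr C f \<longleftrightarrow> f \<in> Arr C \<and>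
    (\<exists>g \<in> Hom C (tgt C f) (src C f).
      g \<cdot>\<^bsub>C\<^esub> f = ident C (src C f) \<and> f \<cdot>\<^bsub>C\<^esub> g = ident C (tgt C f))"

definition isomorphic :: "('o, 'm, 'x) category_scheme \<Rightarrow> 'o \<Rightarrow> 'o \<Rightarrow> bool" where
  "isomorphic C X Y \<longleftrightarrow> X \<in> Obj C \<and> Y \<in> Obj C \<and> (\<exists>f \<in> Hom C X Y. iso_arr C f)"

definition monic :: "('o, 'm, 'x) category_scheme \<Rightarrow> 'm \<Rightarrow> bool" where
  "monic C f \<longleftrightarrow> f \<in> Arr C \<and>
    (\<forall>X. \<forall>g \<in> Hom C X (src C f). \<forall>h \<in> Hom C X (src C f).
      f \<cdot>\<^bsub>C\<^esub> g = f \<cdot>\<^bsub>C\<^esub> h \<longrightarrow> g = h)"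

definition epic :: "('o, 'm, 'x) category_scheme \<Rightarrow> 'm \<Rightarrow> bool" where
  "epic C f \<longleftrightarrow> f \<in> Arr C \<and>
    (\<forall>X. \<forall>g \<in> Hom C (tgt C f) X. \<forall>h \<in> Hom C (tgt C f) X.
      g \<cdot>\<^bsub>C\<^esub> f = h \<cdot>\<^bsub>C\<^esub> f \<longrightarrow> g = h)"

definition zero_obj :: "('o, 'm, 'x) category_scheme \<Rightarrow> 'o \<Rightarrow> bool" where
  "zero_obj C Z \<longleftrightarrow> Z \<in> Obj C \<and>
    (\<forall>X \<in> Obj C. (\<exists>!f. f \<in> Hom C Z X) \<and> (\<exists>!f. f \<in> Hom C X Z))"

definition full_subcategory ::
    "('o, 'm, 'x) category_scheme \<Rightarrow> 'o set \<Rightarrow> ('o, 'm, 'x) category_scheme" where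
  "full_subcategory C P = C\<lparr>Obj := Obj C \<inter> P, Arr := {f \<in> Arr C. src C f \<in> P \<and> tgt C f \<in> P}\<rparr>"

section \<open>Functors, adjunctions and equivalences\<close>

record ('o1, 'm1, 'o2, 'm2) cat_functor =
  obmap :: "'o1 \<Rightarrow> 'o2"
  armap :: "'m1 \<Rightarrow> 'm2"

definition is_functor :: "('o1, 'm1, 'x1) category_scheme \<Rightarrow> ('o2, 'm2, 'x2) category_scheme \<Rightarrow>
    ('o1, 'm1, 'o2, 'm2) cat_functor \<Rightarrow> bool" where
  "is_functor C D F \<longleftrightarrow>
    (\<forall>X \<in> Obj C. obmap F X \<in> Obj D \<and> armap F (ident C X) = ident D (obmap F X)) \<and>
    (\<forall>X Y. \<forall>f \<in> Hom C X Y. armap F f \<in> Hom D (obmap F X) (obmap F Y)) \<and>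
    (\<forall>X Y Z. \<forall>f \<in> Hom C X Y. \<forall>g \<in> Hom C Y Z.
      armap F (g \<cdot>\<^bsub>C\<^esub> f) = armap F g \<cdot>\<^bsub>D\<^esub> armap F f)"

definition id_functor :: "('o, 'm, 'o, 'm) cat_functor" where
  "id_functor = \<lparr>obmap = \<lambda>X. X, armap = \<lambda>f. f\<rparr>"

definition comp_functor :: "('o2, 'm2, 'o3, 'm3) cat_functor \<Rightarrow> ('o1, 'm1, 'o2, 'm2) cat_functor \<Rightarrow>
    ('o1, 'm1, 'o3, 'm3) cat_functor" where
  "comp_functor G F = \<lparr>obmap = obmap G \<circ> obmap F, armap = armap G \<circ> armap F\<rparr>"

definition fully_faithful :: "('o1, 'm1, 'x1) category_scheme \<Rightarrow> ('o2, 'm2, 'x2) category_scheme \<Rightarrow>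
    ('o1, 'm1, 'o2, 'm2) cat_functor \<Rightarrow> bool" where
  "fully_faithful C D F \<longleftrightarrow> is_functor C D F \<and>
    (\<forall>X \<in> Obj C. \<forall>Y \<in> Obj C.
      bij_betw (armap F) (Hom C X Y) (Hom D (obmap F X) (obmap F Y)))"

definition ess_image :: "('o1, 'm1, 'x1) category_scheme \<Rightarrow> ('o2, 'm2, 'x2) category_scheme \<Rightarrow>
    ('o1, 'm1, 'o2, 'm2) cat_functor \<Rightarrow> 'o2 set" where
  "ess_image C D F = {Y \<in> Obj D. \<exists>X \<in> Obj C. isomorphic D (obmap F X) Y}"

definition nat_trans :: "('o1, 'm1, 'x1) category_scheme \<Rightarrow> ('o2, 'm2, 'x2) category_scheme \<Rightarrow>
    ('o1, 'm1, 'o2, 'm2) cat_functor \<Rightarrow> ('o1, 'm1, 'o2, 'm2) cat_functor \<Rightarrow> ('o1 \<Rightarrow> 'm2) \<Rightarrow> bool" where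
  "nat_trans C D F G \<eta> \<longleftrightarrow>
    (\<forall>X \<in> Obj C. \<eta> X \<in> Hom D (obmap F X) (obmap G X)) \<and>
    (\<forall>X Y. \<forall>f \<in> Hom C X Y. \<eta> Y \<cdot>\<^bsub>D\<^esub> armap F f = armap G f \<cdot>\<^bsub>D\<^esub> \<eta> X)"

definition nat_iso :: "('o1, 'm1, 'x1) category_scheme \<Rightarrow> ('o2, 'm2, 'x2) category_scheme \<Rightarrow>
    ('o1, 'm1, 'o2, 'm2) cat_functor \<Rightarrow> ('o1, 'm1, 'o2, 'm2) cat_functor \<Rightarrow> ('o1 \<Rightarrow> 'm2) \<Rightarrow> bool" where
  "nat_iso C D F G \<eta> \<longleftrightarrow> nat_trans C D F G \<eta> \<and> (\<forall>X \<in> Obj C. iso_arr D (\<eta> X))"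

definition equivalent ::
    "('o1, 'm1, 'x1) category_scheme \<Rightarrow> ('o2, 'm2, 'x2) category_scheme \<Rightarrow> bool" where
  "equivalent C D \<longleftrightarrow> (\<exists>F G \<eta> \<epsilon>. is_functor C D F \<and> is_functor D C G \<and>
    nat_iso C C id_functor (comp_functor G F) \<eta> \<and>
    nat_iso D D (comp_functor F G) id_functor \<epsilon>)"

text \<open>\<open>adjoint C D F G\<close>: the functor \<open>F\<close> from \<open>C\<close> to \<open>D\<close> is left adjoint to \<open>G\<close>.\<close>

definition adjoint :: "('o1, 'm1, 'x1) category_scheme \<Rightarrow> ('o2, 'm2, 'x2) category_scheme \<Rightarrow>
    ('o1, 'm1, 'o2, 'm2) cat_functor \<Rightarrow> ('o2, 'm2, 'o1, 'm1) cat_functor \<Rightarrow> bool" where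
  "adjoint C D F G \<longleftrightarrow> is_functor C D F \<and> is_functor D C G \<and>
    (\<exists>\<eta> \<epsilon>. nat_trans C C id_functor (comp_functor G F) \<eta> \<and>
      nat_trans D D (comp_functor F G) id_functor \<epsilon> \<and>
      (\<forall>X \<in> Obj C. \<epsilon> (obmap F X) \<cdot>\<^bsub>D\<^esub> armap F (\<eta> X) = ident D (obmap F X)) \<and>
      (\<forall>Y \<in> Obj D. armap G (\<epsilon> Y) \<cdot>\<^bsub>C\<^esub> \<eta> (obmap G Y) = ident C (obmap G Y)))"

section \<open>Abelian categories\<close>

record ('o, 'm) additive_category = "('o, 'm) category" +
  madd :: "'m \<Rightarrow> 'm \<Rightarrow> 'm"  (infixl \<open>\<boxplus>\<index>\<close> 65)
  mzero :: "'o \<Rightarrow> 'o \<Rightarrow> 'm"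

definition hom_group :: "('o, 'm, 'x) additive_category_scheme \<Rightarrow> 'o \<Rightarrow> 'o \<Rightarrow> 'm monoid" where
  "hom_group C X Y = \<lparr>carrier = Hom C X Y, mult = madd C, one = mzero C X Y\<rparr>"

locale preadditive_category = category C
  for C :: "('o, 'm, 'x) additive_category_scheme" (structure) +
  assumes hom_comm_group: "\<lbrakk>X \<in> Obj C; Y \<in> Obj C\<rbrakk> \<Longrightarrow> comm_group (hom_group C X Y)"
    and cmp_add_left: "\<lbrakk>f \<in> Hom C X Y; g \<in> Hom C Y Z; h \<in> Hom C Y Z\<rbrakk>
      \<Longrightarrow> (g \<boxplus> h) \<cdot> f = (g \<cdot> f) \<boxplus> (h \<cdot> f)"
    and cmp_add_right: "\<lbrakk>f \<in> Hom C X Y; g \<in> Hom C X Y; h \<in> Hom C Y Z\<rbrakk>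
      \<Longrightarrow> h \<cdot> (f \<boxplus> g) = (h \<cdot> f) \<boxplus> (h \<cdot> g)"

definition is_kernel :: "('o, 'm, 'x) additive_category_scheme \<Rightarrow> 'm \<Rightarrow> 'm \<Rightarrow> bool" where
  "is_kernel C k f \<longleftrightarrow> f \<in> Arr C \<and> k \<in> Arr C \<and> tgt C k = src C f \<and>
    f \<cdot>\<^bsub>C\<^esub> k = mzero C (src C k) (tgt C f) \<and>
    (\<forall>X. \<forall>g \<in> Hom C X (src C f). f \<cdot>\<^bsub>C\<^esub> g = mzero C X (tgt C f) \<longrightarrow>
      (\<exists>!u. u \<in> Hom C X (src C k) \<and> k \<cdot>\<^bsub>C\<^esub> u = g))"

definition is_cokernel :: "('o, 'm, 'x) additive_category_scheme \<Rightarrow> 'm \<Rightarrow> 'm \<Rightarrow> bool" where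
  "is_cokernel C c f \<longleftrightarrow> f \<in> Arr C \<and> c \<in> Arr C \<and> src C c = tgt C f \<and>
    c \<cdot>\<^bsub>C\<^esub> f = mzero C (src C f) (tgt C c) \<and>
    (\<forall>X. \<forall>g \<in> Hom C (tgt C f) X. g \<cdot>\<^bsub>C\<^esub> f = mzero C (src C f) X \<longrightarrow>
      (\<exists>!u. u \<in> Hom C (tgt C c) X \<and> u \<cdot>\<^bsub>C\<^esub> c = g))"

definition biproduct :: "('o, 'm, 'x) additive_category_scheme \<Rightarrow> 'o \<Rightarrow> 'o \<Rightarrow>
    'o \<times> 'm \<times> 'm \<times> 'm \<times> 'm \<Rightarrow> bool" where
  "biproduct C X Y = (\<lambda>(P, i, j, p, q). P \<in> Obj C \<and>
    i \<in> Hom C X P \<and> j \<in> Hom C Y P \<and> p \<in> Hom C P X \<and> q \<in> Hom C P Y \<and>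
    p \<cdot>\<^bsub>C\<^esub> i = ident C X \<and> q \<cdot>\<^bsub>C\<^esub> j = ident C Y \<and>
    q \<cdot>\<^bsub>C\<^esub> i = mzero C X Y \<and> p \<cdot>\<^bsub>C\<^esub> j = mzero C Y X \<and>
    (i \<cdot>\<^bsub>C\<^esub> p) \<boxplus>\<^bsub>C\<^esub> (j \<cdot>\<^bsub>C\<^esub> q) = ident C P)"

locale abelian_category = preadditive_category C
  for C :: "('o, 'm, 'x) additive_category_scheme" (structure) +
  assumes ex_zero_obj: "\<exists>Z. zero_obj C Z"
    and ex_biproduct: "\<lbrakk>X \<in> Obj C; Y \<in> Obj C\<rbrakk> \<Longrightarrow> \<exists>P. biproduct C X Y P"
    and ex_kernel: "f \<in> Arr C \<Longrightarrow> \<exists>k. is_kernel C k f"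
    and ex_cokernel: "f \<in> Arr C \<Longrightarrow> \<exists>c. is_cokernel C c f"
    and monic_normal: "monic C f \<Longrightarrow> \<exists>g. is_kernel C f g"
    and epic_normal: "epic C f \<Longrightarrow> \<exists>g. is_cokernel C f g"

definition short_exact :: "('o, 'm, 'x) additive_category_scheme \<Rightarrow> 'm \<Rightarrow> 'm \<Rightarrow> bool" where
  "short_exact C i p \<longleftrightarrow> is_kernel C i p \<and> is_cokernel C p i"

definition exact_functor :: "('o1, 'm1, 'x1) additive_category_scheme \<Rightarrow>
    ('o2, 'm2, 'x2) additive_category_scheme \<Rightarrow> ('o1, 'm1, 'o2, 'm2) cat_functor \<Rightarrow> bool" where
  "exact_functor C D F \<longleftrightarrow> is_functor C D F \<and>
    (\<forall>X Y. \<forall>f \<in> Hom C X Y. \<forall>g \<in> Hom C X Y.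
      armap F (f \<boxplus>\<^bsub>C\<^esub> g) = armap F f \<boxplus>\<^bsub>D\<^esub> armap F g) \<and>
    (\<forall>i p. short_exact C i p \<longrightarrow> short_exact D (armap F i) (armap F p))"

definition simple :: "('o, 'm, 'x) category_scheme \<Rightarrow> 'o \<Rightarrow> bool" where
  "simple C S \<longleftrightarrow> S \<in> Obj C \<and> \<not> zero_obj C S \<and>
    (\<forall>f. monic C f \<and> tgt C f = S \<longrightarrow> zero_obj C (src C f) \<or> iso_arr C f)"

definition indecomposable :: "('o, 'm, 'x) additive_category_scheme \<Rightarrow> 'o \<Rightarrow> bool" where
  "indecomposable C S \<longleftrightarrow> S \<in> Obj C \<and> \<not> zero_obj C S \<and>
    (\<forall>X \<in> Obj C. \<forall>Y \<in> Obj C. (\<exists>i j p q. biproduct C X Y (S, i, j, p, q)) \<longrightarrow>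
      zero_obj C X \<or> zero_obj C Y)"

text \<open>\<open>simple_reps C \<Sigma>\<close>: the set \<open>\<Sigma>\<close> contains exactly one object from each isomorphism
  class of simple objects; \<open>rep C \<Sigma> S\<close> is the representative of a simple object \<open>S\<close>.\<close>

definition simple_reps :: "('o, 'm, 'x) category_scheme \<Rightarrow> 'o set \<Rightarrow> bool" where
  "simple_reps C \<Sigma> \<longleftrightarrow> (\<forall>S \<in> \<Sigma>. simple C S) \<and>
    (\<forall>S. simple C S \<longrightarrow> (\<exists>!T. T \<in> \<Sigma> \<and> isomorphic C S T))"

definition rep :: "('o, 'm, 'x) category_scheme \<Rightarrow> 'o set \<Rightarrow> 'o \<Rightarrow> 'o" where
  "rep C \<Sigma> S = (THE T. T \<in> \<Sigma> \<and> isomorphic C S T)"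

section \<open>Yoneda Ext\<close>

text \<open>\<open>extensions C X Y\<close> consists of the short exact sequences \<open>0 \<rightarrow> Y \<rightarrow> E \<rightarrow> X \<rightarrow> 0\<close>, given by
  their two non-trivial arrows. A morphism of such sequences with end components \<open>b\<close> (on the
  left) and \<open>a\<close> (on the right) is an arrow between the middle terms making both squares commute.\<close>

definition extensions :: "('o, 'm, 'x) additive_category_scheme \<Rightarrow> 'o \<Rightarrow> 'o \<Rightarrow> ('m \<times> 'm) set" where
  "extensions C X Y = {(i, p). short_exact C i p \<and> src C i = Y \<and> tgt C p = X}"

definition ext_morphism :: "('o, 'm, 'x) additive_category_scheme \<Rightarrow>
    'm \<times> 'm \<Rightarrow> 'm \<times> 'm \<Rightarrow> 'm \<Rightarrow> 'm \<Rightarrow> bool" where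
  "ext_morphism C = (\<lambda>(i, p) (i', p') b a. \<exists>e \<in> Hom C (tgt C i) (tgt C i').
    e \<cdot>\<^bsub>C\<^esub> i = i' \<cdot>\<^bsub>C\<^esub> b \<and> p' \<cdot>\<^bsub>C\<^esub> e = a \<cdot>\<^bsub>C\<^esub> p)"

text \<open>By the five lemma, a morphism of extensions with identities at both ends is invertible, so
  no equivalence closure is needed for one-fold extensions.\<close>

definition ext_cong :: "('o, 'm, 'x) additive_category_scheme \<Rightarrow> 'o \<Rightarrow> 'o \<Rightarrow>
    (('m \<times> 'm) \<times> ('m \<times> 'm)) set" where
  "ext_cong C X Y = {(E, E'). E \<in> extensions C X Y \<and> E' \<in> extensions C X Y \<and>
    ext_morphism C E E' (ident C Y) (ident C X)}"

definition Ext1 :: "('o, 'm, 'x) additive_category_scheme \<Rightarrow> 'o \<Rightarrow> 'o \<Rightarrow> ('m \<times> 'm) set set" where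
  "Ext1 C X Y = extensions C X Y // ext_cong C X Y"

definition bip :: "('o, 'm, 'x) additive_category_scheme \<Rightarrow> 'o \<Rightarrow> 'o \<Rightarrow> 'o \<times> 'm \<times> 'm \<times> 'm \<times> 'm" where
  "bip C X Y = (SOME P. biproduct C X Y P)"

definition inj1 :: "('o, 'm, 'x) additive_category_scheme \<Rightarrow> 'o \<Rightarrow> 'o \<Rightarrow> 'm" where
  "inj1 C X Y = (case bip C X Y of (P, i, j, p, q) \<Rightarrow> i)"

definition inj2 :: "('o, 'm, 'x) additive_category_scheme \<Rightarrow> 'o \<Rightarrow> 'o \<Rightarrow> 'm" where
  "inj2 C X Y = (case bip C X Y of (P, i, j, p, q) \<Rightarrow> j)"

definition prj1 :: "('o, 'm, 'x) additive_category_scheme \<Rightarrow> 'o \<Rightarrow> 'o \<Rightarrow> 'm" where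
  "prj1 C X Y = (case bip C X Y of (P, i, j, p, q) \<Rightarrow> p)"

definition prj2 :: "('o, 'm, 'x) additive_category_scheme \<Rightarrow> 'o \<Rightarrow> 'o \<Rightarrow> 'm" where
  "prj2 C X Y = (case bip C X Y of (P, i, j, p, q) \<Rightarrow> q)"

definition dsum :: "('o, 'm, 'x) additive_category_scheme \<Rightarrow> 'm \<Rightarrow> 'm \<Rightarrow> 'm" where
  "dsum C f g =
    (inj1 C (tgt C f) (tgt C g) \<cdot>\<^bsub>C\<^esub> f \<cdot>\<^bsub>C\<^esub> prj1 C (src C f) (src C g)) \<boxplus>\<^bsub>C\<^esub>
    (inj2 C (tgt C f) (tgt C g) \<cdot>\<^bsub>C\<^esub> g \<cdot>\<^bsub>C\<^esub> prj2 C (src C f) (src C g))"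

definition diagonal :: "('o, 'm, 'x) additive_category_scheme \<Rightarrow> 'o \<Rightarrow> 'm" where
  "diagonal C X = inj1 C X X \<boxplus>\<^bsub>C\<^esub> inj2 C X X"

definition codiagonal :: "('o, 'm, 'x) additive_category_scheme \<Rightarrow> 'o \<Rightarrow> 'm" where
  "codiagonal C X = prj1 C X X \<boxplus>\<^bsub>C\<^esub> prj2 C X X"

definition ext_dsum :: "('o, 'm, 'x) additive_category_scheme \<Rightarrow> 'm \<times> 'm \<Rightarrow> 'm \<times> 'm \<Rightarrow> 'm \<times> 'm" where
  "ext_dsum C = (\<lambda>(i, p) (i', p'). (dsum C i i', dsum C p p'))"

text \<open>As in Mac Lane's \<open>Homology\<close>, the class of a pullback or pushout of an extension is
  characterised by the existence of a morphism of extensions with the appropriate end components.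
  The right-hand sides below are therefore whole congruence classes. The Baer sum of \<open>E\<^sub>1\<close> and
  \<open>E\<^sub>2\<close> is \<open>\<nabla>(E\<^sub>1 \<oplus> E\<^sub>2)\<Delta>\<close>.\<close>

definition ext_pullback :: "('o, 'm, 'x) additive_category_scheme \<Rightarrow> 'o \<Rightarrow> 'o \<Rightarrow>
    'm \<Rightarrow> ('m \<times> 'm) set \<Rightarrow> ('m \<times> 'm) set" where
  "ext_pullback C X Y f \<xi> = {E' \<in> extensions C X Y. \<exists>E \<in> \<xi>. ext_morphism C E' E (ident C Y) f}"

definition ext_pushout :: "('o, 'm, 'x) additive_category_scheme \<Rightarrow> 'o \<Rightarrow> 'o \<Rightarrow>
    'm \<Rightarrow> ('m \<times> 'm) set \<Rightarrow> ('m \<times> 'm) set" where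
  "ext_pushout C X Y g \<xi> = {E' \<in> extensions C X Y. \<exists>E \<in> \<xi>. ext_morphism C E E' g (ident C X)}"

definition baer_sum :: "('o, 'm, 'x) additive_category_scheme \<Rightarrow> 'o \<Rightarrow> 'o \<Rightarrow>
    ('m \<times> 'm) set \<Rightarrow> ('m \<times> 'm) set \<Rightarrow> ('m \<times> 'm) set" where
  "baer_sum C X Y \<xi> \<zeta> = ext_pushout C X Y (codiagonal C Y)
    (ext_pullback C X (fst (bip C Y Y)) (diagonal C X) {ext_dsum C E E' | E E'. E \<in> \<xi> \<and> E' \<in> \<zeta>})"

definition ext_zero :: "('o, 'm, 'x) additive_category_scheme \<Rightarrow> 'o \<Rightarrow> 'o \<Rightarrow> ('m \<times> 'm) set" where
  "ext_zero C X Y = ext_cong C X Y `` {(inj1 C Y X, prj2 C Y X)}"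

text \<open>\<open>extensions2 C X Y\<close> consists of the exact sequences
  \<open>0 \<rightarrow> Y \<rightarrow> E\<^sub>1 \<rightarrow> E\<^sub>2 \<rightarrow> X \<rightarrow> 0\<close> with non-trivial arrows \<open>a\<close>, \<open>b\<close>, \<open>c\<close>; exactness says that \<open>a\<close>
  is a kernel and \<open>c\<close> a cokernel of \<open>b\<close>. The Yoneda equivalence is generated by the morphisms
  with identities at both ends, and the zero class is that of \<open>0 \<rightarrow> Y = Y \<rightarrow> X = X \<rightarrow> 0\<close>, with the
  zero map in the middle.\<close>

definition extensions2 :: "('o, 'm, 'x) additive_category_scheme \<Rightarrow> 'o \<Rightarrow> 'o \<Rightarrow>
    ('m \<times> 'm \<times> 'm) set" where
  "extensions2 C X Y = {(a, b, c). is_kernel C a b \<and> is_cokernel C c b \<and> src C a = Y \<and> tgt C c = X}"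

definition ext2_step :: "('o, 'm, 'x) additive_category_scheme \<Rightarrow> 'o \<Rightarrow> 'o \<Rightarrow>
    'm \<times> 'm \<times> 'm \<Rightarrow> 'm \<times> 'm \<times> 'm \<Rightarrow> bool" where
  "ext2_step C X Y = (\<lambda>(a, b, c) (a', b', c').
    (a, b, c) \<in> extensions2 C X Y \<and> (a', b', c') \<in> extensions2 C X Y \<and>
    (\<exists>e \<in> Hom C (src C b) (src C b'). \<exists>f \<in> Hom C (tgt C b) (tgt C b').
      e \<cdot>\<^bsub>C\<^esub> a = a' \<and> b' \<cdot>\<^bsub>C\<^esub> e = f \<cdot>\<^bsub>C\<^esub> b \<and> c' \<cdot>\<^bsub>C\<^esub> f = c))"

definition ext2_cong :: "('o, 'm, 'x) additive_category_scheme \<Rightarrow> 'o \<Rightarrow> 'o \<Rightarrow>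
    (('m \<times> 'm \<times> 'm) \<times> ('m \<times> 'm \<times> 'm)) set" where
  "ext2_cong C X Y = {(E, E'). E \<in> extensions2 C X Y \<and> E' \<in> extensions2 C X Y \<and>
    equivclp (ext2_step C X Y) E E'}"

definition Ext2 :: "('o, 'm, 'x) additive_category_scheme \<Rightarrow> 'o \<Rightarrow> 'o \<Rightarrow> ('m \<times> 'm \<times> 'm) set set" where
  "Ext2 C X Y = extensions2 C X Y // ext2_cong C X Y"

definition ext2_zero :: "('o, 'm, 'x) additive_category_scheme \<Rightarrow> 'o \<Rightarrow> 'o \<Rightarrow>
    ('m \<times> 'm \<times> 'm) set" where
  "ext2_zero C X Y = ext2_cong C X Y `` {(ident C Y, mzero C Y X, ident C X)}"

section \<open>Right modules over a ring\<close>

definition division_ring :: "('r, 'x) ring_scheme \<Rightarrow> bool" where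
  "division_ring R \<longleftrightarrow> ring R \<and> Units R = carrier R - {\<zero>\<^bsub>R\<^esub>}"

definition opposite_ring :: "('r, 'x) ring_scheme \<Rightarrow> ('r, 'x) ring_scheme" where
  "opposite_ring R = R\<lparr>mult := \<lambda>r s. s \<otimes>\<^bsub>R\<^esub> r\<rparr>"

text \<open>Right modules are represented by the record type \<open>module\<close>, where \<open>r \<odot> x\<close>
  stands for the element usually written \<open>x r\<close>; the fields \<open>mult\<close> and \<open>one\<close> of the module record
  carry no meaning.\<close>

definition right_module :: "('r, 'x) ring_scheme \<Rightarrow> ('r, 'v, 'y) module_scheme \<Rightarrow> bool" where
  "right_module R M \<longleftrightarrow> ring R \<and> abelian_group M \<and>
    (\<forall>r \<in> carrier R. \<forall>x \<in> carrier M. r \<odot>\<^bsub>M\<^esub> x \<in> carrier M) \<and>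
    (\<forall>r \<in> carrier R. \<forall>s \<in> carrier R. \<forall>x \<in> carrier M.
      (r \<oplus>\<^bsub>R\<^esub> s) \<odot>\<^bsub>M\<^esub> x = r \<odot>\<^bsub>M\<^esub> x \<oplus>\<^bsub>M\<^esub> s \<odot>\<^bsub>M\<^esub> x) \<and>
    (\<forall>r \<in> carrier R. \<forall>x \<in> carrier M. \<forall>y \<in> carrier M.
      r \<odot>\<^bsub>M\<^esub> (x \<oplus>\<^bsub>M\<^esub> y) = r \<odot>\<^bsub>M\<^esub> x \<oplus>\<^bsub>M\<^esub> r \<odot>\<^bsub>M\<^esub> y) \<and>
    (\<forall>r \<in> carrier R. \<forall>s \<in> carrier R. \<forall>x \<in> carrier M.
      (r \<otimes>\<^bsub>R\<^esub> s) \<odot>\<^bsub>M\<^esub> x = s \<odot>\<^bsub>M\<^esub> (r \<odot>\<^bsub>M\<^esub> x)) \<and>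
    (\<forall>x \<in> carrier M. \<one>\<^bsub>R\<^esub> \<odot>\<^bsub>M\<^esub> x = x)"

definition spans :: "('r, 'x) ring_scheme \<Rightarrow> ('r, 'v, 'y) module_scheme \<Rightarrow> 'v set \<Rightarrow> bool" where
  "spans R M X \<longleftrightarrow> X \<subseteq> carrier M \<and>
    (\<forall>v \<in> carrier M. \<exists>F c. finite F \<and> F \<subseteq> X \<and> c \<in> F \<rightarrow> carrier R \<and>
      v = (\<Oplus>\<^bsub>M\<^esub>x \<in> F. c x \<odot>\<^bsub>M\<^esub> x))"

definition independent :: "('r, 'x) ring_scheme \<Rightarrow> ('r, 'v, 'y) module_scheme \<Rightarrow> 'v set \<Rightarrow> bool" where
  "independent R M X \<longleftrightarrow> X \<subseteq> carrier M \<and>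
    (\<forall>F c. finite F \<and> F \<subseteq> X \<and> c \<in> F \<rightarrow> carrier R \<and>
      (\<Oplus>\<^bsub>M\<^esub>x \<in> F. c x \<odot>\<^bsub>M\<^esub> x) = \<zero>\<^bsub>M\<^esub> \<longrightarrow> (\<forall>x \<in> F. c x = \<zero>\<^bsub>R\<^esub>))"

definition basis :: "('r, 'x) ring_scheme \<Rightarrow> ('r, 'v, 'y) module_scheme \<Rightarrow> 'v set \<Rightarrow> bool" where
  "basis R M X \<longleftrightarrow> independent R M X \<and> spans R M X"

text \<open>Dimensions may be infinite, so they are cardinals in the sense of \<open>card_of\<close>; cardinals
  living on different types are compared by \<open>ordIso\<close>.\<close>

definition dim :: "('r, 'x) ring_scheme \<Rightarrow> ('r, 'v, 'y) module_scheme \<Rightarrow> 'v rel" where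
  "dim R M = card_of (SOME X. basis R M X)"

definition finitely_generated :: "('r, 'x) ring_scheme \<Rightarrow> ('r, 'v, 'y) module_scheme \<Rightarrow> bool" where
  "finitely_generated R M \<longleftrightarrow> (\<exists>X. finite X \<and> spans R M X)"

definition linear_maps :: "('r, 'x) ring_scheme \<Rightarrow> ('r, 'v, 'y) module_scheme \<Rightarrow>
    ('r, 'w, 'z) module_scheme \<Rightarrow> ('v \<Rightarrow> 'w) set" where
  "linear_maps R M N = {f \<in> carrier M \<rightarrow>\<^sub>E carrier N.
    (\<forall>x \<in> carrier M. \<forall>y \<in> carrier M. f (x \<oplus>\<^bsub>M\<^esub> y) = f x \<oplus>\<^bsub>N\<^esub> f y) \<and>
    (\<forall>r \<in> carrier R. \<forall>x \<in> carrier M. f (r \<odot>\<^bsub>M\<^esub> x) = r \<odot>\<^bsub>N\<^esub> f x)}"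

text \<open>The category of finitely generated right \<open>R\<close>-modules. The objects are the modules whose
  carrier is a set of functions \<open>nat \<Rightarrow> 'r\<close>: as a quotient of some \<open>R\<^sup>n\<close>, every finitely generated
  module has at most as many elements as this type and so is isomorphic to one of them.\<close>

type_synonym 'r fg_module = "('r, nat \<Rightarrow> 'r) module"

definition mod_category :: "'r ring \<Rightarrow>
    ('r fg_module, 'r fg_module \<times> ((nat \<Rightarrow> 'r) \<Rightarrow> nat \<Rightarrow> 'r) \<times> 'r fg_module) category" where
  "mod_category R = \<lparr>
    Obj = {M. right_module R M \<and> finitely_generated R M},
    Arr = {(M, f, N). right_module R M \<and> finitely_generated R M \<and>
      right_module R N \<and> finitely_generated R N \<and> f \<in> linear_maps R M N},
    src = (\<lambda>(M, f, N). M),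
    tgt = (\<lambda>(M, f, N). N),
    ident = (\<lambda>M. (M, \<lambda>x \<in> carrier M. x, M)),
    cmp = (\<lambda>(N', g, P) (M, f, N). (M, compose (carrier M) g f, P))\<rparr>"

section \<open>The valuation of the Ext-quiver\<close>

definition End_ring :: "('o, 'm, 'x) additive_category_scheme \<Rightarrow> 'o \<Rightarrow> 'm ring" where
  "End_ring C S = \<lparr>carrier = Hom C S S, mult = cmp C, one = ident C S,
    zero = mzero C S S, add = madd C\<rparr>"

text \<open>\<open>Ext\<^sup>1(S,T)\<close> as a right module over \<open>End(S)\<close>, acting by pullback, and as a right module over
  the opposite of \<open>End(T)\<close>, acting by pushout.\<close>

definition Ext1_right :: "('o, 'm, 'x) additive_category_scheme \<Rightarrow> 'o \<Rightarrow> 'o \<Rightarrow>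
    ('m, ('m \<times> 'm) set) module" where
  "Ext1_right C S T = \<lparr>carrier = Ext1 C S T, mult = undefined, one = undefined,
    zero = ext_zero C S T, add = baer_sum C S T, smult = ext_pullback C S T\<rparr>"

definition Ext1_left :: "('o, 'm, 'x) additive_category_scheme \<Rightarrow> 'o \<Rightarrow> 'o \<Rightarrow>
    ('m, ('m \<times> 'm) set) module" where
  "Ext1_left C S T = \<lparr>carrier = Ext1 C S T, mult = undefined, one = undefined,
    zero = ext_zero C S T, add = baer_sum C S T, smult = ext_pushout C S T\<rparr>"

definition valuation :: "('o, 'm, 'x) additive_category_scheme \<Rightarrow> 'o \<Rightarrow> 'o \<Rightarrow>
    ('m \<times> 'm) set rel \<times> ('m \<times> 'm) set rel" where
  "valuation C S T =
    (dim (End_ring C S) (Ext1_right C S T), dim (opposite_ring (End_ring C T)) (Ext1_left C S T))"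

definition same_valuation :: "'u rel \<times> 'u rel \<Rightarrow> 'v rel \<times> 'v rel \<Rightarrow> bool" where
  "same_valuation = (\<lambda>(s, t) (s', t'). (s, s') \<in> ordIso \<and> (t, t') \<in> ordIso)"

section \<open>Expansions\<close>

definition right_perp :: "('o, 'm, 'x) additive_category_scheme \<Rightarrow> 'o set \<Rightarrow> 'o set" where
  "right_perp C P = {X \<in> Obj C. \<forall>Y \<in> P.
    Hom C Y X = {mzero C Y X} \<and> Ext1 C Y X = {ext_zero C Y X}}"

definition left_perp :: "('o, 'm, 'x) additive_category_scheme \<Rightarrow> 'o set \<Rightarrow> 'o set" where
  "left_perp C P = {X \<in> Obj C. \<forall>Y \<in> P.
    Hom C X Y = {mzero C X Y} \<and> Ext1 C X Y = {ext_zero C X Y}}"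

text \<open>A division ring \<open>\<Delta>\<close> with \<open>D\<close> equivalent to \<open>mod \<Delta>\<close> is isomorphic to the endomorphism ring of
  an object of \<open>D\<close>. Hence it is no restriction to take its elements from the type of the
  arrows of \<open>D\<close>.\<close>

definition equivalent_to_mod :: "('o, 'm, 'x) category_scheme \<Rightarrow> bool" where
  "equivalent_to_mod D \<longleftrightarrow>
    (\<exists>\<Delta> :: 'm ring. division_ring \<Delta> \<and> equivalent D (mod_category \<Delta>))"

definition left_expansion :: "('b, 'g, 'y) additive_category_scheme \<Rightarrow>
    ('a, 'f, 'x) additive_category_scheme \<Rightarrow> ('b, 'g, 'a, 'f) cat_functor \<Rightarrow> bool" where
  "left_expansion B A I \<longleftrightarrow> abelian_category B \<and> abelian_category A \<and>
    fully_faithful B A I \<and> exact_functor B A I \<and>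
    (\<exists>L. exact_functor A B L \<and> adjoint A B L I) \<and>
    equivalent_to_mod (full_subcategory A (left_perp A (ess_image B A I))) \<and>
    (\<forall>X \<in> left_perp A (ess_image B A I). \<forall>Y \<in> left_perp A (ess_image B A I).
      Ext2 A X Y = {ext2_zero A X Y})"

definition right_expansion :: "('b, 'g, 'y) additive_category_scheme \<Rightarrow>
    ('a, 'f, 'x) additive_category_scheme \<Rightarrow> ('b, 'g, 'a, 'f) cat_functor \<Rightarrow> bool" where
  "right_expansion B A I \<longleftrightarrow> abelian_category B \<and> abelian_category A \<and>
    fully_faithful B A I \<and> exact_functor B A I \<and>
    (\<exists>R. exact_functor A B R \<and> adjoint B A I R) \<and>
    equivalent_to_mod (full_subcategory A (right_perp A (ess_image B A I))) \<and>
    (\<forall>X \<in> right_perp A (ess_image B A I). \<forall>Y \<in> right_perp A (ess_image B A I).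
      Ext2 A X Y = {ext2_zero A X Y})"

definition expansion :: "('b, 'g, 'y) additive_category_scheme \<Rightarrow>
    ('a, 'f, 'x) additive_category_scheme \<Rightarrow> ('b, 'g, 'a, 'f) cat_functor \<Rightarrow> bool" where
  "expansion B A I \<longleftrightarrow> left_expansion B A I \<and> right_expansion B A I"

definition split_expansion :: "('b, 'g, 'y) additive_category_scheme \<Rightarrow>
    ('a, 'f, 'x) additive_category_scheme \<Rightarrow> ('b, 'g, 'a, 'f) cat_functor \<Rightarrow> bool" where
  "split_expansion B A I \<longleftrightarrow> expansion B A I \<and>
    right_perp A (ess_image B A I) = left_perp A (ess_image B A I)"

definition nonsplit_expansion :: "('b, 'g, 'y) additive_category_scheme \<Rightarrow>
    ('a, 'f, 'x) additive_category_scheme \<Rightarrow> ('b, 'g, 'a, 'f) cat_functor \<Rightarrow> bool" where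
  "nonsplit_expansion B A I \<longleftrightarrow> expansion B A I \<and> \<not> split_expansion B A I"

end

(*
  An exact adjoint pair F -| G induces natural isomorphisms Ext(F X, Y) = Ext(X, G Y); for the left and
  right adjoints L, R of I these give all valuations that involve an object I U, once L is known to be
  bijective on End(S_r) and R on End(S_l). The left perpendicular category is the kernel of L and the
  right one that of R. As the expansion does not split, the unit S_r -> I S' is monic, where S' = L S_r;
  idempotents of its cokernel lift to I S', whose endomorphism ring is a division ring, so the cokernel
  is S_l. Everything else is read off the sequence 0 -> S_r -> I S' -> S_l -> 0. In particular
  it induces Ext(S_r, S_l) = Ext(I S', S_l) because Ext^1(S_l, S_l) = Ext^2(S_l, S_l) = 0, it spans
  Ext(S_l, S_r) from both sides, and a simple object T other than S_l, S_r lies in the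
  image of I because it is the image of a map I R T -> I L T between objects of that image.
*)

theory Submission
  imports Defs
begin

section \<open>Additive categories\<close>

text \<open>Ext is built from exact sequences alone, so naturality is reduced to producing one
  middle arrow: by \<open>pushout_eq_pullback_iff\<close>, a morphism of extensions with ends
  \<open>b\<close> and \<open>a\<close> exists exactly when the pushout along \<open>b\<close>
  equals the pullback along \<open>a\<close>. Explicit lifting and splitting replace long exact
  sequences. Ext^1(S_l, S_l) vanishes because monomorphisms split in mod Delta, and the vanishing of
  Ext^2 becomes a property of four-term sequences that every step of the Yoneda equivalence
  preserves. The hypothesis that the expansion does not split enters through one observation: a
  simple object in both perpendicular categories would force them to coincide. So S_r is not left
  perpendicular and has only zero maps to left perpendicular objects, which is why endomorphisms of
  S' restrict to S_r; dually for S_l and R. The obstacle is that I S' is not simple, so the pairs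
  (S_r, S_l) and (S', S') cannot be compared by an adjunction alone: the two module structures need
  separate comparison maps. Dimensions may be infinite, which calls for an exchange argument at
  every cardinality.\<close>

lemma Hom_iff: "f \<in> Hom C X Y \<longleftrightarrow> f \<in> Arr C \<and> src C f = X \<and> tgt C f = Y"
  by (simp add: Hom_def)

lemma HomD:
  assumes "f \<in> Hom C X Y"
  shows "f \<in> Arr C" "src C f = X" "tgt C f = Y"
  using assms by (auto simp: Hom_def)

context category
begin

lemma src_Obj [simp]: "f \<in> Arr C \<Longrightarrow> src C f \<in> Obj C"
  by (rule src_in)

lemma tgt_Obj [simp]: "f \<in> Arr C \<Longrightarrow> tgt C f \<in> Obj C"
  by (rule tgt_in)

lemma Hom_Obj:
  assumes "f \<in> Hom C X Y"
  shows "X \<in> Obj C" "Y \<in> Obj C"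
  using assms by (auto simp: Hom_def)

lemma cmp_Arr [simp]:
  assumes "f \<in> Arr C" "g \<in> Arr C" "src C g = tgt C f"
  shows "g \<cdot> f \<in> Arr C" "src C (g \<cdot> f) = src C f" "tgt C (g \<cdot> f) = tgt C g"
  using cmp_in[of f "src C f" "tgt C f" g "tgt C g"] assms by (auto simp: Hom_def)

lemma ident_Arr [simp]:
  assumes "X \<in> Obj C"
  shows "ident C X \<in> Arr C" "src C (ident C X) = X" "tgt C (ident C X) = X"
  using ident_in[OF assms] by (auto simp: Hom_def)

lemma ident_cmp [simp]: "\<lbrakk>f \<in> Arr C; tgt C f = X\<rbrakk> \<Longrightarrow> ident C X \<cdot> f = f"
  using ident_left[of f "src C f" X] by (auto simp: Hom_def)

lemma cmp_ident [simp]: "\<lbrakk>f \<in> Arr C; src C f = X\<rbrakk> \<Longrightarrow> f \<cdot> ident C X = f"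
  using ident_right[of f X "tgt C f"] by (auto simp: Hom_def)

lemma assoc [simp]:
  "\<lbrakk>f \<in> Arr C; g \<in> Arr C; h \<in> Arr C; src C g = tgt C f; src C h = tgt C g\<rbrakk>
    \<Longrightarrow> (h \<cdot> g) \<cdot> f = h \<cdot> (g \<cdot> f)"
  using cmp_assoc[of f "src C f" "tgt C f" g "tgt C g" h "tgt C h"] by (auto simp: Hom_def)

text \<open>Since \<open>assoc\<close> normalises composites to right-nested form, an equation for
  \<open>g \<cdot> f\<close> no longer matches when \<open>f\<close> is followed by a further factor
  on its right. This rule restores such matches in the calculations below.\<close>

lemma reassoc:
  "\<lbrakk>g \<cdot> f = h; f \<in> Arr C; g \<in> Arr C; src C g = tgt C f; x \<in> Arr C; src C f = tgt C x\<rbrakk>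
    \<Longrightarrow> g \<cdot> (f \<cdot> x) = h \<cdot> x"
  using assoc by auto

lemma monicD:
  "\<lbrakk>monic C f; f \<cdot> g = f \<cdot> h; g \<in> Arr C; h \<in> Arr C; tgt C g = src C f; tgt C h = src C f;
    src C g = src C h\<rbrakk> \<Longrightarrow> g = h"
  unfolding monic_def Hom_def by auto

lemma monicI:
  assumes "f \<in> Arr C"
    and "\<And>g h. \<lbrakk>g \<in> Arr C; h \<in> Arr C; tgt C g = src C f; tgt C h = src C f; src C g = src C h;
      f \<cdot> g = f \<cdot> h\<rbrakk> \<Longrightarrow> g = h"
  shows "monic C f"
  unfolding monic_def Hom_def using assms by auto

lemma monic_Arr: "monic C f \<Longrightarrow> f \<in> Arr C"
  by (simp add: monic_def)

lemma epic_Arr: "epic C f \<Longrightarrow> f \<in> Arr C"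
  by (simp add: epic_def)

lemma monic_cmp:
  assumes "monic C f" "monic C g" "src C g = tgt C f"
  shows "monic C (g \<cdot> f)"
proof (rule monicI)
  note [simp] = assms(3) monic_Arr[OF assms(1)] monic_Arr[OF assms(2)]
  show "g \<cdot> f \<in> Arr C" by simp
  fix x y assume xy: "x \<in> Arr C" "y \<in> Arr C" "tgt C x = src C (g \<cdot> f)" "tgt C y = src C (g \<cdot> f)"
    "src C x = src C y" "(g \<cdot> f) \<cdot> x = (g \<cdot> f) \<cdot> y"
  have "f \<cdot> x = f \<cdot> y"
    by (rule monicD[OF assms(2)]) (use xy in auto)
  then show "x = y"
    by (rule monicD[OF assms(1)]) (use xy in auto)
qed

lemma monic_cancel:
  assumes "monic C (g \<cdot> f)" "f \<in> Arr C" "g \<in> Arr C" "src C g = tgt C f"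
  shows "monic C f"
proof (rule monicI)
  fix x y assume xy: "x \<in> Arr C" "y \<in> Arr C" "tgt C x = src C f" "tgt C y = src C f"
    "src C x = src C y" "f \<cdot> x = f \<cdot> y"
  show "x = y"
    by (rule monicD[OF assms(1)]) (use xy assms in auto)
qed (use assms in auto)

lemma iso_arrI:
  assumes "f \<in> Arr C" "g \<in> Arr C" "src C g = tgt C f" "tgt C g = src C f"
    "g \<cdot> f = ident C (src C f)" "f \<cdot> g = ident C (tgt C f)"
  shows "iso_arr C f"
  using assms unfolding iso_arr_def Hom_def by auto

lemma iso_arrE:
  assumes "iso_arr C f"
  obtains g where "f \<in> Arr C" "g \<in> Arr C" "src C g = tgt C f" "tgt C g = src C f"
    "g \<cdot> f = ident C (src C f)" "f \<cdot> g = ident C (tgt C f)"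
  using assms unfolding iso_arr_def Hom_def by auto

lemma iso_arr_Arr: "iso_arr C f \<Longrightarrow> f \<in> Arr C"
  by (simp add: iso_arr_def)

lemma split_monic:
  assumes "f \<in> Arr C" "r \<in> Arr C" "src C r = tgt C f" "r \<cdot> f = ident C (src C f)"
  shows "monic C f"
proof (rule monicI)
  fix x y assume xy: "x \<in> Arr C" "y \<in> Arr C" "tgt C x = src C f" "tgt C y = src C f"
    "src C x = src C y" "f \<cdot> x = f \<cdot> y"
  have "r \<cdot> (f \<cdot> z) = z" if "z \<in> Arr C" "tgt C z = src C f" for z
    using that assms reassoc[OF assms(4)] by simp
  then show "x = y" using xy by metis
qed (use assms in auto)

lemma iso_monic: "iso_arr C f \<Longrightarrow> monic C f"
  by (erule iso_arrE) (rule split_monic)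

lemma iso_cmp:
  assumes "iso_arr C f" "iso_arr C g" "src C g = tgt C f"
  shows "iso_arr C (g \<cdot> f)"
proof -
  obtain f' where f: "f \<in> Arr C" "f' \<in> Arr C" "src C f' = tgt C f" "tgt C f' = src C f"
    "f' \<cdot> f = ident C (src C f)" "f \<cdot> f' = ident C (tgt C f)"
    using assms(1) by (rule iso_arrE)
  obtain g' where g: "g \<in> Arr C" "g' \<in> Arr C" "src C g' = tgt C g" "tgt C g' = src C g"
    "g' \<cdot> g = ident C (src C g)" "g \<cdot> g' = ident C (tgt C g)"
    using assms(2) by (rule iso_arrE)
  show ?thesis
    by (rule iso_arrI[where g = "f' \<cdot> g'"])
      (use f g assms(3) in \<open>simp_all add: reassoc[OF f(5)] reassoc[OF f(6)] reassoc[OF g(5)] reassoc[OF g(6)]\<close>)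
qed

lemma iso_ident: "X \<in> Obj C \<Longrightarrow> iso_arr C (ident C X)"
  by (rule iso_arrI[where g = "ident C X"]) auto

lemma iso_inv:
  assumes "iso_arr C f"
  obtains g where "g \<in> Arr C" "iso_arr C g" "src C g = tgt C f" "tgt C g = src C f"
    "g \<cdot> f = ident C (src C f)" "f \<cdot> g = ident C (tgt C f)"
proof -
  obtain g where g: "f \<in> Arr C" "g \<in> Arr C" "src C g = tgt C f" "tgt C g = src C f"
    "g \<cdot> f = ident C (src C f)" "f \<cdot> g = ident C (tgt C f)"
    using assms by (rule iso_arrE)
  have "iso_arr C g" by (rule iso_arrI[where g = f]) (use g in auto)
  then show thesis using that g by blast
qed

lemma isomorphicI: "\<lbrakk>iso_arr C f; src C f = X; tgt C f = Y\<rbrakk> \<Longrightarrow> isomorphic C X Y"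
  unfolding isomorphic_def Hom_def using iso_arr_Arr[of f] by auto

lemma isomorphicE:
  assumes "isomorphic C X Y"
  obtains f where "iso_arr C f" "f \<in> Arr C" "src C f = X" "tgt C f = Y"
  using assms unfolding isomorphic_def Hom_def by auto

lemma isomorphic_refl: "X \<in> Obj C \<Longrightarrow> isomorphic C X X"
  by (rule isomorphicI[OF iso_ident]) auto

lemma isomorphic_sym: "isomorphic C X Y \<Longrightarrow> isomorphic C Y X"
  by (metis isomorphicE isomorphicI iso_inv)

lemma isomorphic_trans: "\<lbrakk>isomorphic C X Y; isomorphic C Y Z\<rbrakk> \<Longrightarrow> isomorphic C X Z"
  by (smt (verit) isomorphicE isomorphicI iso_cmp cmp_Arr iso_arr_Arr)

end

context preadditive_category
begin

lemma add_grp: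
  assumes "X \<in> Obj C" "Y \<in> Obj C"
  shows "comm_group (hom_group C X Y)"
  using hom_comm_group assms by auto

lemma mzero_Arr [simp]:
  assumes "X \<in> Obj C" "Y \<in> Obj C"
  shows "mzero C X Y \<in> Arr C" "src C (mzero C X Y) = X" "tgt C (mzero C X Y) = Y"
  using monoid.one_closed[OF comm_monoid.axioms(1)[OF comm_group.axioms(1)[OF add_grp[OF assms]]]]
  by (auto simp: hom_group_def Hom_def)

lemma madd_Arr [simp]:
  assumes "f \<in> Arr C" "g \<in> Arr C" "src C f = src C g" "tgt C f = tgt C g"
  shows "f \<boxplus> g \<in> Arr C" "src C (f \<boxplus> g) = src C g" "tgt C (f \<boxplus> g) = tgt C g"
  using monoid.m_closed[OF comm_monoid.axioms(1)[OF comm_group.axioms(1)[OF add_grp[of "src C f"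
    "tgt C f"]]], of f g]
    assms by (auto simp: hom_group_def Hom_def)

lemma madd_assoc:
  "\<lbrakk>f \<in> Arr C; g \<in> Arr C; h \<in> Arr C; src C f = src C g; tgt C f = tgt C g; src C g = src C h;
    tgt C g = tgt C h\<rbrakk> \<Longrightarrow> (f \<boxplus> g) \<boxplus> h = f \<boxplus> (g \<boxplus> h)"
  using monoid.m_assoc[OF comm_monoid.axioms(1)[OF comm_group.axioms(1)[OF add_grp[of "src C f"
    "tgt C f"]]], of f g h]
  by (auto simp: hom_group_def Hom_def)

lemma madd_comm:
  "\<lbrakk>f \<in> Arr C; g \<in> Arr C; src C f = src C g; tgt C f = tgt C g\<rbrakk> \<Longrightarrow> f \<boxplus> g = g \<boxplus> f"
  using comm_monoid.m_comm[OF comm_group.axioms(1)[OF add_grp[of "src C f" "tgt C f"]], of f g]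
  by (auto simp: hom_group_def Hom_def)

lemma madd_zero [simp]:
  assumes "f \<in> Arr C" "src C f = X" "tgt C f = Y"
  shows "f \<boxplus> mzero C X Y = f" "mzero C X Y \<boxplus> f = f"
  using monoid.r_one[OF comm_monoid.axioms(1)[OF comm_group.axioms(1)[OF add_grp[of "src C f"
    "tgt C f"]]], of f]
    monoid.l_one[OF comm_monoid.axioms(1)[OF comm_group.axioms(1)[OF add_grp[of "src C f"
      "tgt C f"]]], of f] assms
  by (auto simp: hom_group_def Hom_def)

definition mneg :: "'m \<Rightarrow> 'm" where
  "mneg f = inv\<^bsub>hom_group C (src C f) (tgt C f)\<^esub> f"

lemma mneg_Arr [simp]:
  assumes "f \<in> Arr C"
  shows "mneg f \<in> Arr C" "src C (mneg f) = src C f" "tgt C (mneg f) = tgt C f"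
  using group.inv_closed[OF comm_group.axioms(2)[OF add_grp[of "src C f" "tgt C f"]], of f] assms
  by (auto simp: hom_group_def Hom_def mneg_def)

lemma madd_neg [simp]:
  assumes "f \<in> Arr C"
  shows "f \<boxplus> mneg f = mzero C (src C f) (tgt C f)" "mneg f \<boxplus> f = mzero C (src C f) (tgt C f)"
  using group.r_inv[OF comm_group.axioms(2)[OF add_grp[of "src C f" "tgt C f"]], of f]
    group.l_inv[OF comm_group.axioms(2)[OF add_grp[of "src C f" "tgt C f"]], of f] assms
  by (auto simp: hom_group_def Hom_def mneg_def)

lemma madd_right_cancel:
  assumes "f \<boxplus> h = g \<boxplus> h" "f \<in> Arr C" "g \<in> Arr C" "h \<in> Arr C" "src C f = src C h" "tgt C f = tgt C h"
    "src C g = src C h" "tgt C g = tgt C h"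
  shows "f = g"
  using group.right_cancel[OF comm_group.axioms(2)[OF add_grp[of "src C h" "tgt C h"]], of h f g] assms
  by (auto simp: hom_group_def Hom_def)

lemma mneg_unique:
  assumes "f \<boxplus> g = mzero C (src C f) (tgt C f)" "f \<in> Arr C" "g \<in> Arr C" "src C f = src C g" "tgt C f = tgt C g"
  shows "f = mneg g"
  by (rule madd_right_cancel[of _ g]) (use assms in auto)

lemma cmp_madd [simp]:
  "\<lbrakk>f \<in> Arr C; g \<in> Arr C; h \<in> Arr C; src C f = src C g; tgt C f = tgt C g; src C h = tgt C g\<rbrakk>
    \<Longrightarrow> h \<cdot> (f \<boxplus> g) = (h \<cdot> f) \<boxplus> (h \<cdot> g)"
  using cmp_add_right[of f "src C f" "tgt C f" g h "tgt C h"] by (auto simp: Hom_def)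

lemma madd_cmp [simp]:
  "\<lbrakk>f \<in> Arr C; g \<in> Arr C; h \<in> Arr C; src C g = src C h; tgt C g = tgt C h; src C h = tgt C f\<rbrakk>
    \<Longrightarrow> (g \<boxplus> h) \<cdot> f = (g \<cdot> f) \<boxplus> (h \<cdot> f)"
  using cmp_add_left[of f "src C f" "tgt C f" g "tgt C g" h] by (auto simp: Hom_def)

lemma cmp_zero [simp]:
  assumes "g \<in> Arr C" "src C g = Y" "X \<in> Obj C"
  shows "g \<cdot> mzero C X Y = mzero C X (tgt C g)"
proof (rule madd_right_cancel[of _ "g \<cdot> mzero C X Y"])
  have "g \<cdot> mzero C X Y \<boxplus> g \<cdot> mzero C X Y = g \<cdot> (mzero C X Y \<boxplus> mzero C X Y)"
    using assms by (subst cmp_madd) auto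
  then show "g \<cdot> mzero C X Y \<boxplus> g \<cdot> mzero C X Y = mzero C X (tgt C g) \<boxplus> g \<cdot> mzero C X Y"
    using assms by auto
qed (use assms in auto)

lemma zero_cmp [simp]:
  assumes "g \<in> Arr C" "tgt C g = Y" "Z \<in> Obj C"
  shows "mzero C Y Z \<cdot> g = mzero C (src C g) Z"
proof (rule madd_right_cancel[of _ "mzero C Y Z \<cdot> g"])
  have "mzero C Y Z \<cdot> g \<boxplus> mzero C Y Z \<cdot> g = (mzero C Y Z \<boxplus> mzero C Y Z) \<cdot> g"
    using assms by (subst madd_cmp) auto
  then show "mzero C Y Z \<cdot> g \<boxplus> mzero C Y Z \<cdot> g = mzero C (src C g) Z \<boxplus> mzero C Y Z \<cdot> g"
    using assms by auto
qed (use assms in auto)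

lemma cmp_mneg [simp]:
  assumes "f \<in> Arr C" "g \<in> Arr C" "src C g = tgt C f"
  shows "g \<cdot> mneg f = mneg (g \<cdot> f)"
proof (rule mneg_unique)
  have "g \<cdot> mneg f \<boxplus> g \<cdot> f = g \<cdot> (mneg f \<boxplus> f)" using assms by (subst cmp_madd) auto
  then show "g \<cdot> mneg f \<boxplus> g \<cdot> f = mzero C (src C (g \<cdot> mneg f)) (tgt C (g \<cdot> mneg f))"
    using assms by auto
qed (use assms in auto)

lemma mneg_cmp [simp]:
  assumes "f \<in> Arr C" "g \<in> Arr C" "src C g = tgt C f"
  shows "mneg g \<cdot> f = mneg (g \<cdot> f)"
proof (rule mneg_unique)
  have "mneg g \<cdot> f \<boxplus> g \<cdot> f = (mneg g \<boxplus> g) \<cdot> f" using assms by (subst madd_cmp) auto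
  then show "mneg g \<cdot> f \<boxplus> g \<cdot> f = mzero C (src C (mneg g \<cdot> f)) (tgt C (mneg g \<cdot> f))"
    using assms by auto
qed (use assms in auto)

lemma eq_iff_diff_zero:
  assumes "f \<in> Arr C" "g \<in> Arr C" "src C f = src C g" "tgt C f = tgt C g"
  shows "f \<boxplus> mneg g = mzero C (src C f) (tgt C f) \<longleftrightarrow> f = g"
proof
  assume "f \<boxplus> mneg g = mzero C (src C f) (tgt C f)"
  then have "f \<boxplus> mneg g = g \<boxplus> mneg g" using assms by simp
  then show "f = g" by (rule madd_right_cancel) (use assms in auto)
qed (use assms in auto)

text \<open>Two parallel arrows can be subtracted, so cancelling an equation reduces to cancelling
  against zero.\<close>

lemma monic_iff:
  "monic C f \<longleftrightarrow> f \<in> Arr C \<and> (\<forall>g \<in> Arr C. tgt C g = src C f \<longrightarrow>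
    f \<cdot> g = mzero C (src C g) (tgt C f) \<longrightarrow> g = mzero C (src C g) (src C f))" (is "?l \<longleftrightarrow> ?r")
proof
  assume m: ?l
  show ?r
  proof (intro conjI ballI impI)
    fix g assume g: "g \<in> Arr C" "tgt C g = src C f" "f \<cdot> g = mzero C (src C g) (tgt C f)"
    show "g = mzero C (src C g) (src C f)"
      by (rule monicD[OF m]) (use g monic_Arr[OF m] in auto)
  qed (use monic_Arr[OF m] in auto)
next
  assume r: ?r
  show ?l
  proof (rule monicI)
    fix g h assume gh: "g \<in> Arr C" "h \<in> Arr C" "tgt C g = src C f" "tgt C h = src C f" "src C g = src C h"
      "f \<cdot> g = f \<cdot> h"
    have "f \<cdot> (g \<boxplus> mneg h) = mzero C (src C (g \<boxplus> mneg h)) (tgt C f)"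
      using gh r by (subst cmp_madd) auto
    moreover have "g \<boxplus> mneg h \<in> Arr C" "tgt C (g \<boxplus> mneg h) = src C f" "src C (g \<boxplus> mneg h) = src C g"
      using gh by auto
    ultimately have "g \<boxplus> mneg h = mzero C (src C g) (src C f)" using r by metis
    then show "g = h" using eq_iff_diff_zero[of g h] gh by metis
  qed (use r in auto)
qed

lemma monic0:
  "\<lbrakk>monic C f; f \<cdot> g = mzero C (src C g) (tgt C f); g \<in> Arr C; tgt C g = src C f\<rbrakk>
    \<Longrightarrow> g = mzero C (src C g) (src C f)"
  using monic_iff by blast

text \<open>Every arrow into or out of \<open>X\<close> factors through the identity of
  \<open>X\<close>, so all of them vanish as soon as the identity does.\<close>

lemma zero_obj_iff: "zero_obj C X \<longleftrightarrow> X \<in> Obj C \<and> ident C X = mzero C X X"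
proof
  assume z: "zero_obj C X"
  then have "X \<in> Obj C" by (simp add: zero_obj_def)
  moreover have "ident C X \<in> Hom C X X" "mzero C X X \<in> Hom C X X"
    using \<open>X \<in> Obj C\<close> by (auto simp: Hom_def)
  ultimately show "X \<in> Obj C \<and> ident C X = mzero C X X"
    using z unfolding zero_obj_def by blast
next
  assume z: "X \<in> Obj C \<and> ident C X = mzero C X X"
  show "zero_obj C X"
    unfolding zero_obj_def
  proof (intro conjI ballI)
    fix Y assume Y: "Y \<in> Obj C"
    have "f = mzero C X Y" if "f \<in> Hom C X Y" for f
      using z that Y cmp_ident[of f X] by (auto simp: Hom_def)
    then show "\<exists>!f. f \<in> Hom C X Y"
      using z Y by (intro ex1I[of _ "mzero C X Y"]) (auto simp: Hom_def)
    have "f = mzero C Y X" if "f \<in> Hom C Y X" for f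
      using z that Y ident_cmp[of f X] by (auto simp: Hom_def)
    then show "\<exists>!f. f \<in> Hom C Y X"
      using z Y by (intro ex1I[of _ "mzero C Y X"]) (auto simp: Hom_def)
  qed (use z in auto)
qed

lemma to_zero:
  assumes "zero_obj C Y" "f \<in> Arr C" "tgt C f = Y"
  shows "f = mzero C (src C f) Y"
  using assms zero_obj_iff[of Y] by (metis ident_cmp zero_cmp)

lemma from_zero:
  assumes "zero_obj C X" "f \<in> Arr C" "src C f = X"
  shows "f = mzero C X (tgt C f)"
  using assms zero_obj_iff[of X] by (metis cmp_ident cmp_zero)

end

section \<open>The opposite category\<close>

text \<open>The arguments of \<open>mzero\<close> are exchanged together with source and target,
  which makes \<open>op\<close> a strict involution. Facts can therefore be dualised in both
  directions by plain simplification.\<close>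

definition op :: "('o, 'm, 'x) additive_category_scheme \<Rightarrow> ('o, 'm, 'x) additive_category_scheme" where
  "op C = C\<lparr>src := tgt C, tgt := src C, cmp := \<lambda>g f. f \<cdot>\<^bsub>C\<^esub> g, mzero := \<lambda>X Y. mzero C Y X\<rparr>"

lemma op_sel [simp]:
  "Obj (op C) = Obj C" "Arr (op C) = Arr C" "src (op C) = tgt C" "tgt (op C) = src C"
  "ident (op C) = ident C" "g \<cdot>\<^bsub>op C\<^esub> f = f \<cdot>\<^bsub>C\<^esub> g" "f \<boxplus>\<^bsub>op C\<^esub> g = f \<boxplus>\<^bsub>C\<^esub> g"
  "mzero (op C) X Y = mzero C Y X"
  by (simp_all add: op_def)

lemma op_op [simp]: "op (op C) = C"
  by (simp add: op_def)

lemma Hom_op [simp]: "Hom (op C) X Y = Hom C Y X"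
  by (auto simp: Hom_def)

lemma monic_op [simp]: "monic (op C) f = epic C f"
  unfolding monic_def epic_def Hom_op op_sel ..

lemma epic_op [simp]: "epic (op C) f = monic C f"
  using monic_op[of "op C" f] by simp

lemma is_kernel_op [simp]: "is_kernel (op C) k f = is_cokernel C k f"
  unfolding is_kernel_def is_cokernel_def by simp

lemma is_cokernel_op [simp]: "is_cokernel (op C) k f = is_kernel C k f"
  unfolding is_kernel_def is_cokernel_def by simp

lemma short_exact_op [simp]: "short_exact (op C) p i = short_exact C i p"
  unfolding short_exact_def is_kernel_op is_cokernel_op by (rule conj_commute)

lemma iso_arr_op [simp]: "iso_arr (op C) f = iso_arr C f"
  unfolding iso_arr_def Hom_op op_sel by (simp add: conj_commute)

lemma zero_obj_op [simp]: "zero_obj (op C) X = zero_obj C X"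
  unfolding zero_obj_def Hom_op op_sel by (simp add: conj_commute)

lemma biproduct_op: "biproduct (op C) X Y (P, i, j, p, q) = biproduct C X Y (P, p, q, i, j)"
  unfolding biproduct_def prod.case Hom_op op_sel by blast

lemma op_preadditive:
  assumes "preadditive_category C"
  shows "preadditive_category (op C)"
proof -
  interpret preadditive_category C by fact
  have "hom_group (op C) X Y = hom_group C Y X" for X Y
    unfolding hom_group_def Hom_op by (simp add: op_def)
  then show ?thesis
    by (intro preadditive_category.intro preadditive_category_axioms.intro category.intro)
      (auto simp: add_grp Hom_iff)
qed

lemma op_abelian:
  assumes "abelian_category C"
  shows "abelian_category (op C)"
proof -
  interpret abelian_category C by fact
  interpret O: preadditive_category "op C" by (rule op_preadditive) unfold_locales
  show ?thesis
  proof
    fix X Y assume "X \<in> Obj (op C)" "Y \<in> Obj (op C)"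
    then show "\<exists>P. biproduct (op C) X Y P"
      using ex_biproduct[of X Y] biproduct_op[of C X Y] by (metis op_sel(1) surj_pair)
  qed (use ex_zero_obj ex_kernel ex_cokernel monic_normal epic_normal in auto)
qed

section \<open>Abelian categories\<close>

context preadditive_category
begin

lemma mneg_zero [simp]: "\<lbrakk>X \<in> Obj C; Y \<in> Obj C\<rbrakk> \<Longrightarrow> mneg (mzero C X Y) = mzero C X Y"
  by (rule mneg_unique[symmetric]) auto

lemma dual_preadditive: "preadditive_category (op C)"
  by (rule op_preadditive) unfold_locales

lemma dual_category: "category (op C)"
  using dual_preadditive preadditive_category.axioms(1) by blast

lemma epicD:
  "\<lbrakk>epic C f; g \<cdot> f = h \<cdot> f; g \<in> Arr C; h \<in> Arr C; src C g = tgt C f; src C h = tgt C f;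
    tgt C g = tgt C h\<rbrakk> \<Longrightarrow> g = h"
  using category.monicD[OF dual_category, of f g h] by simp

lemma epic_cmp: "\<lbrakk>epic C f; epic C g; src C g = tgt C f\<rbrakk> \<Longrightarrow> epic C (g \<cdot> f)"
  using category.monic_cmp[OF dual_category, of g f] by simp

lemma epic_cancel:
  "\<lbrakk>epic C (g \<cdot> f); f \<in> Arr C; g \<in> Arr C; src C g = tgt C f\<rbrakk> \<Longrightarrow> epic C g"
  using category.monic_cancel[OF dual_category, of f g] by simp

lemma split_epic:
  "\<lbrakk>f \<in> Arr C; s \<in> Arr C; tgt C s = src C f; f \<cdot> s = ident C (tgt C f)\<rbrakk> \<Longrightarrow> epic C f"
  using category.split_monic[OF dual_category, of f s] by simp

lemma iso_epic: "iso_arr C f \<Longrightarrow> epic C f"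
  using category.iso_monic[OF dual_category, of f] by simp

lemma epic0:
  "\<lbrakk>epic C f; g \<cdot> f = mzero C (src C f) (tgt C g); g \<in> Arr C; src C g = tgt C f\<rbrakk>
    \<Longrightarrow> g = mzero C (tgt C f) (tgt C g)"
  using preadditive_category.monic0[OF dual_preadditive, of f g] by simp

lemma epic_iff:
  "epic C f \<longleftrightarrow> f \<in> Arr C \<and> (\<forall>g \<in> Arr C. src C g = tgt C f \<longrightarrow>
    g \<cdot> f = mzero C (src C f) (tgt C g) \<longrightarrow> g = mzero C (tgt C f) (tgt C g))"
  using preadditive_category.monic_iff[OF dual_preadditive, of f] by simp

lemma kernelD:
  assumes "is_kernel C k f"
  shows "k \<in> Arr C" "f \<in> Arr C" "tgt C k = src C f" "f \<cdot> k = mzero C (src C k) (tgt C f)"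
  using assms unfolding is_kernel_def by auto

lemma kernel_factor:
  assumes "is_kernel C k f" "g \<in> Arr C" "tgt C g = src C f" "f \<cdot> g = mzero C (src C g) (tgt C f)"
  obtains u where "u \<in> Arr C" "src C u = src C g" "tgt C u = src C k" "k \<cdot> u = g"
proof -
  have "\<exists>!u. u \<in> Hom C (src C g) (src C k) \<and> k \<cdot> u = g"
    using assms unfolding is_kernel_def by (simp add: Hom_iff)
  from ex1_implies_ex[OF this] obtain u where "u \<in> Hom C (src C g) (src C k)" "k \<cdot> u = g"
    by blast
  then show thesis by (intro that[of u]) (simp_all add: Hom_iff)
qed

lemma kernel_monic:
  assumes k: "is_kernel C k f"
  shows "monic C k"
proof (rule monicI)
  note [simp] = kernelD[OF k]
  fix g h assume gh: "g \<in> Arr C" "h \<in> Arr C" "tgt C g = src C k" "tgt C h = src C k" "src C g = src C h"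
    "k \<cdot> g = k \<cdot> h"
  have "f \<cdot> (k \<cdot> g) = mzero C (src C g) (tgt C f)"
    using gh reassoc[OF kernelD(4)[OF k], of g] by simp
  moreover have "k \<cdot> g \<in> Hom C (src C g) (src C f)" using gh by (simp add: Hom_iff)
  ultimately have "\<exists>!u. u \<in> Hom C (src C g) (src C k) \<and> k \<cdot> u = k \<cdot> g"
    using k unfolding is_kernel_def by blast
  moreover have "g \<in> Hom C (src C g) (src C k)" "h \<in> Hom C (src C g) (src C k)"
    using gh by (auto simp: Hom_iff)
  ultimately show "g = h" using gh(6) by metis
qed (use kernelD[OF k] in auto)

text \<open>Uniqueness of the factorisation follows from monicity, so only its existence remains to
  be shown.\<close>

lemma kernelI:
  assumes "f \<in> Arr C" "tgt C k = src C f" "f \<cdot> k = mzero C (src C k) (tgt C f)" "monic C k"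
    and "\<And>g. \<lbrakk>g \<in> Arr C; tgt C g = src C f; f \<cdot> g = mzero C (src C g) (tgt C f)\<rbrakk>
      \<Longrightarrow> \<exists>u \<in> Arr C. src C u = src C g \<and> tgt C u = src C k \<and> k \<cdot> u = g"
  shows "is_kernel C k f"
  unfolding is_kernel_def
proof (intro conjI allI ballI impI)
  fix X g assume g: "g \<in> Hom C X (src C f)" "f \<cdot> g = mzero C X (tgt C f)"
  with assms(5)[of g] obtain u where u: "u \<in> Arr C" "src C u = X" "tgt C u = src C k" "k \<cdot> u = g"
    by (auto simp: Hom_iff)
  show "\<exists>!u. u \<in> Hom C X (src C k) \<and> k \<cdot> u = g"
  proof (rule ex1I[of _ u])
    fix v assume v: "v \<in> Hom C X (src C k) \<and> k \<cdot> v = g"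
    show "v = u" by (rule monicD[OF assms(4)]) (use u v in \<open>auto simp: Hom_iff\<close>)
  qed (use u in \<open>simp add: Hom_iff\<close>)
qed (use assms monic_Arr in auto)

lemma cokernelD:
  assumes "is_cokernel C c f"
  shows "c \<in> Arr C" "f \<in> Arr C" "src C c = tgt C f" "c \<cdot> f = mzero C (src C f) (tgt C c)"
  using assms unfolding is_cokernel_def by auto

lemma cokernel_factor:
  assumes "is_cokernel C c f" "g \<in> Arr C" "src C g = tgt C f" "g \<cdot> f = mzero C (src C f) (tgt C g)"
  obtains u where "u \<in> Arr C" "src C u = tgt C c" "tgt C u = tgt C g" "u \<cdot> c = g"
  using preadditive_category.kernel_factor[OF dual_preadditive, of c f g thesis] assms that by simp

lemma cokernel_epic: "is_cokernel C c f \<Longrightarrow> epic C c"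
  using preadditive_category.kernel_monic[OF dual_preadditive, of c f] by simp

lemma cokernelI:
  assumes "f \<in> Arr C" "src C c = tgt C f" "c \<cdot> f = mzero C (src C f) (tgt C c)" "epic C c"
    and "\<And>g. \<lbrakk>g \<in> Arr C; src C g = tgt C f; g \<cdot> f = mzero C (src C f) (tgt C g)\<rbrakk>
      \<Longrightarrow> \<exists>u \<in> Arr C. tgt C u = tgt C g \<and> src C u = tgt C c \<and> u \<cdot> c = g"
  shows "is_cokernel C c f"
  using preadditive_category.kernelI[OF dual_preadditive, of f c] assms by simp

lemma short_exactD:
  assumes "short_exact C i p"
  shows "i \<in> Arr C" "p \<in> Arr C" "tgt C i = src C p" "p \<cdot> i = mzero C (src C i) (tgt C p)"
    "monic C i" "epic C p"
  using assms kernelD kernel_monic cokernel_epic unfolding short_exact_def by auto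

lemma short_exact_lift:
  assumes "short_exact C i p" "g \<in> Arr C" "tgt C g = src C p" "p \<cdot> g = mzero C (src C g) (tgt C p)"
  obtains u where "u \<in> Arr C" "src C u = src C g" "tgt C u = src C i" "i \<cdot> u = g"
  using assms kernel_factor unfolding short_exact_def by blast

lemma short_exact_colift:
  assumes "short_exact C i p" "g \<in> Arr C" "src C g = src C p" "g \<cdot> i = mzero C (src C i) (tgt C g)"
  obtains u where "u \<in> Arr C" "src C u = tgt C p" "tgt C u = tgt C g" "u \<cdot> p = g"
  using assms cokernel_factor[of p i g] short_exactD(3)[OF assms(1)] unfolding short_exact_def by metis

end

section \<open>Pullback squares\<close>

definition pullback :: "('o, 'm, 'x) category_scheme \<Rightarrow> 'm \<Rightarrow> 'm \<Rightarrow> 'm \<Rightarrow> 'm \<Rightarrow> bool" where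
  "pullback C f g p q \<longleftrightarrow> f \<in> Arr C \<and> g \<in> Arr C \<and> p \<in> Arr C \<and> q \<in> Arr C \<and> tgt C f = tgt C g \<and>
    src C p = src C q \<and> tgt C p = src C f \<and> tgt C q = src C g \<and> f \<cdot>\<^bsub>C\<^esub> p = g \<cdot>\<^bsub>C\<^esub> q \<and>
    (\<forall>u \<in> Arr C. \<forall>v \<in> Arr C. src C u = src C v \<longrightarrow> tgt C u = src C f \<longrightarrow> tgt C v = src C g \<longrightarrow>
      f \<cdot>\<^bsub>C\<^esub> u = g \<cdot>\<^bsub>C\<^esub> v \<longrightarrow> (\<exists>!w. w \<in> Hom C (src C u) (src C p) \<and> p \<cdot>\<^bsub>C\<^esub> w = u \<and> q \<cdot>\<^bsub>C\<^esub> w = v))"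

context category
begin

lemma pullbackD:
  assumes "pullback C f g p q"
  shows "f \<in> Arr C" "g \<in> Arr C" "p \<in> Arr C" "q \<in> Arr C" "tgt C f = tgt C g" "src C p = src C q"
    "tgt C p = src C f" "tgt C q = src C g" "f \<cdot> p = g \<cdot> q"
  using assms unfolding pullback_def by auto

lemma pullback_lift:
  assumes "pullback C f g p q" "u \<in> Arr C" "v \<in> Arr C" "src C u = src C v" "tgt C u = src C f"
    "tgt C v = src C g" "f \<cdot> u = g \<cdot> v"
  obtains w where "w \<in> Arr C" "src C w = src C u" "tgt C w = src C q" "p \<cdot> w = u" "q \<cdot> w = v"
proof -
  have "\<exists>!w. w \<in> Hom C (src C u) (src C p) \<and> p \<cdot> w = u \<and> q \<cdot> w = v"
    using assms unfolding pullback_def by blast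
  from ex1_implies_ex[OF this]
  obtain w where "w \<in> Hom C (src C u) (src C p)" "p \<cdot> w = u" "q \<cdot> w = v"
    by blast
  then show thesis using pullbackD(6)[OF assms(1)] by (intro that[of w]) (simp_all add: Hom_iff)
qed

lemma pullback_eqI:
  assumes pb: "pullback C f g p q" and "p \<cdot> w = p \<cdot> w'" "q \<cdot> w = q \<cdot> w'"
    "w \<in> Arr C" "w' \<in> Arr C" "src C w = src C w'" "tgt C w = src C q" "tgt C w' = src C q"
  shows "w = w'"
proof -
  note [simp] = pullbackD[OF pb]
  have "f \<cdot> (p \<cdot> w) = g \<cdot> (q \<cdot> w)"
    using reassoc[OF pullbackD(9)[OF pb], of w] assms by simp
  moreover have "p \<cdot> w \<in> Arr C" "q \<cdot> w \<in> Arr C" "src C (p \<cdot> w) = src C (q \<cdot> w)"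
    "tgt C (p \<cdot> w) = src C f" "tgt C (q \<cdot> w) = src C g"
    using assms by auto
  ultimately have "\<exists>!z. z \<in> Hom C (src C (p \<cdot> w)) (src C p) \<and> p \<cdot> z = p \<cdot> w \<and> q \<cdot> z = q \<cdot> w"
    using pb unfolding pullback_def by blast
  moreover have "w \<in> Hom C (src C (p \<cdot> w)) (src C p)" "w' \<in> Hom C (src C (p \<cdot> w)) (src C p)"
    using assms by (auto simp: Hom_iff)
  ultimately show ?thesis using assms(2,3) by metis
qed

end

section \<open>Normality, images, pullbacks and the five lemma\<close>

context abelian_category
begin

lemma dual_abelian: "abelian_category (op C)"
  by (rule op_abelian) unfold_locales

lemma obtain_kernel:
  assumes "f \<in> Arr C" obtains k where "is_kernel C k f"
  using ex_kernel assms by blast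

lemma obtain_cokernel:
  assumes "f \<in> Arr C" obtains k where "is_cokernel C k f"
  using ex_cokernel assms by blast

text \<open>By normality \<open>f\<close> is the kernel of some \<open>g\<close>. As
  \<open>g\<close> kills \<open>f\<close>, it factors through \<open>c\<close>; so whatever
  \<open>c\<close> kills is killed by \<open>g\<close> and factors through \<open>f\<close>.\<close>

lemma monic_kernel_of_cokernel:
  assumes m: "monic C f" and c: "is_cokernel C c f"
  shows "is_kernel C f c"
proof -
  obtain g where g: "is_kernel C f g" using monic_normal[OF m] by blast
  note [simp] = kernelD[OF g] cokernelD[OF c]
  obtain u where u: "u \<in> Arr C" "src C u = tgt C c" "tgt C u = tgt C g" "u \<cdot> c = g"
    by (rule cokernel_factor[OF c, of g]) auto
  show ?thesis
  proof (rule kernelI)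
    fix h assume h: "h \<in> Arr C" "tgt C h = src C c" "c \<cdot> h = mzero C (src C h) (tgt C c)"
    have "g \<cdot> h = mzero C (src C h) (tgt C g)"
      using h u reassoc[OF u(4), of h] by simp
    then obtain v where "v \<in> Arr C" "src C v = src C h" "tgt C v = src C f" "f \<cdot> v = h"
      using kernel_factor[OF g, of h] h by auto
    then show "\<exists>v \<in> Arr C. src C v = src C h \<and> tgt C v = src C f \<and> f \<cdot> v = h" by blast
  qed (use m in auto)
qed

lemma short_exact_monic: "\<lbrakk>monic C i; is_cokernel C p i\<rbrakk> \<Longrightarrow> short_exact C i p"
  unfolding short_exact_def using monic_kernel_of_cokernel by blast

lemma short_exact_epic: "\<lbrakk>epic C p; is_kernel C i p\<rbrakk> \<Longrightarrow> short_exact C i p"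
  using abelian_category.short_exact_monic[OF dual_abelian, of p i] by simp

text \<open>If \<open>f\<close> is the kernel of \<open>g\<close> and also epic, then
  \<open>g\<close> is zero. The identity of the target is then killed by \<open>g\<close> and
  factors through \<open>f\<close>.\<close>

lemma monic_epic_iso:
  assumes m: "monic C f" and e: "epic C f"
  shows "iso_arr C f"
proof -
  obtain g where g: "is_kernel C f g" using monic_normal[OF m] by blast
  note [simp] = kernelD[OF g]
  have g0: "g = mzero C (tgt C f) (tgt C g)" by (rule epic0[OF e]) auto
  obtain u where u: "u \<in> Arr C" "src C u = tgt C f" "tgt C u = src C f" "f \<cdot> u = ident C (tgt C f)"
    by (rule kernel_factor[OF g, of "ident C (tgt C f)"]) (use g0 in auto)
  have "u \<cdot> f = ident C (src C f)"
    by (rule monicD[OF m]) (use u reassoc[OF u(4), of f] in auto)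
  then show ?thesis by (intro iso_arrI[of f u]) (use u in auto)
qed

lemma zero_kernel_monic:
  assumes k: "is_kernel C k f" and z: "zero_obj C (src C k)"
  shows "monic C f"
  unfolding monic_iff
proof (intro conjI ballI impI)
  note [simp] = kernelD[OF k]
  show "f \<in> Arr C" by simp
  fix g assume g: "g \<in> Arr C" "tgt C g = src C f" "f \<cdot> g = mzero C (src C g) (tgt C f)"
  obtain u where u: "u \<in> Arr C" "src C u = src C g" "tgt C u = src C k" "k \<cdot> u = g"
    by (rule kernel_factor[OF k, of g]) (use g in auto)
  have "u = mzero C (src C g) (src C k)" using to_zero[OF z] u by auto
  then show "g = mzero C (src C g) (src C f)" using u(4) g by auto
qed

lemma zero_cokernel_epic: "\<lbrakk>is_cokernel C c f; zero_obj C (tgt C c)\<rbrakk> \<Longrightarrow> epic C f"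
  using abelian_category.zero_kernel_monic[OF dual_abelian, of c f] by simp

text \<open>The image is the kernel of the cokernel; the point is that the remaining factor
  \<open>e\<close> is epic.\<close>

lemma image_factor:
  assumes f: "f \<in> Arr C"
  obtains m e where "monic C m" "epic C e" "src C m = tgt C e" "f = m \<cdot> e"
    "src C e = src C f" "tgt C m = tgt C f"
proof -
  obtain c where c: "is_cokernel C c f" using obtain_cokernel[OF f] .
  note [simp] = cokernelD[OF c]
  obtain m where m: "is_kernel C m c" using obtain_kernel[of c] by auto
  note [simp] = kernelD[OF m] and mm = kernel_monic[OF m]
  obtain e where e: "e \<in> Arr C" "src C e = src C f" "tgt C e = src C m" "m \<cdot> e = f"
    by (rule kernel_factor[OF m, of f]) auto
  note [simp] = e(1-3)
  have "epic C e"
    unfolding epic_iff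
  proof (intro conjI ballI impI)
    fix t assume t: "t \<in> Arr C" "src C t = tgt C e" "t \<cdot> e = mzero C (src C e) (tgt C t)"
    obtain k where k: "is_kernel C k t" using obtain_kernel[OF t(1)] .
    note [simp] = kernelD(1,3)[OF k] t(1,2)
    obtain e' where e': "e' \<in> Arr C" "src C e' = src C e" "tgt C e' = src C k" "k \<cdot> e' = e"
      by (rule kernel_factor[OF k, of e]) (use t in auto)
    \<comment> \<open>\<open>f\<close> factors through the subobject \<open>m \<cdot> k\<close>,
      which is the kernel of some \<open>g\<close> by normality. Then \<open>g\<close> kills
      \<open>f\<close>, so it factors through \<open>c\<close> and kills \<open>m\<close>; hence
      \<open>m\<close> factors through \<open>m \<cdot> k\<close>. This gives \<open>k\<close> a
      right inverse, and \<open>t \<cdot> k\<close> being zero forces \<open>t\<close> to be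
      zero.\<close>
    have mk: "monic C (m \<cdot> k)" by (rule monic_cmp[OF kernel_monic[OF k] mm]) auto
    obtain g where g: "is_kernel C (m \<cdot> k) g" using monic_normal[OF mk] by blast
    note [simp] = kernelD(2)[OF g] kernelD(3)[OF g, simplified, symmetric]
    have gmk: "g \<cdot> (m \<cdot> k) = mzero C (src C k) (tgt C g)" using kernelD(4)[OF g] by simp
    have "g \<cdot> f = mzero C (src C f) (tgt C g)"
      using reassoc[OF gmk, of e'] e' by (simp add: e(4))
    then obtain u where u: "u \<in> Arr C" "src C u = tgt C c" "tgt C u = tgt C g" "u \<cdot> c = g"
      using cokernel_factor[OF c, of g] by auto
    have "g \<cdot> m = mzero C (src C m) (tgt C g)" using reassoc[OF u(4), of m] u by simp
    then obtain v where v: "v \<in> Arr C" "src C v = src C m" "tgt C v = src C k" "(m \<cdot> k) \<cdot> v = m"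
      using kernel_factor[OF g, of m] by auto
    have kv: "k \<cdot> v = ident C (src C m)"
      by (rule monicD[OF mm]) (use v in auto)
    have "t = (t \<cdot> k) \<cdot> v" using kv v by simp
    then show "t = mzero C (tgt C e) (tgt C t)" using kernelD(4)[OF k] v by simp
  qed auto
  then show thesis using that[of m e] mm e by auto
qed

lemma biproductD:
  assumes "biproduct C X Y (P, i, j, p, q)"
  shows "P \<in> Obj C" "i \<in> Arr C" "src C i = X" "tgt C i = P" "j \<in> Arr C" "src C j = Y" "tgt C j = P"
    "p \<in> Arr C" "src C p = P" "tgt C p = X" "q \<in> Arr C" "src C q = P" "tgt C q = Y"
    "p \<cdot> i = ident C X" "q \<cdot> j = ident C Y" "q \<cdot> i = mzero C X Y" "p \<cdot> j = mzero C Y X"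
    "(i \<cdot> p) \<boxplus> (j \<cdot> q) = ident C P"
  using assms unfolding biproduct_def Hom_def by auto

text \<open>The pullback is the kernel of the difference \<open>d\<close> of the two maps, formed on
  the biproduct of their sources.\<close>

lemma ex_pullback:
  assumes f: "f \<in> Arr C" and g: "g \<in> Arr C" and fg: "tgt C f = tgt C g"
  obtains p q where "pullback C f g p q"
proof -
  obtain P i j r s where b: "biproduct C (src C f) (src C g) (P, i, j, r, s)"
    using ex_biproduct[of "src C f" "src C g"] f g by (metis prod_cases5 src_Obj)
  note [simp] = biproductD[OF b] f g fg
  have [simp]: "r \<cdot> (i \<cdot> x) = x" "s \<cdot> (i \<cdot> x) = mzero C (src C x) (src C g)"
    if "x \<in> Arr C" "tgt C x = src C f" for x
    using that reassoc[OF biproductD(14)[OF b], of x] reassoc[OF biproductD(16)[OF b], of x] by auto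
  have [simp]: "s \<cdot> (j \<cdot> x) = x" "r \<cdot> (j \<cdot> x) = mzero C (src C x) (src C f)"
    if "x \<in> Arr C" "tgt C x = src C g" for x
    using that reassoc[OF biproductD(15)[OF b], of x] reassoc[OF biproductD(17)[OF b], of x] by auto
  define d where "d = f \<cdot> r \<boxplus> mneg (g \<cdot> s)"
  have [simp]: "d \<in> Arr C" "src C d = P" "tgt C d = tgt C g" by (auto simp: d_def)
  obtain k where k: "is_kernel C k d" using obtain_kernel[of d] by auto
  note [simp] = kernelD[OF k]
  have dx: "d \<cdot> x = f \<cdot> (r \<cdot> x) \<boxplus> mneg (g \<cdot> (s \<cdot> x))" if "x \<in> Arr C" "tgt C x = P" for x
    unfolding d_def using that by simp
  have d0: "d \<cdot> x = mzero C (src C x) (tgt C g) \<longleftrightarrow> f \<cdot> (r \<cdot> x) = g \<cdot> (s \<cdot> x)"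
    if "x \<in> Arr C" "tgt C x = P" for x
    using eq_iff_diff_zero[of "f \<cdot> (r \<cdot> x)" "g \<cdot> (s \<cdot> x)"] that by (simp add: dx)
  have Px: "x = i \<cdot> (r \<cdot> x) \<boxplus> j \<cdot> (s \<cdot> x)" if "x \<in> Arr C" "tgt C x = P" for x
  proof -
    have "((i \<cdot> r) \<boxplus> (j \<cdot> s)) \<cdot> x = i \<cdot> (r \<cdot> x) \<boxplus> j \<cdot> (s \<cdot> x)"
      using that by (simp del: biproductD(18)[OF b])
    then show ?thesis using that by simp
  qed
  have "pullback C f g (r \<cdot> k) (s \<cdot> k)"
    unfolding pullback_def
  proof (intro conjI ballI impI)
    show "f \<cdot> r \<cdot> k = g \<cdot> s \<cdot> k" using d0[of k] by simp
    fix u v assume uv: "u \<in> Arr C" "v \<in> Arr C" "src C u = src C v" "tgt C u = src C f"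
      "tgt C v = src C g" "f \<cdot> u = g \<cdot> v"
    define x where "x = i \<cdot> u \<boxplus> j \<cdot> v"
    have x: "x \<in> Arr C" "tgt C x = P" "src C x = src C u" "r \<cdot> x = u" "s \<cdot> x = v"
      using uv by (auto simp: x_def)
    obtain w where w: "w \<in> Arr C" "src C w = src C x" "tgt C w = src C k" "k \<cdot> w = x"
      by (rule kernel_factor[OF k, of x]) (use x uv d0[of x] in auto)
    show "\<exists>!w. w \<in> Hom C (src C u) (src C (r \<cdot> k)) \<and> (r \<cdot> k) \<cdot> w = u \<and> (s \<cdot> k) \<cdot> w = v"
    proof (rule ex1I[of _ w])
      fix w' assume w': "w' \<in> Hom C (src C u) (src C (r \<cdot> k)) \<and> (r \<cdot> k) \<cdot> w' = u \<and> (s \<cdot> k) \<cdot> w' = v"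
      then have kw: "k \<cdot> w' = x" using Px[of "k \<cdot> w'"] by (auto simp: Hom_iff x_def)
      show "w' = w"
        by (rule monicD[OF kernel_monic[OF k]]) (use w w' x kw in \<open>auto simp: Hom_iff\<close>)
    qed (use w x in \<open>auto simp: Hom_iff\<close>)
  qed auto
  then show thesis by (rule that)
qed

text \<open>If the map \<open>f\<close> is epic, so is \<open>(f, -g)\<close> on the biproduct, which is then a cokernel of the
  inclusion of the pullback; hence the pullback square is also a pushout.\<close>

lemma pullback_epic:
  assumes pb: "pullback C f g p q" and e: "epic C f"
  shows "epic C q"
proof -
  note [simp] = pullbackD[OF pb]
  obtain P i j r s where b: "biproduct C (src C f) (src C g) (P, i, j, r, s)"
    using ex_biproduct[of "src C f" "src C g"] by (metis prod_cases5 src_Obj pullbackD(1,2)[OF pb])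
  note [simp] = biproductD[OF b]
  define d where "d = f \<cdot> r \<boxplus> mneg (g \<cdot> s)"
  have d [simp]: "d \<in> Arr C" "src C d = P" "tgt C d = tgt C g" by (auto simp: d_def)
  have [simp]: "d \<cdot> i = f" by (simp add: d_def)
  have [simp]: "d \<cdot> j = mneg g" by (simp add: d_def)
  have "epic C (d \<cdot> i)" using e by simp
  then have de: "epic C d" by (rule epic_cancel) auto
  define k where "k = i \<cdot> p \<boxplus> j \<cdot> q"
  have k [simp]: "k \<in> Arr C" "src C k = src C q" "tgt C k = P" by (auto simp: k_def)
  have rk: "r \<cdot> k = p" "s \<cdot> k = q"
    using reassoc[OF biproductD(14)[OF b], of p] reassoc[OF biproductD(15)[OF b], of q]
      reassoc[OF biproductD(16)[OF b], of p] reassoc[OF biproductD(17)[OF b], of q]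
    by (auto simp: k_def)
  show ?thesis
    unfolding epic_iff
  proof (intro conjI ballI impI)
    fix t assume t: "t \<in> Arr C" "src C t = tgt C q" "t \<cdot> q = mzero C (src C q) (tgt C t)"
    obtain k' where k': "is_kernel C k' d" using obtain_kernel[of d] by auto
    note [simp] = kernelD(1,3)[OF k'] t(1,2)
    \<comment> \<open>The kernel of \<open>d\<close> factors through the pullback, where
      \<open>t \<cdot> q\<close> vanishes, so \<open>t \<cdot> s\<close> kills the kernel and is
      \<open>u \<cdot> d\<close> for some \<open>u\<close>. Restricted to the first summand this
      reads \<open>u \<cdot> f\<close> equals zero, so \<open>u\<close> is zero.\<close>
    have "f \<cdot> (r \<cdot> k') \<boxplus> mneg (g \<cdot> (s \<cdot> k')) = mzero C (src C k') (tgt C g)"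
      using kernelD(4)[OF k'] unfolding d_def by simp
    then have "f \<cdot> (r \<cdot> k') = g \<cdot> (s \<cdot> k')"
      using eq_iff_diff_zero[of "f \<cdot> (r \<cdot> k')" "g \<cdot> (s \<cdot> k')"] by simp
    then obtain w where w: "w \<in> Arr C" "src C w = src C k'" "tgt C w = src C q" "q \<cdot> w = s \<cdot> k'"
      using pullback_lift[OF pb, of "r \<cdot> k'" "s \<cdot> k'"] by auto
    have "(t \<cdot> s) \<cdot> k' = mzero C (src C k') (tgt C t)"
      using reassoc[OF t(3), of w] w by simp
    then obtain u where u: "u \<in> Arr C" "src C u = tgt C d" "tgt C u = tgt C t" "u \<cdot> d = t \<cdot> s"
      using short_exact_colift[OF short_exact_epic[OF de k'], of "t \<cdot> s"] by auto
    have "u \<cdot> f = mzero C (src C f) (tgt C t)"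
      using reassoc[OF u(4), of i] u by simp
    then have "u = mzero C (tgt C f) (tgt C t)" using epic0[OF e, of u] u by simp
    then have "t \<cdot> s = mzero C P (tgt C t)" using u(4) by simp
    from reassoc[OF this, of j] show "t = mzero C (tgt C q) (tgt C t)" by simp
  qed auto
qed

text \<open>The diagram chase uses arrows in place of elements: an arrow killed by \<open>e\<close>
  is killed by \<open>p\<close>, comes from the left end, and vanishes there because
  \<open>i'\<close> and \<open>b\<close> are monic. The argument for epic is dual, and bijective
  arrows are invertible.\<close>

lemma five_lemma:
  assumes E: "short_exact C i p" and E': "short_exact C i' p'"
    and e: "e \<in> Arr C" "src C e = src C p" "tgt C e = src C p'"
    and b: "iso_arr C b" "src C b = src C i" "tgt C b = src C i'" "e \<cdot> i = i' \<cdot> b"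
    and a: "iso_arr C a" "src C a = tgt C p" "tgt C a = tgt C p'" "p' \<cdot> e = a \<cdot> p"
  shows "iso_arr C e"
proof (rule monic_epic_iso)
  note [simp] = short_exactD(1-4)[OF E] short_exactD(1-4)[OF E'] e b(2,3) a(2,3) iso_arr_Arr[OF a(1)]
    iso_arr_Arr[OF b(1)]
  show "monic C e"
    unfolding monic_iff
  proof (intro conjI ballI impI)
    fix g assume g: "g \<in> Arr C" "tgt C g = src C e" "e \<cdot> g = mzero C (src C g) (tgt C e)"
    note [simp] = g(1,2)
    have "a \<cdot> (p \<cdot> g) = mzero C (src C g) (tgt C a)"
      using reassoc[OF a(4), of g] g(3) by simp
    then have "p \<cdot> g = mzero C (src C g) (tgt C p)"
      using monic0[OF iso_monic[OF a(1)], of "p \<cdot> g"] by simp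
    then obtain u where u: "u \<in> Arr C" "src C u = src C g" "tgt C u = src C i" "i \<cdot> u = g"
      using short_exact_lift[OF E, of g] by auto
    have "i' \<cdot> (b \<cdot> u) = mzero C (src C u) (tgt C i')"
      using reassoc[OF b(4), of u] u g(3) by simp
    then have "b \<cdot> u = mzero C (src C u) (tgt C b)"
      using monic0[OF short_exactD(5)[OF E'], of "b \<cdot> u"] u by simp
    then have "u = mzero C (src C u) (src C b)"
      using monic0[OF iso_monic[OF b(1)], of u] u by simp
    then have "i \<cdot> u = mzero C (src C g) (tgt C i)" using u by (metis cmp_zero b(2) short_exactD(1)[OF E]
      src_Obj)
    then show "g = mzero C (src C g) (src C e)" using u by simp
  qed simp
  show "epic C e"
    unfolding epic_iff
  proof (intro conjI ballI impI)
    fix g assume g: "g \<in> Arr C" "src C g = tgt C e" "g \<cdot> e = mzero C (src C e) (tgt C g)"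
    note [simp] = g(1,2)
    have "(g \<cdot> i') \<cdot> b = mzero C (src C b) (tgt C g)"
      using reassoc[OF g(3), of i] b(4) by simp
    then have "g \<cdot> i' = mzero C (src C i') (tgt C g)"
      using epic0[OF iso_epic[OF b(1)], of "g \<cdot> i'"] by simp
    then obtain u where u: "u \<in> Arr C" "src C u = tgt C p'" "tgt C u = tgt C g" "u \<cdot> p' = g"
      using short_exact_colift[OF E', of g] by auto
    have "(u \<cdot> a) \<cdot> p = mzero C (src C p) (tgt C g)"
      using reassoc[OF u(4), of e] u a(4) g(3) by simp
    then have "u \<cdot> a = mzero C (tgt C p) (tgt C g)"
      using epic0[OF short_exactD(6)[OF E], of "u \<cdot> a"] u by simp
    then have "u = mzero C (tgt C a) (tgt C g)"
      using epic0[OF iso_epic[OF a(1)], of u] u by simp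
    then have "u \<cdot> p' = mzero C (src C p') (tgt C g)" using u by (metis zero_cmp a(3) short_exactD(2)[OF
      E'] tgt_Obj g(1))
    then show "g = mzero C (tgt C e) (tgt C g)" using u by simp
  qed simp
qed

section \<open>Simple objects and Schur's lemma\<close>

lemma simpleD:
  assumes "simple C S"
  shows "S \<in> Obj C" "\<not> zero_obj C S" "\<And>f. \<lbrakk>monic C f; tgt C f = S\<rbrakk> \<Longrightarrow> zero_obj C (src C f) \<or> iso_arr C f"
  using assms unfolding simple_def by auto

text \<open>Simplicity is defined by subobjects; quotients are controlled through their kernels.
  With this lemma every statement about maps into a simple object is the dual of one about maps out
  of it.\<close>

lemma simple_op: 
  assumes S: "simple C S"
  shows "simple (op C) S"
  unfolding simple_def
proof (intro conjI allI impI)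
  fix f assume "monic (op C) f \<and> tgt (op C) f = S"
  then have f: "epic C f" "src C f = S" by auto
  note [simp] = f(2) epic_Arr[OF f(1)]
  obtain k where k: "is_kernel C k f" using obtain_kernel[of f] by auto
  note [simp] = kernelD[OF k]
  from simpleD(3)[OF S kernel_monic[OF k]] consider "zero_obj C (src C k)" | "iso_arr C k" by auto
  then show "zero_obj (op C) (src (op C) f) \<or> iso_arr (op C) f"
  proof cases
    case 1 then show ?thesis using zero_kernel_monic[OF k] monic_epic_iso f by simp
  next
    case 2
    have f0: "f = mzero C (src C f) (tgt C f)"
      using epic0[OF iso_epic[OF 2], of f] by simp
    have "ident C (tgt C f) = mzero C (tgt C f) (tgt C f)"
      by (rule epic0[OF f(1), of "ident C (tgt C f)", simplified]) (use f0 in auto)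
    then show ?thesis by (simp add: zero_obj_iff)
  qed
qed (use simpleD[OF S] in auto)

lemma simple_op_iff [simp]: "simple (op C) S = simple C S"
  using simple_op abelian_category.simple_op[OF dual_abelian] by auto

lemma simple_monic:
  assumes S: "simple C S" and f: "f \<in> Arr C" "src C f = S" "f \<noteq> mzero C S (tgt C f)"
  shows "monic C f"
proof -
  obtain k where k: "is_kernel C k f" using obtain_kernel[of f] f by auto
  note [simp] = kernelD[OF k] f(2)
  from simpleD(3)[OF S kernel_monic[OF k]] consider "zero_obj C (src C k)" | "iso_arr C k" by auto
  then show ?thesis
  proof cases
    case 1 then show ?thesis using zero_kernel_monic[OF k] by simp
  next
    case 2
    then show ?thesis using epic0[OF iso_epic[OF 2], of f] f by simp
  qed
qed

lemma simple_epic: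
  "\<lbrakk>simple C S; f \<in> Arr C; tgt C f = S; f \<noteq> mzero C (src C f) S\<rbrakk> \<Longrightarrow> epic C f"
  using abelian_category.simple_monic[OF dual_abelian, of S f] by simp

lemma schur:
  assumes "simple C S" "simple C T" "f \<in> Arr C" "src C f = S" "tgt C f = T" "f \<noteq> mzero C S T"
  shows "iso_arr C f"
  using simple_monic[OF assms(1,3,4)] simple_epic[OF assms(2,3,5)] assms monic_epic_iso by auto

lemma simple_iso:
  assumes S: "simple C S" and i: "isomorphic C S T"
  shows "simple C T"
proof -
  obtain h where h: "iso_arr C h" "h \<in> Arr C" "src C h = S" "tgt C h = T" using i by (rule isomorphicE)
  obtain g where g: "g \<in> Arr C" "iso_arr C g" "src C g = tgt C h" "tgt C g = src C h"
    "g \<cdot> h = ident C (src C h)" "h \<cdot> g = ident C (tgt C h)" using iso_inv[OF h(1)] .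
  note [simp] = h(2-4) g(1,3,4)
  have "\<not> zero_obj C T"
  proof
    assume "zero_obj C T"
    then have "ident C T = mzero C T T" using zero_obj_iff by auto
    then have "g \<cdot> (ident C T \<cdot> h) = mzero C S S" by (metis h(2-4) g(1,3,4) cmp_zero zero_cmp src_Obj tgt_Obj)
    then have "ident C S = mzero C S S" using g(5) by simp
    then show False using simpleD(1,2)[OF S] zero_obj_iff by auto
  qed
  moreover have "zero_obj C (src C f) \<or> iso_arr C f" if f: "monic C f" "tgt C f = T" for f
  proof -
    note [simp] = monic_Arr[OF f(1)] f(2)
    have "monic C (g \<cdot> f)" by (rule monic_cmp[OF f(1) iso_monic[OF g(2)]]) simp
    with simpleD(3)[OF S this] consider "zero_obj C (src C f)" | "iso_arr C (g \<cdot> f)" by auto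
    then show ?thesis
    proof cases
      case 2
      have "iso_arr C (h \<cdot> (g \<cdot> f))" by (rule iso_cmp[OF 2 h(1)]) simp
      then show ?thesis using reassoc[OF g(6), of f] by simp
    qed auto
  qed
  ultimately show ?thesis unfolding simple_def using h by (metis tgt_Obj)
qed

end

section \<open>The bimodule structure of Ext\<close>

context abelian_category
begin

section \<open>Extensions, their congruence, pullbacks and pushouts\<close>

lemma extensionsE:
  assumes "E \<in> extensions C X Y"
  obtains i p where "E = (i, p)" "short_exact C i p" "src C i = Y" "tgt C p = X"
    "i \<in> Arr C" "p \<in> Arr C" "src C p = tgt C i" "p \<cdot> i = mzero C Y X" "X \<in> Obj C" "Y \<in> Obj C"
proof -
  obtain i p where E: "E = (i, p)" by force
  with assms have "short_exact C i p" "src C i = Y" "tgt C p = X" by (auto simp: extensions_def)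
  then show thesis using that[of i p] E short_exactD[of i p] src_Obj[of i] tgt_Obj[of p] by auto
qed

lemma extensionsI: "\<lbrakk>short_exact C i p; src C i = Y; tgt C p = X\<rbrakk> \<Longrightarrow> (i, p) \<in> extensions C X Y"
  by (auto simp: extensions_def)

lemma ext_Obj:
  assumes "E \<in> extensions C X Y"
  shows "X \<in> Obj C" "Y \<in> Obj C"
  using extensionsE[OF assms] by blast+

lemma ext_morphismI:
  "\<lbrakk>e \<in> Arr C; src C e = tgt C i; tgt C e = tgt C i'; e \<cdot> i = i' \<cdot> b; p' \<cdot> e = a \<cdot> p\<rbrakk>
    \<Longrightarrow> ext_morphism C (i, p) (i', p') b a"
  unfolding ext_morphism_def Hom_def by auto

lemma ext_morphismE:
  assumes "ext_morphism C (i, p) (i', p') b a"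
  obtains e where "e \<in> Arr C" "src C e = tgt C i" "tgt C e = tgt C i'" "e \<cdot> i = i' \<cdot> b" "p' \<cdot> e = a \<cdot> p"
  using assms unfolding ext_morphism_def Hom_def by auto

lemma ext_morphism_cmp:
  assumes E: "E \<in> extensions C X Y" and E': "E' \<in> extensions C X' Y'" and E'': "E'' \<in> extensions C X'' Y''"
    and m: "ext_morphism C E E' b a" and m': "ext_morphism C E' E'' b' a'"
    and ab: "b \<in> Hom C Y Y'" "a \<in> Hom C X X'" "b' \<in> Hom C Y' Y''" "a' \<in> Hom C X' X''"
  shows "ext_morphism C E E'' (b' \<cdot> b) (a' \<cdot> a)"
proof -
  obtain i p where e: "E = (i, p)" "src C i = Y" "tgt C p = X" "i \<in> Arr C" "p \<in> Arr C" "src C p = tgt C i"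
    using extensionsE[OF E] by metis
  obtain i' p' where e': "E' = (i', p')" "src C i' = Y'" "tgt C p' = X'" "i' \<in> Arr C" "p' \<in> Arr C"
    "src C p' = tgt C i'"
    using extensionsE[OF E'] by metis
  obtain i'' p'' where e'': "E'' = (i'', p'')" "src C i'' = Y''" "tgt C p'' = X''" "i'' \<in> Arr C"
    "p'' \<in> Arr C" "src C p'' = tgt C i''"
    using extensionsE[OF E''] by metis
  obtain f where f: "f \<in> Arr C" "src C f = tgt C i" "tgt C f = tgt C i'" "f \<cdot> i = i' \<cdot> b" "p' \<cdot> f = a \<cdot> p"
    using m e e' by (auto elim: ext_morphismE)
  obtain g where g: "g \<in> Arr C" "src C g = tgt C i'" "tgt C g = tgt C i''" "g \<cdot> i' = i'' \<cdot> b'"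
    "p'' \<cdot> g = a' \<cdot> p'"
    using m' e' e'' by (auto elim: ext_morphismE)
  note [simp] = e(2-) e'(2-) e''(2-) f g HomD[OF ab(1)] HomD[OF ab(2)] HomD[OF ab(3)] HomD[OF ab(4)]
  show ?thesis
    unfolding e(1) e''(1)
    by (rule ext_morphismI[of "g \<cdot> f"])
      (simp_all add: reassoc[OF g(4)] reassoc[OF g(5)])
qed

lemma ext_morphism_cmp_eq:
  assumes "E \<in> extensions C X Y" "E' \<in> extensions C X' Y'" "E'' \<in> extensions C X'' Y''"
    and "ext_morphism C E E' b a" "ext_morphism C E' E'' b' a'"
    and "b \<in> Hom C Y Y'" "a \<in> Hom C X X'" "b' \<in> Hom C Y' Y''" "a' \<in> Hom C X' X''"
    and "b' \<cdot> b = b2" "a' \<cdot> a = a2"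
  shows "ext_morphism C E E'' b2 a2"
  using ext_morphism_cmp[OF assms(1-9)] assms(10,11) by simp

lemma ext_morphism_refl:
  assumes E: "E \<in> extensions C X Y"
  shows "ext_morphism C E E (ident C Y) (ident C X)"
proof -
  obtain i p where e: "E = (i, p)" "src C i = Y" "tgt C p = X" "i \<in> Arr C" "p \<in> Arr C" "src C p = tgt C i"
    using extensionsE[OF E] by metis
  show ?thesis
    unfolding e(1) by (rule ext_morphismI[of "ident C (tgt C i)"]) (use e in auto)
qed

text \<open>The five lemma makes the middle arrow invertible, and its inverse is a morphism in the
  other direction.\<close>

lemma ext_morphism_sym:
  assumes E: "E \<in> extensions C X Y" and E': "E' \<in> extensions C X Y"
    and m: "ext_morphism C E E' (ident C Y) (ident C X)"
  shows "ext_morphism C E' E (ident C Y) (ident C X)"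
proof -
  obtain i p where e: "E = (i, p)" "short_exact C i p" "src C i = Y" "tgt C p = X" "i \<in> Arr C" "p \<in> Arr C"
    "src C p = tgt C i"
    using extensionsE[OF E] by metis
  obtain i' p' where e': "E' = (i', p')" "short_exact C i' p'" "src C i' = Y" "tgt C p' = X" "i' \<in> Arr C"
    "p' \<in> Arr C" "src C p' = tgt C i'"
    using extensionsE[OF E'] by metis
  obtain f where f: "f \<in> Arr C" "src C f = tgt C i" "tgt C f = tgt C i'" "f \<cdot> i = i'" "p' \<cdot> f = p"
    using m e e' by (auto elim: ext_morphismE)
  note [simp] = e(3-) e'(3-) f
  have [simp]: "X \<in> Obj C" "Y \<in> Obj C" using ext_Obj[OF E] by auto
  have "iso_arr C f"
    by (rule five_lemma[OF e(2) e'(2), where b = "ident C Y" and a = "ident C X"])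
      (auto intro: iso_ident)
  then obtain g where g: "g \<in> Arr C" "src C g = tgt C f" "tgt C g = src C f"
    "g \<cdot> f = ident C (src C f)" "f \<cdot> g = ident C (tgt C f)" by (rule iso_arrE)
  note [simp] = g
  have "g \<cdot> i' = i" using reassoc[OF g(4), of i] by simp
  moreover have "p \<cdot> g = p'" using reassoc[OF f(5), of g] by simp
  ultimately show ?thesis
    unfolding e(1) e'(1) by (intro ext_morphismI[of g]) simp_all
qed

lemma ident_Hom: "X \<in> Obj C \<Longrightarrow> ident C X \<in> Hom C X X"
  by (simp add: Hom_iff)

lemma ext_morphism_cmp_cong:
  assumes E: "E \<in> extensions C X Y" and E1: "E1 \<in> extensions C X Y"
    and E': "E' \<in> extensions C X' Y'" and E1': "E1' \<in> extensions C X' Y'"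
    and "ext_morphism C E E1 (ident C Y) (ident C X)" "ext_morphism C E1 E1' b a"
      "ext_morphism C E1' E' (ident C Y') (ident C X')"
    and ab: "b \<in> Hom C Y Y'" "a \<in> Hom C X X'"
  shows "ext_morphism C E E' b a"
  using ext_morphism_cmp[OF E E1' E' ext_morphism_cmp[OF E E1 E1' assms(5,6) _ _ ab] assms(7)] ab
    ext_Obj[OF E] ext_Obj[OF E'] by (simp add: Hom_iff)

lemma ext_morphism_trans:
  assumes E: "E \<in> extensions C X Y" and E1: "E1 \<in> extensions C X Y" and E2: "E2 \<in> extensions C X Y"
    and "ext_morphism C E E1 (ident C Y) (ident C X)" "ext_morphism C E1 E2 (ident C Y) (ident C X)"
  shows "ext_morphism C E E2 (ident C Y) (ident C X)"
  using ext_morphism_cmp_cong[OF E E1 E2 E2 assms(4,5) ext_morphism_refl[OF E2]] ext_Obj[OF E]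
  by (simp add: Hom_iff)

lemma equiv_ext_cong: "equiv (extensions C X Y) (ext_cong C X Y)"
proof (rule equivI)
  show "ext_cong C X Y \<subseteq> extensions C X Y \<times> extensions C X Y" by (auto simp: ext_cong_def)
  show "refl_on (extensions C X Y) (ext_cong C X Y)"
    by (rule refl_onI) (auto simp: ext_cong_def ext_morphism_refl)
  show "sym (ext_cong C X Y)"
    by (rule symI) (auto simp: ext_cong_def intro: ext_morphism_sym)
  show "trans (ext_cong C X Y)"
    by (rule transI) (auto simp: ext_cong_def intro: ext_morphism_trans)
qed

definition ext_class :: "'o \<Rightarrow> 'o \<Rightarrow> 'm \<times> 'm \<Rightarrow> ('m \<times> 'm) set" where
  "ext_class X Y E = ext_cong C X Y `` {E}"

lemma ext_class_eq_iff:
  assumes "E \<in> extensions C X Y" "E' \<in> extensions C X Y"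
  shows "ext_class X Y E = ext_class X Y E' \<longleftrightarrow> ext_morphism C E E' (ident C Y) (ident C X)"
  unfolding ext_class_def using eq_equiv_class_iff[OF equiv_ext_cong assms] assms
  by (simp add: ext_cong_def)

lemma ext_class_Ext1: "E \<in> extensions C X Y \<Longrightarrow> ext_class X Y E \<in> Ext1 C X Y"
  unfolding ext_class_def Ext1_def by (rule quotientI)

lemma Ext1_cases:
  assumes "\<xi> \<in> Ext1 C X Y"
  obtains E where "E \<in> extensions C X Y" "\<xi> = ext_class X Y E"
  using assms unfolding ext_class_def Ext1_def by (rule quotientE)

lemma Ext1_Obj:
  assumes "\<xi> \<in> Ext1 C X Y"
  shows "X \<in> Obj C" "Y \<in> Obj C"
  using Ext1_cases[OF assms] ext_Obj by metis+

lemma mem_ext_class: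
  "E' \<in> ext_class X Y E \<longleftrightarrow> E \<in> extensions C X Y \<and> E' \<in> extensions C X Y \<and>
    ext_morphism C E E' (ident C Y) (ident C X)"
  by (auto simp: ext_class_def ext_cong_def)

text \<open>The middle term is the pullback of \<open>p\<close> along \<open>a\<close>, and the left
  end stays the kernel. The last conclusion is the universal property with an arbitrary left
  component: any morphism over \<open>a\<close> factors through the constructed extension with an
  identity on the right.\<close>

lemma ext_pullback_exists:
  assumes E': "E' \<in> extensions C X Y" and a: "a \<in> Hom C X1 X"
  obtains E where "E \<in> extensions C X1 Y" "ext_morphism C E E' (ident C Y) a"
    "\<And>E1 Y1 b. \<lbrakk>E1 \<in> extensions C X1 Y1; b \<in> Hom C Y1 Y; ext_morphism C E1 E' b a\<rbrakk>
      \<Longrightarrow> ext_morphism C E1 E b (ident C X1)"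
proof -
  note [simp] = HomD[OF a]
  obtain i p where e: "E' = (i, p)" "short_exact C i p" "src C i = Y" "tgt C p = X" "i \<in> Arr C"
    "p \<in> Arr C" "src C p = tgt C i"
    "p \<cdot> i = mzero C Y X" using extensionsE[OF E'] by metis
  note [simp] = e(3-)
  have [simp]: "X \<in> Obj C" "Y \<in> Obj C" "X1 \<in> Obj C" using ext_Obj[OF E'] Hom_Obj[OF a] by auto
  obtain f q where pb: "pullback C p a f q" using ex_pullback[of p a] by auto
  note [simp] = pullbackD[OF pb]
  have q: "epic C q" using pullback_epic[OF pb] short_exactD(6)[OF e(2)] by blast
  obtain j where j: "j \<in> Arr C" "src C j = Y" "tgt C j = src C q" "f \<cdot> j = i" "q \<cdot> j = mzero C Y X1"
    by (rule pullback_lift[OF pb, of i "mzero C Y X1"]) auto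
  note [simp] = j
  have mj: "monic C j" by (rule monic_cancel[of f]) (use short_exactD(5)[OF e(2)] in auto)
  have "is_kernel C j q"
  proof (rule kernelI[OF _ _ _ mj])
    fix g assume g: "g \<in> Arr C" "tgt C g = src C q" "q \<cdot> g = mzero C (src C g) (tgt C q)"
    note [simp] = g
    obtain u where u: "u \<in> Arr C" "src C u = src C g" "tgt C u = Y" "i \<cdot> u = f \<cdot> g"
      using short_exact_lift[OF e(2), of "f \<cdot> g"] reassoc[OF pullbackD(9)[OF pb], of g] by auto
    have "j \<cdot> u = g"
      by (rule pullback_eqI[OF pb]) (use u reassoc[OF j(4), of u] reassoc[OF j(5), of u] in auto)
    then show "\<exists>u \<in> Arr C. src C u = src C g \<and> tgt C u = src C j \<and> j \<cdot> u = g" using u by auto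
  qed auto
  then have "short_exact C j q" by (rule short_exact_epic[OF q])
  then have E: "(j, q) \<in> extensions C X1 Y" by (rule extensionsI) auto
  show thesis
  proof (rule that[OF E])
    show "ext_morphism C (j, q) E' (ident C Y) a"
      unfolding e(1) by (rule ext_morphismI[of f]) auto
    fix E1 Y1 b assume E1: "E1 \<in> extensions C X1 Y1" and b: "b \<in> Hom C Y1 Y" and m: "ext_morphism C E1 E' b a"
    obtain i1 p1 where e1: "E1 = (i1, p1)" "short_exact C i1 p1" "src C i1 = Y1" "tgt C p1 = X1"
      "i1 \<in> Arr C" "p1 \<in> Arr C" "src C p1 = tgt C i1" "p1 \<cdot> i1 = mzero C Y1 X1" using extensionsE[OF E1]
        by metis
    note [simp] = e1(3-) HomD[OF b]
    have [simp]: "Y1 \<in> Obj C" using ext_Obj[OF E1] by auto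
    obtain g where g: "g \<in> Arr C" "src C g = tgt C i1" "tgt C g = tgt C i" "g \<cdot> i1 = i \<cdot> b" "p \<cdot> g = a \<cdot> p1"
      using m unfolding e(1) e1(1) by (rule ext_morphismE)
    note [simp] = g
    obtain w where w: "w \<in> Arr C" "src C w = src C g" "tgt C w = src C q" "f \<cdot> w = g" "q \<cdot> w = p1"
      by (rule pullback_lift[OF pb, of g p1]) auto
    note [simp] = w
    have "w \<cdot> i1 = j \<cdot> b"
      by (rule pullback_eqI[OF pb])
        (auto simp: reassoc[OF j(4), of b] reassoc[OF j(5), of b] reassoc[OF w(4), of i1] reassoc[OF w(5),
          of i1])
    then show "ext_morphism C E1 (j, q) b (ident C X1)"
      unfolding e1(1) by (intro ext_morphismI[of w]) auto
  qed
qed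

text \<open>Any extension mapping to \<open>E'\<close> with ends the identity and \<open>a\<close>
  is congruent to the constructed pullback, and so inherits its universal property.\<close>

lemma ext_pullback_universal:
  assumes E1: "E1 \<in> extensions C X1 Y1" and E: "E \<in> extensions C X1 Y" and E': "E' \<in> extensions C X Y"
    and a: "a \<in> Hom C X1 X" and b: "b \<in> Hom C Y1 Y"
    and m: "ext_morphism C E E' (ident C Y) a" and m1: "ext_morphism C E1 E' b a"
  shows "ext_morphism C E1 E b (ident C X1)"
proof -
  obtain P where P: "P \<in> extensions C X1 Y" "ext_morphism C P E' (ident C Y) a"
    "\<And>E1 Y1 b. \<lbrakk>E1 \<in> extensions C X1 Y1; b \<in> Hom C Y1 Y; ext_morphism C E1 E' b a\<rbrakk>
      \<Longrightarrow> ext_morphism C E1 P b (ident C X1)"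
    using ext_pullback_exists[OF E' a] by metis
  have "ext_morphism C E P (ident C Y) (ident C X1)"
    using P(3)[OF E _ m] ext_Obj[OF E] by (simp add: Hom_iff)
  then have "ext_morphism C P E (ident C Y) (ident C X1)" by (rule ext_morphism_sym[OF E P(1)])
  then show ?thesis
    by (rule ext_morphism_cmp_eq[OF E1 P(1) E P(3)[OF E1 b m1]])
      (use ext_Obj[OF E] b in \<open>auto simp: Hom_iff\<close>)
qed

lemma extensions_op: "(p, i) \<in> extensions (op C) Y X \<longleftrightarrow> (i, p) \<in> extensions C X Y"
  by (auto simp: extensions_def)

text \<open>\<open>ext_morphism\<close> names the middle terms through the targets of the left
  arrows, its dual through the sources of the right ones. The hypotheses make these agree, so
  pushouts can be obtained as pullbacks in the opposite category.\<close>

lemma ext_morphism_op: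
  assumes "(i, p) \<in> extensions C X Y" "(i', p') \<in> extensions C X' Y'"
  shows "ext_morphism (op C) (p', i') (p, i) a b \<longleftrightarrow> ext_morphism C (i, p) (i', p') b a"
proof -
  have "src C p = tgt C i" "src C p' = tgt C i'"
    using assms short_exactD(3) by (auto simp: extensions_def)
  then show ?thesis
    unfolding ext_morphism_def Hom_op prod.case op_sel by (simp add: conj_commute)
qed

lemma ext_pushout_exists:
  assumes E: "E \<in> extensions C X Y" and b: "b \<in> Hom C Y Y1"
  obtains E' where "E' \<in> extensions C X Y1" "ext_morphism C E E' b (ident C X)"
proof -
  obtain i p where e: "E = (i, p)" by force
  have "(p, i) \<in> extensions (op C) Y X" "b \<in> Hom (op C) Y1 Y"
    using E b unfolding e extensions_op by auto
  from abelian_category.ext_pullback_exists[OF dual_abelian this]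
  obtain q j where q: "(q, j) \<in> extensions (op C) Y1 X" "ext_morphism (op C) (q, j) (p, i) (ident C X) b"
    unfolding op_sel by (metis surj_pair)
  then show thesis using that[of "(j, q)"] E unfolding e extensions_op by (simp add: ext_morphism_op)
qed

lemma ext_pushout_universal:
  assumes E: "E \<in> extensions C X Y" and E': "E' \<in> extensions C X Y1" and E2: "E2 \<in> extensions C X2 Y1"
    and b: "b \<in> Hom C Y Y1" and a: "a \<in> Hom C X X2"
    and m: "ext_morphism C E E' b (ident C X)" and m2: "ext_morphism C E E2 b a"
  shows "ext_morphism C E' E2 (ident C Y1) a"
proof -
  obtain i p i' p' i2 p2 where e: "E = (i, p)" "E' = (i', p')" "E2 = (i2, p2)" by (metis surj_pair)
  have "ext_morphism (op C) (p2, i2) (p', i') a (ident C Y1)"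
    using abelian_category.ext_pullback_universal[OF dual_abelian, of "(p2, i2)" Y1 X2 "(p', i')" X
      "(p, i)" Y b a]
      assms unfolding e extensions_op Hom_op op_sel by (simp add: ext_morphism_op)
  then show ?thesis using E' E2 unfolding e by (simp add: ext_morphism_op)
qed

text \<open>Stated for any set between a single extension and its class, since the Baer sum pulls
  back a set of direct sums, which is only part of a congruence class.\<close>

lemma ext_pullback_eq:
  assumes P: "P \<in> extensions C X1 Y" and E: "E \<in> extensions C X Y" and a: "a \<in> Hom C X1 X"
    and m: "ext_morphism C P E (ident C Y) a" and EE: "E \<in> \<xi>" "\<xi> \<subseteq> ext_class X Y E"
  shows "ext_pullback C X1 Y a \<xi> = ext_class X1 Y P"
proof -
  have [simp]: "X \<in> Obj C" "Y \<in> Obj C" "X1 \<in> Obj C" using ext_Obj[OF E] ext_Obj[OF P] by auto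
  note h = HomD[OF a]
  have "E' \<in> ext_class X1 Y P" if E': "E' \<in> extensions C X1 Y" and F: "F \<in> \<xi>"
    "ext_morphism C E' F (ident C Y) a" for E' F
  proof -
    have "F \<in> ext_class X Y E" using F EE by auto
    then have F': "F \<in> extensions C X Y" "ext_morphism C F E (ident C Y) (ident C X)"
      using ext_morphism_sym unfolding mem_ext_class by blast+
    have "ext_morphism C E' E (ident C Y) a"
      using ext_morphism_cmp[OF E' F'(1) E F(2) F'(2)] h by (simp add: Hom_iff)
    then have "ext_morphism C E' P (ident C Y) (ident C X1)"
      using ext_pullback_universal[OF E' P E a _ m] by (simp add: Hom_iff)
    then show ?thesis using ext_morphism_sym[OF E' P] E' P by (simp add: mem_ext_class)
  qed
  moreover have "E' \<in> extensions C X1 Y" "ext_morphism C E' E (ident C Y) a" if "E' \<in> ext_class X1 Y P" for E'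
  proof -
    have E': "E' \<in> extensions C X1 Y" "ext_morphism C E' P (ident C Y) (ident C X1)"
      using that ext_morphism_sym by (auto simp: mem_ext_class)
    then show "E' \<in> extensions C X1 Y" "ext_morphism C E' E (ident C Y) a"
      using ext_morphism_cmp[OF E'(1) P E E'(2) m] h by (simp_all add: Hom_iff)
  qed
  ultimately show ?thesis unfolding ext_pullback_def using EE by blast
qed

lemma ext_class_self: "E \<in> extensions C X Y \<Longrightarrow> E \<in> ext_class X Y E"
  by (simp add: mem_ext_class ext_morphism_refl)

lemma ext_pullback_class:
  assumes "P \<in> extensions C X1 Y" "E \<in> extensions C X Y" "a \<in> Hom C X1 X" "ext_morphism C P E (ident C Y) a"
  shows "ext_pullback C X1 Y a (ext_class X Y E) = ext_class X1 Y P"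
  by (rule ext_pullback_eq[OF assms ext_class_self[OF assms(2)] subset_refl])

lemma ext_pushout_class:
  assumes P: "P \<in> extensions C X Y1" and E: "E \<in> extensions C X Y" and b: "b \<in> Hom C Y Y1"
    and m: "ext_morphism C E P b (ident C X)"
  shows "ext_pushout C X Y1 b (ext_class X Y E) = ext_class X Y1 P"
proof -
  have [simp]: "X \<in> Obj C" "Y \<in> Obj C" "Y1 \<in> Obj C" using ext_Obj[OF E] ext_Obj[OF P] by auto
  note h = HomD[OF b]
  have "E' \<in> ext_class X Y1 P" if E': "E' \<in> extensions C X Y1"
    and F: "F \<in> ext_class X Y E" "ext_morphism C F E' b (ident C X)" for E' F
  proof -
    have F': "F \<in> extensions C X Y" "ext_morphism C E F (ident C Y) (ident C X)"
      using F by (auto simp: mem_ext_class)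
    have "ext_morphism C E E' b (ident C X)"
      using ext_morphism_cmp[OF E F'(1) E' F'(2) F(2)] h by (simp add: Hom_iff)
    then have "ext_morphism C P E' (ident C Y1) (ident C X)"
      using ext_pushout_universal[OF E P E' b _ m] by (simp add: Hom_iff)
    then show ?thesis using E' P by (simp add: mem_ext_class)
  qed
  moreover have "E' \<in> extensions C X Y1" "ext_morphism C E E' b (ident C X)" if "E' \<in> ext_class X Y1 P" for E'
  proof -
    have E': "E' \<in> extensions C X Y1" "ext_morphism C P E' (ident C Y1) (ident C X)"
      using that by (auto simp: mem_ext_class)
    then show "E' \<in> extensions C X Y1" "ext_morphism C E E' b (ident C X)"
      using ext_morphism_cmp[OF E P E'(1) m E'(2)] h by (simp_all add: Hom_iff)
  qed
  ultimately show ?thesis unfolding ext_pushout_def using ext_class_self[OF E] by blast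
qed

lemma ext_pullback_Ext1:
  assumes "\<xi> \<in> Ext1 C X Y" "a \<in> Hom C X1 X"
  shows "ext_pullback C X1 Y a \<xi> \<in> Ext1 C X1 Y"
proof -
  obtain E where E: "E \<in> extensions C X Y" "\<xi> = ext_class X Y E" using Ext1_cases[OF assms(1)] .
  obtain P where "P \<in> extensions C X1 Y" "ext_morphism C P E (ident C Y) a"
    using ext_pullback_exists[OF E(1) assms(2)] by metis
  then show ?thesis using ext_pullback_class[OF _ E(1) assms(2)] ext_class_Ext1 E(2) by simp
qed

lemma ext_pushout_Ext1:
  assumes "\<xi> \<in> Ext1 C X Y" "b \<in> Hom C Y Y1"
  shows "ext_pushout C X Y1 b \<xi> \<in> Ext1 C X Y1"
proof -
  obtain E where E: "E \<in> extensions C X Y" "\<xi> = ext_class X Y E" using Ext1_cases[OF assms(1)] .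
  obtain P where "P \<in> extensions C X Y1" "ext_morphism C E P b (ident C X)"
    using ext_pushout_exists[OF E(1) assms(2)] by metis
  then show ?thesis using ext_pushout_class[OF _ E(1) assms(2)] ext_class_Ext1 E(2) by simp
qed

text \<open>Every morphism of extensions factors through the pullback of its target and through the
  pushout of its source. This is the tool for all naturality statements about Ext: an identity of
  classes is proved by exhibiting one arrow between middle terms.\<close>

lemma pushout_eq_pullback_iff:
  assumes E: "E \<in> extensions C X Y" and E': "E' \<in> extensions C X' Y'"
    and b: "b \<in> Hom C Y Y'" and a: "a \<in> Hom C X X'"
  shows "ext_pushout C X Y' b (ext_class X Y E) = ext_pullback C X Y' a (ext_class X' Y' E')
    \<longleftrightarrow> ext_morphism C E E' b a"
proof -
  have [simp]: "X \<in> Obj C" "Y \<in> Obj C" "Y' \<in> Obj C" using ext_Obj[OF E] ext_Obj[OF E'] by auto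
  note h = HomD[OF b] HomD[OF a]
  obtain P where P: "P \<in> extensions C X Y'" "ext_morphism C P E' (ident C Y') a"
    using ext_pullback_exists[OF E' a] by metis
  obtain Q where Q: "Q \<in> extensions C X Y'" "ext_morphism C E Q b (ident C X)"
    using ext_pushout_exists[OF E b] by metis
  have eq: "ext_pushout C X Y' b (ext_class X Y E) = ext_pullback C X Y' a (ext_class X' Y' E')
    \<longleftrightarrow> ext_morphism C Q P (ident C Y') (ident C X)"
    using ext_pushout_class[OF Q(1) E b Q(2)] ext_pullback_class[OF P(1) E' a P(2)]
      ext_class_eq_iff[OF Q(1) P(1)] by simp
  show ?thesis
    unfolding eq
  proof
    assume "ext_morphism C Q P (ident C Y') (ident C X)"
    then have "ext_morphism C E P b (ident C X)"
      by (rule ext_morphism_cmp_eq[OF E Q(1) P(1) Q(2)]) (use h in \<open>auto simp: Hom_iff\<close>)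
    from this P(2) show "ext_morphism C E E' b a"
      by (rule ext_morphism_cmp_eq[OF E P(1) E']) (use h in \<open>auto simp: Hom_iff\<close>)
  next
    assume "ext_morphism C E E' b a"
    then have "ext_morphism C E P b (ident C X)" by (rule ext_pullback_universal[OF E P(1) E' a b P(2)])
    then show "ext_morphism C Q P (ident C Y') (ident C X)"
      using ext_pushout_universal[OF E Q(1) P(1) b _ Q(2)] by (simp add: Hom_iff)
  qed
qed

lemma ext_pullback_cmp:
  assumes "\<xi> \<in> Ext1 C X Y" "a \<in> Hom C X1 X" "a' \<in> Hom C X2 X1"
  shows "ext_pullback C X2 Y a' (ext_pullback C X1 Y a \<xi>) = ext_pullback C X2 Y (a \<cdot> a') \<xi>"
proof -
  obtain E where E: "E \<in> extensions C X Y" "\<xi> = ext_class X Y E" using Ext1_cases[OF assms(1)] .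
  obtain P where P: "P \<in> extensions C X1 Y" "ext_morphism C P E (ident C Y) a"
    using ext_pullback_exists[OF E(1) assms(2)] by metis
  obtain Q where Q: "Q \<in> extensions C X2 Y" "ext_morphism C Q P (ident C Y) a'"
    using ext_pullback_exists[OF P(1) assms(3)] by metis
  have "ext_morphism C Q E (ident C Y) (a \<cdot> a')"
    using ext_morphism_cmp[OF Q(1) P(1) E(1) Q(2) P(2)] assms(2,3) ext_Obj[OF E(1)] by (simp add: Hom_iff)
  moreover have "a \<cdot> a' \<in> Hom C X2 X" using assms by (simp add: Hom_iff)
  ultimately show ?thesis
    using ext_pullback_class[OF P(1) E(1) assms(2) P(2)] ext_pullback_class[OF Q(1) P(1) assms(3) Q(2)]
      ext_pullback_class[OF Q(1) E(1)] E(2) by simp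
qed

lemma ext_pushout_cmp:
  assumes "\<xi> \<in> Ext1 C X Y" "b \<in> Hom C Y Y1" "b' \<in> Hom C Y1 Y2"
  shows "ext_pushout C X Y2 b' (ext_pushout C X Y1 b \<xi>) = ext_pushout C X Y2 (b' \<cdot> b) \<xi>"
proof -
  obtain E where E: "E \<in> extensions C X Y" "\<xi> = ext_class X Y E" using Ext1_cases[OF assms(1)] .
  obtain P where P: "P \<in> extensions C X Y1" "ext_morphism C E P b (ident C X)"
    using ext_pushout_exists[OF E(1) assms(2)] by metis
  obtain Q where Q: "Q \<in> extensions C X Y2" "ext_morphism C P Q b' (ident C X)"
    using ext_pushout_exists[OF P(1) assms(3)] by metis
  have "ext_morphism C E Q (b' \<cdot> b) (ident C X)"
    using ext_morphism_cmp[OF E(1) P(1) Q(1) P(2) Q(2)] assms(2,3) ext_Obj[OF E(1)] by (simp add: Hom_iff)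
  moreover have "b' \<cdot> b \<in> Hom C Y Y2" using assms by (simp add: Hom_iff)
  ultimately show ?thesis
    using ext_pushout_class[OF P(1) E(1) assms(2) P(2)] ext_pushout_class[OF Q(1) P(1) assms(3) Q(2)]
      ext_pushout_class[OF Q(1) E(1)] E(2) by simp
qed

text \<open>The composite from the pullback through the given extension to the pushout has ends
  \<open>b\<close> and \<open>a\<close>; \<open>pushout_eq_pullback_iff\<close> turns it into the
  equation.\<close>

lemma ext_pushout_pullback:
  assumes "\<xi> \<in> Ext1 C X Y" "a \<in> Hom C X1 X" "b \<in> Hom C Y Y1"
  shows "ext_pushout C X1 Y1 b (ext_pullback C X1 Y a \<xi>) = ext_pullback C X1 Y1 a (ext_pushout C X Y1 b \<xi>)"
proof -
  obtain E where E: "E \<in> extensions C X Y" "\<xi> = ext_class X Y E" using Ext1_cases[OF assms(1)] .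
  obtain P where P: "P \<in> extensions C X1 Y" "ext_morphism C P E (ident C Y) a"
    using ext_pullback_exists[OF E(1) assms(2)] by metis
  obtain Q where Q: "Q \<in> extensions C X Y1" "ext_morphism C E Q b (ident C X)"
    using ext_pushout_exists[OF E(1) assms(3)] by metis
  have "ext_morphism C P Q b a"
    using ext_morphism_cmp[OF P(1) E(1) Q(1) P(2) Q(2)] assms(2,3) ext_Obj[OF E(1)] by (simp add: Hom_iff)
  then show ?thesis
    using ext_pullback_class[OF P(1) E(1) assms(2) P(2)] ext_pushout_class[OF Q(1) E(1) assms(3) Q(2)]
      pushout_eq_pullback_iff[OF P(1) Q(1) assms(3,2)] E(2) by simp
qed

lemma ext_pullback_ident: "\<xi> \<in> Ext1 C X Y \<Longrightarrow> ext_pullback C X Y (ident C X) \<xi> = \<xi>"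
  by (metis Ext1_cases ext_Obj(1) ext_morphism_refl ext_pullback_class ident_Hom)

lemma ext_pushout_ident: "\<xi> \<in> Ext1 C X Y \<Longrightarrow> ext_pushout C X Y (ident C Y) \<xi> = \<xi>"
  by (metis Ext1_cases ext_Obj(2) ext_morphism_refl ext_pushout_class ident_Hom)

section \<open>Direct sums of extensions and the Baer sum\<close>

definition bobj :: "'o \<Rightarrow> 'o \<Rightarrow> 'o" where
  "bobj X Y = fst (bip C X Y)"

lemma bip_biproduct:
  assumes "X \<in> Obj C" "Y \<in> Obj C"
  shows "biproduct C X Y (bobj X Y, inj1 C X Y, inj2 C X Y, prj1 C X Y, prj2 C X Y)"
proof -
  have "biproduct C X Y (bip C X Y)"
    unfolding bip_def by (rule someI_ex) (rule ex_biproduct[OF assms])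
  moreover obtain P i j p q where "bip C X Y = (P, i, j, p, q)" by (metis surj_pair)
  ultimately show ?thesis
    by (simp add: bobj_def inj1_def inj2_def prj1_def prj2_def)
qed

lemma bip_simps [simp]:
  assumes "X \<in> Obj C" "Y \<in> Obj C"
  shows "bobj X Y \<in> Obj C"
    "inj1 C X Y \<in> Arr C" "src C (inj1 C X Y) = X" "tgt C (inj1 C X Y) = bobj X Y"
    "inj2 C X Y \<in> Arr C" "src C (inj2 C X Y) = Y" "tgt C (inj2 C X Y) = bobj X Y"
    "prj1 C X Y \<in> Arr C" "src C (prj1 C X Y) = bobj X Y" "tgt C (prj1 C X Y) = X"
    "prj2 C X Y \<in> Arr C" "src C (prj2 C X Y) = bobj X Y" "tgt C (prj2 C X Y) = Y"
    "prj1 C X Y \<cdot> inj1 C X Y = ident C X" "prj2 C X Y \<cdot> inj2 C X Y = ident C Y"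
    "prj2 C X Y \<cdot> inj1 C X Y = mzero C X Y" "prj1 C X Y \<cdot> inj2 C X Y = mzero C Y X"
  using biproductD[OF bip_biproduct[OF assms]] by auto

lemma bip_reassoc [simp]:
  assumes "X \<in> Obj C" "Y \<in> Obj C"
  shows "\<lbrakk>f \<in> Arr C; tgt C f = X\<rbrakk> \<Longrightarrow> prj1 C X Y \<cdot> (inj1 C X Y \<cdot> f) = f"
    "\<lbrakk>f \<in> Arr C; tgt C f = Y\<rbrakk> \<Longrightarrow> prj2 C X Y \<cdot> (inj2 C X Y \<cdot> f) = f"
    "\<lbrakk>f \<in> Arr C; tgt C f = X\<rbrakk> \<Longrightarrow> prj2 C X Y \<cdot> (inj1 C X Y \<cdot> f) = mzero C (src C f) Y"
    "\<lbrakk>f \<in> Arr C; tgt C f = Y\<rbrakk> \<Longrightarrow> prj1 C X Y \<cdot> (inj2 C X Y \<cdot> f) = mzero C (src C f) X"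
  using assms by (simp_all flip: assoc)

lemma bip_expand:
  assumes "X \<in> Obj C" "Y \<in> Obj C" "f \<in> Arr C" "tgt C f = bobj X Y"
  shows "inj1 C X Y \<cdot> (prj1 C X Y \<cdot> f) \<boxplus> inj2 C X Y \<cdot> (prj2 C X Y \<cdot> f) = f"
proof -
  have "(inj1 C X Y \<cdot> prj1 C X Y \<boxplus> inj2 C X Y \<cdot> prj2 C X Y) \<cdot> f = f"
    using assms biproductD(18)[OF bip_biproduct[OF assms(1,2)]] by simp
  then show ?thesis using assms by simp
qed

lemma bip_coexpand:
  assumes "X \<in> Obj C" "Y \<in> Obj C" "f \<in> Arr C" "src C f = bobj X Y"
  shows "f \<cdot> (inj1 C X Y \<cdot> prj1 C X Y) \<boxplus> f \<cdot> (inj2 C X Y \<cdot> prj2 C X Y) = f"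
proof -
  have "f \<cdot> (inj1 C X Y \<cdot> prj1 C X Y \<boxplus> inj2 C X Y \<cdot> prj2 C X Y) = f"
    using assms biproductD(18)[OF bip_biproduct[OF assms(1,2)]] by simp
  then show ?thesis using assms by simp
qed

lemma bip_eqI:
  assumes "X \<in> Obj C" "Y \<in> Obj C" "f \<in> Arr C" "tgt C f = bobj X Y" "g \<in> Arr C" "tgt C g = bobj X Y"
    "prj1 C X Y \<cdot> f = prj1 C X Y \<cdot> g" "prj2 C X Y \<cdot> f = prj2 C X Y \<cdot> g"
  shows "f = g"
  using bip_expand[of X Y f] bip_expand[of X Y g] assms by metis

lemma bip_coeqI:
  assumes "X \<in> Obj C" "Y \<in> Obj C" "f \<in> Arr C" "src C f = bobj X Y" "g \<in> Arr C" "src C g = bobj X Y"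
    "f \<cdot> inj1 C X Y = g \<cdot> inj1 C X Y" "f \<cdot> inj2 C X Y = g \<cdot> inj2 C X Y"
  shows "f = g"
proof -
  have "f \<cdot> (inj1 C X Y \<cdot> prj1 C X Y) = g \<cdot> (inj1 C X Y \<cdot> prj1 C X Y)"
    "f \<cdot> (inj2 C X Y \<cdot> prj2 C X Y) = g \<cdot> (inj2 C X Y \<cdot> prj2 C X Y)"
    using reassoc[OF assms(7), of "prj1 C X Y"] reassoc[OF assms(8), of "prj2 C X Y"] assms(1-6) by simp_all
  then show ?thesis using bip_coexpand[of X Y f] bip_coexpand[of X Y g] assms by metis
qed

lemma dsum_simps [simp]:
  assumes "f \<in> Arr C" "g \<in> Arr C"
  shows "dsum C f g \<in> Arr C" "src C (dsum C f g) = bobj (src C f) (src C g)"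
    "tgt C (dsum C f g) = bobj (tgt C f) (tgt C g)"
  using assms by (auto simp: dsum_def)

lemma prj_dsum [simp]:
  assumes "f \<in> Arr C" "g \<in> Arr C" "X = tgt C f" "Y = tgt C g"
  shows "prj1 C X Y \<cdot> dsum C f g = f \<cdot> prj1 C (src C f) (src C g)"
    "prj2 C X Y \<cdot> dsum C f g = g \<cdot> prj2 C (src C f) (src C g)"
    "\<And>h. \<lbrakk>h \<in> Arr C; tgt C h = bobj (src C f) (src C g)\<rbrakk> \<Longrightarrow>
      prj1 C X Y \<cdot> (dsum C f g \<cdot> h) = f \<cdot> (prj1 C (src C f) (src C g) \<cdot> h)"
    "\<And>h. \<lbrakk>h \<in> Arr C; tgt C h = bobj (src C f) (src C g)\<rbrakk> \<Longrightarrow>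
      prj2 C X Y \<cdot> (dsum C f g \<cdot> h) = g \<cdot> (prj2 C (src C f) (src C g) \<cdot> h)"
  using assms by (auto simp: dsum_def)

lemma dsum_inj [simp]:
  assumes "f \<in> Arr C" "g \<in> Arr C" "X = src C f" "Y = src C g"
  shows "dsum C f g \<cdot> inj1 C X Y = inj1 C (tgt C f) (tgt C g) \<cdot> f"
    "dsum C f g \<cdot> inj2 C X Y = inj2 C (tgt C f) (tgt C g) \<cdot> g"
  using assms by (auto simp: dsum_def)

lemma dsum_cmp:
  assumes "f \<in> Arr C" "g \<in> Arr C" "f' \<in> Arr C" "g' \<in> Arr C" "src C f' = tgt C f" "src C g' = tgt C g"
  shows "dsum C f' g' \<cdot> dsum C f g = dsum C (f' \<cdot> f) (g' \<cdot> g)"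
  by (rule bip_eqI[of "tgt C f'" "tgt C g'"]) (use assms in auto)

lemma dsum_monic:
  assumes "monic C f" "monic C g"
  shows "monic C (dsum C f g)"
  unfolding monic_iff
proof (intro conjI ballI impI)
  note [simp] = monic_Arr[OF assms(1)] monic_Arr[OF assms(2)]
  show "dsum C f g \<in> Arr C" by simp
  fix x assume x: "x \<in> Arr C" "tgt C x = src C (dsum C f g)"
    "dsum C f g \<cdot> x = mzero C (src C x) (tgt C (dsum C f g))"
  note [simp] = x(1,2)
  let ?p = "prj1 C (src C f) (src C g)" and ?q = "prj2 C (src C f) (src C g)"
  have "prj1 C (tgt C f) (tgt C g) \<cdot> (dsum C f g \<cdot> x) = mzero C (src C x) (tgt C f)"
    "prj2 C (tgt C f) (tgt C g) \<cdot> (dsum C f g \<cdot> x) = mzero C (src C x) (tgt C g)"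
    unfolding x(3) by auto
  then have eqs: "?p \<cdot> x = mzero C (src C x) (src C f)" "?q \<cdot> x = mzero C (src C x) (src C g)"
    using monic0[OF assms(1), of "?p \<cdot> x"] monic0[OF assms(2), of "?q \<cdot> x"] by auto
  show "x = mzero C (src C x) (src C (dsum C f g))"
    by (rule bip_eqI[of "src C f" "src C g"]) (use eqs in auto)
qed

lemma dsum_epic:
  assumes "epic C f" "epic C g"
  shows "epic C (dsum C f g)"
  unfolding epic_iff
proof (intro conjI ballI impI)
  note [simp] = epic_Arr[OF assms(1)] epic_Arr[OF assms(2)]
  show "dsum C f g \<in> Arr C" by simp
  fix x assume x: "x \<in> Arr C" "src C x = tgt C (dsum C f g)"
    "x \<cdot> dsum C f g = mzero C (src C (dsum C f g)) (tgt C x)"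
  note [simp] = x(1,2)
  let ?i = "inj1 C (tgt C f) (tgt C g)" and ?j = "inj2 C (tgt C f) (tgt C g)"
  have "(x \<cdot> ?i) \<cdot> f = mzero C (src C f) (tgt C x)" "(x \<cdot> ?j) \<cdot> g = mzero C (src C g) (tgt C x)"
    using reassoc[OF x(3), of "inj1 C (src C f) (src C g)"] reassoc[OF x(3), of "inj2 C (src C f) (src C g)"]
    by auto
  then have eqs: "x \<cdot> ?i = mzero C (tgt C f) (tgt C x)" "x \<cdot> ?j = mzero C (tgt C g) (tgt C x)"
    using epic0[OF assms(1), of "x \<cdot> ?i"] epic0[OF assms(2), of "x \<cdot> ?j"] by auto
  show "x = mzero C (tgt C (dsum C f g)) (tgt C x)"
    by (rule bip_coeqI[of "tgt C f" "tgt C g"]) (use eqs in auto)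
qed

lemma dsum_short_exact:
  assumes E: "short_exact C i p" and E': "short_exact C i' p'"
  shows "short_exact C (dsum C i i') (dsum C p p')"
proof (rule short_exact_epic)
  note [simp] = short_exactD(1-4)[OF E] short_exactD(1-4)[OF E']
  show "epic C (dsum C p p')" using E E' by (intro dsum_epic short_exactD)
  show "is_kernel C (dsum C i i') (dsum C p p')"
  proof (rule kernelI)
    show "monic C (dsum C i i')" using E E' by (intro dsum_monic short_exactD)
    show "dsum C p p' \<cdot> dsum C i i' = mzero C (src C (dsum C i i')) (tgt C (dsum C p p'))"
      by (rule bip_eqI[of "tgt C p" "tgt C p'"]) (auto simp: reassoc[OF short_exactD(4)[OF E]] reassoc[OF
        short_exactD(4)[OF E']])
    fix g assume g: "g \<in> Arr C" "tgt C g = src C (dsum C p p')"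
      "dsum C p p' \<cdot> g = mzero C (src C g) (tgt C (dsum C p p'))"
    note [simp] = g(1,2)
    let ?r = "prj1 C (src C p) (src C p')" and ?s = "prj2 C (src C p) (src C p')"
    have "prj1 C (tgt C p) (tgt C p') \<cdot> (dsum C p p' \<cdot> g) = mzero C (src C g) (tgt C p)"
      "prj2 C (tgt C p) (tgt C p') \<cdot> (dsum C p p' \<cdot> g) = mzero C (src C g) (tgt C p')"
      unfolding g(3) by auto
    then have rs: "p \<cdot> (?r \<cdot> g) = mzero C (src C g) (tgt C p)"
      "p' \<cdot> (?s \<cdot> g) = mzero C (src C g) (tgt C p')" by auto
    obtain u where u: "u \<in> Arr C" "src C u = src C g" "tgt C u = src C i" "i \<cdot> u = ?r \<cdot> g"
      by (rule short_exact_lift[OF E, of "?r \<cdot> g"]) (use rs in auto)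
    obtain v where v: "v \<in> Arr C" "src C v = src C g" "tgt C v = src C i'" "i' \<cdot> v = ?s \<cdot> g"
      by (rule short_exact_lift[OF E', of "?s \<cdot> g"]) (use rs in auto)
    let ?w = "inj1 C (src C i) (src C i') \<cdot> u \<boxplus> inj2 C (src C i) (src C i') \<cdot> v"
    have "dsum C i i' \<cdot> ?w = g"
      by (rule bip_eqI[of "src C p" "src C p'"]) (use u v in auto)
    then show "\<exists>w \<in> Arr C. src C w = src C g \<and> tgt C w = src C (dsum C i i') \<and> dsum C i i' \<cdot> w = g"
      using u v by (intro bexI[of _ ?w]) auto
  qed auto
qed

lemma ext_dsum_extensions:
  assumes "E \<in> extensions C X Y" "E' \<in> extensions C X' Y'"
  shows "ext_dsum C E E' \<in> extensions C (bobj X X') (bobj Y Y')"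
proof -
  obtain i p where e: "E = (i, p)" "short_exact C i p" "src C i = Y" "tgt C p = X" "i \<in> Arr C" "p \<in> Arr C"
    "src C p = tgt C i"
    using extensionsE[OF assms(1)] by metis
  obtain i' p' where e': "E' = (i', p')" "short_exact C i' p'" "src C i' = Y'" "tgt C p' = X'"
    "i' \<in> Arr C" "p' \<in> Arr C" "src C p' = tgt C i'"
    using extensionsE[OF assms(2)] by metis
  show ?thesis
    unfolding e(1) e'(1) ext_dsum_def prod.case
    by (rule extensionsI[OF dsum_short_exact[OF e(2) e'(2)]]) (use e e' in auto)
qed

lemma ext_dsum_morphism:
  assumes E: "E \<in> extensions C X Y" and E': "E' \<in> extensions C X' Y'"
    and F: "F \<in> extensions C X Y" and F': "F' \<in> extensions C X' Y'"
    and m: "ext_morphism C E F (ident C Y) (ident C X)" and m': "ext_morphism C E' F' (ident C Y') (ident C X')"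
  shows "ext_morphism C (ext_dsum C E E') (ext_dsum C F F') (ident C (bobj Y Y')) (ident C (bobj X X'))"
proof -
  obtain i p where e: "E = (i, p)" "src C i = Y" "tgt C p = X" "i \<in> Arr C" "p \<in> Arr C" "src C p = tgt C i"
    using extensionsE[OF E] by metis
  obtain i' p' where e': "E' = (i', p')" "src C i' = Y'" "tgt C p' = X'" "i' \<in> Arr C" "p' \<in> Arr C"
    "src C p' = tgt C i'"
    using extensionsE[OF E'] by metis
  obtain j q where f: "F = (j, q)" "src C j = Y" "tgt C q = X" "j \<in> Arr C" "q \<in> Arr C" "src C q = tgt C j"
    using extensionsE[OF F] by metis
  obtain j' q' where f': "F' = (j', q')" "src C j' = Y'" "tgt C q' = X'" "j' \<in> Arr C" "q' \<in> Arr C"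
    "src C q' = tgt C j'"
    using extensionsE[OF F'] by metis
  obtain g where g: "g \<in> Arr C" "src C g = tgt C i" "tgt C g = tgt C j" "g \<cdot> i = j" "q \<cdot> g = p"
    using m unfolding e(1) f(1) by (rule ext_morphismE) (use e f in auto)
  obtain g' where g': "g' \<in> Arr C" "src C g' = tgt C i'" "tgt C g' = tgt C j'" "g' \<cdot> i' = j'" "q' \<cdot> g' = p'"
    using m' unfolding e'(1) f'(1) by (rule ext_morphismE) (use e' f' in auto)
  note [simp] = e(2-) e'(2-) f(2-) f'(2-) g g'
  have [simp]: "X \<in> Obj C" "Y \<in> Obj C" "X' \<in> Obj C" "Y' \<in> Obj C" using ext_Obj[OF E] ext_Obj[OF E'] by auto
  show ?thesis
    unfolding e(1) e'(1) f(1) f'(1) ext_dsum_def prod.case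
    by (rule ext_morphismI[of "dsum C g g'"]) (simp_all add: dsum_cmp)
qed

lemma ext_dsum_prj:
  assumes E: "E \<in> extensions C X Y" and E': "E' \<in> extensions C X' Y'"
  shows "ext_morphism C (ext_dsum C E E') E (prj1 C Y Y') (prj1 C X X')"
    "ext_morphism C (ext_dsum C E E') E' (prj2 C Y Y') (prj2 C X X')"
proof -
  obtain i p where e: "E = (i, p)" "src C i = Y" "tgt C p = X" "i \<in> Arr C" "p \<in> Arr C" "src C p = tgt C i"
    using extensionsE[OF E] by metis
  obtain i' p' where e': "E' = (i', p')" "src C i' = Y'" "tgt C p' = X'" "i' \<in> Arr C" "p' \<in> Arr C"
    "src C p' = tgt C i'"
    using extensionsE[OF E'] by metis
  note [simp] = e(2-) e'(2-)
  show "ext_morphism C (ext_dsum C E E') E (prj1 C Y Y') (prj1 C X X')"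
    unfolding e(1) e'(1) ext_dsum_def prod.case
    by (rule ext_morphismI[of "prj1 C (tgt C i) (tgt C i')"]) simp_all
  show "ext_morphism C (ext_dsum C E E') E' (prj2 C Y Y') (prj2 C X X')"
    unfolding e(1) e'(1) ext_dsum_def prod.case
    by (rule ext_morphismI[of "prj2 C (tgt C i) (tgt C i')"]) simp_all
qed

lemma diagonal_simps [simp]:
  assumes "X \<in> Obj C"
  shows "diagonal C X \<in> Arr C" "src C (diagonal C X) = X" "tgt C (diagonal C X) = bobj X X"
    "prj1 C X X \<cdot> diagonal C X = ident C X" "prj2 C X X \<cdot> diagonal C X = ident C X"
  using assms by (auto simp: diagonal_def)

lemma codiagonal_simps [simp]:
  assumes "X \<in> Obj C"
  shows "codiagonal C X \<in> Arr C" "src C (codiagonal C X) = bobj X X" "tgt C (codiagonal C X) = X"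
    "codiagonal C X \<cdot> inj1 C X X = ident C X" "codiagonal C X \<cdot> inj2 C X X = ident C X"
  using assms by (auto simp: codiagonal_def)

lemma codiagonal_reassoc [simp]:
  assumes "f \<in> Arr C" "tgt C f = X"
  shows "codiagonal C X \<cdot> (inj1 C X X \<cdot> f) = f" "codiagonal C X \<cdot> (inj2 C X X \<cdot> f) = f"
  using assms reassoc[OF codiagonal_simps(4)[of X], of f] reassoc[OF codiagonal_simps(5)[of X], of f]
  by auto

text \<open>Together with the projections in \<open>ext_dsum_prj\<close>, the folding morphism is
  what makes pullback additive in its arrow.\<close>

lemma ext_dsum_codiagonal:
  assumes E: "E \<in> extensions C X Y"
  shows "ext_morphism C (ext_dsum C E E) E (codiagonal C Y) (codiagonal C X)"
proof -
  obtain i p where e: "E = (i, p)" "src C i = Y" "tgt C p = X" "i \<in> Arr C" "p \<in> Arr C" "src C p = tgt C i"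
    using extensionsE[OF E] by metis
  note [simp] = e(2-)
  have [simp]: "X \<in> Obj C" "Y \<in> Obj C" using ext_Obj[OF E] by auto
  have "codiagonal C (tgt C i) \<cdot> dsum C i i = i \<cdot> codiagonal C Y"
    by (rule bip_coeqI[of Y Y]) auto
  moreover have "p \<cdot> codiagonal C (tgt C i) = codiagonal C X \<cdot> dsum C p p"
    by (rule bip_coeqI[of "tgt C i" "tgt C i"]) auto
  ultimately show ?thesis
    unfolding e(1) ext_dsum_def prod.case
    by (intro ext_morphismI[of "codiagonal C (tgt C i)"]) simp_all
qed

text \<open>The extension by \<open>Y\<close> plus \<open>Y'\<close> with components
  \<open>\<xi>\<close> and \<open>\<zeta>\<close>, that is, the inverse of the canonical map from
  Ext(X, Y + Y') to the product of Ext(X, Y) and Ext(X, Y').\<close>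

definition ext_pair :: "'o \<Rightarrow> 'o \<Rightarrow> 'o \<Rightarrow> ('m \<times> 'm) set \<Rightarrow> ('m \<times> 'm) set \<Rightarrow> ('m \<times> 'm) set" where
  "ext_pair X Y Y' \<xi> \<zeta> = ext_pullback C X (bobj Y Y') (diagonal C X) {ext_dsum C E E' | E E'. E \<in> \<xi> \<and> E' \<in> \<zeta>}"

lemma ext_pair_class:
  assumes E: "E \<in> extensions C X Y" and E': "E' \<in> extensions C X Y'"
    and P: "P \<in> extensions C X (bobj Y Y')"
      "ext_morphism C P (ext_dsum C E E') (ident C (bobj Y Y')) (diagonal C X)"
  shows "ext_pair X Y Y' (ext_class X Y E) (ext_class X Y' E') = ext_class X (bobj Y Y') P"
  unfolding ext_pair_def
proof (rule ext_pullback_eq[OF P(1) ext_dsum_extensions[OF E E'] _ P(2)])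
  show "diagonal C X \<in> Hom C X (bobj X X)" using ext_Obj[OF E] by (simp add: Hom_iff)
  show "ext_dsum C E E' \<in> {ext_dsum C F F' |F F'. F \<in> ext_class X Y E \<and> F' \<in> ext_class X Y' E'}"
    using ext_class_self[OF E] ext_class_self[OF E'] by blast
  show "{ext_dsum C F F' |F F'. F \<in> ext_class X Y E \<and> F' \<in> ext_class X Y' E'}
    \<subseteq> ext_class (bobj X X) (bobj Y Y') (ext_dsum C E E')"
    using ext_dsum_morphism[OF E E'] ext_dsum_extensions[OF E E'] ext_dsum_extensions
    by (auto simp: mem_ext_class)
qed

lemma ext_pair_props:
  assumes "\<xi> \<in> Ext1 C X Y" "\<zeta> \<in> Ext1 C X Y'"
  shows "ext_pair X Y Y' \<xi> \<zeta> \<in> Ext1 C X (bobj Y Y')"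
    "ext_pushout C X Y (prj1 C Y Y') (ext_pair X Y Y' \<xi> \<zeta>) = \<xi>"
    "ext_pushout C X Y' (prj2 C Y Y') (ext_pair X Y Y' \<xi> \<zeta>) = \<zeta>"
proof -
  obtain E where E: "E \<in> extensions C X Y" "\<xi> = ext_class X Y E" using Ext1_cases[OF assms(1)] .
  obtain E' where E': "E' \<in> extensions C X Y'" "\<zeta> = ext_class X Y' E'" using Ext1_cases[OF assms(2)] .
  have [simp]: "X \<in> Obj C" "Y \<in> Obj C" "Y' \<in> Obj C" using ext_Obj[OF E(1)] ext_Obj[OF E'(1)] by auto
  note D = ext_dsum_extensions[OF E(1) E'(1)]
  have dg: "diagonal C X \<in> Hom C X (bobj X X)" by (simp add: Hom_iff)
  obtain P where P: "P \<in> extensions C X (bobj Y Y')"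
    "ext_morphism C P (ext_dsum C E E') (ident C (bobj Y Y')) (diagonal C X)"
    using ext_pullback_exists[OF D dg] by metis
  have eq: "ext_pair X Y Y' \<xi> \<zeta> = ext_class X (bobj Y Y') P"
    unfolding E(2) E'(2) by (rule ext_pair_class[OF E(1) E'(1) P])
  show "ext_pair X Y Y' \<xi> \<zeta> \<in> Ext1 C X (bobj Y Y')" unfolding eq using P(1) by (rule ext_class_Ext1)
  have "ext_morphism C P E (prj1 C Y Y') (ident C X)"
    by (rule ext_morphism_cmp_eq[OF P(1) D E(1) P(2) ext_dsum_prj(1)[OF E(1) E'(1)]]) (auto simp: Hom_iff)
  then have "ext_pushout C X Y (prj1 C Y Y') (ext_class X (bobj Y Y') P) = ext_class X Y E"
    by (intro ext_pushout_class[OF E(1) P(1)]) (simp_all add: Hom_iff)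
  then show "ext_pushout C X Y (prj1 C Y Y') (ext_pair X Y Y' \<xi> \<zeta>) = \<xi>"
    using eq E(2) by simp
  have "ext_morphism C P E' (prj2 C Y Y') (ident C X)"
    by (rule ext_morphism_cmp_eq[OF P(1) D E'(1) P(2) ext_dsum_prj(2)[OF E(1) E'(1)]]) (auto simp: Hom_iff)
  then have "ext_pushout C X Y' (prj2 C Y Y') (ext_class X (bobj Y Y') P) = ext_class X Y' E'"
    by (intro ext_pushout_class[OF E'(1) P(1)]) (simp_all add: Hom_iff)
  then show "ext_pushout C X Y' (prj2 C Y Y') (ext_pair X Y Y' \<xi> \<zeta>) = \<zeta>"
    using eq E'(2) by simp
qed

text \<open>The maps from the middle term of \<open>\<omega>\<close> to those of its two pushouts
  combine into a morphism to their direct sum that is the diagonal on \<open>X\<close>. Hence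
  \<open>\<omega>\<close> is the pullback of that direct sum.\<close>

lemma ext_pair_surj:
  assumes w: "\<omega> \<in> Ext1 C X (bobj Y Y')" and Y: "Y \<in> Obj C" "Y' \<in> Obj C"
  shows "ext_pair X Y Y' (ext_pushout C X Y (prj1 C Y Y') \<omega>) (ext_pushout C X Y' (prj2 C Y Y') \<omega>) = \<omega>"
proof -
  obtain P where P: "P \<in> extensions C X (bobj Y Y')" "\<omega> = ext_class X (bobj Y Y') P" using Ext1_cases[OF w] .
  have [simp]: "X \<in> Obj C" "Y \<in> Obj C" "Y' \<in> Obj C" using ext_Obj[OF P(1)] Y by auto
  have h: "prj1 C Y Y' \<in> Hom C (bobj Y Y') Y" "prj2 C Y Y' \<in> Hom C (bobj Y Y') Y'" by (auto simp: Hom_iff)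
  obtain E where E: "E \<in> extensions C X Y" "ext_morphism C P E (prj1 C Y Y') (ident C X)"
    using ext_pushout_exists[OF P(1) h(1)] by metis
  obtain E' where E': "E' \<in> extensions C X Y'" "ext_morphism C P E' (prj2 C Y Y') (ident C X)"
    using ext_pushout_exists[OF P(1) h(2)] by metis
  obtain j q where f: "P = (j, q)" "src C j = bobj Y Y'" "tgt C q = X" "j \<in> Arr C" "q \<in> Arr C"
    "src C q = tgt C j"
    using extensionsE[OF P(1)] by metis
  obtain i p where e: "E = (i, p)" "src C i = Y" "tgt C p = X" "i \<in> Arr C" "p \<in> Arr C" "src C p = tgt C i"
    using extensionsE[OF E(1)] by metis
  obtain i' p' where e': "E' = (i', p')" "src C i' = Y'" "tgt C p' = X" "i' \<in> Arr C" "p' \<in> Arr C"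
    "src C p' = tgt C i'"
    using extensionsE[OF E'(1)] by metis
  note [simp] = e(2-) e'(2-) f(2-)
  obtain g where g: "g \<in> Arr C" "src C g = tgt C j" "tgt C g = tgt C i" "g \<cdot> j = i \<cdot> prj1 C Y Y'" "p \<cdot> g = q"
    using E(2) unfolding e(1) f(1) by (rule ext_morphismE) auto
  obtain g' where g': "g' \<in> Arr C" "src C g' = tgt C j" "tgt C g' = tgt C i'" "g' \<cdot> j = i' \<cdot> prj2 C Y Y'"
    "p' \<cdot> g' = q"
    using E'(2) unfolding e'(1) f(1) by (rule ext_morphismE) auto
  note [simp] = g g'
  let ?h = "inj1 C (tgt C i) (tgt C i') \<cdot> g \<boxplus> inj2 C (tgt C i) (tgt C i') \<cdot> g'"
  have "?h \<cdot> j = dsum C i i'" by (rule bip_eqI[of "tgt C i" "tgt C i'"]) auto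
  moreover have "dsum C p p' \<cdot> ?h = diagonal C X \<cdot> q"
    by (rule bip_eqI[of X X]) (auto simp: reassoc[OF diagonal_simps(4)] reassoc[OF diagonal_simps(5)])
  ultimately have "ext_morphism C P (ext_dsum C E E') (ident C (bobj Y Y')) (diagonal C X)"
    unfolding e(1) e'(1) f(1) ext_dsum_def prod.case by (intro ext_morphismI[of ?h]) (auto simp del: cmp_madd)
  then show ?thesis
    using ext_pair_class[OF E(1) E'(1) P(1)] ext_pushout_class[OF E(1) P(1) h(1) E(2)]
      ext_pushout_class[OF E'(1) P(1) h(2) E'(2)] P(2) by simp
qed

lemma baer_sum_pair: "baer_sum C X Y \<xi> \<zeta> = ext_pushout C X Y (codiagonal C Y) (ext_pair X Y Y \<xi> \<zeta>)"
  unfolding baer_sum_def ext_pair_def bobj_def ..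

text \<open>\<open>f \<boxplus> g\<close> is the codiagonal after the arrow with components
  \<open>f\<close> and \<open>g\<close>, and the pushout along the latter is the pair of the two
  pushouts by \<open>ext_pair_surj\<close>.\<close>

lemma ext_pushout_add:
  assumes w: "\<omega> \<in> Ext1 C X Y" and f: "f \<in> Hom C Y Z" and g: "g \<in> Hom C Y Z"
  shows "ext_pushout C X Z (f \<boxplus> g) \<omega> = baer_sum C X Z (ext_pushout C X Z f \<omega>) (ext_pushout C X Z g \<omega>)"
proof -
  note [simp] = HomD[OF f] HomD[OF g]
  have [simp]: "X \<in> Obj C" "Y \<in> Obj C" "Z \<in> Obj C" using Ext1_Obj[OF w] Hom_Obj[OF f] by auto
  let ?h = "inj1 C Z Z \<cdot> f \<boxplus> inj2 C Z Z \<cdot> g"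
  have h: "?h \<in> Hom C Y (bobj Z Z)" and c: "codiagonal C Z \<in> Hom C (bobj Z Z) Z"
    and p: "prj1 C Z Z \<in> Hom C (bobj Z Z) Z" "prj2 C Z Z \<in> Hom C (bobj Z Z) Z" by (auto simp: Hom_iff)
  have "ext_pair X Z Z (ext_pushout C X Z f \<omega>) (ext_pushout C X Z g \<omega>) = ext_pushout C X (bobj Z Z) ?h \<omega>"
    using ext_pair_surj[OF ext_pushout_Ext1[OF w h]] ext_pushout_cmp[OF w h p(1)] ext_pushout_cmp[OF w h p(2)]
    by simp
  then show ?thesis unfolding baer_sum_pair using ext_pushout_cmp[OF w h c] by simp
qed

lemma baer_sum_Ext1:
  assumes "\<xi> \<in> Ext1 C X Y" "\<zeta> \<in> Ext1 C X Y"
  shows "baer_sum C X Y \<xi> \<zeta> \<in> Ext1 C X Y"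
  unfolding baer_sum_pair
  by (rule ext_pushout_Ext1[OF ext_pair_props(1)[OF assms]]) (use Ext1_Obj[OF assms(1)] in \<open>simp add: Hom_iff\<close>)

text \<open>Since any two extensions are the components of one extension by a biproduct, the following
  identity reduces the laws of the Baer sum to those of the addition of arrows.\<close>

lemma baer_sum_pushout:
  assumes "\<xi> \<in> Ext1 C X Y" "\<zeta> \<in> Ext1 C X Y"
  shows "baer_sum C X Y \<xi> \<zeta> = ext_pushout C X Y (prj1 C Y Y \<boxplus> prj2 C Y Y) (ext_pair X Y Y \<xi> \<zeta>)"
  unfolding baer_sum_pair codiagonal_def ..

lemma ext_pushout_baer:
  assumes x: "\<xi> \<in> Ext1 C X Y" and z: "\<zeta> \<in> Ext1 C X Y" and f: "f \<in> Hom C Y Z"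
  shows "ext_pushout C X Z f (baer_sum C X Y \<xi> \<zeta>) = baer_sum C X Z (ext_pushout C X Z f \<xi>) (ext_pushout C
    X Z f \<zeta>)"
proof -
  note [simp] = HomD[OF f]
  have [simp]: "X \<in> Obj C" "Y \<in> Obj C" using Ext1_Obj[OF x] by auto
  note w = ext_pair_props[OF x z]
  have p: "prj1 C Y Y \<in> Hom C (bobj Y Y) Y" "prj2 C Y Y \<in> Hom C (bobj Y Y) Y"
    and s: "prj1 C Y Y \<boxplus> prj2 C Y Y \<in> Hom C (bobj Y Y) Y"
    and fp: "f \<cdot> prj1 C Y Y \<in> Hom C (bobj Y Y) Z" "f \<cdot> prj2 C Y Y \<in> Hom C (bobj Y Y) Z"
    by (auto simp: Hom_iff)
  show ?thesis
    unfolding baer_sum_pushout[OF x z]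
    using ext_pushout_cmp[OF w(1) s f] ext_pushout_add[OF w(1) fp] ext_pushout_cmp[OF w(1) p(1) f]
      ext_pushout_cmp[OF w(1) p(2) f] w(2,3) by simp
qed

lemma ext_pullback_baer:
  assumes x: "\<xi> \<in> Ext1 C X Y" and z: "\<zeta> \<in> Ext1 C X Y" and f: "f \<in> Hom C X1 X"
  shows "ext_pullback C X1 Y f (baer_sum C X Y \<xi> \<zeta>) = baer_sum C X1 Y (ext_pullback C X1 Y f \<xi>)
    (ext_pullback C X1 Y f \<zeta>)"
proof -
  have [simp]: "X \<in> Obj C" "Y \<in> Obj C" using Ext1_Obj[OF x] by auto
  note w = ext_pair_props[OF x z]
  have p: "prj1 C Y Y \<in> Hom C (bobj Y Y) Y" "prj2 C Y Y \<in> Hom C (bobj Y Y) Y"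
    and s: "prj1 C Y Y \<boxplus> prj2 C Y Y \<in> Hom C (bobj Y Y) Y"
    by (auto simp: Hom_iff)
  show ?thesis
    unfolding baer_sum_pushout[OF x z]
    using ext_pushout_pullback[OF w(1) f s] ext_pushout_add[OF ext_pullback_Ext1[OF w(1) f] p]
      ext_pushout_pullback[OF w(1) f p(1)] ext_pushout_pullback[OF w(1) f p(2)] w(2,3) by simp
qed

lemma baer_sum_comm:
  assumes x: "\<xi> \<in> Ext1 C X Y" and z: "\<zeta> \<in> Ext1 C X Y"
  shows "baer_sum C X Y \<xi> \<zeta> = baer_sum C X Y \<zeta> \<xi>"
proof -
  have [simp]: "X \<in> Obj C" "Y \<in> Obj C" using Ext1_Obj[OF x] by auto
  note w = ext_pair_props[OF x z]
  have p: "prj1 C Y Y \<in> Hom C (bobj Y Y) Y" "prj2 C Y Y \<in> Hom C (bobj Y Y) Y"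
    by (auto simp: Hom_iff)
  have "prj1 C Y Y \<boxplus> prj2 C Y Y = prj2 C Y Y \<boxplus> prj1 C Y Y" by (rule madd_comm) auto
  then show ?thesis
    using baer_sum_pushout[OF x z] ext_pushout_add[OF w(1) p(2,1)] w(2,3) by simp
qed

text \<open>All three classes are pushouts of one extension by a threefold biproduct, along its
  three projections. Associativity then is that of adding these projections.\<close>

lemma baer_sum_assoc:
  assumes x: "\<xi> \<in> Ext1 C X Y" and z: "\<zeta> \<in> Ext1 C X Y" and t: "\<theta> \<in> Ext1 C X Y"
  shows "baer_sum C X Y (baer_sum C X Y \<xi> \<zeta>) \<theta> = baer_sum C X Y \<xi> (baer_sum C X Y \<zeta> \<theta>)"
proof -
  have [simp]: "X \<in> Obj C" "Y \<in> Obj C" using Ext1_Obj[OF x] by auto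
  note w = ext_pair_props[OF x z]
  note v = ext_pair_props[OF w(1) t]
  let ?W = "ext_pair X (bobj Y Y) Y (ext_pair X Y Y \<xi> \<zeta>) \<theta>" and ?V = "bobj (bobj Y Y) Y"
  let ?p = "prj1 C (bobj Y Y) Y"
  let ?a = "prj1 C Y Y \<cdot> ?p" and ?b = "prj2 C Y Y \<cdot> ?p" and ?c = "prj2 C (bobj Y Y) Y"
  have h: "?a \<in> Hom C ?V Y" "?b \<in> Hom C ?V Y" "?c \<in> Hom C ?V Y" "?a \<boxplus> ?b \<in> Hom C ?V Y" "?b \<boxplus> ?c \<in> Hom C ?V Y"
    "?p \<in> Hom C ?V (bobj Y Y)" "prj1 C Y Y \<in> Hom C (bobj Y Y) Y" "prj2 C Y Y \<in> Hom C (bobj Y Y) Y"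
    by (auto simp: Hom_iff)
  have a: "ext_pushout C X Y ?a ?W = \<xi>" and b: "ext_pushout C X Y ?b ?W = \<zeta>"
    using ext_pushout_cmp[OF v(1) h(6,7)] ext_pushout_cmp[OF v(1) h(6,8)] v(2) w(2,3) by auto
  have "(?a \<boxplus> ?b) \<boxplus> ?c = ?a \<boxplus> (?b \<boxplus> ?c)" by (rule madd_assoc) auto
  then show ?thesis
    using ext_pushout_add[OF v(1) h(4,3)] ext_pushout_add[OF v(1) h(1,5)]
      ext_pushout_add[OF v(1) h(1,2)] ext_pushout_add[OF v(1) h(2,3)] a b v(3) by simp
qed

section \<open>The split extension and the zero class\<close>

lemma split_extension:
  assumes "X \<in> Obj C" "Y \<in> Obj C"
  shows "(inj1 C Y X, prj2 C Y X) \<in> extensions C X Y"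
proof (rule extensionsI)
  note [simp] = assms
  show "short_exact C (inj1 C Y X) (prj2 C Y X)"
  proof (rule short_exact_epic)
    show "epic C (prj2 C Y X)" by (rule split_epic[of _ "inj2 C Y X"]) auto
    show "is_kernel C (inj1 C Y X) (prj2 C Y X)"
    proof (rule kernelI)
      show "monic C (inj1 C Y X)" by (rule split_monic[of _ "prj1 C Y X"]) auto
      fix g assume g: "g \<in> Arr C" "tgt C g = src C (prj2 C Y X)"
        "prj2 C Y X \<cdot> g = mzero C (src C g) (tgt C (prj2 C Y X))"
      have "inj1 C Y X \<cdot> (prj1 C Y X \<cdot> g) = g"
        by (rule bip_eqI[of Y X]) (use g in auto)
      then show "\<exists>u \<in> Arr C. src C u = src C g \<and> tgt C u = src C (inj1 C Y X) \<and> inj1 C Y X \<cdot> u = g"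
        using g by (intro bexI[of _ "prj1 C Y X \<cdot> g"]) auto
    qed auto
  qed
qed (use assms in auto)

lemma ext_zero_class: "ext_zero C X Y = ext_class X Y (inj1 C Y X, prj2 C Y X)"
  unfolding ext_zero_def ext_class_def ..

lemma ext_zero_Ext1: "\<lbrakk>X \<in> Obj C; Y \<in> Obj C\<rbrakk> \<Longrightarrow> ext_zero C X Y \<in> Ext1 C X Y"
  unfolding ext_zero_class by (intro ext_class_Ext1 split_extension)

text \<open>A morphism from the split extension with ends the identity and \<open>a\<close>
  restricts on the second summand to a lift of \<open>a\<close> through \<open>p\<close>; conversely
  \<open>i\<close> and a lift assemble to such a morphism. For \<open>a\<close> the identity this is
  the usual criterion for splitting.\<close>

lemma ext_pullback_zero_iff:
  assumes E: "(i, p) \<in> extensions C X Y" and a: "a \<in> Hom C X1 X"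
  shows "ext_pullback C X1 Y a (ext_class X Y (i, p)) = ext_zero C X1 Y
    \<longleftrightarrow> (\<exists>t \<in> Hom C X1 (tgt C i). p \<cdot> t = a)"
proof -
  have [simp]: "X \<in> Obj C" "Y \<in> Obj C" "X1 \<in> Obj C" using ext_Obj[OF E] Hom_Obj[OF a] by auto
  have e: "src C i = Y" "tgt C p = X" "i \<in> Arr C" "p \<in> Arr C" "src C p = tgt C i" "p \<cdot> i = mzero C Y X"
    using extensionsE[OF E] by auto
  note [simp] = e HomD[OF a]
  let ?E0 = "(inj1 C Y X1, prj2 C Y X1)"
  have E0: "?E0 \<in> extensions C X1 Y" by (rule split_extension) auto
  have "ext_pullback C X1 Y a (ext_class X Y (i, p)) = ext_zero C X1 Y \<longleftrightarrow> ext_morphism C ?E0 (i, p) (ident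
    C Y) a"
    using pushout_eq_pullback_iff[OF E0 E, of "ident C Y" a] a ext_pushout_ident[OF ext_zero_Ext1[of X1 Y]]
    unfolding ext_zero_class by (auto simp: Hom_iff)
  also have "\<dots> \<longleftrightarrow> (\<exists>t \<in> Hom C X1 (tgt C i). p \<cdot> t = a)"
  proof
    assume "ext_morphism C ?E0 (i, p) (ident C Y) a"
    then obtain g where g: "g \<in> Arr C" "src C g = bobj Y X1" "tgt C g = tgt C i" "p \<cdot> g = a \<cdot> prj2 C Y X1"
      by (rule ext_morphismE) auto
    then show "\<exists>t \<in> Hom C X1 (tgt C i). p \<cdot> t = a"
      using reassoc[OF g(4), of "inj2 C Y X1"] by (intro bexI[of _ "g \<cdot> inj2 C Y X1"]) (auto simp: Hom_iff)
  next
    assume "\<exists>t \<in> Hom C X1 (tgt C i). p \<cdot> t = a"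
    then obtain t where t: "t \<in> Arr C" "src C t = X1" "tgt C t = tgt C i" "p \<cdot> t = a" by (auto simp: Hom_iff)
    then show "ext_morphism C ?E0 (i, p) (ident C Y) a"
      using reassoc[OF t(4), of "prj2 C Y X1"] reassoc[OF e(6), of "prj1 C Y X1"]
      by (intro ext_morphismI[of "i \<cdot> prj1 C Y X1 \<boxplus> t \<cdot> prj2 C Y X1"]) auto
  qed
  finally show ?thesis .
qed

lemma ext_pushout_zero_iff:
  assumes E: "(i, p) \<in> extensions C X Y" and b: "b \<in> Hom C Y Y1"
  shows "ext_pushout C X Y1 b (ext_class X Y (i, p)) = ext_zero C X Y1
    \<longleftrightarrow> (\<exists>t \<in> Hom C (tgt C i) Y1. t \<cdot> i = b)"
proof -
  have [simp]: "X \<in> Obj C" "Y \<in> Obj C" "Y1 \<in> Obj C" using ext_Obj[OF E] Hom_Obj[OF b] by auto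
  have e: "src C i = Y" "tgt C p = X" "i \<in> Arr C" "p \<in> Arr C" "src C p = tgt C i" "p \<cdot> i = mzero C Y X"
    using extensionsE[OF E] by auto
  note [simp] = e HomD[OF b]
  let ?E0 = "(inj1 C Y1 X, prj2 C Y1 X)"
  have E0: "?E0 \<in> extensions C X Y1" by (rule split_extension) auto
  have "ext_pushout C X Y1 b (ext_class X Y (i, p)) = ext_zero C X Y1 \<longleftrightarrow> ext_morphism C (i, p) ?E0 b (ident C X)"
    using pushout_eq_pullback_iff[OF E E0, of b "ident C X"] b ext_pullback_ident[OF ext_zero_Ext1[of X Y1]]
    unfolding ext_zero_class by (auto simp: Hom_iff)
  also have "\<dots> \<longleftrightarrow> (\<exists>t \<in> Hom C (tgt C i) Y1. t \<cdot> i = b)"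
  proof
    assume "ext_morphism C (i, p) ?E0 b (ident C X)"
    then obtain g where g: "g \<in> Arr C" "src C g = tgt C i" "tgt C g = bobj Y1 X" "g \<cdot> i = inj1 C Y1 X \<cdot> b"
      by (rule ext_morphismE) auto
    then show "\<exists>t \<in> Hom C (tgt C i) Y1. t \<cdot> i = b"
      by (intro bexI[of _ "prj1 C Y1 X \<cdot> g"]) (auto simp: Hom_iff)
  next
    assume "\<exists>t \<in> Hom C (tgt C i) Y1. t \<cdot> i = b"
    then obtain t where t: "t \<in> Arr C" "src C t = tgt C i" "tgt C t = Y1" "t \<cdot> i = b" by (auto simp: Hom_iff)
    then show "ext_morphism C (i, p) ?E0 b (ident C X)"
      by (intro ext_morphismI[of "inj1 C Y1 X \<cdot> t \<boxplus> inj2 C Y1 X \<cdot> p"]) auto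
  qed
  finally show ?thesis .
qed

lemma ext_class_zero_iff:
  assumes E: "(i, p) \<in> extensions C X Y"
  shows "ext_class X Y (i, p) = ext_zero C X Y \<longleftrightarrow> (\<exists>t \<in> Hom C X (tgt C i). p \<cdot> t = ident C X)"
    "ext_class X Y (i, p) = ext_zero C X Y \<longleftrightarrow> (\<exists>t \<in> Hom C (tgt C i) Y. t \<cdot> i = ident C Y)"
  using ext_pullback_zero_iff[OF E ident_Hom] ext_pushout_zero_iff[OF E ident_Hom] ext_Obj[OF E]
    ext_pullback_ident ext_pushout_ident ext_class_Ext1[OF E] by auto

lemma ext_pushout_mzero:
  assumes x: "\<xi> \<in> Ext1 C X Y" and Z: "Z \<in> Obj C"
  shows "ext_pushout C X Z (mzero C Y Z) \<xi> = ext_zero C X Z"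
proof -
  obtain i p where E: "(i, p) \<in> extensions C X Y" "\<xi> = ext_class X Y (i, p)"
    using Ext1_cases[OF x] by (metis surj_pair)
  have e: "src C i = Y" "i \<in> Arr C" using extensionsE[OF E(1)] by auto
  have "mzero C (tgt C i) Z \<in> Hom C (tgt C i) Z" "mzero C (tgt C i) Z \<cdot> i = mzero C Y Z"
    using e Z by (auto simp: Hom_iff)
  then show ?thesis
    unfolding E(2) using ext_pushout_zero_iff[OF E(1), of "mzero C Y Z" Z] Ext1_Obj[OF x] Z
    by (auto simp: Hom_iff)
qed

lemma baer_sum_zero:
  assumes x: "\<xi> \<in> Ext1 C X Y"
  shows "baer_sum C X Y (ext_zero C X Y) \<xi> = \<xi>"
proof -
  have [simp]: "X \<in> Obj C" "Y \<in> Obj C" using Ext1_Obj[OF x] by auto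
  have h: "mzero C Y Y \<in> Hom C Y Y" "ident C Y \<in> Hom C Y Y" by (auto simp: Hom_iff)
  show ?thesis
    using ext_pushout_add[OF x h] ext_pushout_ident[OF x] ext_pushout_mzero[OF x] by simp
qed

lemma baer_sum_neg:
  assumes x: "\<xi> \<in> Ext1 C X Y"
  shows "baer_sum C X Y (ext_pushout C X Y (mneg (ident C Y)) \<xi>) \<xi> = ext_zero C X Y"
proof -
  have [simp]: "X \<in> Obj C" "Y \<in> Obj C" using Ext1_Obj[OF x] by auto
  have h: "mneg (ident C Y) \<in> Hom C Y Y" "ident C Y \<in> Hom C Y Y" by (auto simp: Hom_iff)
  show ?thesis
    using ext_pushout_add[OF x h] ext_pushout_ident[OF x] ext_pushout_mzero[OF x] by simp
qed

text \<open>The direct sum of \<open>E\<close> with itself is pulled back along the arrow with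
  components \<open>f\<close> and \<open>g\<close>. The projections identify the components of the
  result as the two pullbacks, and folding identifies their Baer sum as the pullback along
  \<open>f \<boxplus> g\<close>.\<close>

lemma ext_pullback_add:
  assumes x: "\<xi> \<in> Ext1 C X Y" and f: "f \<in> Hom C X1 X" and g: "g \<in> Hom C X1 X"
  shows "ext_pullback C X1 Y (f \<boxplus> g) \<xi> = baer_sum C X1 Y (ext_pullback C X1 Y f \<xi>) (ext_pullback C X1 Y g \<xi>)"
proof -
  note [simp] = HomD[OF f] HomD[OF g]
  have [simp]: "X \<in> Obj C" "Y \<in> Obj C" "X1 \<in> Obj C" using Ext1_Obj[OF x] Hom_Obj[OF f] by auto
  obtain E where E: "E \<in> extensions C X Y" "\<xi> = ext_class X Y E" using Ext1_cases[OF x] .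
  note D = ext_dsum_extensions[OF E(1) E(1)]
  let ?h = "inj1 C X X \<cdot> f \<boxplus> inj2 C X X \<cdot> g"
  have h: "?h \<in> Hom C X1 (bobj X X)" by (simp add: Hom_iff)
  obtain P where P: "P \<in> extensions C X1 (bobj Y Y)" "ext_morphism C P (ext_dsum C E E) (ident C (bobj Y Y)) ?h"
    using ext_pullback_exists[OF D h] by metis
  have "ext_morphism C P E (prj1 C Y Y) f" "ext_morphism C P E (prj2 C Y Y) g"
    by (rule ext_morphism_cmp_eq[OF P(1) D E(1) P(2) ext_dsum_prj(1)[OF E(1) E(1)]]; simp add: Hom_iff)
      (rule ext_morphism_cmp_eq[OF P(1) D E(1) P(2) ext_dsum_prj(2)[OF E(1) E(1)]]; simp add: Hom_iff)
  then have p: "ext_pushout C X1 Y (prj1 C Y Y) (ext_class X1 (bobj Y Y) P) = ext_pullback C X1 Y f \<xi>"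
    "ext_pushout C X1 Y (prj2 C Y Y) (ext_class X1 (bobj Y Y) P) = ext_pullback C X1 Y g \<xi>"
    using pushout_eq_pullback_iff[OF P(1) E(1) _ f, of "prj1 C Y Y"]
      pushout_eq_pullback_iff[OF P(1) E(1) _ g, of "prj2 C Y Y"] E(2) by (simp_all add: Hom_iff)
  have "ext_morphism C P E (codiagonal C Y) (f \<boxplus> g)"
    by (rule ext_morphism_cmp_eq[OF P(1) D E(1) P(2) ext_dsum_codiagonal[OF E(1)]]; simp add: Hom_iff)
  then have "ext_pushout C X1 Y (codiagonal C Y) (ext_class X1 (bobj Y Y) P) = ext_pullback C X1 Y (f \<boxplus> g) \<xi>"
    using pushout_eq_pullback_iff[OF P(1) E(1), of "codiagonal C Y" "f \<boxplus> g"] E(2) by (simp add: Hom_iff)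
  then show ?thesis
    unfolding baer_sum_pair using ext_pair_surj[OF ext_class_Ext1[OF P(1)]] p by simp
qed

section \<open>The two module structures on Ext\<close>

lemma End_ring_ring:
  assumes S: "S \<in> Obj C"
  shows "ring (End_ring C S)"
proof -
  note [simp] = S
  have "abelian_group (End_ring C S)"
  proof (rule abelian_groupI)
    fix f assume "f \<in> carrier (End_ring C S)"
    then show "\<exists>g \<in> carrier (End_ring C S). g \<oplus>\<^bsub>End_ring C S\<^esub> f = \<zero>\<^bsub>End_ring C S\<^esub>"
      by (intro bexI[of _ "mneg f"]) (auto simp: End_ring_def Hom_iff)
  qed (auto simp: End_ring_def Hom_iff madd_assoc intro: madd_comm)
  moreover have "monoid (End_ring C S)"
    by (rule monoidI) (auto simp: End_ring_def Hom_iff)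
  ultimately show ?thesis
    by (rule ringI) (auto simp: End_ring_def Hom_iff)
qed

lemma End_ring_op: "End_ring (op C) S = opposite_ring (End_ring C S)"
  by (simp add: End_ring_def opposite_ring_def) (simp add: op_def)

lemma opposite_End_ring_ring:
  assumes S: "S \<in> Obj C"
  shows "ring (opposite_ring (End_ring C S))"
  using abelian_category.End_ring_ring[OF dual_abelian, of S] S by (simp add: End_ring_op)

text \<open>Stated for any record with these fields because \<open>Ext1_right\<close> and
  \<open>Ext1_left\<close> share the group and differ only in the scalars.\<close>

lemma Ext1_group:
  assumes S: "S \<in> Obj C" and T: "T \<in> Obj C"
    and M: "carrier M = Ext1 C S T" "add M = baer_sum C S T" "zero M = ext_zero C S T"
  shows "abelian_group M"
proof (rule abelian_groupI)
  fix x assume "x \<in> carrier M"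
  then have x: "x \<in> Ext1 C S T" using M by simp
  have "ext_pushout C S T (mneg (ident C T)) x \<in> Ext1 C S T"
    by (rule ext_pushout_Ext1[OF x]) (use T in \<open>simp add: Hom_iff\<close>)
  then show "\<exists>y \<in> carrier M. y \<oplus>\<^bsub>M\<^esub> x = \<zero>\<^bsub>M\<^esub>"
    using baer_sum_neg[OF x] M by auto
next
  fix x y assume "x \<in> carrier M" "y \<in> carrier M"
  then show "x \<oplus>\<^bsub>M\<^esub> y = y \<oplus>\<^bsub>M\<^esub> x" using baer_sum_comm M by simp
qed (use assms in \<open>auto simp: ext_zero_Ext1 baer_sum_Ext1 baer_sum_assoc baer_sum_zero\<close>)

lemma Ext1_right_module:
  assumes S: "S \<in> Obj C" and T: "T \<in> Obj C"
  shows "right_module (End_ring C S) (Ext1_right C S T)"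
  unfolding right_module_def
  using End_ring_ring[OF S] Ext1_group[OF S T, of "Ext1_right C S T"]
  by (auto simp: Ext1_right_def End_ring_def ext_pullback_Ext1 ext_pullback_add ext_pullback_baer
      ext_pullback_cmp ext_pullback_ident)

text \<open>Pushout is covariant, so it is a left action of \<open>End_ring C T\<close>; over the
  opposite ring it satisfies the same right module law as the contravariant pullback.\<close>

lemma Ext1_left_module:
  assumes S: "S \<in> Obj C" and T: "T \<in> Obj C"
  shows "right_module (opposite_ring (End_ring C T)) (Ext1_left C S T)"
  unfolding right_module_def
  using opposite_End_ring_ring[OF T] Ext1_group[OF S T, of "Ext1_left C S T"]
  by (auto simp: Ext1_left_def End_ring_def opposite_ring_def ext_pushout_Ext1 ext_pushout_add ext_pushout_baer
      ext_pushout_cmp ext_pushout_ident)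

lemma End_division_ring:
  assumes S: "simple C S"
  shows "division_ring (End_ring C S)"
proof -
  have O: "S \<in> Obj C" using simpleD(1)[OF S] .
  have "Units (End_ring C S) = carrier (End_ring C S) - {\<zero>\<^bsub>End_ring C S\<^esub>}"
  proof (intro equalityI subsetI)
    fix f assume "f \<in> Units (End_ring C S)"
    then obtain g where f: "f \<in> Arr C" "src C f = S" "tgt C f = S" and g: "g \<in> Arr C" "src C g = S"
      "tgt C g = S" "g \<cdot> f = ident C S"
      unfolding Units_def End_ring_def by (auto simp: Hom_iff)
    have "f \<noteq> mzero C S S"
    proof
      assume "f = mzero C S S"
      then have "ident C S = mzero C S S" using g O by simp
      then show False using simpleD(2)[OF S] O zero_obj_iff by simp
    qed
    then show "f \<in> carrier (End_ring C S) - {\<zero>\<^bsub>End_ring C S\<^esub>}" using f by (simp add: End_ring_def Hom_iff)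
  next
    fix f assume "f \<in> carrier (End_ring C S) - {\<zero>\<^bsub>End_ring C S\<^esub>}"
    then have f: "f \<in> Arr C" "src C f = S" "tgt C f = S" "f \<noteq> mzero C S S" by (auto simp: End_ring_def Hom_iff)
    have "iso_arr C f" by (rule schur[OF S S]) (use f in auto)
    then obtain g where "g \<in> Arr C" "src C g = S" "tgt C g = S" "g \<cdot> f = ident C S" "f \<cdot> g = ident C S"
      using f by (elim iso_arrE) auto
    then show "f \<in> Units (End_ring C S)" unfolding Units_def using f by (auto simp: End_ring_def Hom_iff)
  qed
  then show ?thesis unfolding division_ring_def using End_ring_ring[OF O] by simp
qed

lemma opposite_End_division_ring: "simple C S \<Longrightarrow> division_ring (opposite_ring (End_ring C S))"
  using abelian_category.End_division_ring[OF dual_abelian, of S] by (simp add: End_ring_op)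

end

section \<open>Modules over division rings\<close>

locale r_module =
  fixes R :: "('r, 'x) ring_scheme" and M :: "('r, 'v, 'y) module_scheme" (structure)
  assumes rm: "right_module R M"
begin

sublocale R: ring R using rm unfolding right_module_def by blast
sublocale abelian_group M using rm unfolding right_module_def by blast

lemma smult_closed [simp]: "\<lbrakk>r \<in> carrier R; x \<in> carrier M\<rbrakk> \<Longrightarrow> r \<odot> x \<in> carrier M"
  using rm unfolding right_module_def by blast

lemma smult_l_distr:
  "\<lbrakk>r \<in> carrier R; s \<in> carrier R; x \<in> carrier M\<rbrakk> \<Longrightarrow> (r \<oplus>\<^bsub>R\<^esub> s) \<odot> x = r \<odot> x \<oplus> s \<odot> x"
  using rm unfolding right_module_def by blast

lemma smult_r_distr:
  "\<lbrakk>r \<in> carrier R; x \<in> carrier M; y \<in> carrier M\<rbrakk> \<Longrightarrow> r \<odot> (x \<oplus> y) = r \<odot> x \<oplus> r \<odot> y"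
  using rm unfolding right_module_def by blast

lemma smult_assoc:
  "\<lbrakk>r \<in> carrier R; s \<in> carrier R; x \<in> carrier M\<rbrakk> \<Longrightarrow> (r \<otimes>\<^bsub>R\<^esub> s) \<odot> x = s \<odot> (r \<odot> x)"
  using rm unfolding right_module_def by blast

lemma smult_one [simp]: "x \<in> carrier M \<Longrightarrow> \<one>\<^bsub>R\<^esub> \<odot> x = x"
  using rm unfolding right_module_def by blast

lemma smult_zero_left [simp]:
  assumes "x \<in> carrier M"
  shows "\<zero>\<^bsub>R\<^esub> \<odot> x = \<zero>"
proof -
  have "\<zero>\<^bsub>R\<^esub> \<odot> x \<oplus> \<zero>\<^bsub>R\<^esub> \<odot> x = \<zero>\<^bsub>R\<^esub> \<odot> x"
    using smult_l_distr[of "\<zero>\<^bsub>R\<^esub>" "\<zero>\<^bsub>R\<^esub>" x] assms by simp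
  then show ?thesis using assms by (metis add.l_cancel_one' add.m_closed smult_closed R.zero_closed)
qed

lemma smult_zero_right [simp]:
  assumes "r \<in> carrier R"
  shows "r \<odot> \<zero> = \<zero>"
proof -
  have "r \<odot> \<zero> \<oplus> r \<odot> \<zero> = r \<odot> \<zero>"
    using smult_r_distr[of r \<zero> \<zero>] assms by simp
  then show ?thesis using assms by (metis add.l_cancel_one' add.m_closed smult_closed zero_closed)
qed

lemma smult_minus_one:
  assumes "x \<in> carrier M"
  shows "(\<ominus>\<^bsub>R\<^esub> \<one>\<^bsub>R\<^esub>) \<odot> x = \<ominus> x"
proof -
  have "(\<ominus>\<^bsub>R\<^esub> \<one>\<^bsub>R\<^esub>) \<odot> x \<oplus> x = \<zero>"
    using smult_l_distr[of "\<ominus>\<^bsub>R\<^esub> \<one>\<^bsub>R\<^esub>" "\<one>\<^bsub>R\<^esub>" x] assms R.l_neg[of "\<one>\<^bsub>R\<^esub>"] by simp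
  then show ?thesis using assms by (metis add.inv_equality smult_closed R.a_inv_closed R.one_closed)
qed

definition subm :: "'v set \<Rightarrow> bool" where
  "subm W \<longleftrightarrow> W \<subseteq> carrier M \<and> \<zero> \<in> W \<and> (\<forall>x \<in> W. \<forall>y \<in> W. x \<oplus> y \<in> W) \<and>
    (\<forall>r \<in> carrier R. \<forall>x \<in> W. r \<odot> x \<in> W)"

lemma submD:
  assumes "subm W"
  shows "x \<in> W \<Longrightarrow> x \<in> carrier M" "\<zero> \<in> W" "\<lbrakk>x \<in> W; y \<in> W\<rbrakk> \<Longrightarrow> x \<oplus> y \<in> W"
    "\<lbrakk>r \<in> carrier R; x \<in> W\<rbrakk> \<Longrightarrow> r \<odot> x \<in> W"
  using assms unfolding subm_def by auto

lemma subm_minus: "\<lbrakk>subm W; x \<in> W\<rbrakk> \<Longrightarrow> \<ominus> x \<in> W"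
  using submD(4)[of W "\<ominus>\<^bsub>R\<^esub> \<one>\<^bsub>R\<^esub>" x] smult_minus_one[of x] submD(1) by simp

lemma subm_module:
  assumes W: "subm W"
  shows "right_module R (M\<lparr>carrier := W\<rparr>)"
proof -
  have "abelian_group (M\<lparr>carrier := W\<rparr>)"
  proof (rule abelian_groupI)
    fix x assume "x \<in> carrier (M\<lparr>carrier := W\<rparr>)"
    then show "\<exists>y \<in> carrier (M\<lparr>carrier := W\<rparr>). y \<oplus>\<^bsub>M\<lparr>carrier := W\<rparr>\<^esub> x = \<zero>\<^bsub>M\<lparr>carrier := W\<rparr>\<^esub>"
      using subm_minus[OF W, of x] submD(1)[OF W] by (intro bexI[of _ "\<ominus> x"]) (auto simp: l_neg)
  qed (use submD[OF W] in \<open>auto simp: a_assoc intro: a_comm\<close>)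
  then show ?thesis
    unfolding right_module_def using submD[OF W] R.ring_axioms
    by (auto simp: smult_l_distr smult_r_distr smult_assoc)
qed

lemma finsum_smult:
  assumes "finite F" "r \<in> carrier R" "g \<in> F \<rightarrow> carrier M"
  shows "r \<odot> (\<Oplus>x \<in> F. g x) = (\<Oplus>x \<in> F. r \<odot> g x)"
  using assms(1,3) by induction (use assms(2) in \<open>auto simp: smult_r_distr Pi_iff\<close>)

lemma subm_finsum:
  assumes "subm W" "finite F" "g \<in> F \<rightarrow> W"
  shows "(\<Oplus>x \<in> F. g x) \<in> W"
  using assms(2,3) 
proof induction
  case empty then show ?case using submD(2)[OF assms(1)] by simp
next
  case (insert a F)
  then show ?case using submD(1,3)[OF assms(1)] by (subst finsum_insert) (auto simp: Pi_iff)
qed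

definition lspan :: "'v set \<Rightarrow> 'v set" where
  "lspan X = {v. \<exists>F c. finite F \<and> F \<subseteq> X \<and> c \<in> F \<rightarrow> carrier R \<and> v = (\<Oplus>x \<in> F. c x \<odot> x)}"

lemma spans_iff: "spans R M X \<longleftrightarrow> X \<subseteq> carrier M \<and> carrier M \<subseteq> lspan X"
  unfolding spans_def lspan_def by blast

lemma extend_coefficients:
  assumes "finite G" "F \<subseteq> G" "G \<subseteq> carrier M" "c \<in> F \<rightarrow> carrier R"
  shows "(\<Oplus>x \<in> F. c x \<odot> x) = (\<Oplus>x \<in> G. (if x \<in> F then c x else \<zero>\<^bsub>R\<^esub>) \<odot> x)"
  by (rule add.finprod_mono_neutral_cong_left) (use assms in \<open>auto simp: Pi_iff subset_iff\<close>)

lemma lspan_subm: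
  assumes X: "X \<subseteq> carrier M"
  shows "subm (lspan X)"
  unfolding subm_def
proof (intro conjI ballI)
  show "lspan X \<subseteq> carrier M" using X unfolding lspan_def by (auto intro!: finsum_closed simp: Pi_iff subset_iff)
  show "\<zero> \<in> lspan X" unfolding lspan_def by (auto intro!: exI[of _ "{}"])
  fix v w assume "v \<in> lspan X" "w \<in> lspan X"
  then obtain F c G d where F: "finite F" "F \<subseteq> X" "c \<in> F \<rightarrow> carrier R" "v = (\<Oplus>x \<in> F. c x \<odot> x)"
    and G: "finite G" "G \<subseteq> X" "d \<in> G \<rightarrow> carrier R" "w = (\<Oplus>x \<in> G. d x \<odot> x)"
    unfolding lspan_def by blast
  define c' where "c' = (\<lambda>x. if x \<in> F then c x else \<zero>\<^bsub>R\<^esub>)"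
  define d' where "d' = (\<lambda>x. if x \<in> G then d x else \<zero>\<^bsub>R\<^esub>)"
  have c: "c' \<in> F \<union> G \<rightarrow> carrier R" and d: "d' \<in> F \<union> G \<rightarrow> carrier R"
    using F(3) G(3) by (auto simp: c'_def d'_def Pi_iff)
  have sub: "F \<union> G \<subseteq> carrier M" using X F G by blast
  have "v = (\<Oplus>x \<in> F \<union> G. c' x \<odot> x)" "w = (\<Oplus>x \<in> F \<union> G. d' x \<odot> x)"
    using extend_coefficients[of "F \<union> G" F c] extend_coefficients[of "F \<union> G" G d] F G sub
    by (auto simp: c'_def d'_def)
  then have "v \<oplus> w = (\<Oplus>x \<in> F \<union> G. c' x \<odot> x \<oplus> d' x \<odot> x)"
    using c d sub by (subst finsum_addf) (auto simp: Pi_iff subset_iff)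
  also have "\<dots> = (\<Oplus>x \<in> F \<union> G. (c' x \<oplus>\<^bsub>R\<^esub> d' x) \<odot> x)"
    by (rule finsum_cong') (use c d sub in \<open>auto simp: Pi_iff subset_iff smult_l_distr\<close>)
  finally show "v \<oplus> w \<in> lspan X"
    unfolding lspan_def using F G c d
    by (intro CollectI exI[of _ "F \<union> G"] exI[of _ "\<lambda>x. c' x \<oplus>\<^bsub>R\<^esub> d' x"]) (auto simp: Pi_iff)
next
  fix r v assume r: "r \<in> carrier R" and "v \<in> lspan X"
  then obtain F c where F: "finite F" "F \<subseteq> X" "c \<in> F \<rightarrow> carrier R" "v = (\<Oplus>x \<in> F. c x \<odot> x)"
    unfolding lspan_def by blast
  have sub: "F \<subseteq> carrier M" using X F by blast
  have "r \<odot> v = (\<Oplus>x \<in> F. r \<odot> (c x \<odot> x))"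
    unfolding F(4) by (rule finsum_smult) (use F r sub in \<open>auto simp: Pi_iff subset_iff\<close>)
  also have "\<dots> = (\<Oplus>x \<in> F. (c x \<otimes>\<^bsub>R\<^esub> r) \<odot> x)"
    by (rule finsum_cong') (use F r sub in \<open>auto simp: Pi_iff subset_iff smult_assoc\<close>)
  finally show "r \<odot> v \<in> lspan X"
    unfolding lspan_def using F r
    by (intro CollectI exI[of _ F] exI[of _ "\<lambda>x. c x \<otimes>\<^bsub>R\<^esub> r"]) (auto simp: Pi_iff)
qed

lemma lspan_superset:
  assumes "X \<subseteq> carrier M"
  shows "X \<subseteq> lspan X"
proof
  fix x assume x: "x \<in> X"
  have "x = (\<Oplus>y \<in> {x}. \<one>\<^bsub>R\<^esub> \<odot> y)" using x assms by (subst finsum_insert) auto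
  then show "x \<in> lspan X"
    unfolding lspan_def using x by (intro CollectI exI[of _ "{x}"] exI[of _ "\<lambda>_. \<one>\<^bsub>R\<^esub>"]) auto
qed

lemma lspan_least: "\<lbrakk>subm W; X \<subseteq> W\<rbrakk> \<Longrightarrow> lspan X \<subseteq> W"
proof
  fix v assume W: "subm W" "X \<subseteq> W" and "v \<in> lspan X"
  then obtain F c where F: "finite F" "F \<subseteq> X" "c \<in> F \<rightarrow> carrier R" "v = (\<Oplus>x \<in> F. c x \<odot> x)"
    unfolding lspan_def by blast
  show "v \<in> W"
    unfolding F(4) by (rule subm_finsum[OF W(1) F(1)]) (use F W submD(4)[OF W(1)] in blast)
qed

lemma independentD:
  "\<lbrakk>independent R M X; finite F; F \<subseteq> X; c \<in> F \<rightarrow> carrier R; (\<Oplus>x \<in> F. c x \<odot> x) = \<zero>; x \<in> F\<rbrakk>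
    \<Longrightarrow> c x = \<zero>\<^bsub>R\<^esub>"
  unfolding independent_def by blast

lemma independent_subset: "\<lbrakk>independent R M X; Y \<subseteq> X\<rbrakk> \<Longrightarrow> independent R M Y"
  unfolding independent_def by (meson subset_trans)

lemma independent_not_lspan:
  assumes "\<one>\<^bsub>R\<^esub> \<noteq> \<zero>\<^bsub>R\<^esub>" and ind: "independent R M X" and x: "x \<in> X"
  shows "x \<notin> lspan (X - {x})"
proof
  have XM: "X \<subseteq> carrier M" using ind by (simp add: independent_def)
  assume "x \<in> lspan (X - {x})"
  then obtain F c where F: "finite F" "F \<subseteq> X - {x}" "c \<in> F \<rightarrow> carrier R" "x = (\<Oplus>y \<in> F. c y \<odot> y)"
    unfolding lspan_def by blast
  \<comment> \<open>Moving \<open>x\<close> to the other side of the relation gives it the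
    coefficient minus one, which is non-zero.\<close>
  define d where "d = (\<lambda>y. if y = x then \<ominus>\<^bsub>R\<^esub> \<one>\<^bsub>R\<^esub> else c y)"
  have d: "d \<in> insert x F \<rightarrow> carrier R" using F by (auto simp: d_def Pi_iff)
  have "(\<Oplus>y \<in> F. d y \<odot> y) = (\<Oplus>y \<in> F. c y \<odot> y)"
    by (rule finsum_cong') (use F XM in \<open>auto simp: d_def Pi_iff subset_iff\<close>)
  then have "(\<Oplus>y \<in> insert x F. d y \<odot> y) = d x \<odot> x \<oplus> x"
    using F d x XM by (subst finsum_insert) (auto simp: Pi_iff subset_iff)
  also have "\<dots> = \<zero>" using x XM by (auto simp: d_def smult_minus_one l_neg)
  finally have "d x = \<zero>\<^bsub>R\<^esub>"
    using F d x by (intro independentD[OF ind, of "insert x F" d x]) auto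
  then have "\<ominus>\<^bsub>R\<^esub> \<one>\<^bsub>R\<^esub> = \<zero>\<^bsub>R\<^esub>" by (simp add: d_def)
  then show False using assms(1) by (metis R.minus_minus R.minus_zero R.one_closed)
qed

end

section \<open>Bases and dimension over a division ring\<close>

locale div_module = r_module R M
  for R :: "('r, 'x) ring_scheme" and M :: "('r, 'v, 'y) module_scheme" (structure) +
  assumes div: "division_ring R"
begin

lemma one_neq_zero: "\<one>\<^bsub>R\<^esub> \<noteq> \<zero>\<^bsub>R\<^esub>"
  using div R.Units_one_closed unfolding division_ring_def by blast

lemma inverse_scalar:
  assumes "r \<in> carrier R" "r \<noteq> \<zero>\<^bsub>R\<^esub>"
  obtains s where "s \<in> carrier R" "r \<otimes>\<^bsub>R\<^esub> s = \<one>\<^bsub>R\<^esub>" "s \<otimes>\<^bsub>R\<^esub> r = \<one>\<^bsub>R\<^esub>"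
proof -
  have "r \<in> Units R" using assms div unfolding division_ring_def by blast
  then show thesis using that by (auto simp: Units_def)
qed

lemma smult_inverse:
  assumes "r \<in> carrier R" "r \<noteq> \<zero>\<^bsub>R\<^esub>" "x \<in> carrier M" "subm W" "r \<odot> x \<in> W"
  shows "x \<in> W"
proof -
  obtain s where s: "s \<in> carrier R" "r \<otimes>\<^bsub>R\<^esub> s = \<one>\<^bsub>R\<^esub>" using inverse_scalar[OF assms(1,2)] by metis
  have "x = s \<odot> (r \<odot> x)" using smult_assoc[of r s x] assms s by simp
  then show ?thesis using submD(4)[OF assms(4) s(1) assms(5)] by simp
qed

text \<open>In a relation the coefficient of \<open>y\<close> has to vanish: otherwise dividing by
  it would express \<open>y\<close> through \<open>X\<close>. The rest is a relation on
  \<open>X\<close>.\<close>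

lemma independent_insert:
  assumes ind: "independent R M X" and y: "y \<in> carrier M" "y \<notin> lspan X"
  shows "independent R M (insert y X)"
  unfolding independent_def
proof (intro conjI allI impI)
  have XM: "X \<subseteq> carrier M" using ind by (simp add: independent_def)
  then show "insert y X \<subseteq> carrier M" using y by simp
  fix F c assume "finite F \<and> F \<subseteq> insert y X \<and> c \<in> F \<rightarrow> carrier R \<and> (\<Oplus>x \<in> F. c x \<odot> x) = \<zero>"
  then have F: "finite F" "F \<subseteq> insert y X" "c \<in> F \<rightarrow> carrier R" "(\<Oplus>x \<in> F. c x \<odot> x) = \<zero>" by auto
  have FX: "F - {y} \<subseteq> X" and FM: "F \<subseteq> carrier M" using F(2) XM y(1) by auto
  let ?s = "\<Oplus>x \<in> F - {y}. c x \<odot> x"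
  have s: "?s \<in> lspan X" unfolding lspan_def using F FX by (intro CollectI exI[of _ "F - {y}"] exI[of _ c]) auto
  note sub = lspan_subm[OF XM]
  have sM: "?s \<in> carrier M" using submD(1)[OF sub s] .
  have cy: "c y = \<zero>\<^bsub>R\<^esub>" if "y \<in> F"
  proof (rule ccontr)
    assume nz: "c y \<noteq> \<zero>\<^bsub>R\<^esub>"
    have "(\<Oplus>x \<in> insert y (F - {y}). c x \<odot> x) = c y \<odot> y \<oplus> ?s"
      using F FM that by (subst finsum_insert) (auto simp: Pi_iff subset_iff)
    then have "c y \<odot> y \<oplus> ?s = \<zero>" using F(4) that by (simp add: insert_absorb)
    moreover have "c y \<odot> y \<in> carrier M" using smult_closed[of "c y" y] y(1) F(3) that by blast
    ultimately have "c y \<odot> y = \<ominus> ?s" using sM minus_equality by simp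
    then have "c y \<odot> y \<in> lspan X" using subm_minus[OF sub s] by simp
    then show False using smult_inverse[OF _ nz y(1) sub] F(3) that y(2) by blast
  qed
  have "(\<Oplus>x \<in> F. c x \<odot> x) = ?s"
    by (rule add.finprod_mono_neutral_cong_right) (use F FM cy y in \<open>auto simp: Pi_iff subset_iff\<close>)
  then have "c x = \<zero>\<^bsub>R\<^esub>" if "x \<in> F - {y}" for x
    using F FX that by (intro independentD[OF ind, of "F - {y}" c x]) auto
  then show "\<forall>x \<in> F. c x = \<zero>\<^bsub>R\<^esub>" using cy by blast
qed

lemma basis_exists: "\<exists>X. basis R M X"
proof -
  have "\<exists>X \<in> {X. independent R M X}. \<forall>Y \<in> {X. independent R M X}. X \<subseteq> Y \<longrightarrow> Y = X"
  proof (rule subset_Zorn_nonempty)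
    have "independent R M {}" by (simp add: independent_def)
    then show "{X. independent R M X} \<noteq> {}" by blast
    fix \<C> assume ne: "\<C> \<noteq> {}" and ch: "subset.chain {X. independent R M X} \<C>"
    have ind: "independent R M X" if "X \<in> \<C>" for X using ch that by (auto simp: subset.chain_def)
    have "\<forall>x \<in> F. c x = \<zero>\<^bsub>R\<^esub>"
      if F: "finite F" "F \<subseteq> \<Union>\<C>" "c \<in> F \<rightarrow> carrier R" "(\<Oplus>x \<in> F. c x \<odot> x) = \<zero>" for F c
    proof -
      \<comment> \<open>A relation involves finitely many vectors, and these already lie in one
        member of the chain.\<close>
      obtain X where "X \<in> \<C>" "F \<subseteq> X" using finite_subset_Union_chain[OF F(1,2) ne ch] .
      then show ?thesis using independentD[OF ind[of X] F(1) _ F(3,4)] by blast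
    qed
    moreover have "\<Union>\<C> \<subseteq> carrier M" using ind by (auto simp: independent_def)
    ultimately show "\<Union>\<C> \<in> {X. independent R M X}" by (auto simp: independent_def)
  qed
  then obtain X where X: "independent R M X" "\<And>Y. \<lbrakk>independent R M Y; X \<subseteq> Y\<rbrakk> \<Longrightarrow> Y = X" by blast
  have XM: "X \<subseteq> carrier M" using X by (simp add: independent_def)
  have "v \<in> lspan X" if "v \<in> carrier M" for v
  proof (rule ccontr)
    assume v: "v \<notin> lspan X"
    then have "insert v X = X" using X(2) independent_insert[OF X(1) that] by blast
    then show False using v lspan_superset[OF XM] by blast
  qed
  then have "basis R M X" using X XM by (auto simp: basis_def spans_iff)
  then show ?thesis by blast
qed

text \<open>Steinitz exchange for sets of arbitrary cardinality: a maximal partial injection \<open>G\<close> from \<open>X\<close> to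
  \<open>Y\<close> such that replacing the elements of its domain by their images keeps \<open>X\<close> independent
  is defined everywhere.\<close>

lemma independent_le_spanning:
  assumes X: "independent R M X" and Y: "spans R M Y"
  shows "\<exists>f. inj_on f X \<and> f ` X \<subseteq> Y"
proof -
  \<comment> \<open>\<open>N G\<close> is \<open>X\<close> after the exchange that \<open>G\<close>
    prescribes. The disjointness condition in \<open>\<P>\<close> keeps the elements brought in
    apart from those still waiting, so exchanging a further element really removes it.\<close>
  define N where "N G = (X - fst ` G) \<union> snd ` G" for G :: "('v \<times> 'v) set"
  define \<P> where "\<P> = {G. G \<subseteq> X \<times> Y \<and> (\<forall>(x, y) \<in> G. \<forall>(x', y') \<in> G. x = x' \<longleftrightarrow> y = y') \<and>
    independent R M (N G) \<and> (X - fst ` G) \<inter> snd ` G = {}}"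
  have YM: "Y \<subseteq> carrier M" using Y by (simp add: spans_def)
  have "\<exists>G \<in> \<P>. \<forall>H \<in> \<P>. G \<subseteq> H \<longrightarrow> H = G"
  proof (rule subset_Zorn_nonempty)
    have "{} \<in> \<P>" using X by (simp add: \<P>_def N_def)
    then show "\<P> \<noteq> {}" by blast
    fix \<C> assume ne: "\<C> \<noteq> {}" and ch: "subset.chain \<P> \<C>"
    have in\<P>: "G \<in> \<P>" if "G \<in> \<C>" for G using ch that by (auto simp: subset.chain_def)
    have join: "\<exists>G \<in> \<C>. a \<in> G \<and> b \<in> G" if "a \<in> \<Union>\<C>" "b \<in> \<Union>\<C>" for a b
      using finite_subset_Union_chain[of "{a, b}" \<C> \<P>] that ne ch by (metis empty_subsetI finite.intros
        insert_subset)
    have "independent R M (N (\<Union>\<C>))"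
      unfolding independent_def
    proof (intro conjI allI impI)
      have "X \<subseteq> carrier M" using X by (simp add: independent_def)
      moreover have "snd ` G \<subseteq> Y" if "G \<in> \<C>" for G using in\<P>[OF that] by (auto simp: \<P>_def)
      ultimately show "N (\<Union>\<C>) \<subseteq> carrier M" using YM unfolding N_def by blast
      fix F c assume F: "finite F \<and> F \<subseteq> N (\<Union>\<C>) \<and> c \<in> F \<rightarrow> carrier R \<and> (\<Oplus>x \<in> F. c x \<odot> x) = \<zero>"
      \<comment> \<open>The exchanged elements of the finite set \<open>F\<close> are accounted for
        by finitely many pairs, hence by one \<open>G\<close> of the chain. The other elements of
        \<open>F\<close> are never exchanged in the union, so not in \<open>G\<close> either; thus
        \<open>F\<close> lies in \<open>N G\<close>.\<close>
      have "F \<inter> snd ` \<Union>\<C> \<subseteq> snd ` \<Union>\<C>" "finite (F \<inter> snd ` \<Union>\<C>)" using F by auto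
      then obtain H where H: "H \<subseteq> \<Union>\<C>" "finite H" "F \<inter> snd ` \<Union>\<C> = snd ` H"
        using finite_subset_image[of "F \<inter> snd ` \<Union>\<C>" snd "\<Union>\<C>"] by blast
      obtain G where G: "G \<in> \<C>" "H \<subseteq> G" using finite_subset_Union_chain[OF H(2,1) ne ch] .
      have "F \<subseteq> N G"
      proof
        fix x assume x: "x \<in> F"
        show "x \<in> N G"
        proof (cases "x \<in> snd ` \<Union>\<C>")
          case True then show ?thesis using x H(3) G(2) unfolding N_def by blast
        next
          case False then show ?thesis using x F G(1) unfolding N_def by blast
        qed
      qed
      moreover have "independent R M (N G)" using in\<P>[OF G(1)] by (simp add: \<P>_def)
      ultimately show "\<forall>x \<in> F. c x = \<zero>\<^bsub>R\<^esub>" using F independentD[of "N G" F c] by blast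
    qed
    moreover have "\<forall>(x, y) \<in> \<Union>\<C>. \<forall>(x', y') \<in> \<Union>\<C>. x = x' \<longleftrightarrow> y = y'"
    proof clarify
      fix x y x' y' G G' assume "(x, y) \<in> G" "G \<in> \<C>" "(x', y') \<in> G'" "G' \<in> \<C>"
      then obtain K where "K \<in> \<C>" "(x, y) \<in> K" "(x', y') \<in> K" using join[of "(x, y)" "(x', y')"] by blast
      then show "x = x' \<longleftrightarrow> y = y'" using in\<P>[of K] unfolding \<P>_def by blast
    qed
    moreover have "(X - fst ` \<Union>\<C>) \<inter> snd ` \<Union>\<C> = {}" using in\<P> unfolding \<P>_def by blast
    moreover have "\<Union>\<C> \<subseteq> X \<times> Y" using in\<P> unfolding \<P>_def by blast
    ultimately show "\<Union>\<C> \<in> \<P>" unfolding \<P>_def by blast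
  qed
  then obtain G where G: "G \<in> \<P>" and max: "\<And>H. \<lbrakk>H \<in> \<P>; G \<subseteq> H\<rbrakk> \<Longrightarrow> H = G" by blast
  have G1: "G \<subseteq> X \<times> Y" and G2: "\<And>x y x' y'. \<lbrakk>(x, y) \<in> G; (x', y') \<in> G\<rbrakk> \<Longrightarrow> x = x' \<longleftrightarrow> y = y'"
    and G3: "independent R M (N G)" and G4: "(X - fst ` G) \<inter> snd ` G = {}"
    using G unfolding \<P>_def by blast+
  have "X \<subseteq> fst ` G"
  proof
    fix x assume x: "x \<in> X"
    show "x \<in> fst ` G"
    proof (rule ccontr)
      assume nx: "x \<notin> fst ` G"
      \<comment> \<open>An element \<open>x\<close> left over is outside the span of
        \<open>?Z\<close>. As \<open>Y\<close> spans everything, some \<open>y\<close> in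
        \<open>Y\<close> is outside it too, and exchanging \<open>x\<close> for this
        \<open>y\<close> enlarges \<open>G\<close>.\<close>
      let ?Z = "N G - {x}"
      have ZM: "?Z \<subseteq> carrier M" using G3 by (auto simp: independent_def)
      have xN: "x \<in> N G" using x nx by (simp add: N_def)
      have "x \<notin> lspan ?Z" using independent_not_lspan[OF one_neq_zero G3 xN] .
      moreover have "x \<in> carrier M" using X x by (auto simp: independent_def)
      ultimately have "\<not> Y \<subseteq> lspan ?Z"
        using lspan_least[OF lspan_subm[OF ZM], of Y] Y by (auto simp: spans_iff)
      then obtain y where y: "y \<in> Y" "y \<notin> lspan ?Z" by blast
      have yZ: "y \<notin> ?Z" using y lspan_superset[OF ZM] by blast
      have xs: "x \<notin> snd ` G" using G4 x nx by blast
      let ?H = "insert (x, y) G"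
      have NH: "N ?H = insert y ?Z" using xs by (auto simp: N_def)
      have "independent R M (N ?H)"
        unfolding NH using independent_insert[OF independent_subset[OF G3] _ y(2)] y YM by auto
      moreover have "?H \<subseteq> X \<times> Y" using G1 x y by simp
      moreover have ys: "y \<notin> snd ` G" using yZ xs by (auto simp: N_def)
      moreover have "\<forall>(a, b) \<in> ?H. \<forall>(a', b') \<in> ?H. a = a' \<longleftrightarrow> b = b'"
      proof -
        have "fst p \<noteq> x \<and> snd p \<noteq> y" if "p \<in> G" for p using nx ys that by blast
        then show ?thesis using G2 by fastforce
      qed
      moreover have "(X - fst ` ?H) \<inter> snd ` ?H = {}" using G4 yZ by (auto simp: N_def)
      ultimately have "?H \<in> \<P>" unfolding \<P>_def by blast
      then have "?H = G" using max by blast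
      then show False using nx by force
    qed
  qed
  then have ex: "\<exists>y. (x, y) \<in> G" if "x \<in> X" for x using that by force
  define f where "f x = (SOME y. (x, y) \<in> G)" for x
  have f: "(x, f x) \<in> G" if "x \<in> X" for x unfolding f_def using someI_ex[OF ex[OF that]] .
  have "inj_on f X"
  proof (rule inj_onI)
    fix x x' assume "x \<in> X" "x' \<in> X" "f x = f x'"
    then show "x = x'" using G2[OF f f, of x x'] by simp
  qed
  moreover have "f ` X \<subseteq> Y" using f G1 by blast
  ultimately show ?thesis by blast
qed

lemma basis_card_unique:
  assumes "basis R M X" "basis R M Y"
  shows "(card_of X, card_of Y) \<in> ordIso"
proof -
  have "(card_of X, card_of Y) \<in> ordLeq" "(card_of Y, card_of X) \<in> ordLeq"
    using independent_le_spanning assms by (auto simp: basis_def simp flip: card_of_ordLeq)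
  then show ?thesis by (simp add: ordIso_iff_ordLeq)
qed

lemma dim_basis:
  assumes "basis R M X"
  shows "(dim R M, card_of X) \<in> ordIso"
  unfolding dim_def using basis_card_unique[OF someI_ex[OF basis_exists] assms] .

end

text \<open>The modules live over different rings, so a linear isomorphism is twisted by a bijection
  \<open>\<rho>\<close> of the scalars. Linear combinations are carried over coefficient by
  coefficient, and a vanishing coefficient is recognised through the preservation of zero.\<close>

locale semilinear_iso = M: r_module R M + N: r_module S N
  for R :: "('r, 'x) ring_scheme" and M :: "('r, 'v, 'y) module_scheme"
    and S :: "('s, 'w) ring_scheme" and N :: "('s, 'u, 'z) module_scheme" +
  fixes \<rho> :: "'r \<Rightarrow> 's" and \<theta> :: "'v \<Rightarrow> 'u"
  assumes bij_ring: "bij_betw \<rho> (carrier R) (carrier S)" and ring_zero: "\<rho> \<zero>\<^bsub>R\<^esub> = \<zero>\<^bsub>S\<^esub>"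
    and bij: "bij_betw \<theta> (carrier M) (carrier N)"
    and hom_add: "\<lbrakk>x \<in> carrier M; y \<in> carrier M\<rbrakk> \<Longrightarrow> \<theta> (x \<oplus>\<^bsub>M\<^esub> y) = \<theta> x \<oplus>\<^bsub>N\<^esub> \<theta> y"
    and hom_smult: "\<lbrakk>r \<in> carrier R; x \<in> carrier M\<rbrakk> \<Longrightarrow> \<theta> (r \<odot>\<^bsub>M\<^esub> x) = \<rho> r \<odot>\<^bsub>N\<^esub> \<theta> x"
begin

lemma closed [simp]: "x \<in> carrier M \<Longrightarrow> \<theta> x \<in> carrier N" "r \<in> carrier R \<Longrightarrow> \<rho> r \<in> carrier S"
  using bij bij_ring bij_betwE by blast+

lemma hom_zero: "\<theta> \<zero>\<^bsub>M\<^esub> = \<zero>\<^bsub>N\<^esub>"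
  using hom_add[of "\<zero>\<^bsub>M\<^esub>" "\<zero>\<^bsub>M\<^esub>"] by (metis M.zero_closed M.l_zero N.add.l_cancel_one' closed(1))

lemma hom_finsum:
  assumes "finite F" "g \<in> F \<rightarrow> carrier M"
  shows "\<theta> (\<Oplus>\<^bsub>M\<^esub>x \<in> F. g x) = (\<Oplus>\<^bsub>N\<^esub>x \<in> F. \<theta> (g x))"
  using assms
proof induction
  case empty then show ?case by (simp add: hom_zero)
next
  case (insert a F)
  then show ?case by (subst M.finsum_insert N.finsum_insert; auto simp: Pi_iff hom_add)
qed

text \<open>Coefficients are carried back along the inverse of \<open>\<rho>\<close>, so both
  relations and expansions in \<open>N\<close> are images of such in \<open>M\<close>.\<close>

lemma hom_combination:
  assumes "finite F" "F \<subseteq> carrier M" "c \<in> \<theta> ` F \<rightarrow> carrier S"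
  shows "(\<Oplus>\<^bsub>N\<^esub>y \<in> \<theta> ` F. c y \<odot>\<^bsub>N\<^esub> y) = \<theta> (\<Oplus>\<^bsub>M\<^esub>x \<in> F. inv_into (carrier R) \<rho> (c (\<theta> x)) \<odot>\<^bsub>M\<^esub> x)"
proof -
  have inj: "inj_on \<theta> F" using bij assms(2) inj_on_subset by (auto simp: bij_betw_def)
  have r: "inv_into (carrier R) \<rho> (c (\<theta> x)) \<in> carrier R" "\<rho> (inv_into (carrier R) \<rho> (c (\<theta> x))) = c (\<theta> x)"
    if "x \<in> F" for x
    using assms(3) that bij_ring by (auto simp: Pi_iff bij_betw_def intro: inv_into_into f_inv_into_f)
  have "(\<Oplus>\<^bsub>N\<^esub>y \<in> \<theta> ` F. c y \<odot>\<^bsub>N\<^esub> y) = (\<Oplus>\<^bsub>N\<^esub>x \<in> F. c (\<theta> x) \<odot>\<^bsub>N\<^esub> \<theta> x)"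
    by (rule N.add.finprod_reindex) (use assms inj in \<open>auto simp: Pi_iff subset_iff\<close>)
  also have "\<dots> = (\<Oplus>\<^bsub>N\<^esub>x \<in> F. \<theta> (inv_into (carrier R) \<rho> (c (\<theta> x)) \<odot>\<^bsub>M\<^esub> x))"
    by (rule N.finsum_cong') (use assms r in \<open>auto simp: Pi_iff subset_iff hom_smult\<close>)
  also have "\<dots> = \<theta> (\<Oplus>\<^bsub>M\<^esub>x \<in> F. inv_into (carrier R) \<rho> (c (\<theta> x)) \<odot>\<^bsub>M\<^esub> x)"
    by (rule hom_finsum[symmetric]) (use assms r in \<open>auto simp: Pi_iff subset_iff\<close>)
  finally show ?thesis .
qed

lemma basis_image:
  assumes X: "basis R M X"
  shows "basis S N (\<theta> ` X)"
proof -
  have XM: "X \<subseteq> carrier M" using X by (simp add: basis_def independent_def)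
  have "independent S N (\<theta> ` X)"
    unfolding independent_def
  proof (intro conjI allI impI)
    show "\<theta> ` X \<subseteq> carrier N" using XM by auto
    fix F c assume F: "finite F \<and> F \<subseteq> \<theta> ` X \<and> c \<in> F \<rightarrow> carrier S \<and> (\<Oplus>\<^bsub>N\<^esub>x \<in> F. c x \<odot>\<^bsub>N\<^esub> x) = \<zero>\<^bsub>N\<^esub>"
    then have "finite F" "F \<subseteq> \<theta> ` X" by auto
    then obtain G where G: "G \<subseteq> X" "finite G" "F = \<theta> ` G" using finite_subset_image[of F \<theta> X] by blast
    let ?d = "\<lambda>x. inv_into (carrier R) \<rho> (c (\<theta> x))"
    have d: "?d \<in> G \<rightarrow> carrier R" and rd: "\<And>x. x \<in> G \<Longrightarrow> \<rho> (?d x) = c (\<theta> x)"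
      using F G(3) bij_ring by (auto simp: Pi_iff bij_betw_def intro: inv_into_into f_inv_into_f)
    have "(\<Oplus>\<^bsub>M\<^esub>x \<in> G. ?d x \<odot>\<^bsub>M\<^esub> x) \<in> carrier M"
      by (rule M.finsum_closed) (use d G XM in \<open>auto simp: Pi_iff subset_iff\<close>)
    moreover have "\<theta> (\<Oplus>\<^bsub>M\<^esub>x \<in> G. ?d x \<odot>\<^bsub>M\<^esub> x) = \<theta> \<zero>\<^bsub>M\<^esub>"
      using hom_combination[of G c] F G XM hom_zero by auto
    ultimately have "(\<Oplus>\<^bsub>M\<^esub>x \<in> G. ?d x \<odot>\<^bsub>M\<^esub> x) = \<zero>\<^bsub>M\<^esub>"
      using bij inj_onD[of \<theta> "carrier M"] unfolding bij_betw_def by blast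
    then have "\<forall>x \<in> G. ?d x = \<zero>\<^bsub>R\<^esub>"
      using X G d M.independentD[of X G ?d] unfolding basis_def by blast
    then show "\<forall>y \<in> F. c y = \<zero>\<^bsub>S\<^esub>" using rd ring_zero G(3) by (metis imageE)
  qed
  moreover have "spans S N (\<theta> ` X)"
    unfolding spans_def
  proof (intro conjI ballI)
    show "\<theta> ` X \<subseteq> carrier N" using XM by auto
    fix v assume "v \<in> carrier N"
    then obtain w where w: "w \<in> carrier M" "v = \<theta> w" using bij by (auto simp: bij_betw_def)
    then obtain F c where F: "finite F" "F \<subseteq> X" "c \<in> F \<rightarrow> carrier R" "w = (\<Oplus>\<^bsub>M\<^esub>x \<in> F. c x \<odot>\<^bsub>M\<^esub> x)"
      using X unfolding basis_def spans_def by meson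
    have FM: "F \<subseteq> carrier M" using F XM by blast
    then have inj: "inj_on \<theta> F" using bij inj_on_subset[of \<theta> "carrier M" F] by (simp add: bij_betw_def)
    let ?d = "\<lambda>y. \<rho> (c (inv_into F \<theta> y))"
    have d: "?d \<in> \<theta> ` F \<rightarrow> carrier S" using F inj by (auto simp: Pi_iff)
    have "inv_into (carrier R) \<rho> (?d (\<theta> x)) = c x" if "x \<in> F" for x
      using that F inj bij_ring by (auto simp: Pi_iff bij_betw_def)
    then have "(\<Oplus>\<^bsub>M\<^esub>x \<in> F. inv_into (carrier R) \<rho> (?d (\<theta> x)) \<odot>\<^bsub>M\<^esub> x) = w"
      unfolding F(4) by (intro M.finsum_cong') (use F FM in \<open>auto simp: Pi_iff subset_iff\<close>)
    then have "v = (\<Oplus>\<^bsub>N\<^esub>y \<in> \<theta> ` F. ?d y \<odot>\<^bsub>N\<^esub> y)"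
      using hom_combination[OF F(1) FM d] w(2) by simp
    then show "\<exists>F c. finite F \<and> F \<subseteq> \<theta> ` X \<and> c \<in> F \<rightarrow> carrier S \<and> v = (\<Oplus>\<^bsub>N\<^esub>x \<in> F. c x \<odot>\<^bsub>N\<^esub> x)"
      using F d by (intro exI[of _ "\<theta> ` F"] exI[of _ ?d]) auto
  qed
  ultimately show ?thesis by (simp add: basis_def)
qed

lemma dim_eq:
  assumes "division_ring R" "division_ring S"
  shows "(dim R M, dim S N) \<in> ordIso"
proof -
  interpret M': div_module R M by unfold_locales (rule assms(1))
  interpret N': div_module S N by unfold_locales (rule assms(2))
  obtain X where X: "basis R M X" using M'.basis_exists by blast
  have "inj_on \<theta> X" using X bij inj_on_subset by (auto simp: basis_def independent_def bij_betw_def)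
  then have "(card_of X, card_of (\<theta> ` X)) \<in> ordIso"
    using card_of_ordIsoI[of \<theta> X "\<theta> ` X"] inj_on_imp_bij_betw by blast
  from ordIso_transitive[OF M'.dim_basis[OF X]
      ordIso_transitive[OF this ordIso_symmetric[OF N'.dim_basis[OF basis_image[OF X]]]]]
  show ?thesis .
qed

end

section \<open>Linear maps and the splitting of injections\<close>

lemma linear_mapsD:
  assumes "f \<in> linear_maps R M N"
  shows "x \<in> carrier M \<Longrightarrow> f x \<in> carrier N" "f \<in> extensional (carrier M)"
    "\<lbrakk>x \<in> carrier M; y \<in> carrier M\<rbrakk> \<Longrightarrow> f (x \<oplus>\<^bsub>M\<^esub> y) = f x \<oplus>\<^bsub>N\<^esub> f y"
    "\<lbrakk>r \<in> carrier R; x \<in> carrier M\<rbrakk> \<Longrightarrow> f (r \<odot>\<^bsub>M\<^esub> x) = r \<odot>\<^bsub>N\<^esub> f x"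
  using assms unfolding linear_maps_def PiE_def by auto

lemma linear_mapsI:
  assumes "\<And>x. x \<in> carrier M \<Longrightarrow> f x \<in> carrier N"
    "\<And>x y. \<lbrakk>x \<in> carrier M; y \<in> carrier M\<rbrakk> \<Longrightarrow> f (x \<oplus>\<^bsub>M\<^esub> y) = f x \<oplus>\<^bsub>N\<^esub> f y"
    "\<And>r x. \<lbrakk>r \<in> carrier R; x \<in> carrier M\<rbrakk> \<Longrightarrow> f (r \<odot>\<^bsub>M\<^esub> x) = r \<odot>\<^bsub>N\<^esub> f x"
    "right_module R M"
  shows "restrict f (carrier M) \<in> linear_maps R M N"
proof -
  interpret r_module R M by (rule r_module.intro) (rule assms(4))
  show ?thesis unfolding linear_maps_def using assms(1-3) by auto
qed

lemma linear_map_zero: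
  assumes f: "f \<in> linear_maps R M N" and M: "right_module R M" and N: "right_module R N"
  shows "f \<zero>\<^bsub>M\<^esub> = \<zero>\<^bsub>N\<^esub>"
proof -
  interpret M: r_module R M by (rule r_module.intro) (rule M)
  interpret N: r_module R N by (rule r_module.intro) (rule N)
  have "f (\<zero>\<^bsub>R\<^esub> \<odot>\<^bsub>M\<^esub> \<zero>\<^bsub>M\<^esub>) = \<zero>\<^bsub>R\<^esub> \<odot>\<^bsub>N\<^esub> f \<zero>\<^bsub>M\<^esub>" by (rule linear_mapsD(4)[OF f]) auto
  then show ?thesis using linear_mapsD(1)[OF f, of "\<zero>\<^bsub>M\<^esub>"] by simp
qed

text \<open>Zorn's lemma provides \<open>W\<close>, maximal among the submodules that meet the image
  of \<open>f\<close> only in zero. It is a complement of the image, and the retraction is the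
  projection along it.\<close>

lemma linear_retraction:
  assumes div: "division_ring R" and M: "right_module R M" and N: "right_module R N"
    and f: "f \<in> linear_maps R M N" and ker: "\<And>x. \<lbrakk>x \<in> carrier M; f x = \<zero>\<^bsub>N\<^esub>\<rbrakk> \<Longrightarrow> x = \<zero>\<^bsub>M\<^esub>"
  obtains g where "g \<in> linear_maps R N M" "\<And>x. x \<in> carrier M \<Longrightarrow> g (f x) = x"
proof -
  interpret M: r_module R M by (rule r_module.intro) (rule M)
  interpret N: div_module R N by (intro div_module.intro r_module.intro div_module_axioms.intro N div)
  note fD = linear_mapsD[OF f] and f0 = linear_map_zero[OF f M N]
  define \<P> where "\<P> = {W. N.subm W \<and> W \<inter> f ` carrier M \<subseteq> {\<zero>\<^bsub>N\<^esub>}}"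
  have "\<exists>W \<in> \<P>. \<forall>V \<in> \<P>. W \<subseteq> V \<longrightarrow> V = W"
  proof (rule subset_Zorn_nonempty)
    have "N.subm {\<zero>\<^bsub>N\<^esub>}" by (auto simp: N.subm_def)
    then have "{\<zero>\<^bsub>N\<^esub>} \<in> \<P>" by (auto simp: \<P>_def)
    then show "\<P> \<noteq> {}" by blast
    fix \<C> assume ne: "\<C> \<noteq> {}" and ch: "subset.chain \<P> \<C>"
    have in\<P>: "N.subm W" "W \<inter> f ` carrier M \<subseteq> {\<zero>\<^bsub>N\<^esub>}" if "W \<in> \<C>" for W
      using ch that by (auto simp: subset.chain_def \<P>_def)
    have add: "x \<oplus>\<^bsub>N\<^esub> y \<in> \<Union>\<C>" if xy: "x \<in> \<Union>\<C>" "y \<in> \<Union>\<C>" for x y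
    proof -
      obtain W where "W \<in> \<C>" "{x, y} \<subseteq> W"
        by (rule finite_subset_Union_chain[of "{x, y}" \<C> \<P>]) (use xy ne ch in auto)
      then show ?thesis using N.submD(3)[OF in\<P>(1)] by blast
    qed
    have "\<zero>\<^bsub>N\<^esub> \<in> \<Union>\<C>" using ne N.submD(2)[OF in\<P>(1)] by blast
    moreover have "\<Union>\<C> \<subseteq> carrier N" using N.submD(1)[OF in\<P>(1)] by blast
    moreover have "r \<odot>\<^bsub>N\<^esub> x \<in> \<Union>\<C>" if "r \<in> carrier R" "x \<in> \<Union>\<C>" for r x
      using that N.submD(4)[OF in\<P>(1)] by blast
    ultimately have "N.subm (\<Union>\<C>)" using add by (auto simp: N.subm_def)
    then show "\<Union>\<C> \<in> \<P>" using in\<P>(2) unfolding \<P>_def by blast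
  qed
  then obtain W where W\<P>: "W \<in> \<P>" and max: "\<And>V. \<lbrakk>V \<in> \<P>; W \<subseteq> V\<rbrakk> \<Longrightarrow> V = W"
    by blast
  have W: "N.subm W" "W \<inter> f ` carrier M \<subseteq> {\<zero>\<^bsub>N\<^esub>}" using W\<P> by (auto simp: \<P>_def)
  note WD = N.submD[OF W(1)]
  define U where "U = {f m \<oplus>\<^bsub>N\<^esub> w | m w. m \<in> carrier M \<and> w \<in> W}"
  have U: "N.subm U"
    unfolding N.subm_def
  proof (intro conjI ballI)
    show "U \<subseteq> carrier N" using fD WD by (auto simp: U_def)
    show "\<zero>\<^bsub>N\<^esub> \<in> U" unfolding U_def using f0 WD(2) by (intro CollectI exI[of _ "\<zero>\<^bsub>M\<^esub>"] exI[of _ "\<zero>\<^bsub>N\<^esub>"]) auto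
    fix x y assume "x \<in> U" "y \<in> U"
    then obtain m w m' w' where *: "x = f m \<oplus>\<^bsub>N\<^esub> w" "y = f m' \<oplus>\<^bsub>N\<^esub> w'" "m \<in> carrier M" "m' \<in> carrier M"
      "w \<in> W" "w' \<in> W"
      unfolding U_def by blast
    then have "x \<oplus>\<^bsub>N\<^esub> y = f (m \<oplus>\<^bsub>M\<^esub> m') \<oplus>\<^bsub>N\<^esub> (w \<oplus>\<^bsub>N\<^esub> w')"
      using fD WD(1) N.a_ac by simp
    then show "x \<oplus>\<^bsub>N\<^esub> y \<in> U" unfolding U_def using * WD(3) by blast
  next
    fix r x assume r: "r \<in> carrier R" and "x \<in> U"
    then obtain m w where *: "x = f m \<oplus>\<^bsub>N\<^esub> w" "m \<in> carrier M" "w \<in> W"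
      unfolding U_def by blast
    then have "r \<odot>\<^bsub>N\<^esub> x = f (r \<odot>\<^bsub>M\<^esub> m) \<oplus>\<^bsub>N\<^esub> (r \<odot>\<^bsub>N\<^esub> w)"
      using fD WD(1) r N.smult_r_distr by simp
    then show "r \<odot>\<^bsub>N\<^esub> x \<in> U" unfolding U_def using * r WD(4) M.smult_closed by blast
  qed
  have WU: "W \<subseteq> U"
  proof
    fix w assume w: "w \<in> W"
    then have "w = f \<zero>\<^bsub>M\<^esub> \<oplus>\<^bsub>N\<^esub> w" using f0 WD(1) by simp
    then show "w \<in> U" unfolding U_def using w by blast
  qed
  have "n \<in> U" if n: "n \<in> carrier N" for n
  proof (rule ccontr)
    assume nU: "n \<notin> U"
    \<comment> \<open>Adjoining the line through \<open>n\<close> to \<open>W\<close> keeps the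
      intersection with the image trivial, because a common element with non-zero coefficient at
      \<open>n\<close> would put \<open>n\<close> into \<open>U\<close>. This contradicts the
      maximality of \<open>W\<close>.\<close>
    define V where "V = {w \<oplus>\<^bsub>N\<^esub> r \<odot>\<^bsub>N\<^esub> n | w r. w \<in> W \<and> r \<in> carrier R}"
    have "N.subm V"
      unfolding N.subm_def
    proof (intro conjI ballI)
      show "V \<subseteq> carrier N" using n WD by (auto simp: V_def)
      show "\<zero>\<^bsub>N\<^esub> \<in> V" unfolding V_def using n WD(2) by (intro CollectI exI[of _ "\<zero>\<^bsub>N\<^esub>"] exI[of _ "\<zero>\<^bsub>R\<^esub>"]) auto
      fix x y assume "x \<in> V" "y \<in> V"
      then obtain w r w' r' where *: "x = w \<oplus>\<^bsub>N\<^esub> r \<odot>\<^bsub>N\<^esub> n" "y = w' \<oplus>\<^bsub>N\<^esub> r' \<odot>\<^bsub>N\<^esub> n" "w \<in> W" "w' \<in> W"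
        "r \<in> carrier R" "r' \<in> carrier R"
        unfolding V_def by blast
      then have "x \<oplus>\<^bsub>N\<^esub> y = (w \<oplus>\<^bsub>N\<^esub> w') \<oplus>\<^bsub>N\<^esub> (r \<oplus>\<^bsub>R\<^esub> r') \<odot>\<^bsub>N\<^esub> n"
        using n WD(1) N.a_ac N.smult_l_distr by simp
      then show "x \<oplus>\<^bsub>N\<^esub> y \<in> V" unfolding V_def using * WD(3) by blast
    next
      fix s x assume s: "s \<in> carrier R" and "x \<in> V"
      then obtain w r where *: "x = w \<oplus>\<^bsub>N\<^esub> r \<odot>\<^bsub>N\<^esub> n" "w \<in> W" "r \<in> carrier R"
        unfolding V_def by blast
      then have "s \<odot>\<^bsub>N\<^esub> x = s \<odot>\<^bsub>N\<^esub> w \<oplus>\<^bsub>N\<^esub> (r \<otimes>\<^bsub>R\<^esub> s) \<odot>\<^bsub>N\<^esub> n"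
        using n WD(1) s N.smult_r_distr N.smult_assoc by simp
      then show "s \<odot>\<^bsub>N\<^esub> x \<in> V" unfolding V_def using * s WD(4) by blast
    qed
    moreover have "V \<inter> f ` carrier M \<subseteq> {\<zero>\<^bsub>N\<^esub>}"
    proof
      fix x assume x: "x \<in> V \<inter> f ` carrier M"
      then obtain w r m where *: "x = w \<oplus>\<^bsub>N\<^esub> r \<odot>\<^bsub>N\<^esub> n" "w \<in> W" "r \<in> carrier R" "m \<in> carrier M" "x = f m"
        unfolding V_def by blast
      show "x \<in> {\<zero>\<^bsub>N\<^esub>}"
      proof (cases "r = \<zero>\<^bsub>R\<^esub>")
        case True
        then have "x = w" using * n WD(1) by simp
        then show ?thesis using * W(2) by blast
      next
        case False
        have c: "w \<in> carrier N" "r \<odot>\<^bsub>N\<^esub> n \<in> carrier N" using * n WD(1) by auto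
        have "f m = w \<oplus>\<^bsub>N\<^esub> r \<odot>\<^bsub>N\<^esub> n" using * by simp
        moreover have "(w \<oplus>\<^bsub>N\<^esub> r \<odot>\<^bsub>N\<^esub> n) \<oplus>\<^bsub>N\<^esub> \<ominus>\<^bsub>N\<^esub> w = r \<odot>\<^bsub>N\<^esub> n \<oplus>\<^bsub>N\<^esub> (w \<oplus>\<^bsub>N\<^esub> \<ominus>\<^bsub>N\<^esub> w)"
          using c by (simp add: N.a_ac)
        ultimately have "r \<odot>\<^bsub>N\<^esub> n = f m \<oplus>\<^bsub>N\<^esub> \<ominus>\<^bsub>N\<^esub> w" using c by (simp add: N.r_neg)
        then have "r \<odot>\<^bsub>N\<^esub> n \<in> U" unfolding U_def using * N.subm_minus[OF W(1)] by blast
        then show ?thesis using N.smult_inverse[OF *(3) False n U] nU by blast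
      qed
    qed
    ultimately have V\<P>: "V \<in> \<P>" by (simp add: \<P>_def)
    have "W \<subseteq> V"
    proof
      fix w assume w: "w \<in> W"
      then have "w = w \<oplus>\<^bsub>N\<^esub> \<zero>\<^bsub>R\<^esub> \<odot>\<^bsub>N\<^esub> n" using n WD(1) by simp
      then show "w \<in> V" unfolding V_def using w by blast
    qed
    then have VW: "V = W" using max[OF V\<P>] by blast
    have "n = \<zero>\<^bsub>N\<^esub> \<oplus>\<^bsub>N\<^esub> \<one>\<^bsub>R\<^esub> \<odot>\<^bsub>N\<^esub> n" using n by simp
    then have "n \<in> V" unfolding V_def using WD(2) by blast
    then show False using VW WU nU by blast
  qed
  then have ex: "\<exists>m \<in> carrier M. \<exists>w \<in> W. n = f m \<oplus>\<^bsub>N\<^esub> w" if "n \<in> carrier N" for n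
    using that unfolding U_def by blast
  have uniq: "m = m'" if eq: "f m \<oplus>\<^bsub>N\<^esub> w = f m' \<oplus>\<^bsub>N\<^esub> w'" and m: "m \<in> carrier M" "m' \<in> carrier M" and w:
    "w \<in> W" "w' \<in> W" for m m' w w'
  proof -
    have fm: "f (\<ominus>\<^bsub>M\<^esub> m') = \<ominus>\<^bsub>N\<^esub> f m'"
      using fD(4)[of "\<ominus>\<^bsub>R\<^esub> \<one>\<^bsub>R\<^esub>" m'] m fD(1) M.smult_minus_one N.smult_minus_one by simp
    have c: "f m \<in> carrier N" "f m' \<in> carrier N" "w \<in> carrier N" "w' \<in> carrier N" using m w fD(1) WD(1) by auto
    have "f (m \<oplus>\<^bsub>M\<^esub> \<ominus>\<^bsub>M\<^esub> m') = (f m \<oplus>\<^bsub>N\<^esub> w) \<oplus>\<^bsub>N\<^esub> (\<ominus>\<^bsub>N\<^esub> f m' \<oplus>\<^bsub>N\<^esub> \<ominus>\<^bsub>N\<^esub> w)"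
    proof -
      have "(f m \<oplus>\<^bsub>N\<^esub> w) \<oplus>\<^bsub>N\<^esub> (\<ominus>\<^bsub>N\<^esub> f m' \<oplus>\<^bsub>N\<^esub> \<ominus>\<^bsub>N\<^esub> w) = (f m \<oplus>\<^bsub>N\<^esub> \<ominus>\<^bsub>N\<^esub> f m') \<oplus>\<^bsub>N\<^esub> (w \<oplus>\<^bsub>N\<^esub> \<ominus>\<^bsub>N\<^esub> w)"
        using c by (simp add: N.a_ac)
      then show ?thesis using c m fm fD(3) by (simp add: N.r_neg)
    qed
    also have "\<dots> = (f m' \<oplus>\<^bsub>N\<^esub> \<ominus>\<^bsub>N\<^esub> f m') \<oplus>\<^bsub>N\<^esub> (w' \<oplus>\<^bsub>N\<^esub> \<ominus>\<^bsub>N\<^esub> w)"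
      unfolding eq using c by (simp add: N.a_ac)
    also have "\<dots> = w' \<oplus>\<^bsub>N\<^esub> \<ominus>\<^bsub>N\<^esub> w" using c by (simp add: N.r_neg)
    finally have "f (m \<oplus>\<^bsub>M\<^esub> \<ominus>\<^bsub>M\<^esub> m') \<in> W" using w WD(3) N.subm_minus[OF W(1)] by simp
    then have "f (m \<oplus>\<^bsub>M\<^esub> \<ominus>\<^bsub>M\<^esub> m') = \<zero>\<^bsub>N\<^esub>" using W(2) m by blast
    then have "m \<oplus>\<^bsub>M\<^esub> \<ominus>\<^bsub>M\<^esub> m' = \<zero>\<^bsub>M\<^esub>" using ker m by simp
    then show ?thesis using m by (metis M.minus_equality M.minus_minus M.a_inv_closed)
  qed
  \<comment> \<open>\<open>g\<close> reads off the component in \<open>M\<close>, which is well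
    defined by \<open>uniq\<close>. On the image of \<open>f\<close> the component in
    \<open>W\<close> is zero, so \<open>g\<close> inverts \<open>f\<close> there.\<close>
  define g where "g n = (THE m. m \<in> carrier M \<and> (\<exists>w \<in> W. n = f m \<oplus>\<^bsub>N\<^esub> w))" for n
  have g: "g n = m" if "m \<in> carrier M" "w \<in> W" "n = f m \<oplus>\<^bsub>N\<^esub> w" for n m w
    unfolding g_def by (rule the_equality) (use that uniq in blast)+
  have "restrict g (carrier N) \<in> linear_maps R N M"
  proof (rule linear_mapsI[OF _ _ _ N])
    fix n assume n: "n \<in> carrier N"
    obtain m w where m: "m \<in> carrier M" "w \<in> W" "n = f m \<oplus>\<^bsub>N\<^esub> w" using ex[OF n] by blast
    show "g n \<in> carrier M" using g[OF m] m by simp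
    { fix n' assume "n' \<in> carrier N"
      then obtain m' w' where m': "m' \<in> carrier M" "w' \<in> W" "n' = f m' \<oplus>\<^bsub>N\<^esub> w'" using ex by blast
      have "n \<oplus>\<^bsub>N\<^esub> n' = f (m \<oplus>\<^bsub>M\<^esub> m') \<oplus>\<^bsub>N\<^esub> (w \<oplus>\<^bsub>N\<^esub> w')"
        using m m' fD WD(1) N.a_ac by simp
      then show "g (n \<oplus>\<^bsub>N\<^esub> n') = g n \<oplus>\<^bsub>M\<^esub> g n'"
        using g[of "m \<oplus>\<^bsub>M\<^esub> m'" "w \<oplus>\<^bsub>N\<^esub> w'"] g[OF m] g[OF m'] m m' WD(3) by simp }
    fix r assume r: "r \<in> carrier R"
    have "r \<odot>\<^bsub>N\<^esub> n = f (r \<odot>\<^bsub>M\<^esub> m) \<oplus>\<^bsub>N\<^esub> (r \<odot>\<^bsub>N\<^esub> w)"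
      using m r fD WD(1) N.smult_r_distr by simp
    then show "g (r \<odot>\<^bsub>N\<^esub> n) = r \<odot>\<^bsub>M\<^esub> g n"
      using g[of "r \<odot>\<^bsub>M\<^esub> m" "r \<odot>\<^bsub>N\<^esub> w"] g[OF m] m r WD(4) by simp
  qed
  moreover have "restrict g (carrier N) (f x) = x" if "x \<in> carrier M" for x
    using g[of x "\<zero>\<^bsub>N\<^esub>" "f x"] that fD(1) WD(2) by simp
  ultimately show thesis using that by blast
qed

section \<open>The category of finitely generated modules\<close>

lemma mod_sel [simp]:
  "Obj (mod_category R) = {M. right_module R M \<and> finitely_generated R M}"
  "src (mod_category R) (M, f, N) = M" "tgt (mod_category R) (M, f, N) = N"
  "ident (mod_category R) M = (M, \<lambda>x \<in> carrier M. x, M)"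
  "(N', g, P) \<cdot>\<^bsub>mod_category R\<^esub> (M, f, N) = (M, compose (carrier M) g f, P)"
  by (simp_all add: mod_category_def)

lemma mod_Hom:
  assumes "right_module R M" "finitely_generated R M" "right_module R N" "finitely_generated R N"
  shows "Hom (mod_category R) M N = {(M, f, N) | f. f \<in> linear_maps R M N}"
  using assms unfolding Hom_def mod_category_def by auto

lemma mod_Arr: "F \<in> Arr (mod_category R) \<longleftrightarrow> (\<exists>M f N. F = (M, f, N) \<and> right_module R M \<and> finitely_generated R M \<and>
      right_module R N \<and> finitely_generated R N \<and> f \<in> linear_maps R M N)"
  by (auto simp: mod_category_def)

lemma compose_linear:
  assumes "f \<in> linear_maps R M N" "g \<in> linear_maps R N P" "right_module R M"
  shows "compose (carrier M) g f \<in> linear_maps R M P"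
  unfolding compose_def
  by (rule linear_mapsI) (use assms linear_mapsD[OF assms(1)] linear_mapsD[OF assms(2)] in auto)

lemma ident_linear: "right_module R M \<Longrightarrow> (\<lambda>x \<in> carrier M. x) \<in> linear_maps R M M"
  by (rule linear_mapsI) auto

lemma mod_category_category: "category (mod_category R)"
proof
  fix F G X Y Z assume F: "F \<in> Hom (mod_category R) X Y" and G: "G \<in> Hom (mod_category R) Y Z"
  then show "G \<cdot>\<^bsub>mod_category R\<^esub> F \<in> Hom (mod_category R) X Z"
    unfolding Hom_def mod_Arr by (auto intro: compose_linear)
next
  fix F G H W X Y Z assume F: "F \<in> Hom (mod_category R) W X" and G: "G \<in> Hom (mod_category R) X Y"
    and H: "H \<in> Hom (mod_category R) Y Z"
  then obtain f g h where "F = (W, f, X)" "G = (X, g, Y)" "H = (Y, h, Z)" "f \<in> linear_maps R W X"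
    unfolding Hom_def mod_Arr by force
  then show "(H \<cdot>\<^bsub>mod_category R\<^esub> G) \<cdot>\<^bsub>mod_category R\<^esub> F = H \<cdot>\<^bsub>mod_category R\<^esub> (G \<cdot>\<^bsub>mod_category R\<^esub> F)"
    using linear_mapsD(1)[of f R W X] by (auto simp: compose_def intro!: restrict_ext)
next
  fix F X Y assume F: "F \<in> Hom (mod_category R) X Y"
  then obtain f where f: "F = (X, f, Y)" "f \<in> linear_maps R X Y"
    unfolding Hom_def mod_Arr by force
  have "compose (carrier X) (\<lambda>x \<in> carrier Y. x) f = f" "compose (carrier X) f (\<lambda>x \<in> carrier X. x) = f"
    using linear_mapsD(1,2)[OF f(2)] by (auto simp: compose_def extensional_def fun_eq_iff)
  then show "ident (mod_category R) Y \<cdot>\<^bsub>mod_category R\<^esub> F = F"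
    "F \<cdot>\<^bsub>mod_category R\<^esub> ident (mod_category R) X = F"
    using f by auto
qed (auto simp: mod_Arr Hom_def ident_linear)

text \<open>Cyclic submodules serve as test objects of the category. They detect a single element of
  a kernel, whereas the kernel itself would first have to be shown finitely generated.\<close>

lemma singleton_span:
  fixes M :: "('r, 'v) module"
  assumes M: "right_module R M" and m: "m \<in> carrier M"
  defines "D \<equiv> M\<lparr>carrier := {r \<odot>\<^bsub>M\<^esub> m | r. r \<in> carrier R}\<rparr>"
  shows "right_module R D" "finitely_generated R D" "m \<in> carrier D"
proof -
  interpret M: r_module R M by (rule r_module.intro) (rule M)
  have sub: "M.subm {r \<odot>\<^bsub>M\<^esub> m | r. r \<in> carrier R}"
    unfolding M.subm_def
  proof (intro conjI ballI)
    show "\<zero>\<^bsub>M\<^esub> \<in> {r \<odot>\<^bsub>M\<^esub> m | r. r \<in> carrier R}" using m by (auto intro!: exI[of _ "\<zero>\<^bsub>R\<^esub>"])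
  qed (use m in \<open>auto simp flip: M.smult_l_distr M.smult_assoc\<close>)
  show D: "right_module R D" unfolding D_def by (rule M.subm_module[OF sub])
  interpret D: r_module R D by (rule r_module.intro) (rule D)
  have "m = \<one>\<^bsub>R\<^esub> \<odot>\<^bsub>M\<^esub> m" using m by simp
  then show mD: "m \<in> carrier D" unfolding D_def by (auto intro: exI[of _ "\<one>\<^bsub>R\<^esub>"])
  have "spans R D {m}"
    unfolding spans_def
  proof (intro conjI ballI)
    fix v assume "v \<in> carrier D"
    then obtain r where r: "r \<in> carrier R" "v = r \<odot>\<^bsub>D\<^esub> m" unfolding D_def by auto
    show "\<exists>F c. finite F \<and> F \<subseteq> {m} \<and> c \<in> F \<rightarrow> carrier R \<and> v = (\<Oplus>\<^bsub>D\<^esub>x \<in> F. c x \<odot>\<^bsub>D\<^esub> x)"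
    proof (intro exI[of _ "{m}"] exI[of _ "\<lambda>_. r"] conjI)
      show "v = (\<Oplus>\<^bsub>D\<^esub>x \<in> {m}. r \<odot>\<^bsub>D\<^esub> x)" using r mD by (subst D.finsum_insert) auto
    qed (use r in auto)
  qed (use mD in simp)
  then show "finitely_generated R D" unfolding finitely_generated_def by blast
qed

lemma span_inclusion:
  fixes M :: "('r, 'v) module"
  assumes M: "right_module R M" and m: "m \<in> carrier M"
  defines "D \<equiv> M\<lparr>carrier := {r \<odot>\<^bsub>M\<^esub> m | r. r \<in> carrier R}\<rparr>"
  shows "(\<lambda>x \<in> carrier D. x) \<in> linear_maps R D M"
proof (rule linear_mapsI)
  interpret M: r_module R M by (rule r_module.intro) (rule M)
  show "right_module R D" unfolding D_def by (rule singleton_span(1)[OF M m])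
  show "x \<in> carrier M" if "x \<in> carrier D" for x using that m by (auto simp: D_def)
qed (auto simp: D_def)

lemma zero_linear:
  assumes "right_module R M" "right_module R N"
  shows "(\<lambda>x \<in> carrier M. \<zero>\<^bsub>N\<^esub>) \<in> linear_maps R M N"
proof -
  interpret N: r_module R N by (rule r_module.intro) (rule assms)
  show ?thesis by (rule linear_mapsI) (use assms in auto)
qed

text \<open>If \<open>x\<close> lies in the kernel of a monic \<open>f\<close>, the inclusion of the
  submodule generated by \<open>x\<close> and the zero map agree after \<open>f\<close>, so
  \<open>x\<close> is zero. An injective linear map over a division ring has a retraction.\<close>

lemma mod_monic_split:
  assumes div: "division_ring R" and F: "monic (mod_category R) F"
  shows "\<exists>G \<in> Arr (mod_category R). src (mod_category R) G = tgt (mod_category R) F \<and>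
    tgt (mod_category R) G = src (mod_category R) F \<and>
    G \<cdot>\<^bsub>mod_category R\<^esub> F = ident (mod_category R) (src (mod_category R) F)"
proof -
  have "F \<in> Arr (mod_category R)" using F by (simp add: monic_def)
  then obtain M f N where f: "F = (M, f, N)" and M: "right_module R M" "finitely_generated R M"
    and N: "right_module R N" "finitely_generated R N" and lf: "f \<in> linear_maps R M N"
    unfolding mod_Arr by blast
  have ker: "x = \<zero>\<^bsub>M\<^esub>" if x: "x \<in> carrier M" "f x = \<zero>\<^bsub>N\<^esub>" for x
  proof -
    interpret M: r_module R M by (rule r_module.intro) (rule M)
    interpret N: r_module R N by (rule r_module.intro) (rule N)
    define D where "D = M\<lparr>carrier := {r \<odot>\<^bsub>M\<^esub> x | r. r \<in> carrier R}\<rparr>"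
    note D = singleton_span[OF M(1) x(1), folded D_def]
    let ?i = "\<lambda>y \<in> carrier D. y" and ?z = "\<lambda>y \<in> carrier D. \<zero>\<^bsub>M\<^esub>"
    have "?i \<in> linear_maps R D M" "?z \<in> linear_maps R D M"
      using span_inclusion[OF M(1) x(1), folded D_def] zero_linear[OF D(1) M(1)] by auto
    then have "(D, ?i, M) \<in> Hom (mod_category R) D M" "(D, ?z, M) \<in> Hom (mod_category R) D M"
      unfolding mod_Hom[OF D(1,2) M] by blast+
    moreover have "compose (carrier D) f ?i = compose (carrier D) f ?z"
      using linear_mapsD(4)[OF lf] x linear_map_zero[OF lf M(1) N(1)]
      by (auto simp: compose_def D_def intro!: restrict_ext)
    moreover from this have "(M, f, N) \<cdot>\<^bsub>mod_category R\<^esub> (D, ?i, M) = (M, f, N) \<cdot>\<^bsub>mod_category R\<^esub> (D, ?z, M)"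
      by simp
    moreover have "\<forall>a \<in> Hom (mod_category R) D M. \<forall>b \<in> Hom (mod_category R) D M.
      (M, f, N) \<cdot>\<^bsub>mod_category R\<^esub> a = (M, f, N) \<cdot>\<^bsub>mod_category R\<^esub> b \<longrightarrow> a = b"
      using F unfolding f monic_def mod_sel by blast
    ultimately have "(D, ?i, M) = (D, ?z, M)" by blast
    then have "?i x = ?z x" by simp
    then show ?thesis using D(3) by simp
  qed
  obtain g where g: "g \<in> linear_maps R N M" "\<And>x. x \<in> carrier M \<Longrightarrow> g (f x) = x"
    using linear_retraction[OF div M(1) N(1) lf ker] by blast
  have "(N, g, M) \<in> Arr (mod_category R)" unfolding mod_Arr using g M N by blast
  moreover have "compose (carrier M) g f = (\<lambda>x \<in> carrier M. x)"
    using g(2) by (auto simp: compose_def intro!: restrict_ext)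
  ultimately show ?thesis unfolding f by (intro bexI[of _ "(N, g, M)"]) auto
qed

text \<open>\<open>M\<close> is retracted onto the line through \<open>m\<close>, and then
  \<open>m\<close> is sent to \<open>n\<close>. The conclusion speaks of two distinct maps because
  \<open>mod_category\<close> carries no zero arrows and because this form survives an equivalence
  of categories.\<close>

lemma mod_nonzero_map:
  fixes M N :: "'r fg_module"
  assumes div: "division_ring R" and M: "right_module R M" "finitely_generated R M"
    and N: "right_module R N" "finitely_generated R N"
    and m: "m \<in> carrier M" "m \<noteq> \<zero>\<^bsub>M\<^esub>" and n: "n \<in> carrier N" "n \<noteq> \<zero>\<^bsub>N\<^esub>"
  shows "\<exists>a \<in> Hom (mod_category R) M N. \<exists>b \<in> Hom (mod_category R) M N. a \<noteq> b"
proof -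
  interpret M: div_module R M by (intro div_module.intro r_module.intro div_module_axioms.intro M div)
  interpret N: div_module R N by (intro div_module.intro r_module.intro div_module_axioms.intro N div)
  define D where "D = M\<lparr>carrier := {r \<odot>\<^bsub>M\<^esub> m | r. r \<in> carrier R}\<rparr>"
  note D = singleton_span[OF M(1) m(1), folded D_def]
  obtain g where g: "g \<in> linear_maps R M D" "\<And>x. x \<in> carrier D \<Longrightarrow> g x = x"
    using linear_retraction[OF div D(1) M(1) span_inclusion[OF M(1) m(1), folded D_def]]
    by (auto simp: D_def)
  have uniq: "r = s" if rs: "r \<in> carrier R" "s \<in> carrier R" "r \<odot>\<^bsub>M\<^esub> m = s \<odot>\<^bsub>M\<^esub> m" for r s
  proof (rule ccontr)
    assume ne: "r \<noteq> s"
    let ?t = "r \<oplus>\<^bsub>R\<^esub> \<ominus>\<^bsub>R\<^esub> s"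
    have t: "?t \<in> carrier R" "?t \<noteq> \<zero>\<^bsub>R\<^esub>"
      using rs ne by (auto, metis M.R.minus_equality M.R.minus_minus M.R.a_inv_closed)
    have "s \<odot>\<^bsub>M\<^esub> m \<oplus>\<^bsub>M\<^esub> (\<ominus>\<^bsub>R\<^esub> s) \<odot>\<^bsub>M\<^esub> m = \<zero>\<^bsub>M\<^esub>"
      using rs m M.smult_l_distr[of s "\<ominus>\<^bsub>R\<^esub> s" m] M.R.r_neg by simp
    then have "?t \<odot>\<^bsub>M\<^esub> m = \<zero>\<^bsub>M\<^esub>" using rs m M.smult_l_distr[of r "\<ominus>\<^bsub>R\<^esub> s" m] by simp
    moreover have "M.subm {\<zero>\<^bsub>M\<^esub>}" by (auto simp: M.subm_def)
    ultimately have "m \<in> {\<zero>\<^bsub>M\<^esub>}" using M.smult_inverse[OF t m(1)] by blast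
    then show False using m by simp
  qed
  define h where "h x = (THE r. r \<in> carrier R \<and> x = r \<odot>\<^bsub>M\<^esub> m) \<odot>\<^bsub>N\<^esub> n" for x
  have h: "h (r \<odot>\<^bsub>M\<^esub> m) = r \<odot>\<^bsub>N\<^esub> n" if "r \<in> carrier R" for r
  proof -
    have "(THE s. s \<in> carrier R \<and> r \<odot>\<^bsub>M\<^esub> m = s \<odot>\<^bsub>M\<^esub> m) = r"
      by (rule the_equality) (use that uniq in blast)+
    then show ?thesis by (simp add: h_def)
  qed
  have lh: "restrict h (carrier D) \<in> linear_maps R D N"
  proof (rule linear_mapsI[OF _ _ _ D(1)])
    fix x assume "x \<in> carrier D"
    then obtain r where r: "r \<in> carrier R" "x = r \<odot>\<^bsub>M\<^esub> m" unfolding D_def by auto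
    show "h x \<in> carrier N" using r h n by simp
    { fix y assume "y \<in> carrier D"
      then obtain s where s: "s \<in> carrier R" "y = s \<odot>\<^bsub>M\<^esub> m" unfolding D_def by auto
      have "x \<oplus>\<^bsub>D\<^esub> y = (r \<oplus>\<^bsub>R\<^esub> s) \<odot>\<^bsub>M\<^esub> m" using r s m by (simp add: D_def M.smult_l_distr)
      then show "h (x \<oplus>\<^bsub>D\<^esub> y) = h x \<oplus>\<^bsub>N\<^esub> h y" using h r s n N.smult_l_distr by simp }
    fix s assume s: "s \<in> carrier R"
    have "s \<odot>\<^bsub>D\<^esub> x = (r \<otimes>\<^bsub>R\<^esub> s) \<odot>\<^bsub>M\<^esub> m" using r s m by (simp add: D_def M.smult_assoc)
    then show "h (s \<odot>\<^bsub>D\<^esub> x) = s \<odot>\<^bsub>N\<^esub> h x" using h r s n N.smult_assoc by simp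
  qed
  let ?k = "compose (carrier M) (restrict h (carrier D)) g" and ?z = "\<lambda>x \<in> carrier M. \<zero>\<^bsub>N\<^esub>"
  have "?k \<in> linear_maps R M N" by (rule compose_linear[OF g(1) lh M(1)])
  moreover have "?z \<in> linear_maps R M N" by (rule zero_linear[OF M(1) N(1)])
  moreover have "?k m = n" using m g(2)[OF D(3)] D(3) h[of "\<one>\<^bsub>R\<^esub>"] n by (simp add: compose_def)
  then have "?k \<noteq> ?z" using m(1) n(2) by (metis restrict_apply')
  ultimately show ?thesis unfolding mod_Hom[OF M N] by blast
qed

section \<open>Functors\<close>

lemma functor_Obj: "\<lbrakk>is_functor C D F; X \<in> Obj C\<rbrakk> \<Longrightarrow> obmap F X \<in> Obj D"
  by (auto simp: is_functor_def)

lemma functor_ident: "\<lbrakk>is_functor C D F; X \<in> Obj C\<rbrakk> \<Longrightarrow> armap F (ident C X) = ident D (obmap F X)"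
  by (auto simp: is_functor_def)

lemma functor_Arr:
  assumes "is_functor C D F" "f \<in> Arr C"
  shows "armap F f \<in> Arr D" "src D (armap F f) = obmap F (src C f)" "tgt D (armap F f) = obmap F (tgt C f)"
  using assms unfolding is_functor_def Hom_def by blast+

lemma functor_cmp:
  assumes "is_functor C D F" "f \<in> Arr C" "g \<in> Arr C" "src C g = tgt C f"
  shows "armap F (g \<cdot>\<^bsub>C\<^esub> f) = armap F g \<cdot>\<^bsub>D\<^esub> armap F f"
  using assms unfolding is_functor_def Hom_def by blast

lemma nat_transD:
  assumes "nat_trans C D F G \<eta>"
  shows "X \<in> Obj C \<Longrightarrow> \<eta> X \<in> Arr D" "X \<in> Obj C \<Longrightarrow> src D (\<eta> X) = obmap F X"
    "X \<in> Obj C \<Longrightarrow> tgt D (\<eta> X) = obmap G X"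
    "f \<in> Arr C \<Longrightarrow> \<eta> (tgt C f) \<cdot>\<^bsub>D\<^esub> armap F f = armap G f \<cdot>\<^bsub>D\<^esub> \<eta> (src C f)"
  using assms unfolding nat_trans_def Hom_def by blast+

section \<open>Transfer along an equivalence with a module category\<close>

lemma full_subcategory_sel [simp]:
  "Obj (full_subcategory C P) = Obj C \<inter> P"
  "Arr (full_subcategory C P) = {f \<in> Arr C. src C f \<in> P \<and> tgt C f \<in> P}"
  "src (full_subcategory C P) = src C" "tgt (full_subcategory C P) = tgt C"
  "ident (full_subcategory C P) = ident C" "cmp (full_subcategory C P) = cmp C"
  by (simp_all add: full_subcategory_def)

lemma full_subcategory_category:
  assumes "category C"
  shows "category (full_subcategory C P)"
proof -
  interpret category C by fact
  show ?thesis by unfold_locales (auto simp: Hom_iff)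
qed

text \<open>The composite of \<open>F\<close> and \<open>G\<close> being isomorphic to the identity
  makes \<open>F\<close> faithful. Both directions of the isomorphism are allowed, since an
  equivalence supplies it in one direction on \<open>C\<close> and in the other on
  \<open>D\<close>.\<close>

lemma retract_faithful:
  assumes C: "category C" and F: "is_functor C D F" and G: "is_functor D C G"
    and n: "nat_iso C C (comp_functor G F) id_functor \<epsilon> \<or> nat_iso C C id_functor (comp_functor G F) \<epsilon>"
    and ab: "a \<in> Arr C" "b \<in> Arr C" "src C a = src C b" "tgt C a = tgt C b" "armap F a = armap F b"
  shows "a = b"
proof -
  interpret category C by fact
  from n show ?thesis
  proof
    assume n: "nat_iso C C (comp_functor G F) id_functor \<epsilon>"
    then have t: "nat_trans C C (comp_functor G F) id_functor \<epsilon>" by (simp add: nat_iso_def)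
    have "iso_arr C (\<epsilon> (src C a))" using n ab by (simp add: nat_iso_def)
    then obtain e where e: "e \<in> Arr C" "src C e = tgt C (\<epsilon> (src C a))"
      "\<epsilon> (src C a) \<cdot>\<^bsub>C\<^esub> e = ident C (tgt C (\<epsilon> (src C a)))"
        "tgt C e = src C (\<epsilon> (src C a))"
      by (rule iso_arrE)
    note tD = nat_transD[OF t, unfolded comp_functor_def id_functor_def, simplified]
    have "a \<cdot>\<^bsub>C\<^esub> \<epsilon> (src C a) = b \<cdot>\<^bsub>C\<^esub> \<epsilon> (src C a)" using tD(4)[of a] tD(4)[of b] ab by simp
    then have "a \<cdot>\<^bsub>C\<^esub> (\<epsilon> (src C a) \<cdot>\<^bsub>C\<^esub> e) = b \<cdot>\<^bsub>C\<^esub> (\<epsilon> (src C a) \<cdot>\<^bsub>C\<^esub> e)"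
      using e ab tD(1-3)[of "src C a"] by (metis assoc src_Obj)
    then show ?thesis using e ab tD(1-3)[of "src C a"] by simp
  next
    assume n: "nat_iso C C id_functor (comp_functor G F) \<epsilon>"
    then have t: "nat_trans C C id_functor (comp_functor G F) \<epsilon>" by (simp add: nat_iso_def)
    have i: "iso_arr C (\<epsilon> (tgt C a))" using n ab by (simp add: nat_iso_def)
    note tD = nat_transD[OF t, unfolded comp_functor_def id_functor_def, simplified]
    show ?thesis
      by (rule monicD[OF iso_monic[OF i]]) (use tD(4)[of a] tD(4)[of b] tD(1-3)[of "tgt C a"] ab in auto)
  qed
qed

text \<open>Up to the isomorphisms \<open>\<eta>\<close>, the arrow
  \<open>armap G (armap F f)\<close> is \<open>f\<close>, hence monic; as \<open>G\<close> is
  faithful, \<open>armap F f\<close> is monic. Its retraction among modules is carried back by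
  \<open>G\<close> and conjugated with \<open>\<eta>\<close>.\<close>

lemma equivalent_to_mod_split:
  fixes D :: "('o, 'm, 'x) category_scheme"
  assumes D: "category D" and eq: "equivalent_to_mod D" and f: "monic D f"
  shows "\<exists>r \<in> Arr D. src D r = tgt D f \<and> tgt D r = src D f \<and> r \<cdot>\<^bsub>D\<^esub> f = ident D (src D f)"
proof -
  interpret D: category D by fact
  obtain \<Delta> :: "'m ring" where \<Delta>: "division_ring \<Delta>" "equivalent D (mod_category \<Delta>)"
    using eq unfolding equivalent_to_mod_def by blast
  let ?M = "mod_category \<Delta>"
  interpret M: category ?M by (rule mod_category_category)
  obtain F G \<eta> \<epsilon> where F: "is_functor D ?M F" and G: "is_functor ?M D G"
    and n: "nat_iso D D id_functor (comp_functor G F) \<eta>" and e: "nat_iso ?M ?M (comp_functor F G) id_functor \<epsilon>"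
    using \<Delta>(2) unfolding equivalent_def by blast
  have t: "nat_trans D D id_functor (comp_functor G F) \<eta>" using n by (simp add: nat_iso_def)
  note tD = nat_transD[OF t, unfolded comp_functor_def id_functor_def, simplified]
  have fA [simp]: "f \<in> Arr D" using f by (rule D.monic_Arr)
  note FA [simp] = functor_Arr[OF F] and GA [simp] = functor_Arr[OF G] and FO [simp] = functor_Obj[OF F]
    and GO [simp] = functor_Obj[OF G]
  have iso: "iso_arr D (\<eta> X)" if "X \<in> Obj D" for X using n that by (simp add: nat_iso_def)
  obtain h where h: "h \<in> Arr D" "src D h = tgt D (\<eta> (src D f))" "tgt D h = src D (\<eta> (src D f))"
    "h \<cdot>\<^bsub>D\<^esub> \<eta> (src D f) = ident D (src D (\<eta> (src D f)))" "\<eta> (src D f) \<cdot>\<^bsub>D\<^esub> h = ident D (tgt D (\<eta> (src D f)))"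
    using iso[of "src D f"] by (auto elim: D.iso_arrE)
  note [simp] = h(1-3) tD(1-3)
  have hm: "monic D h" by (rule D.split_monic[of _ "\<eta> (src D f)"]) (use h in auto)
  have GFf: "armap G (armap F f) = \<eta> (tgt D f) \<cdot>\<^bsub>D\<^esub> (f \<cdot>\<^bsub>D\<^esub> h)"
  proof -
    have "armap G (armap F f) = (armap G (armap F f) \<cdot>\<^bsub>D\<^esub> \<eta> (src D f)) \<cdot>\<^bsub>D\<^esub> h" using h(5) by simp
    also have "\<dots> = \<eta> (tgt D f) \<cdot>\<^bsub>D\<^esub> (f \<cdot>\<^bsub>D\<^esub> h)" using tD(4)[of f, symmetric] by simp
    finally show ?thesis .
  qed
  have "monic D (\<eta> (tgt D f) \<cdot>\<^bsub>D\<^esub> (f \<cdot>\<^bsub>D\<^esub> h))"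
    by (rule D.monic_cmp[OF D.monic_cmp[OF hm f] D.iso_monic[OF iso]]) simp_all
  then have m: "monic D (armap G (armap F f))" by (simp add: GFf)
  have "monic ?M (armap F f)"
  proof (rule M.monicI)
    fix a b assume ab: "a \<in> Arr ?M" "b \<in> Arr ?M" "tgt ?M a = src ?M (armap F f)" "tgt ?M b = src ?M (armap F f)"
      "src ?M a = src ?M b" "armap F f \<cdot>\<^bsub>?M\<^esub> a = armap F f \<cdot>\<^bsub>?M\<^esub> b"
    have "armap G (armap F f) \<cdot>\<^bsub>D\<^esub> armap G a = armap G (armap F f) \<cdot>\<^bsub>D\<^esub> armap G b"
      using functor_cmp[OF G ab(1), of "armap F f"] functor_cmp[OF G ab(2), of "armap F f"] ab fA FA by metis
    then have "armap G a = armap G b"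
      by (rule D.monicD[OF m]) (use ab in auto)
    then show "a = b"
      by (intro retract_faithful[OF M.category_axioms G F disjI1[OF e]]) (use ab in auto)
  qed simp
  then obtain R where R: "R \<in> Arr ?M" "src ?M R = tgt ?M (armap F f)" "tgt ?M R = src ?M (armap F f)"
    "R \<cdot>\<^bsub>?M\<^esub> armap F f = ident ?M (src ?M (armap F f))"
    using mod_monic_split[OF \<Delta>(1)] by blast
  have GR: "armap G R \<cdot>\<^bsub>D\<^esub> armap G (armap F f) = ident D (obmap G (obmap F (src D f)))"
    using functor_cmp[OF G, of "armap F f" R] R functor_ident[OF G, of "obmap F (src D f)"] 
      FO[OF D.src_Obj[OF fA]] FA[OF fA] by metis
  let ?r = "h \<cdot>\<^bsub>D\<^esub> (armap G R \<cdot>\<^bsub>D\<^esub> \<eta> (tgt D f))"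
  note [simp] = R(1-3)
  have "?r \<cdot>\<^bsub>D\<^esub> f = h \<cdot>\<^bsub>D\<^esub> (armap G R \<cdot>\<^bsub>D\<^esub> (\<eta> (tgt D f) \<cdot>\<^bsub>D\<^esub> f))" by simp
  also have "\<dots> = h \<cdot>\<^bsub>D\<^esub> ((armap G R \<cdot>\<^bsub>D\<^esub> armap G (armap F f)) \<cdot>\<^bsub>D\<^esub> \<eta> (src D f))" by (simp add: tD(4))
  also have "\<dots> = ident D (src D f)" unfolding GR using h(4) by simp
  finally show ?thesis by (intro bexI[of _ ?r]) simp_all
qed

text \<open>Having two distinct endomorphisms is the way to say non-zero without zero arrows. The
  faithful \<open>F\<close> sends such an object to a module with a non-zero element, because the
  zero module has only one endomorphism.\<close>

lemma equivalent_to_mod_map: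
  fixes D :: "('o, 'm, 'x) category_scheme"
  assumes D: "category D" and eq: "equivalent_to_mod D"
    and X: "a \<in> Hom D X X" "b \<in> Hom D X X" "a \<noteq> b" and Y: "c \<in> Hom D Y Y" "d \<in> Hom D Y Y" "c \<noteq> d"
  shows "\<exists>f \<in> Hom D X Y. \<exists>g \<in> Hom D X Y. f \<noteq> g"
proof -
  interpret D: category D by fact
  obtain \<Delta> :: "'m ring" where \<Delta>: "division_ring \<Delta>" "equivalent D (mod_category \<Delta>)"
    using eq unfolding equivalent_to_mod_def by blast
  let ?M = "mod_category \<Delta>"
  interpret M: category ?M by (rule mod_category_category)
  obtain F G \<eta> \<epsilon> where F: "is_functor D ?M F" and G: "is_functor ?M D G"
    and n: "nat_iso D D id_functor (comp_functor G F) \<eta>" and e: "nat_iso ?M ?M (comp_functor F G) id_functor \<epsilon>"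
    using \<Delta>(2) unfolding equivalent_def by blast
  have nonzero: "\<exists>z. z \<in> carrier (obmap F Z) \<and> z \<noteq> \<zero>\<^bsub>obmap F Z\<^esub>"
    if p: "p \<in> Hom D Z Z" "q \<in> Hom D Z Z" "p \<noteq> q" for p q Z
  proof (rule ccontr)
    assume none: "\<not> ?thesis"
    let ?Z = "obmap F Z"
    have Z: "Z \<in> Obj D" using D.Hom_Obj[OF p(1)] by simp
    have rm: "right_module \<Delta> ?Z" "finitely_generated \<Delta> ?Z" using functor_Obj[OF F Z] by auto
    have "armap F p \<in> Hom ?M ?Z ?Z" "armap F q \<in> Hom ?M ?Z ?Z"
      using p functor_Arr[OF F, of p] functor_Arr[OF F, of q] by (auto simp: Hom_iff)
    then obtain u v where uv: "armap F p = (?Z, u, ?Z)" "armap F q = (?Z, v, ?Z)"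
      "u \<in> linear_maps \<Delta> ?Z ?Z" "v \<in> linear_maps \<Delta> ?Z ?Z"
      unfolding mod_Hom[OF rm rm] by blast
    have "u = v"
    proof (rule extensionalityI[OF linear_mapsD(2)[OF uv(3)] linear_mapsD(2)[OF uv(4)]])
      fix z assume "z \<in> carrier ?Z"
      then show "u z = v z" using linear_mapsD(1)[OF uv(3), of z] linear_mapsD(1)[OF uv(4), of z] none by metis
    qed
    then have "p = q"
      using uv p by (intro retract_faithful[OF D F G disjI2[OF n]]) (auto simp: Hom_iff)
    then show False using p by simp
  qed
  have XY: "X \<in> Obj D" "Y \<in> Obj D" using D.Hom_Obj[OF X(1)] D.Hom_Obj[OF Y(1)] by auto
  have o: "obmap F X \<in> Obj ?M" "obmap F Y \<in> Obj ?M" using functor_Obj[OF F] XY by auto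
  have r: "right_module \<Delta> (obmap F X)" "finitely_generated \<Delta> (obmap F X)"
    "right_module \<Delta> (obmap F Y)" "finitely_generated \<Delta> (obmap F Y)" using o by auto
  obtain x y where xy: "x \<in> carrier (obmap F X)" "x \<noteq> \<zero>\<^bsub>obmap F X\<^esub>" "y \<in> carrier (obmap F Y)" "y \<noteq> \<zero>\<^bsub>obmap F Y\<^esub>"
    using nonzero[OF X] nonzero[OF Y] by blast
  obtain s t where st: "s \<in> Hom ?M (obmap F X) (obmap F Y)" "t \<in> Hom ?M (obmap F X) (obmap F Y)" "s \<noteq> t"
    using mod_nonzero_map[OF \<Delta>(1) r xy] by blast
  have ne: "armap G s \<noteq> armap G t"
  proof
    assume "armap G s = armap G t"
    then have "s = t" by (intro retract_faithful[OF M.category_axioms G F disjI1[OF e]])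
      (use st in \<open>auto simp: Hom_iff\<close>)
    then show False using st by simp
  qed
  note t = n[unfolded nat_iso_def]
  note tD = nat_transD[OF t[THEN conjunct1], unfolded comp_functor_def id_functor_def, simplified]
  obtain k where k: "k \<in> Arr D" "src D k = tgt D (\<eta> Y)" "tgt D k = src D (\<eta> Y)"
    "k \<cdot>\<^bsub>D\<^esub> \<eta> Y = ident D (src D (\<eta> Y))" "\<eta> Y \<cdot>\<^bsub>D\<^esub> k = ident D (tgt D (\<eta> Y))"
    using t XY by (auto elim: D.iso_arrE)
  obtain h where h: "h \<in> Arr D" "src D h = tgt D (\<eta> X)" "tgt D h = src D (\<eta> X)"
    "h \<cdot>\<^bsub>D\<^esub> \<eta> X = ident D (src D (\<eta> X))" "\<eta> X \<cdot>\<^bsub>D\<^esub> h = ident D (tgt D (\<eta> X))"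
    using t XY by (auto elim: D.iso_arrE)
  note [simp] = k(1-3) h(1-3) tD(1-3) XY
  have [simp]: "armap G s \<in> Arr D" "src D (armap G s) = obmap G (obmap F X)"
    "tgt D (armap G s) = obmap G (obmap F Y)"
    "armap G t \<in> Arr D" "src D (armap G t) = obmap G (obmap F X)" "tgt D (armap G t) = obmap G (obmap F Y)"
    using functor_Arr[OF G, of s] functor_Arr[OF G, of t] st by (auto simp: Hom_iff)
  define w where "w z = k \<cdot>\<^bsub>D\<^esub> (z \<cdot>\<^bsub>D\<^esub> \<eta> X)" for z
  have conj: "\<eta> Y \<cdot>\<^bsub>D\<^esub> (w z \<cdot>\<^bsub>D\<^esub> h) = z"
    if "z \<in> Arr D" "src D z = obmap G (obmap F X)" "tgt D z = obmap G (obmap F Y)" for z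
    using that h(5) D.reassoc[OF k(5), of z] by (simp add: w_def)
  have "w (armap G s) \<noteq> w (armap G t)" using conj[of "armap G s"] conj[of "armap G t"] ne by auto
  moreover have "w (armap G s) \<in> Hom D X Y" "w (armap G t) \<in> Hom D X Y" by (auto simp: w_def Hom_iff)
  ultimately show ?thesis by blast
qed

context abelian_category
begin

lemma perp_split:
  assumes eq: "equivalent_to_mod (full_subcategory C P)" and f: "monic C f" "src C f \<in> P" "tgt C f \<in> P"
  obtains r where "r \<in> Arr C" "src C r = tgt C f" "tgt C r = src C f" "r \<cdot> f = ident C (src C f)"
proof -
  have "monic (full_subcategory C P) f"
    unfolding monic_def using f monic_Arr[OF f(1)] by (auto simp: Hom_iff intro: monicD[OF f(1)])
  then show thesis
    using equivalent_to_mod_split[OF full_subcategory_category[OF category_axioms] eq] that by auto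
qed

text \<open>For a non-zero object the identity and the zero arrow are two distinct endomorphisms,
  and of two distinct maps from \<open>X\<close> to \<open>Y\<close> one is non-zero.\<close>

lemma perp_map:
  assumes eq: "equivalent_to_mod (full_subcategory C P)"
    and XY: "X \<in> P" "Y \<in> P" "X \<in> Obj C" "Y \<in> Obj C" "\<not> zero_obj C X" "\<not> zero_obj C Y"
  obtains f where "f \<in> Arr C" "src C f = X" "tgt C f = Y" "f \<noteq> mzero C X Y"
proof -
  let ?D = "full_subcategory C P"
  have "ident C X \<in> Hom ?D X X" "mzero C X X \<in> Hom ?D X X" "ident C X \<noteq> mzero C X X"
    "ident C Y \<in> Hom ?D Y Y" "mzero C Y Y \<in> Hom ?D Y Y" "ident C Y \<noteq> mzero C Y Y"
    using XY by (auto simp: Hom_iff zero_obj_iff)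
  from equivalent_to_mod_map[OF full_subcategory_category[OF category_axioms] eq this]
  obtain f g where fg: "f \<in> Hom ?D X Y" "g \<in> Hom ?D X Y" "f \<noteq> g" by blast
  then have "f \<noteq> mzero C X Y \<or> g \<noteq> mzero C X Y" by auto
  then show thesis using fg that by (auto simp: Hom_iff)
qed

end

section \<open>Exact functors and Ext\<close>

locale exact_func = C: abelian_category C + D: abelian_category D
  for C :: "('o, 'm, 'x) additive_category_scheme" and D :: "('p, 'n, 'y) additive_category_scheme" +
  fixes F :: "('o, 'm, 'p, 'n) cat_functor"
  assumes exact: "exact_functor C D F"
begin

lemma is_functor: "is_functor C D F"
  using exact by (simp add: exact_functor_def)

lemmas map_Obj [simp] = functor_Obj[OF is_functor]
lemmas map_Arr [simp] = functor_Arr[OF is_functor]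
lemmas map_cmp = functor_cmp[OF is_functor]
lemmas map_ident = functor_ident[OF is_functor]

lemma map_add:
  "\<lbrakk>f \<in> Arr C; g \<in> Arr C; src C f = src C g; tgt C f = tgt C g\<rbrakk>
    \<Longrightarrow> armap F (f \<boxplus>\<^bsub>C\<^esub> g) = armap F f \<boxplus>\<^bsub>D\<^esub> armap F g"
  using exact unfolding exact_functor_def Hom_def by blast

lemma map_zero: 
  assumes "X \<in> Obj C" "Y \<in> Obj C"
  shows "armap F (mzero C X Y) = mzero D (obmap F X) (obmap F Y)"
proof (rule D.madd_right_cancel[of _ "armap F (mzero C X Y)"])
  show "armap F (mzero C X Y) \<boxplus>\<^bsub>D\<^esub> armap F (mzero C X Y) = mzero D (obmap F X) (obmap F Y) \<boxplus>\<^bsub>D\<^esub> armap F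
    (mzero C X Y)"
    using map_add[of "mzero C X Y" "mzero C X Y"] assms by simp
qed (use assms in auto)

lemma map_short_exact: "short_exact C i p \<Longrightarrow> short_exact D (armap F i) (armap F p)"
  using exact by (simp add: exact_functor_def)

lemma map_monic: "monic C f \<Longrightarrow> monic D (armap F f)"
  by (metis C.monic_Arr C.obtain_cokernel C.short_exact_monic D.short_exactD(5) map_short_exact)

lemma map_epic: "epic C f \<Longrightarrow> epic D (armap F f)"
  by (metis C.epic_Arr C.obtain_kernel C.short_exact_epic D.short_exactD(6) map_short_exact)

lemma map_iso: "iso_arr C f \<Longrightarrow> iso_arr D (armap F f)"
  using C.iso_monic C.iso_epic map_monic map_epic D.monic_epic_iso by blast

lemma map_isomorphic: "isomorphic C X Y \<Longrightarrow> isomorphic D (obmap F X) (obmap F Y)"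
  by (metis C.isomorphicE D.isomorphicI map_iso map_Arr)

lemma map_zero_obj: "zero_obj C X \<Longrightarrow> zero_obj D (obmap F X)"
  using C.zero_obj_iff[of X] D.zero_obj_iff[of "obmap F X"] map_ident[of X] map_zero[of X X] by simp

definition map_ext :: "'m \<times> 'm \<Rightarrow> 'n \<times> 'n" where
  "map_ext = map_prod (armap F) (armap F)"

lemma map_ext_extensions: "E \<in> extensions C X Y \<Longrightarrow> map_ext E \<in> extensions D (obmap F X) (obmap F Y)"
  unfolding map_ext_def using map_short_exact C.short_exactD(1,2) by (auto simp: extensions_def)

lemma map_ext_morphism:
  assumes E: "E \<in> extensions C X Y" and E': "E' \<in> extensions C X' Y'"
    and ab: "b \<in> Hom C Y Y'" "a \<in> Hom C X X'" and m: "ext_morphism C E E' b a"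
  shows "ext_morphism D (map_ext E) (map_ext E') (armap F b) (armap F a)"
proof -
  obtain i p where e: "E = (i, p)" "src C i = Y" "tgt C p = X" "i \<in> Arr C" "p \<in> Arr C" "src C p = tgt C i"
    using C.extensionsE[OF E] by metis
  obtain i' p' where e': "E' = (i', p')" "src C i' = Y'" "tgt C p' = X'" "i' \<in> Arr C" "p' \<in> Arr C"
    "src C p' = tgt C i'"
    using C.extensionsE[OF E'] by metis
  obtain g where g: "g \<in> Arr C" "src C g = tgt C i" "tgt C g = tgt C i'" "g \<cdot>\<^bsub>C\<^esub> i = i' \<cdot>\<^bsub>C\<^esub> b"
    "p' \<cdot>\<^bsub>C\<^esub> g = a \<cdot>\<^bsub>C\<^esub> p"
    using m unfolding e(1) e'(1) by (rule C.ext_morphismE)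
  note [simp] = HomD[OF ab(1)] HomD[OF ab(2)] e(2-) e'(2-) g(1-3)
  show ?thesis
    unfolding e(1) e'(1) map_ext_def map_prod_simp
    by (rule D.ext_morphismI[of "armap F g"]) (use g(4,5) in \<open>simp_all flip: map_cmp\<close>)
qed

text \<open>Choosing a representative, instead of taking the image of the class, makes the value a
  whole congruence class of the target category. By \<open>map_Ext_class\<close> the choice does not
  matter.\<close>

definition map_Ext :: "'o \<Rightarrow> 'o \<Rightarrow> ('m \<times> 'm) set \<Rightarrow> ('n \<times> 'n) set" where
  "map_Ext X Y \<xi> = D.ext_class (obmap F X) (obmap F Y) (map_ext (SOME E. E \<in> \<xi>))"

lemma map_Ext_class:
  assumes E: "E \<in> extensions C X Y"
  shows "map_Ext X Y (C.ext_class X Y E) = D.ext_class (obmap F X) (obmap F Y) (map_ext E)"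
proof -
  have O: "X \<in> Obj C" "Y \<in> Obj C" using C.ext_Obj[OF E] by auto
  define E' where "E' = (SOME E'. E' \<in> C.ext_class X Y E)"
  have "E' \<in> C.ext_class X Y E" unfolding E'_def using C.ext_class_self[OF E] by (rule someI)
  then have E': "E' \<in> extensions C X Y" "ext_morphism C E E' (ident C Y) (ident C X)" by
    (auto simp: C.mem_ext_class)
  have "ext_morphism D (map_ext E) (map_ext E') (ident D (obmap F Y)) (ident D (obmap F X))"
    using map_ext_morphism[OF E E'(1) C.ident_Hom C.ident_Hom E'(2)] O map_ident by simp
  then show ?thesis
    unfolding map_Ext_def E'_def[symmetric]
    using D.ext_class_eq_iff[OF map_ext_extensions[OF E] map_ext_extensions[OF E'(1)]] by simp
qed

lemma map_Ext_Ext1: "\<xi> \<in> Ext1 C X Y \<Longrightarrow> map_Ext X Y \<xi> \<in> Ext1 D (obmap F X) (obmap F Y)"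
  by (metis C.Ext1_cases D.ext_class_Ext1 map_Ext_class map_ext_extensions)

lemma map_Hom: "f \<in> Hom C X Y \<Longrightarrow> armap F f \<in> Hom D (obmap F X) (obmap F Y)"
  by (auto simp: Hom_iff)

lemma map_Ext_pullback:
  assumes x: "\<xi> \<in> Ext1 C X Y" and a: "a \<in> Hom C X1 X"
  shows "map_Ext X1 Y (ext_pullback C X1 Y a \<xi>) = ext_pullback D (obmap F X1) (obmap F Y) (armap F a)
    (map_Ext X Y \<xi>)"
proof -
  obtain E where E: "E \<in> extensions C X Y" "\<xi> = C.ext_class X Y E" using C.Ext1_cases[OF x] .
  obtain P where P: "P \<in> extensions C X1 Y" "ext_morphism C P E (ident C Y) a"
    using C.ext_pullback_exists[OF E(1) a] by metis
  have "ext_morphism D (map_ext P) (map_ext E) (ident D (obmap F Y)) (armap F a)"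
    using map_ext_morphism[OF P(1) E(1) C.ident_Hom a P(2)] C.ext_Obj[OF E(1)] map_ident by simp
  then show ?thesis
    using C.ext_pullback_class[OF P(1) E(1) a P(2)] map_Ext_class[OF P(1)] map_Ext_class[OF E(1)] E(2)
      D.ext_pullback_class[OF map_ext_extensions[OF P(1)] map_ext_extensions[OF E(1)] map_Hom[OF a]] by simp
qed

lemma map_Ext_pushout:
  assumes x: "\<xi> \<in> Ext1 C X Y" and b: "b \<in> Hom C Y Y1"
  shows "map_Ext X Y1 (ext_pushout C X Y1 b \<xi>) = ext_pushout D (obmap F X) (obmap F Y1) (armap F b)
    (map_Ext X Y \<xi>)"
proof -
  obtain E where E: "E \<in> extensions C X Y" "\<xi> = C.ext_class X Y E" using C.Ext1_cases[OF x] .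
  obtain P where P: "P \<in> extensions C X Y1" "ext_morphism C E P b (ident C X)"
    using C.ext_pushout_exists[OF E(1) b] by metis
  have "ext_morphism D (map_ext E) (map_ext P) (armap F b) (ident D (obmap F X))"
    using map_ext_morphism[OF E(1) P(1) b C.ident_Hom P(2)] C.ext_Obj[OF E(1)] map_ident by simp
  then show ?thesis
    using C.ext_pushout_class[OF P(1) E(1) b P(2)] map_Ext_class[OF P(1)] map_Ext_class[OF E(1)] E(2)
      D.ext_pushout_class[OF map_ext_extensions[OF P(1)] map_ext_extensions[OF E(1)] map_Hom[OF b]] by simp
qed

text \<open>\<open>F\<close> need not send the chosen biproducts of \<open>C\<close> to those of
  \<open>D\<close>, so the defining diagrams cannot be compared directly. Instead both summands are
  written as pushouts of one extension, and \<open>F\<close> is compatible with pushouts and with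
  sums of arrows.\<close>

lemma map_Ext_baer:
  assumes x: "\<xi> \<in> Ext1 C X Y" and z: "\<zeta> \<in> Ext1 C X Y"
  shows "map_Ext X Y (baer_sum C X Y \<xi> \<zeta>) = baer_sum D (obmap F X) (obmap F Y) (map_Ext X Y \<xi>) (map_Ext X Y \<zeta>)"
proof -
  have [simp]: "X \<in> Obj C" "Y \<in> Obj C" using C.Ext1_Obj[OF x] by auto
  note w = C.ext_pair_props[OF x z]
  have p: "prj1 C Y Y \<in> Hom C (C.bobj Y Y) Y" "prj2 C Y Y \<in> Hom C (C.bobj Y Y) Y"
    and s: "prj1 C Y Y \<boxplus>\<^bsub>C\<^esub> prj2 C Y Y \<in> Hom C (C.bobj Y Y) Y" by (auto simp: Hom_iff)
  show ?thesis
    unfolding C.baer_sum_pushout[OF x z]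
    using map_Ext_pushout[OF w(1) s] D.ext_pushout_add[OF map_Ext_Ext1[OF w(1)] map_Hom[OF p(1)]
      map_Hom[OF p(2)]]
      map_Ext_pushout[OF w(1) p(1)] map_Ext_pushout[OF w(1) p(2)] w(2,3) map_add[of "prj1 C Y Y"
        "prj2 C Y Y"] by simp
qed

end

section \<open>Vanishing second extensions\<close>

context abelian_category
begin

text \<open>The class of the Yoneda product of \<open>0 \<rightarrow> Y \<rightarrow> E\<^sub>1 \<rightarrow> K \<rightarrow> 0\<close> and \<open>0 \<rightarrow> K \<rightarrow> E\<^sub>2 \<rightarrow> X \<rightarrow> 0\<close> vanishes if and only if
  the first extension is the restriction of an extension of \<open>E\<^sub>2\<close> by \<open>Y\<close>. With \<open>b\<close> the composite
  of \<open>E\<^sub>1 \<rightarrow> K \<rightarrow> E\<^sub>2\<close>, this is expressed by a factorisation of \<open>b\<close>.\<close>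

definition unspliced :: "'m \<Rightarrow> 'm \<Rightarrow> bool" where
  "unspliced a b \<longleftrightarrow> (\<exists>m \<in> Arr C. \<exists>q \<in> Arr C. src C m = src C b \<and> tgt C m = src C q \<and> tgt C q = tgt C b \<and>
    short_exact C (m \<cdot> a) q \<and> q \<cdot> m = b)"

lemma unsplicedI:
  "\<lbrakk>m \<in> Arr C; q \<in> Arr C; src C m = src C b; tgt C m = src C q; tgt C q = tgt C b;
    short_exact C (m \<cdot> a) q; q \<cdot> m = b\<rbrakk> \<Longrightarrow> unspliced a b"
  unfolding unspliced_def by blast

lemma extensions2D:
  assumes "(a, b, c) \<in> extensions2 C X Y"
  shows "a \<in> Arr C" "b \<in> Arr C" "c \<in> Arr C" "tgt C a = src C b" "src C c = tgt C b"
    "b \<cdot> a = mzero C (src C a) (tgt C b)" "c \<cdot> b = mzero C (src C b) (tgt C c)" "src C a = Y" "tgt C c = X"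
    "is_kernel C a b" "is_cokernel C c b"
  using assms kernelD[of a b] cokernelD[of c b] unfolding extensions2_def by auto

text \<open>The extension that witnesses the property for \<open>a'\<close> and \<open>b'\<close> is
  pulled back along \<open>f\<close>. Its kernel is still given by \<open>a\<close>, as
  \<open>e\<close> carries \<open>a\<close> to \<open>a'\<close>.\<close>

lemma unspliced_pullback:
  assumes ab: "a \<in> Arr C" "b \<in> Arr C" "tgt C a = src C b" "b \<cdot> a = mzero C (src C a) (tgt C b)"
    and b': "b' \<in> Arr C"
    and e: "e \<in> Arr C" "src C e = src C b" "tgt C e = src C b'"
    and f: "f \<in> Arr C" "src C f = tgt C b" "tgt C f = tgt C b'"
    and eq: "e \<cdot> a = a'" "b' \<cdot> e = f \<cdot> b" and u: "unspliced a' b'"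
  shows "unspliced a b"
proof -
  note [simp] = ab(1-3) b' e f
  obtain m' q' where m': "m' \<in> Arr C" "q' \<in> Arr C" "src C m' = src C b'" "tgt C m' = src C q'"
    "tgt C q' = tgt C b'"
    "short_exact C (m' \<cdot> a') q'" "q' \<cdot> m' = b'" using u unfolding unspliced_def by blast
  note [simp] = m'(1-5)
  obtain r q where pb: "pullback C q' f r q" using ex_pullback[of q' f] by auto
  note [simp] = pullbackD[OF pb]
  have qe: "epic C q" by (rule pullback_epic[OF pb short_exactD(6)[OF m'(6)]])
  obtain m where m: "m \<in> Arr C" "src C m = src C b" "tgt C m = src C q" "r \<cdot> m = m' \<cdot> e" "q \<cdot> m = b"
    by (rule pullback_lift[OF pb, of "m' \<cdot> e" b]) (use eq(2) reassoc[OF m'(7), of e] in auto)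
  note [simp] = m(1-3)
  have ma: "r \<cdot> (m \<cdot> a) = m' \<cdot> a'" using reassoc[OF m(4), of a] eq(1) by simp
  have qma: "q \<cdot> (m \<cdot> a) = mzero C (src C a) (tgt C b)" using reassoc[OF m(5), of a] ab(4) by simp
  have mm: "monic C (m \<cdot> a)"
    by (rule monic_cancel[of r]) (use ma short_exactD(5)[OF m'(6)] in auto)
  have "is_kernel C (m \<cdot> a) q"
  proof (rule kernelI[OF _ _ _ mm])
    fix g assume g: "g \<in> Arr C" "tgt C g = src C q" "q \<cdot> g = mzero C (src C g) (tgt C q)"
    note [simp] = g(1,2)
    have ea: "src C (m' \<cdot> a') = src C a" using eq(1) by auto
    obtain u where u: "u \<in> Arr C" "src C u = src C g" "tgt C u = src C a" "(m' \<cdot> a') \<cdot> u = r \<cdot> g"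
      by (rule short_exact_lift[OF m'(6), of "r \<cdot> g"])
        (use reassoc[OF pullbackD(9)[OF pb], of g] g(3) ea in auto)
    note [simp] = u(1-3)
    have "(m \<cdot> a) \<cdot> u = g"
    proof (rule pullback_eqI[OF pb])
      show "r \<cdot> (m \<cdot> a) \<cdot> u = r \<cdot> g" using reassoc[OF ma, of u] u(4) by simp
      show "q \<cdot> (m \<cdot> a) \<cdot> u = q \<cdot> g" using reassoc[OF qma, of u] g(3) by simp
    qed auto
    then show "\<exists>u \<in> Arr C. src C u = src C g \<and> tgt C u = src C (m \<cdot> a) \<and> (m \<cdot> a) \<cdot> u = g" 
      by (intro bexI[of _ u]) auto
  qed (use qma in auto)
  then have "short_exact C (m \<cdot> a) q" by (rule short_exact_epic[OF qe])
  then show ?thesis using m by (intro unsplicedI[of m q]) simp_all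
qed

text \<open>The property is self-dual although its definition is not visibly so: for a witness
  \<open>m\<close>, \<open>q\<close> the arrow \<open>m\<close> is monic with cokernel
  \<open>c \<cdot> q\<close>, so \<open>m\<close> and \<open>q\<close> exchange their roles in the
  opposite category.\<close>

lemma unspliced_dual_imp:
  assumes E: "(a, b, c) \<in> extensions2 C X Y" and u: "unspliced a b"
  shows "abelian_category.unspliced (op C) c b"
proof -
  note x = extensions2D[OF E]
  note [simp] = x(1-5)
  obtain m q where m: "m \<in> Arr C" "q \<in> Arr C" "src C m = src C b" "tgt C m = src C q" "tgt C q = tgt C b"
    "short_exact C (m \<cdot> a) q" "q \<cdot> m = b" using u unfolding unspliced_def by blast
  note [simp] = m(1-5)
  note q = short_exactD(6)[OF m(6)] and ma = short_exactD(5)[OF m(6)]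
  have mm: "monic C m"
    unfolding monic_iff
  proof (intro conjI ballI impI)
    fix g assume g: "g \<in> Arr C" "tgt C g = src C m" "m \<cdot> g = mzero C (src C g) (tgt C m)"
    note [simp] = g(1,2)
    have "b \<cdot> g = mzero C (src C g) (tgt C b)" using reassoc[OF m(7), of g] g(3) by simp
    then obtain h where h: "h \<in> Arr C" "src C h = src C g" "tgt C h = src C a" "a \<cdot> h = g"
      using kernel_factor[OF x(10), of g] by auto
    note [simp] = h(1-3)
    have "h = mzero C (src C h) (src C (m \<cdot> a))"
      by (rule monic0[OF ma]) (use h g in auto)
    then have "a \<cdot> h = mzero C (src C g) (tgt C a)" by (metis cmp_Arr(2) cmp_zero h(2) m(1) m(3) src_Obj
      g(1) x(1,4))
    then show "g = mzero C (src C g) (src C m)" using h(4) by simp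
  qed simp
  have cqe: "epic C (c \<cdot> q)" by (rule epic_cmp[OF q cokernel_epic[OF x(11)]]) simp
  have "is_cokernel C (c \<cdot> q) m"
  proof (rule cokernelI[OF _ _ _ cqe])
    fix t assume t: "t \<in> Arr C" "src C t = tgt C m" "t \<cdot> m = mzero C (src C m) (tgt C t)"
    note [simp] = t(1,2)
    obtain s where s: "s \<in> Arr C" "src C s = tgt C q" "tgt C s = tgt C t" "s \<cdot> q = t"
      by (rule short_exact_colift[OF m(6), of t]) (use reassoc[OF t(3), of a] in auto)
    note [simp] = s(1-3)
    obtain w where w: "w \<in> Arr C" "src C w = tgt C c" "tgt C w = tgt C s" "w \<cdot> c = s"
      by (rule cokernel_factor[OF x(11), of s]) (use reassoc[OF s(4), of m] t(3) m(7) in auto)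
    show "\<exists>u \<in> Arr C. tgt C u = tgt C t \<and> src C u = tgt C (c \<cdot> q) \<and> u \<cdot> c \<cdot> q = t"
      using w s reassoc[OF w(4), of q] by (intro bexI[of _ w]) auto
  qed (use m(7) x(7) in auto)
  then have "short_exact C m (c \<cdot> q)" by (rule short_exact_monic[OF mm])
  then have "short_exact (op C) (q \<cdot>\<^bsub>op C\<^esub> c) m" by simp
  then show ?thesis
    using m by (intro abelian_category.unsplicedI[OF dual_abelian, of q m]) simp_all
qed

lemma extensions2_op: "(c, b, a) \<in> extensions2 (op C) Y X \<longleftrightarrow> (a, b, c) \<in> extensions2 C X Y"
  by (auto simp: extensions2_def)

lemma unspliced_dual:
  assumes E: "(a, b, c) \<in> extensions2 C X Y"
  shows "abelian_category.unspliced (op C) c b \<longleftrightarrow> unspliced a b"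
  using unspliced_dual_imp[OF E] abelian_category.unspliced_dual_imp[OF dual_abelian, of c b a Y X] E
  by (auto simp: extensions2_op)

text \<open>One direction is a pullback; the other is the same pullback in the opposite category,
  where the step points the other way.\<close>

lemma unspliced_step:
  assumes s: "ext2_step C X Y (a, b, c) (a', b', c')"
  shows "unspliced a b \<longleftrightarrow> unspliced a' b'"
proof -
  obtain e f where E: "(a, b, c) \<in> extensions2 C X Y" and E': "(a', b', c') \<in> extensions2 C X Y"
    and e: "e \<in> Arr C" "src C e = src C b" "tgt C e = src C b'"
    and f: "f \<in> Arr C" "src C f = tgt C b" "tgt C f = tgt C b'"
    and eq: "e \<cdot> a = a'" "b' \<cdot> e = f \<cdot> b" "c' \<cdot> f = c"
    using s unfolding ext2_step_def Hom_def by auto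
  note x = extensions2D[OF E] and x' = extensions2D[OF E']
  show ?thesis
  proof
    assume "unspliced a' b'"
    then show "unspliced a b" by (rule unspliced_pullback[OF x(1,2,4,6) x'(2) e f eq(1,2)])
  next
    assume "unspliced a b"
    then have "abelian_category.unspliced (op C) c b" by (simp add: unspliced_dual[OF E])
    then have "abelian_category.unspliced (op C) c' b'"
      by (intro abelian_category.unspliced_pullback[OF dual_abelian, of c' b' b f e c])
        (use x x' e f eq in auto)
    then show "unspliced a' b'" by (simp add: unspliced_dual[OF E'])
  qed
qed

text \<open>The property holds for the zero sequence and passes along each step of the zigzag that
  connects this sequence to the given one.\<close>

lemma Ext2_zero_unspliced:
  assumes z: "Ext2 C X Y = {ext2_zero C X Y}" and E: "(a, b, c) \<in> extensions2 C X Y"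
  shows "unspliced a b"
proof -
  have O [simp]: "X \<in> Obj C" "Y \<in> Obj C" using extensions2D[OF E] src_Obj tgt_Obj by auto
  have "ext2_cong C X Y `` {(a, b, c)} \<in> Ext2 C X Y"
    unfolding Ext2_def by (rule quotientI[OF E])
  then have "ext2_cong C X Y `` {(a, b, c)} = ext2_zero C X Y" using z by simp
  moreover have "(a, b, c) \<in> ext2_cong C X Y `` {(a, b, c)}" using E by (auto simp: ext2_cong_def)
  ultimately have "equivclp (ext2_step C X Y) (ident C Y, mzero C Y X, ident C X) (a, b, c)"
    unfolding ext2_zero_def ext2_cong_def by auto
  then have "case (a, b, c) of (a, b, c) \<Rightarrow> unspliced a b"
  proof (induction rule: equivclp_induct)
    \<comment> \<open>The witness is the split extension: the middle term is the biproduct of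
      \<open>Y\<close> and \<open>X\<close>, and the zero arrow is the second projection after the
      first injection.\<close>
    case base
    have "unspliced (ident C Y) (mzero C Y X)"
      using split_extension[OF O] by (intro unsplicedI[of "inj1 C Y X" "prj2 C Y X"])
        (auto simp: extensions_def)
    then show ?case by simp
  next
    case (step y z)
    then show ?case by (auto simp: unspliced_step split: prod.splits)
  qed
  then show ?thesis by simp
qed

end

section \<open>Comparison of valuations\<close>

text \<open>Kept apart from \<open>dim_Ext1_left\<close>, since a comparison map may respect only
  one of the two actions, and only the object whose endomorphisms act has to be simple.\<close>

lemma dim_Ext1_right:
  fixes C :: "('o, 'm, 'x) additive_category_scheme" and D :: "('p, 'n, 'y) additive_category_scheme"
  assumes C: "abelian_category C" and D: "abelian_category D" and S: "simple C S" "simple D S'"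
    and T: "T \<in> Obj C" "T' \<in> Obj D"
    and \<alpha>: "bij_betw \<alpha> (Hom C S S) (Hom D S' S')" "\<alpha> (mzero C S S) = mzero D S' S'"
    and \<theta>: "bij_betw \<theta> (Ext1 C S T) (Ext1 D S' T')"
    and add: "\<And>\<xi> \<zeta>. \<lbrakk>\<xi> \<in> Ext1 C S T; \<zeta> \<in> Ext1 C S T\<rbrakk> \<Longrightarrow> \<theta> (baer_sum C S T \<xi> \<zeta>) = baer_sum D S' T' (\<theta> \<xi>) (\<theta> \<zeta>)"
    and smult: "\<And>r \<xi>. \<lbrakk>r \<in> Hom C S S; \<xi> \<in> Ext1 C S T\<rbrakk> \<Longrightarrow>
      \<theta> (ext_pullback C S T r \<xi>) = ext_pullback D S' T' (\<alpha> r) (\<theta> \<xi>)"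
  shows "(dim (End_ring C S) (Ext1_right C S T), dim (End_ring D S') (Ext1_right D S' T')) \<in> ordIso"
proof -
  interpret C: abelian_category C by (rule C)
  interpret D: abelian_category D by (rule D)
  note O = C.simpleD(1)[OF S(1)] D.simpleD(1)[OF S(2)]
  interpret M: r_module "End_ring C S" "Ext1_right C S T"
    by (rule r_module.intro) (rule C.Ext1_right_module[OF O(1) T(1)])
  interpret N: r_module "End_ring D S'" "Ext1_right D S' T'"
    by (rule r_module.intro) (rule D.Ext1_right_module[OF O(2) T(2)])
  interpret semilinear_iso "End_ring C S" "Ext1_right C S T" "End_ring D S'" "Ext1_right D S' T'" \<alpha> \<theta>
    by unfold_locales (use \<alpha> \<theta> add smult in \<open>auto simp: End_ring_def Ext1_right_def\<close>)
  show ?thesis by (rule dim_eq[OF C.End_division_ring[OF S(1)] D.End_division_ring[OF S(2)]])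
qed

lemma dim_Ext1_left:
  fixes C :: "('o, 'm, 'x) additive_category_scheme" and D :: "('p, 'n, 'y) additive_category_scheme"
  assumes C: "abelian_category C" and D: "abelian_category D" and T: "simple C T" "simple D T'"
    and S: "S \<in> Obj C" "S' \<in> Obj D"
    and \<beta>: "bij_betw \<beta> (Hom C T T) (Hom D T' T')" "\<beta> (mzero C T T) = mzero D T' T'"
    and \<theta>: "bij_betw \<theta> (Ext1 C S T) (Ext1 D S' T')"
    and add: "\<And>\<xi> \<zeta>. \<lbrakk>\<xi> \<in> Ext1 C S T; \<zeta> \<in> Ext1 C S T\<rbrakk> \<Longrightarrow> \<theta> (baer_sum C S T \<xi> \<zeta>) = baer_sum D S' T' (\<theta> \<xi>) (\<theta> \<zeta>)"
    and smult: "\<And>r \<xi>. \<lbrakk>r \<in> Hom C T T; \<xi> \<in> Ext1 C S T\<rbrakk> \<Longrightarrow>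
      \<theta> (ext_pushout C S T r \<xi>) = ext_pushout D S' T' (\<beta> r) (\<theta> \<xi>)"
  shows "(dim (opposite_ring (End_ring C T)) (Ext1_left C S T),
    dim (opposite_ring (End_ring D T')) (Ext1_left D S' T')) \<in> ordIso"
proof -
  interpret C: abelian_category C by (rule C)
  interpret D: abelian_category D by (rule D)
  note O = C.simpleD(1)[OF T(1)] D.simpleD(1)[OF T(2)]
  interpret M: r_module "opposite_ring (End_ring C T)" "Ext1_left C S T"
    by (rule r_module.intro) (rule C.Ext1_left_module[OF S(1) O(1)])
  interpret N: r_module "opposite_ring (End_ring D T')" "Ext1_left D S' T'"
    by (rule r_module.intro) (rule D.Ext1_left_module[OF S(2) O(2)])
  interpret semilinear_iso "opposite_ring (End_ring C T)" "Ext1_left C S T"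
    "opposite_ring (End_ring D T')" "Ext1_left D S' T'" \<beta> \<theta>
    by unfold_locales (use \<beta> \<theta> add smult in \<open>auto simp: End_ring_def opposite_ring_def Ext1_left_def\<close>)
  show ?thesis by (rule dim_eq[OF C.opposite_End_division_ring[OF T(1)] D.opposite_End_division_ring[OF T(2)]])
qed

lemma same_valuationI:
  assumes "(dim (End_ring C S) (Ext1_right C S T), dim (End_ring D S') (Ext1_right D S' T')) \<in> ordIso"
    and "(dim (opposite_ring (End_ring C T)) (Ext1_left C S T),
      dim (opposite_ring (End_ring D T')) (Ext1_left D S' T')) \<in> ordIso"
  shows "same_valuation (valuation C S T) (valuation D S' T')"
  using assms by (simp add: same_valuation_def valuation_def)

lemma same_valuation_trans:
  "\<lbrakk>same_valuation u v; same_valuation v w\<rbrakk> \<Longrightarrow> same_valuation u w"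
  unfolding same_valuation_def using ordIso_transitive by (auto split: prod.splits)

lemma same_valuation_sym: "same_valuation u v \<Longrightarrow> same_valuation v u"
  unfolding same_valuation_def using ordIso_symmetric by (auto split: prod.splits)

context abelian_category
begin

lemma pushout_iso_bij:
  assumes k: "iso_arr C k" "src C k = T" "tgt C k = T'"
  shows "bij_betw (ext_pushout C S T' k) (Ext1 C S T) (Ext1 C S T')"
proof -
  obtain l where l: "k \<in> Arr C" "l \<in> Arr C" "src C l = T'" "tgt C l = T" "l \<cdot> k = ident C T"
    "k \<cdot> l = ident C T'"
    using k by (auto elim: iso_arrE)
  have h: "k \<in> Hom C T T'" "l \<in> Hom C T' T" using l k by (auto simp: Hom_iff)
  show ?thesis
    by (rule bij_betw_byWitness[where f' = "ext_pushout C S T l"])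
      (use l h ext_pushout_Ext1 in \<open>auto simp: ext_pushout_cmp ext_pushout_ident\<close>)
qed

lemma pullback_iso_bij:
  assumes k: "iso_arr C k" "src C k = S'" "tgt C k = S"
  shows "bij_betw (ext_pullback C S' T k) (Ext1 C S T) (Ext1 C S' T)"
proof -
  obtain l where l: "k \<in> Arr C" "l \<in> Arr C" "src C l = S" "tgt C l = S'" "l \<cdot> k = ident C S'"
    "k \<cdot> l = ident C S"
    using k by (auto elim: iso_arrE)
  have h: "k \<in> Hom C S' S" "l \<in> Hom C S S'" using l k by (auto simp: Hom_iff)
  show ?thesis
    by (rule bij_betw_byWitness[where f' = "ext_pullback C S T l"])
      (use l h ext_pullback_Ext1 in \<open>auto simp: ext_pullback_cmp ext_pullback_ident\<close>)
qed

text \<open>Over \<open>End_ring C T\<close> pulling back along the isomorphism is linear; over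
  \<open>End_ring C S\<close> it is semilinear with respect to conjugation by the
  isomorphism.\<close>

lemma valuation_iso_left:
  assumes S: "simple C S" "isomorphic C S S'" and T: "simple C T"
  shows "same_valuation (valuation C S T) (valuation C S' T)"
proof -
  have S': "simple C S'" by (rule simple_iso[OF S])
  note O [simp] = simpleD(1)[OF S(1)] simpleD(1)[OF S'] simpleD(1)[OF T]
  obtain k where "iso_arr C k" "k \<in> Arr C" "src C k = S'" "tgt C k = S"
    using isomorphic_sym[OF S(2)] by (rule isomorphicE)
  note k = this
  obtain l where l: "l \<in> Arr C" "src C l = S" "tgt C l = S'" "l \<cdot> k = ident C S'" "k \<cdot> l = ident C S"
    using k by (auto elim: iso_arrE)
  have h: "k \<in> Hom C S' S" "l \<in> Hom C S S'" using l k by (auto simp: Hom_iff)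
  note [simp] = k(2-4) l(1-3) reassoc[OF l(4)] reassoc[OF l(5)]
  note bij = pullback_iso_bij[OF k(1,3,4)]
  have abel: "abelian_category C" by unfold_locales
  show ?thesis
  proof (rule same_valuationI)
    show "(dim (End_ring C S) (Ext1_right C S T), dim (End_ring C S') (Ext1_right C S' T)) \<in> ordIso"
    proof (rule dim_Ext1_right[OF abel abel S(1) S' O(3) O(3) _ _ bij])
      show "bij_betw (\<lambda>r. l \<cdot> (r \<cdot> k)) (Hom C S S) (Hom C S' S')"
        by (rule bij_betw_byWitness[where f' = "\<lambda>r. k \<cdot> (r \<cdot> l)"]) (auto simp: Hom_iff l(4,5))
      fix r \<xi> assume r: "r \<in> Hom C S S" and x: "\<xi> \<in> Ext1 C S T"
      have lrk: "l \<cdot> (r \<cdot> k) \<in> Hom C S' S'" using r by (auto simp: Hom_iff)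
      show "ext_pullback C S' T k (ext_pullback C S T r \<xi>) = ext_pullback C S' T (l \<cdot> (r \<cdot> k))
        (ext_pullback C S' T k \<xi>)"
        unfolding ext_pullback_cmp[OF x r h(1)] ext_pullback_cmp[OF x h(1) lrk] using r by (simp add: Hom_iff)
    qed (use ext_pullback_baer h in auto)
    show "(dim (opposite_ring (End_ring C T)) (Ext1_left C S T), dim (opposite_ring (End_ring C T))
      (Ext1_left C S' T)) \<in> ordIso"
      by (rule dim_Ext1_left[OF abel abel T T O(1) O(2) _ _ bij, where \<beta> = "\<lambda>r. r"])
        (use ext_pullback_baer h ext_pushout_pullback bij_betw_id[unfolded id_def] in auto)
  qed
qed

lemma valuation_iso_right:
  assumes S: "simple C S" and T: "simple C T" "isomorphic C T T'"
  shows "same_valuation (valuation C S T) (valuation C S T')"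
proof -
  have T': "simple C T'" by (rule simple_iso[OF T])
  note O [simp] = simpleD(1)[OF S] simpleD(1)[OF T(1)] simpleD(1)[OF T']
  obtain k where k: "iso_arr C k" "k \<in> Arr C" "src C k = T" "tgt C k = T'"
    using T(2) by (rule isomorphicE)
  obtain l where l: "l \<in> Arr C" "src C l = T'" "tgt C l = T" "l \<cdot> k = ident C T" "k \<cdot> l = ident C T'"
    using k by (auto elim: iso_arrE)
  have h: "k \<in> Hom C T T'" "l \<in> Hom C T' T" using l k by (auto simp: Hom_iff)
  note [simp] = k(2-4) l(1-3) reassoc[OF l(4)] reassoc[OF l(5)]
  note bij = pushout_iso_bij[OF k(1,3,4)]
  have abel: "abelian_category C" by unfold_locales
  show ?thesis
  proof (rule same_valuationI)
    show "(dim (End_ring C S) (Ext1_right C S T), dim (End_ring C S) (Ext1_right C S T')) \<in> ordIso"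
      by (rule dim_Ext1_right[OF abel abel S S O(2) O(3) _ _ bij, where \<alpha> = "\<lambda>r. r"])
        (use ext_pushout_baer h ext_pushout_pullback bij_betw_id[unfolded id_def] in auto)
    show "(dim (opposite_ring (End_ring C T)) (Ext1_left C S T), dim (opposite_ring (End_ring C T'))
      (Ext1_left C S T')) \<in> ordIso"
    proof (rule dim_Ext1_left[OF abel abel T(1) T' O(1) O(1) _ _ bij])
      show "bij_betw (\<lambda>r. k \<cdot> (r \<cdot> l)) (Hom C T T) (Hom C T' T')"
        by (rule bij_betw_byWitness[where f' = "\<lambda>r. l \<cdot> (r \<cdot> k)"]) (auto simp: Hom_iff l(4,5))
      fix r \<xi> assume r: "r \<in> Hom C T T" and x: "\<xi> \<in> Ext1 C S T"
      have krl: "k \<cdot> (r \<cdot> l) \<in> Hom C T' T'" using r by (auto simp: Hom_iff)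
      show "ext_pushout C S T' k (ext_pushout C S T r \<xi>) = ext_pushout C S T' (k \<cdot> (r \<cdot> l)) (ext_pushout C
        S T' k \<xi>)"
        unfolding ext_pushout_cmp[OF x r h(1)] ext_pushout_cmp[OF x h(1) krl] using r by
          (simp add: Hom_iff l(4))
    qed (use ext_pushout_baer h in auto)
  qed
qed

end

section \<open>Exact adjoint pairs\<close>

text \<open>Unit and counit, which \<open>adjoint\<close> only asserts to exist, are fixed here
  because the comparison maps on Ext are defined from them.\<close>

locale adjunction = C: category C + D: category D
  for C :: "('o, 'm, 'x) category_scheme" and D :: "('p, 'n, 'y) category_scheme" +
  fixes F :: "('o, 'm, 'p, 'n) cat_functor" and G :: "('p, 'n, 'o, 'm) cat_functor"
    and \<eta> :: "'o \<Rightarrow> 'm" and \<epsilon> :: "'p \<Rightarrow> 'n"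
  assumes functors: "is_functor C D F" "is_functor D C G"
    and unit: "nat_trans C C id_functor (comp_functor G F) \<eta>"
    and counit: "nat_trans D D (comp_functor F G) id_functor \<epsilon>"
    and triangle1: "X \<in> Obj C \<Longrightarrow> \<epsilon> (obmap F X) \<cdot>\<^bsub>D\<^esub> armap F (\<eta> X) = ident D (obmap F X)"
    and triangle2: "Y \<in> Obj D \<Longrightarrow> armap G (\<epsilon> Y) \<cdot>\<^bsub>C\<^esub> \<eta> (obmap G Y) = ident C (obmap G Y)"
begin

lemmas unitD = nat_transD[OF unit, unfolded comp_functor_def id_functor_def, simplified]
lemmas counitD = nat_transD[OF counit, unfolded comp_functor_def id_functor_def, simplified]
lemmas [simp] = unitD(1-3) counitD(1-3) functor_Arr[OF functors(1)] functor_Arr[OF functors(2)]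
  functor_Obj[OF functors(1)] functor_Obj[OF functors(2)]

lemma unit_Hom: "X \<in> Obj C \<Longrightarrow> \<eta> X \<in> Hom C X (obmap G (obmap F X))"
  by (simp add: Hom_iff)

lemma counit_Hom: "Y \<in> Obj D \<Longrightarrow> \<epsilon> Y \<in> Hom D (obmap F (obmap G Y)) Y"
  by (simp add: Hom_iff)

lemma transpose_left:
  assumes "g \<in> Arr D" "src D g = obmap F X" "tgt D g = Y" "X \<in> Obj C"
  shows "\<epsilon> Y \<cdot>\<^bsub>D\<^esub> armap F (armap G g \<cdot>\<^bsub>C\<^esub> \<eta> X) = g"
proof -
  have [simp]: "Y \<in> Obj D" using assms by auto
  have "\<epsilon> Y \<cdot>\<^bsub>D\<^esub> armap F (armap G g \<cdot>\<^bsub>C\<^esub> \<eta> X) = (\<epsilon> Y \<cdot>\<^bsub>D\<^esub> armap F (armap G g)) \<cdot>\<^bsub>D\<^esub> armap F (\<eta> X)"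
    using assms functor_cmp[OF functors(1), of "\<eta> X" "armap G g"] by simp
  also have "\<epsilon> Y \<cdot>\<^bsub>D\<^esub> armap F (armap G g) = g \<cdot>\<^bsub>D\<^esub> \<epsilon> (obmap F X)" using counitD(4)[of g] assms by simp
  also have "(g \<cdot>\<^bsub>D\<^esub> \<epsilon> (obmap F X)) \<cdot>\<^bsub>D\<^esub> armap F (\<eta> X) = g \<cdot>\<^bsub>D\<^esub> (\<epsilon> (obmap F X) \<cdot>\<^bsub>D\<^esub> armap F (\<eta> X))"
    using assms by simp
  also have "\<dots> = g" unfolding triangle1[OF assms(4)] using assms by simp
  finally show ?thesis .
qed

lemma transpose_right:
  assumes "f \<in> Arr C" "src C f = X" "tgt C f = obmap G Y" "Y \<in> Obj D"
  shows "armap G (\<epsilon> Y \<cdot>\<^bsub>D\<^esub> armap F f) \<cdot>\<^bsub>C\<^esub> \<eta> X = f"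
proof -
  have [simp]: "X \<in> Obj C" using assms by auto
  have "armap G (\<epsilon> Y \<cdot>\<^bsub>D\<^esub> armap F f) \<cdot>\<^bsub>C\<^esub> \<eta> X = armap G (\<epsilon> Y) \<cdot>\<^bsub>C\<^esub> (armap G (armap F f) \<cdot>\<^bsub>C\<^esub> \<eta> X)"
    using assms functor_cmp[OF functors(2), of "armap F f" "\<epsilon> Y"] by simp
  also have "armap G (armap F f) \<cdot>\<^bsub>C\<^esub> \<eta> X = \<eta> (obmap G Y) \<cdot>\<^bsub>C\<^esub> f" using unitD(4)[of f] assms by simp
  also have "armap G (\<epsilon> Y) \<cdot>\<^bsub>C\<^esub> (\<eta> (obmap G Y) \<cdot>\<^bsub>C\<^esub> f) = f"
    using C.reassoc[OF triangle2[OF assms(4)], of f] assms by simp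
  finally show ?thesis .
qed

lemma unit_cancel:
  assumes "armap G g \<cdot>\<^bsub>C\<^esub> \<eta> X = armap G g' \<cdot>\<^bsub>C\<^esub> \<eta> X" "X \<in> Obj C" "g \<in> Arr D" "src D g = obmap F X"
    "g' \<in> Arr D" "src D g' = obmap F X" "tgt D g = tgt D g'"
  shows "g = g'"
  using transpose_left[of g X] transpose_left[of g' X] assms by metis

lemma counit_cancel:
  assumes "\<epsilon> Y \<cdot>\<^bsub>D\<^esub> armap F f = \<epsilon> Y \<cdot>\<^bsub>D\<^esub> armap F f'" "Y \<in> Obj D" "f \<in> Arr C" "tgt C f = obmap G Y"
    "f' \<in> Arr C" "tgt C f' = obmap G Y" "src C f = src C f'"
  shows "f = f'"
  using transpose_right[of f _ Y] transpose_right[of f' _ Y] assms by metis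

end

lemma adjoint_adjunction:
  assumes "category C" "category D" "adjoint C D F G"
  obtains \<eta> \<epsilon> where "adjunction C D F G \<eta> \<epsilon>"
  using assms unfolding adjoint_def adjunction_def adjunction_axioms_def by blast

text \<open>An expansion provides some exact left adjoint, while the theorem speaks of an arbitrary
  one; this carries the statements from the former to the latter.\<close>

lemma left_adjoint_unique:
  assumes C: "category C" and D: "category D" and F: "adjoint C D F G" and F': "adjoint C D F' G" and X:
    "X \<in> Obj C"
  shows "isomorphic D (obmap F X) (obmap F' X)"
proof -
  obtain \<eta> \<epsilon> where "adjunction C D F G \<eta> \<epsilon>" using adjoint_adjunction[OF C D F] .
  then interpret adjunction C D F G \<eta> \<epsilon> .
  obtain \<eta>' \<epsilon>' where "adjunction C D F' G \<eta>' \<epsilon>'" using adjoint_adjunction[OF C D F'] .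
  then interpret A': adjunction C D F' G \<eta>' \<epsilon>' .
  note [simp] = X
  define u where "u = \<epsilon> (obmap F' X) \<cdot>\<^bsub>D\<^esub> armap F (\<eta>' X)"
  define v where "v = \<epsilon>' (obmap F X) \<cdot>\<^bsub>D\<^esub> armap F' (\<eta> X)"
  have [simp]: "u \<in> Arr D" "src D u = obmap F X" "tgt D u = obmap F' X"
    "v \<in> Arr D" "src D v = obmap F' X" "tgt D v = obmap F X" by (auto simp: u_def v_def)
  have u: "armap G u \<cdot>\<^bsub>C\<^esub> \<eta> X = \<eta>' X" unfolding u_def by (rule transpose_right) auto
  have v: "armap G v \<cdot>\<^bsub>C\<^esub> \<eta>' X = \<eta> X" unfolding v_def by (rule A'.transpose_right) auto
  have "v \<cdot>\<^bsub>D\<^esub> u = ident D (obmap F X)"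
    by (rule unit_cancel[of _ X]) (simp_all add: functor_cmp[OF functors(2)] functor_ident[OF functors(2)] u v)
  moreover have "u \<cdot>\<^bsub>D\<^esub> v = ident D (obmap F' X)"
    by (rule A'.unit_cancel[of _ X]) (simp_all add: functor_cmp[OF functors(2)] functor_ident[OF
      functors(2)] u v)
  ultimately have "iso_arr D u" by (intro D.iso_arrI[of u v]) auto
  then show ?thesis by (rule D.isomorphicI) auto
qed

locale exact_adjunction = F: exact_func C D F + G: exact_func D C G + adjunction C D F G \<eta> \<epsilon>
  for C :: "('o, 'm, 'x) additive_category_scheme" and D :: "('p, 'n, 'y) additive_category_scheme"
    and F :: "('o, 'm, 'p, 'n) cat_functor" and G :: "('p, 'n, 'o, 'm) cat_functor"
    and \<eta> :: "'o \<Rightarrow> 'm" and \<epsilon> :: "'p \<Rightarrow> 'n"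
begin

text \<open>The transpose of an adjunction one degree higher: \<open>G\<close> is applied to the
  extension in place of an arrow. Its inverse is \<open>psi\<close>.\<close>

definition phi :: "'o \<Rightarrow> 'p \<Rightarrow> ('n \<times> 'n) set \<Rightarrow> ('m \<times> 'm) set" where
  "phi X Y \<xi> = ext_pullback C X (obmap G Y) (\<eta> X) (G.map_Ext (obmap F X) Y \<xi>)"

definition psi :: "'o \<Rightarrow> 'p \<Rightarrow> ('m \<times> 'm) set \<Rightarrow> ('n \<times> 'n) set" where
  "psi X Y \<zeta> = ext_pushout D (obmap F X) Y (\<epsilon> Y) (F.map_Ext X (obmap G Y) \<zeta>)"

lemma phi_Ext1: "\<lbrakk>\<xi> \<in> Ext1 D (obmap F X) Y; X \<in> Obj C\<rbrakk> \<Longrightarrow> phi X Y \<xi> \<in> Ext1 C X (obmap G Y)"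
  unfolding phi_def by (rule F.C.ext_pullback_Ext1[OF G.map_Ext_Ext1 unit_Hom])

lemma psi_Ext1: "\<lbrakk>\<zeta> \<in> Ext1 C X (obmap G Y); Y \<in> Obj D\<rbrakk> \<Longrightarrow> psi X Y \<zeta> \<in> Ext1 D (obmap F X) Y"
  unfolding psi_def by (rule F.D.ext_pushout_Ext1[OF F.map_Ext_Ext1 counit_Hom])

text \<open>The counit at the middle term is a morphism from the image of an extension under both
  functors to the extension itself. This is naturality of the counit on Ext.\<close>

lemma counit_Ext:
  assumes x: "\<xi> \<in> Ext1 D Z Y"
  shows "ext_pushout D (obmap F (obmap G Z)) Y (\<epsilon> Y) (F.map_Ext (obmap G Z) (obmap G Y) (G.map_Ext Z Y \<xi>))
    = ext_pullback D (obmap F (obmap G Z)) Y (\<epsilon> Z) \<xi>"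
proof -
  obtain i p where E: "(i, p) \<in> extensions D Z Y" "\<xi> = F.D.ext_class Z Y (i, p)"
    using F.D.Ext1_cases[OF x] by (metis surj_pair)
  note O = F.D.ext_Obj[OF E(1)]
  have e: "src D i = Y" "tgt D p = Z" "i \<in> Arr D" "p \<in> Arr D" "src D p = tgt D i"
    using F.D.extensionsE[OF E(1)] by auto
  have "ext_morphism D (F.map_ext (G.map_ext (i, p))) (i, p) (\<epsilon> Y) (\<epsilon> Z)"
    unfolding F.map_ext_def G.map_ext_def map_prod_simp
    by (rule F.D.ext_morphismI[of "\<epsilon> (tgt D i)"]) (use e counitD(4)[of i] counitD(4)[of p] in auto)
  then show ?thesis
    using F.D.pushout_eq_pullback_iff[OF F.map_ext_extensions[OF G.map_ext_extensions[OF E(1)]] E(1)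
      counit_Hom[OF O(2)] counit_Hom[OF O(1)]]
      F.map_Ext_class[OF G.map_ext_extensions[OF E(1)]] G.map_Ext_class[OF E(1)] E(2) by simp
qed

lemma unit_Ext:
  assumes x: "\<zeta> \<in> Ext1 C X W"
  shows "ext_pushout C X (obmap G (obmap F W)) (\<eta> W) \<zeta>
    = ext_pullback C X (obmap G (obmap F W)) (\<eta> X) (G.map_Ext (obmap F X) (obmap F W) (F.map_Ext X W \<zeta>))"
proof -
  obtain i p where E: "(i, p) \<in> extensions C X W" "\<zeta> = F.C.ext_class X W (i, p)"
    using F.C.Ext1_cases[OF x] by (metis surj_pair)
  note O = F.C.ext_Obj[OF E(1)]
  have e: "src C i = W" "tgt C p = X" "i \<in> Arr C" "p \<in> Arr C" "src C p = tgt C i"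
    using F.C.extensionsE[OF E(1)] by auto
  have "ext_morphism C (i, p) (G.map_ext (F.map_ext (i, p))) (\<eta> W) (\<eta> X)"
    unfolding F.map_ext_def G.map_ext_def map_prod_simp
    by (rule F.C.ext_morphismI[of "\<eta> (tgt C i)"]) (use e unitD(4)[of i] unitD(4)[of p] in auto)
  then show ?thesis
    using F.C.pushout_eq_pullback_iff[OF E(1) G.map_ext_extensions[OF F.map_ext_extensions[OF E(1)]]
      unit_Hom[OF O(2)] unit_Hom[OF O(1)]]
      G.map_Ext_class[OF F.map_ext_extensions[OF E(1)]] F.map_Ext_class[OF E(1)] E(2) by simp
qed

text \<open>Naturality of the counit on Ext turns the composite into the pullback along the two
  sides of the first triangle identity. The other composite uses the unit and the second triangle
  identity.\<close>

lemma psi_phi: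
  assumes x: "\<xi> \<in> Ext1 D (obmap F X) Y" and X: "X \<in> Obj C"
  shows "psi X Y (phi X Y \<xi>) = \<xi>"
proof -
  have Y: "Y \<in> Obj D" using F.D.Ext1_Obj[OF x] by simp
  note g = G.map_Ext_Ext1[OF x]
  have "psi X Y (phi X Y \<xi>) = ext_pushout D (obmap F X) Y (\<epsilon> Y)
    (ext_pullback D (obmap F X) (obmap F (obmap G Y)) (armap F (\<eta> X)) (F.map_Ext (obmap G (obmap F X))
      (obmap G Y) (G.map_Ext (obmap F X) Y \<xi>)))"
    unfolding psi_def phi_def F.map_Ext_pullback[OF g unit_Hom[OF X]] ..
  also have "\<dots> = ext_pullback D (obmap F X) Y (armap F (\<eta> X))
    (ext_pullback D (obmap F (obmap G (obmap F X))) Y (\<epsilon> (obmap F X)) \<xi>)"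
    unfolding F.D.ext_pushout_pullback[OF F.map_Ext_Ext1[OF g] F.map_Hom[OF unit_Hom[OF X]] counit_Hom[OF Y]]
      counit_Ext[OF x] ..
  also have "\<dots> = \<xi>"
    unfolding F.D.ext_pullback_cmp[OF x counit_Hom[OF F.map_Obj[OF X]] F.map_Hom[OF unit_Hom[OF X]]]
      triangle1[OF X]
    by (rule F.D.ext_pullback_ident[OF x])
  finally show ?thesis .
qed

lemma phi_psi:
  assumes x: "\<zeta> \<in> Ext1 C X (obmap G Y)" and Y: "Y \<in> Obj D"
  shows "phi X Y (psi X Y \<zeta>) = \<zeta>"
proof -
  have X: "X \<in> Obj C" using F.C.Ext1_Obj[OF x] by simp
  note g = F.map_Ext_Ext1[OF x]
  have "phi X Y (psi X Y \<zeta>) = ext_pullback C X (obmap G Y) (\<eta> X)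
    (ext_pushout C (obmap G (obmap F X)) (obmap G Y) (armap G (\<epsilon> Y)) (G.map_Ext (obmap F X) (obmap F
      (obmap G Y)) (F.map_Ext X (obmap G Y) \<zeta>)))"
    unfolding psi_def phi_def G.map_Ext_pushout[OF g counit_Hom[OF Y]] ..
  also have "\<dots> = ext_pushout C X (obmap G Y) (armap G (\<epsilon> Y))
    (ext_pushout C X (obmap G (obmap F (obmap G Y))) (\<eta> (obmap G Y)) \<zeta>)"
    unfolding F.C.ext_pushout_pullback[OF G.map_Ext_Ext1[OF g] unit_Hom[OF X] G.map_Hom[OF counit_Hom[OF
      Y]], symmetric]
      unit_Ext[OF x] ..
  also have "\<dots> = \<zeta>"
    unfolding F.C.ext_pushout_cmp[OF x unit_Hom[OF G.map_Obj[OF Y]] G.map_Hom[OF counit_Hom[OF Y]]]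
      triangle2[OF Y]
    by (rule F.C.ext_pushout_ident[OF x])
  finally show ?thesis .
qed

lemma phi_bij:
  assumes "X \<in> Obj C" "Y \<in> Obj D"
  shows "bij_betw (phi X Y) (Ext1 D (obmap F X) Y) (Ext1 C X (obmap G Y))"
  by (rule bij_betw_byWitness[where f' = "psi X Y"]) (use assms phi_psi psi_phi phi_Ext1 psi_Ext1 in auto)

lemma psi_bij:
  assumes "X \<in> Obj C" "Y \<in> Obj D"
  shows "bij_betw (psi X Y) (Ext1 C X (obmap G Y)) (Ext1 D (obmap F X) Y)"
  by (rule bij_betw_byWitness[where f' = "phi X Y"]) (use assms phi_psi psi_phi phi_Ext1 psi_Ext1 in auto)

lemma phi_baer:
  assumes "\<xi> \<in> Ext1 D (obmap F X) Y" "\<zeta> \<in> Ext1 D (obmap F X) Y" and X: "X \<in> Obj C"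
  shows "phi X Y (baer_sum D (obmap F X) Y \<xi> \<zeta>) = baer_sum C X (obmap G Y) (phi X Y \<xi>) (phi X Y \<zeta>)"
  unfolding phi_def G.map_Ext_baer[OF assms(1,2)]
  by (rule F.C.ext_pullback_baer[OF G.map_Ext_Ext1[OF assms(1)] G.map_Ext_Ext1[OF assms(2)] unit_Hom[OF X]])

lemma psi_baer:
  assumes "\<xi> \<in> Ext1 C X (obmap G Y)" "\<zeta> \<in> Ext1 C X (obmap G Y)" and Y: "Y \<in> Obj D"
  shows "psi X Y (baer_sum C X (obmap G Y) \<xi> \<zeta>) = baer_sum D (obmap F X) Y (psi X Y \<xi>) (psi X Y \<zeta>)"
  unfolding psi_def F.map_Ext_baer[OF assms(1,2)]
  by (rule F.D.ext_pushout_baer[OF F.map_Ext_Ext1[OF assms(1)] F.map_Ext_Ext1[OF assms(2)] counit_Hom[OF Y]])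

lemma phi_pushout:
  assumes x: "\<xi> \<in> Ext1 D (obmap F X) Y" and X: "X \<in> Obj C" and b: "b \<in> Hom D Y Y'"
  shows "phi X Y' (ext_pushout D (obmap F X) Y' b \<xi>) = ext_pushout C X (obmap G Y') (armap G b) (phi X Y \<xi>)"
  unfolding phi_def G.map_Ext_pushout[OF x b]
  by (rule F.C.ext_pushout_pullback[OF G.map_Ext_Ext1[OF x] unit_Hom[OF X] G.map_Hom[OF b], symmetric])

lemma psi_pullback:
  assumes x: "\<zeta> \<in> Ext1 C X (obmap G Y)" and Y: "Y \<in> Obj D" and a: "a \<in> Hom C X' X"
  shows "psi X' Y (ext_pullback C X' (obmap G Y) a \<zeta>) = ext_pullback D (obmap F X') Y (armap F a) (psi X Y \<zeta>)"
  unfolding psi_def F.map_Ext_pullback[OF x a]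
  by (rule F.D.ext_pushout_pullback[OF F.map_Ext_Ext1[OF x] F.map_Hom[OF a] counit_Hom[OF Y]])

text \<open>\<open>phi\<close> is natural in \<open>Y\<close>, so it respects the scalars of
  \<open>Y\<close> once \<open>G\<close> is bijective on them, and \<open>X\<close> may be any
  object. The scalars of \<open>X\<close> are handled by \<open>psi\<close> and \<open>F\<close>.
  The separation matters where the object on one side is not simple.\<close>

lemma dim_left_adjunction:
  assumes Y: "simple D Y" "simple C (obmap G Y)" and X: "X \<in> Obj C"
    and bij: "bij_betw (armap G) (Hom D Y Y) (Hom C (obmap G Y) (obmap G Y))"
  shows "(dim (opposite_ring (End_ring D Y)) (Ext1_left D (obmap F X) Y),
    dim (opposite_ring (End_ring C (obmap G Y))) (Ext1_left C X (obmap G Y))) \<in> ordIso"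
proof (rule dim_Ext1_left[OF F.D.abelian_category_axioms F.C.abelian_category_axioms Y F.map_Obj[OF X] X bij])
  have O: "Y \<in> Obj D" by (rule F.D.simpleD(1)[OF Y(1)])
  show "bij_betw (phi X Y) (Ext1 D (obmap F X) Y) (Ext1 C X (obmap G Y))" by (rule phi_bij[OF X O])
  show "armap G (mzero D Y Y) = mzero C (obmap G Y) (obmap G Y)" by (rule G.map_zero[OF O O])
qed (auto simp: phi_baer X phi_pushout)

lemma dim_right_adjunction:
  assumes X: "simple C X" "simple D (obmap F X)" and Y: "Y \<in> Obj D"
    and bij: "bij_betw (armap F) (Hom C X X) (Hom D (obmap F X) (obmap F X))"
  shows "(dim (End_ring C X) (Ext1_right C X (obmap G Y)),
    dim (End_ring D (obmap F X)) (Ext1_right D (obmap F X) Y)) \<in> ordIso"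
proof (rule dim_Ext1_right[OF F.C.abelian_category_axioms F.D.abelian_category_axioms X G.map_Obj[OF Y] Y bij])
  have O: "X \<in> Obj C" by (rule F.C.simpleD(1)[OF X(1)])
  show "bij_betw (psi X Y) (Ext1 C X (obmap G Y)) (Ext1 D (obmap F X) Y)" by (rule psi_bij[OF O Y])
  show "armap F (mzero C X X) = mzero D (obmap F X) (obmap F X)" by (rule F.map_zero[OF O O])
qed (auto simp: psi_baer Y psi_pullback)

lemma valuation_adjunction:
  assumes "simple C X" "simple D (obmap F X)" "simple D Y" "simple C (obmap G Y)"
    and "bij_betw (armap F) (Hom C X X) (Hom D (obmap F X) (obmap F X))"
    and "bij_betw (armap G) (Hom D Y Y) (Hom C (obmap G Y) (obmap G Y))"
  shows "same_valuation (valuation D (obmap F X) Y) (valuation C X (obmap G Y))"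
proof (rule same_valuationI)
  have O: "X \<in> Obj C" "Y \<in> Obj D" using assms F.C.simpleD(1) F.D.simpleD(1) by auto
  show "(dim (End_ring D (obmap F X)) (Ext1_right D (obmap F X) Y), dim (End_ring C X) (Ext1_right C X
    (obmap G Y))) \<in> ordIso"
    by (rule ordIso_symmetric[OF dim_right_adjunction[OF assms(1,2) O(2) assms(5)]])
  show "(dim (opposite_ring (End_ring D Y)) (Ext1_left D (obmap F X) Y), dim (opposite_ring (End_ring C
    (obmap G Y))) (Ext1_left C X (obmap G Y))) \<in> ordIso"
    by (rule dim_left_adjunction[OF assms(3,4) O(1) assms(6)])
qed

end

section \<open>Expansions\<close>

context abelian_category
begin

lemma zero_of_monic:
  assumes f: "monic C f" and z: "zero_obj C (tgt C f)"
  shows "zero_obj C (src C f)"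
proof -
  note [simp] = monic_Arr[OF f]
  have "f = mzero C (src C f) (tgt C f)" using to_zero[OF z] by simp
  then have "f \<cdot> ident C (src C f) = mzero C (src C f) (tgt C f)" by simp
  then have "ident C (src C f) = mzero C (src C f) (src C f)"
    using monic0[OF f, of "ident C (src C f)"] by simp
  then show ?thesis by (simp add: zero_obj_iff)
qed

lemma zero_of_epic: "\<lbrakk>epic C f; zero_obj C (src C f)\<rbrakk> \<Longrightarrow> zero_obj C (tgt C f)"
  using abelian_category.zero_of_monic[OF dual_abelian, of f] by simp

lemma monic_zero_map: "\<lbrakk>monic C f; f = mzero C (src C f) (tgt C f)\<rbrakk> \<Longrightarrow> zero_obj C (src C f)"
  using monic0[of f "ident C (src C f)"] monic_Arr[of f] by (simp add: zero_obj_iff)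

lemma epic_zero_map: "\<lbrakk>epic C f; f = mzero C (src C f) (tgt C f)\<rbrakk> \<Longrightarrow> zero_obj C (tgt C f)"
  using epic0[of f "ident C (tgt C f)"] epic_Arr[of f] by (simp add: zero_obj_iff)

lemma short_exact_zero_left: "\<lbrakk>short_exact C i p; zero_obj C (src C i)\<rbrakk> \<Longrightarrow> iso_arr C p"
  using short_exactD[of i p] zero_kernel_monic[of i p] monic_epic_iso[of p] by (auto simp: short_exact_def)

text \<open>The pullback of the sequence along \<open>g\<close> splits, and a splitting is a lift.
  With its dual \<open>extend_through\<close> this takes the place of the long exact
  sequence.\<close>

lemma lift_through:
  assumes E: "short_exact C i p" and z: "Ext1 C X (src C i) = {ext_zero C X (src C i)}"
    and g: "g \<in> Arr C" "src C g = X" "tgt C g = tgt C p"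
  obtains t where "t \<in> Arr C" "src C t = X" "tgt C t = src C p" "p \<cdot> t = g"
proof -
  have E': "(i, p) \<in> extensions C (tgt C p) (src C i)" using E by (rule extensionsI) auto
  have h: "g \<in> Hom C X (tgt C p)" using g by (simp add: Hom_iff)
  have "ext_pullback C X (src C i) g (ext_class (tgt C p) (src C i) (i, p)) = ext_zero C X (src C i)"
    using ext_pullback_Ext1[OF ext_class_Ext1[OF E'] h] z by simp
  then obtain t where "t \<in> Hom C X (tgt C i)" "p \<cdot> t = g" using ext_pullback_zero_iff[OF E' h] by blast
  then show thesis using that short_exactD(3)[OF E] by (auto simp: Hom_iff)
qed

lemma extend_through:
  assumes E: "short_exact C i p" and z: "Ext1 C (tgt C p) Y = {ext_zero C (tgt C p) Y}"
    and g: "g \<in> Arr C" "src C g = src C i" "tgt C g = Y"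
  obtains t where "t \<in> Arr C" "src C t = src C p" "tgt C t = Y" "t \<cdot> i = g"
proof -
  have E': "(i, p) \<in> extensions C (tgt C p) (src C i)" using E by (rule extensionsI) auto
  have h: "g \<in> Hom C (src C i) Y" using g by (simp add: Hom_iff)
  have "ext_pushout C (tgt C p) Y g (ext_class (tgt C p) (src C i) (i, p)) = ext_zero C (tgt C p) Y"
    using ext_pushout_Ext1[OF ext_class_Ext1[OF E'] h] z by simp
  then obtain t where "t \<in> Hom C (tgt C i) Y" "t \<cdot> i = g" using ext_pushout_zero_iff[OF E' h] by blast
  then show thesis using that short_exactD(3)[OF E] by (auto simp: Hom_iff)
qed

lemma Ext1_singletonI:
  assumes "X \<in> Obj C" "Y \<in> Obj C" "\<And>\<xi>. \<xi> \<in> Ext1 C X Y \<Longrightarrow> \<xi> = ext_zero C X Y"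
  shows "Ext1 C X Y = {ext_zero C X Y}"
  using assms ext_zero_Ext1 by blast

lemma Ext1_zero_left:
  assumes Z: "zero_obj C Z" and Y: "Y \<in> Obj C"
  shows "Ext1 C Z Y = {ext_zero C Z Y}"
proof (rule Ext1_singletonI[OF _ Y])
  show ZO: "Z \<in> Obj C" using Z zero_obj_iff by simp
  fix \<xi> assume "\<xi> \<in> Ext1 C Z Y"
  then obtain i p where E: "(i, p) \<in> extensions C Z Y" "\<xi> = ext_class Z Y (i, p)"
    using Ext1_cases by (metis surj_pair)
  have e: "i \<in> Arr C" "p \<in> Arr C" "src C p = tgt C i" "tgt C p = Z" using extensionsE[OF E(1)] by auto
  have "\<exists>t \<in> Hom C Z (tgt C i). p \<cdot> t = ident C Z"
    using e ZO Z zero_obj_iff by (intro bexI[of _ "mzero C Z (tgt C i)"]) (auto simp: Hom_iff)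
  then show "\<xi> = ext_zero C Z Y" using ext_class_zero_iff(1)[OF E(1)] E(2) by simp
qed

lemma Ext1_zero_right:
  assumes Z: "zero_obj C Z" and X: "X \<in> Obj C"
  shows "Ext1 C X Z = {ext_zero C X Z}"
proof (rule Ext1_singletonI[OF X])
  show ZO: "Z \<in> Obj C" using Z zero_obj_iff by simp
  fix \<xi> assume "\<xi> \<in> Ext1 C X Z"
  then obtain i p where E: "(i, p) \<in> extensions C X Z" "\<xi> = ext_class X Z (i, p)"
    using Ext1_cases by (metis surj_pair)
  have e: "i \<in> Arr C" "p \<in> Arr C" "src C i = Z" using extensionsE[OF E(1)] by auto
  have "\<exists>t \<in> Hom C (tgt C i) Z. t \<cdot> i = ident C Z"
    using e ZO Z zero_obj_iff by (intro bexI[of _ "mzero C (tgt C i) Z"]) (auto simp: Hom_iff)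
  then show "\<xi> = ext_zero C X Z" using ext_class_zero_iff(2)[OF E(1)] E(2) by simp
qed

text \<open>The identity minus \<open>f \<cdot> r\<close> kills \<open>f\<close>, hence factors
  through the cokernel; the factor is the missing injection.\<close>

lemma split_biproduct:
  assumes E: "short_exact C f c" and r: "r \<in> Arr C" "src C r = tgt C f" "tgt C r = src C f"
    "r \<cdot> f = ident C (src C f)"
  obtains j where "biproduct C (src C f) (tgt C c) (tgt C f, f, j, r, c)"
proof -
  note [simp] = short_exactD(1,2,4)[OF E] short_exactD(3)[OF E, symmetric] r(1-3)
  let ?d = "ident C (tgt C f) \<boxplus> mneg (f \<cdot> r)"
  have df: "?d \<cdot> f = mzero C (src C f) (tgt C f)" using r(4) by simp
  obtain j where j: "j \<in> Arr C" "src C j = tgt C c" "tgt C j = tgt C f" "j \<cdot> c = ?d"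
    by (rule short_exact_colift[OF E, of ?d]) (use df in auto)
  note [simp] = j(1-3)
  have "c \<cdot> (j \<cdot> c) = c" unfolding j(4) using reassoc[OF short_exactD(4)[OF E], of r] by simp
  then have cj: "c \<cdot> j = ident C (tgt C c)"
    by (intro epicD[OF short_exactD(6)[OF E], of "c \<cdot> j"]) auto
  have "r \<cdot> (j \<cdot> c) = mzero C (tgt C f) (src C f)"
    unfolding j(4) using reassoc[OF r(4), of r] by simp
  then have rj: "r \<cdot> j = mzero C (tgt C c) (src C f)"
    using epic0[OF short_exactD(6)[OF E], of "r \<cdot> j"] by simp
  have sum: "(f \<cdot> r) \<boxplus> ?d = ident C (tgt C f)"
  proof -
    have "(f \<cdot> r) \<boxplus> ?d = (f \<cdot> r) \<boxplus> (mneg (f \<cdot> r) \<boxplus> ident C (tgt C f))"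
      by (subst madd_comm[of "ident C (tgt C f)"]) auto
    also have "\<dots> = ((f \<cdot> r) \<boxplus> mneg (f \<cdot> r)) \<boxplus> ident C (tgt C f)" by (subst madd_assoc) auto
    finally show ?thesis by simp
  qed
  show thesis
    by (rule that[of j]) (use r(4) cj rj sum j(4) in \<open>auto simp: biproduct_def Hom_iff\<close>)
qed

text \<open>As \<open>m'\<close> is monic, \<open>e'\<close> kills the kernel of \<open>e\<close>,
  so it is \<open>u \<cdot> e\<close> for some \<open>u\<close>. Then \<open>m' \<cdot> u\<close> is
  \<open>m\<close>, and \<open>u\<close> is both monic and epic.\<close>

lemma image_unique:
  assumes "monic C m" "monic C m'" "epic C e" "epic C e'" "m \<cdot> e = m' \<cdot> e'" "src C m = tgt C e"
    "src C m' = tgt C e'"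
  shows "isomorphic C (tgt C e) (tgt C e')"
proof -
  note [simp] = monic_Arr[OF assms(1)] monic_Arr[OF assms(2)] epic_Arr[OF assms(3)] epic_Arr[OF assms(4)]
    assms(6,7)
  have [simp]: "src C e' = src C e" "tgt C m' = tgt C m" using arg_cong[OF assms(5), of
    "src C"] arg_cong[OF assms(5), of "tgt C"] by simp_all
  obtain k where k: "is_kernel C k e" using obtain_kernel[of e] by auto
  note [simp] = kernelD[OF k]
  have "m' \<cdot> (e' \<cdot> k) = mzero C (src C k) (tgt C m')"
    using reassoc[OF assms(5), of k] by simp
  then have "e' \<cdot> k = mzero C (src C k) (tgt C e')" using monic0[OF assms(2), of "e' \<cdot> k"] by simp
  then obtain u where u: "u \<in> Arr C" "src C u = tgt C e" "tgt C u = tgt C e'" "u \<cdot> e = e'"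
    using short_exact_colift[OF short_exact_epic[OF assms(3) k], of e'] by auto
  note [simp] = u(1-3)
  have "(m' \<cdot> u) \<cdot> e = m \<cdot> e" using u(4) assms(5) by simp
  then have "m' \<cdot> u = m" by (intro epicD[OF assms(3), of "m' \<cdot> u" m]) auto
  then have "monic C u" using monic_cancel[of m' u] assms(1) by simp
  moreover have "epic C u" using epic_cancel[of u e] u(4) assms(4) by simp
  ultimately have "iso_arr C u" by (rule monic_epic_iso)
  then show ?thesis by (rule isomorphicI) auto
qed

end

text \<open>An abstraction covering both perpendicular categories. Closure under subobjects and
  quotients lets splittings inside the class decide simplicity and maps in the whole
  category.\<close>

locale semisimple_class = abelian_category C
  for C :: "('o, 'm, 'x) additive_category_scheme" (structure) +
  fixes P :: "'o set"
  assumes mod: "equivalent_to_mod (full_subcategory C P)" and P_Obj: "X \<in> P \<Longrightarrow> X \<in> Obj C"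
    and P_sub: "\<lbrakk>monic C f; tgt C f \<in> P\<rbrakk> \<Longrightarrow> src C f \<in> P"
    and P_quot: "\<lbrakk>epic C f; src C f \<in> P\<rbrakk> \<Longrightarrow> tgt C f \<in> P"
begin

text \<open>A subobject of \<open>S\<close> stays in the class, where monomorphisms split; so it is
  a direct summand, and either it or its complement is zero.\<close>

lemma indecomposable_simple:
  assumes S: "indecomposable C S" "S \<in> P"
  shows "simple C S"
  unfolding simple_def
proof (intro conjI allI impI)
  show "S \<in> Obj C" "\<not> zero_obj C S" using S by (auto simp: indecomposable_def)
  fix f assume f: "monic C f \<and> tgt C f = S"
  note [simp] = monic_Arr[of f]
  have fP: "src C f \<in> P" using P_sub f S by blast
  obtain r where r: "r \<in> Arr C" "src C r = tgt C f" "tgt C r = src C f" "r \<cdot> f = ident C (src C f)"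
    using perp_split[OF mod, of f] f fP S(2) by auto
  obtain c where c: "is_cokernel C c f" using obtain_cokernel[of f] f by auto
  obtain j where j: "biproduct C (src C f) (tgt C c) (tgt C f, f, j, r, c)"
    using split_biproduct[OF short_exact_monic[OF _ c] r] f by blast
  have "zero_obj C (src C f) \<or> zero_obj C (tgt C c)"
    using S(1) j f cokernelD(1)[OF c] unfolding indecomposable_def by (metis src_Obj tgt_Obj monic_Arr)
  then show "zero_obj C (src C f) \<or> iso_arr C f"
    using zero_cokernel_epic[OF c] monic_epic_iso f by blast
qed

lemma nonzero_map:
  assumes "X \<in> P" "Y \<in> P" "\<not> zero_obj C X" "\<not> zero_obj C Y"
  obtains f where "f \<in> Arr C" "src C f = X" "tgt C f = Y" "f \<noteq> mzero C X Y"
  using perp_map[OF mod assms(1,2) P_Obj[OF assms(1)] P_Obj[OF assms(2)] assms(3,4)] .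

lemma simple_unique:
  assumes "simple C S" "simple C T" "S \<in> P" "T \<in> P"
  shows "isomorphic C S T"
proof -
  obtain f where "f \<in> Arr C" "src C f = S" "tgt C f = T" "f \<noteq> mzero C S T"
    using nonzero_map[OF assms(3,4)] simpleD(2)[OF assms(1)] simpleD(2)[OF assms(2)] by blast
  then show ?thesis using schur[OF assms(1,2)] isomorphicI by blast
qed

end

text \<open>\<open>I\<close> with exact adjoints on both sides. Unprimed unit and counit belong to
  the pair with \<open>L\<close>, primed ones to the pair with \<open>R\<close>.\<close>

locale recollement =
  A: abelian_category A + B: abelian_category B + LI: exact_adjunction A B L I \<eta> \<epsilon> + IR: exact_adjunction
    B A I R \<eta>' \<epsilon>'
  for A :: "('a, 'f, 'x) additive_category_scheme" and B :: "('b, 'g, 'y) additive_category_scheme"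
    and L :: "('a, 'f, 'b, 'g) cat_functor" and I :: "('b, 'g, 'a, 'f) cat_functor" and R ::
      "('a, 'f, 'b, 'g) cat_functor"
    and \<eta> :: "'a \<Rightarrow> 'f" and \<epsilon> :: "'b \<Rightarrow> 'g" and \<eta>' :: "'b \<Rightarrow> 'g" and \<epsilon>' :: "'a \<Rightarrow> 'f" +
  assumes ff: "fully_faithful B A I"
begin

section \<open>Units, counits and the two perpendicular categories\<close>

abbreviation Im :: "'a set" where
  "Im \<equiv> ess_image B A I"

lemma I_full:
  assumes "f \<in> Arr A" "src A f = obmap I U" "tgt A f = obmap I V" "U \<in> Obj B" "V \<in> Obj B"
  obtains g where "g \<in> Arr B" "src B g = U" "tgt B g = V" "armap I g = f"
proof -
  have "bij_betw (armap I) (Hom B U V) (Hom A (obmap I U) (obmap I V))"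
    using ff assms unfolding fully_faithful_def by blast
  then have "f \<in> armap I ` Hom B U V" using assms by (auto simp: bij_betw_def Hom_iff)
  then show thesis using that by (auto simp: Hom_iff)
qed

lemma I_faithful:
  assumes "armap I f = armap I g" "f \<in> Arr B" "g \<in> Arr B" "src B f = src B g" "tgt B f = tgt B g"
  shows "f = g"
proof -
  have "bij_betw (armap I) (Hom B (src B f) (tgt B f)) (Hom A (obmap I (src B f)) (obmap I (tgt B f)))"
    using ff assms unfolding fully_faithful_def by simp
  then show ?thesis using assms by (auto simp: bij_betw_def Hom_iff inj_on_def)
qed

lemma I_End_bij: "U \<in> Obj B \<Longrightarrow> bij_betw (armap I) (Hom B U U) (Hom A (obmap I U) (obmap I U))"
  using ff unfolding fully_faithful_def by blast

lemma I_reflects_zero: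
  assumes "zero_obj A (obmap I U)" "U \<in> Obj B"
  shows "zero_obj B U"
proof -
  have "armap I (ident B U) = armap I (mzero B U U)"
    using assms LI.G.map_ident LI.G.map_zero A.zero_obj_iff by simp
  then have "ident B U = mzero B U U" by (rule I_faithful) (use assms in auto)
  then show ?thesis using assms B.zero_obj_iff by simp
qed

lemma Im_I: "U \<in> Obj B \<Longrightarrow> obmap I U \<in> Im"
  unfolding ess_image_def using A.isomorphic_refl[of "obmap I U"] by (auto intro!: bexI[of _ U])

text \<open>Fullness lifts the unit at \<open>obmap I U\<close> to an arrow of \<open>B\<close>; the
  triangle identity and faithfulness show that it inverts the counit.\<close>

lemma counit_iso:
  assumes U: "U \<in> Obj B"
  shows "iso_arr B (\<epsilon> U)"
proof -
  note [simp] = U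
  obtain s where s: "s \<in> Arr B" "src B s = U" "tgt B s = obmap L (obmap I U)" "armap I s = \<eta> (obmap I U)"
    by (rule I_full[of "\<eta> (obmap I U)" U "obmap L (obmap I U)"]) auto
  note [simp] = s(1-3)
  have es: "\<epsilon> U \<cdot>\<^bsub>B\<^esub> s = ident B U"
    by (rule I_faithful) (use LI.triangle2[OF U] in \<open>auto simp: LI.G.map_cmp LI.G.map_ident s(4)\<close>)
  have "s \<cdot>\<^bsub>B\<^esub> \<epsilon> U = ident B (obmap L (obmap I U))"
    by (rule LI.unit_cancel[of _ "obmap I U"])
      (use LI.triangle2[OF U] in \<open>auto simp: LI.G.map_cmp LI.G.map_ident s(4)\<close>)
  then show ?thesis using es by (intro B.iso_arrI[of _ s]) auto
qed

lemma unit_iso: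
  assumes U: "U \<in> Obj B"
  shows "iso_arr B (\<eta>' U)"
proof -
  note [simp] = U
  obtain t where t: "t \<in> Arr B" "src B t = obmap R (obmap I U)" "tgt B t = U" "armap I t = \<epsilon>' (obmap I U)"
    by (rule I_full[of "\<epsilon>' (obmap I U)" "obmap R (obmap I U)" U]) auto
  note [simp] = t(1-3)
  have es: "t \<cdot>\<^bsub>B\<^esub> \<eta>' U = ident B U"
    by (rule I_faithful) (use IR.triangle1[OF U] in \<open>auto simp: LI.G.map_cmp LI.G.map_ident t(4)\<close>)
  have "\<eta>' U \<cdot>\<^bsub>B\<^esub> t = ident B (obmap R (obmap I U))"
    by (rule IR.counit_cancel[of "obmap I U"])
      (use A.reassoc[OF IR.triangle1[OF U], of "armap I t"] in \<open>auto simp: LI.G.map_cmp LI.G.map_ident t(4)\<close>)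
  then show ?thesis using es by (intro B.iso_arrI[of _ t]) auto
qed

text \<open>By the triangle identity this arrow is inverse to the counit at
  \<open>obmap L X\<close>. In particular the unit at \<open>X\<close> cannot vanish unless
  \<open>obmap L X\<close> does.\<close>

lemma L_unit_iso:
  assumes X: "X \<in> Obj A"
  shows "iso_arr B (armap L (\<eta> X))"
proof -
  obtain e where e: "e \<in> Arr B" "iso_arr B e" "src B e = obmap L X" "tgt B e = obmap L (obmap I (obmap L X))"
    "e \<cdot>\<^bsub>B\<^esub> \<epsilon> (obmap L X) = ident B (obmap L (obmap I (obmap L X)))"
    using B.iso_inv[OF counit_iso[of "obmap L X"]] X by auto
  have "armap L (\<eta> X) = e"
    using B.reassoc[OF e(5), of "armap L (\<eta> X)"] LI.triangle1[OF X] e X by simp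
  then show ?thesis using e by simp
qed

lemma R_counit_iso:
  assumes X: "X \<in> Obj A"
  shows "iso_arr B (armap R (\<epsilon>' X))"
proof -
  obtain e where e: "e \<in> Arr B" "iso_arr B e" "src B e = obmap R (obmap I (obmap R X))" "tgt B e = obmap R X"
    "\<eta>' (obmap R X) \<cdot>\<^bsub>B\<^esub> e = ident B (obmap R (obmap I (obmap R X)))"
    using B.iso_inv[OF unit_iso[of "obmap R X"]] X by auto
  have "armap R (\<epsilon>' X) = armap R (\<epsilon>' X) \<cdot>\<^bsub>B\<^esub> (\<eta>' (obmap R X) \<cdot>\<^bsub>B\<^esub> e)" using e X by simp
  also have "\<dots> = e" using B.reassoc[OF IR.triangle2[OF X], of e] e X by simp
  finally show ?thesis using e by simp
qed

text \<open>If the unit at \<open>X\<close> is zero, the triangle identity makes the identity of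
  \<open>obmap L X\<close> zero. Conversely Hom and Ext from \<open>X\<close> to the image of
  \<open>I\<close> are, by adjunction, Hom and Ext from the zero object
  \<open>obmap L X\<close>.\<close>

lemma left_perp_iff: "X \<in> left_perp A Im \<longleftrightarrow> X \<in> Obj A \<and> zero_obj B (obmap L X)"
proof (intro iffI conjI)
  assume X: "X \<in> left_perp A Im"
  then show O: "X \<in> Obj A" by (simp add: left_perp_def)
  note [simp] = O
  have "Hom A X (obmap I (obmap L X)) = {mzero A X (obmap I (obmap L X))}"
    using X Im_I[of "obmap L X"] by (simp add: left_perp_def)
  then have "\<eta> X = mzero A X (obmap I (obmap L X))" using LI.unit_Hom[OF O] by simp
  then have "armap L (\<eta> X) = mzero B (obmap L X) (obmap L (obmap I (obmap L X)))" by (simp add: LI.F.map_zero)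
  then have "ident B (obmap L X) = mzero B (obmap L X) (obmap L X)"
    using LI.triangle1[OF O] by simp
  then show "zero_obj B (obmap L X)" by (simp add: B.zero_obj_iff)
next
  assume "X \<in> Obj A \<and> zero_obj B (obmap L X)"
  then have O: "X \<in> Obj A" and z: "zero_obj B (obmap L X)" by auto
  note [simp] = O
  show "X \<in> left_perp A Im"
    unfolding left_perp_def
  proof (intro CollectI conjI ballI O)
    fix Y assume "Y \<in> Im"
    then obtain U where U: "U \<in> Obj B" "isomorphic A (obmap I U) Y" and [simp]: "Y \<in> Obj A" by
      (auto simp: ess_image_def)
    obtain k where k: "iso_arr A k" "k \<in> Arr A" "src A k = Y" "tgt A k = obmap I U"
      using A.isomorphic_sym[OF U(2)] by (rule A.isomorphicE)
    note [simp] = U(1) k(2-4)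
    have "f = mzero A X Y" if f: "f \<in> Hom A X Y" for f
    proof -
      note [simp] = HomD[OF f]
      have "\<epsilon> U \<cdot>\<^bsub>B\<^esub> armap L (k \<cdot>\<^bsub>A\<^esub> f) = mzero B (obmap L X) U"
        using B.from_zero[OF z, of "\<epsilon> U \<cdot>\<^bsub>B\<^esub> armap L (k \<cdot>\<^bsub>A\<^esub> f)"] by simp
      then have "armap I (mzero B (obmap L X) U) \<cdot>\<^bsub>A\<^esub> \<eta> X = k \<cdot>\<^bsub>A\<^esub> f"
        using LI.transpose_right[of "k \<cdot>\<^bsub>A\<^esub> f" X U] by simp
      then have "k \<cdot>\<^bsub>A\<^esub> f = mzero A X (obmap I U)" by (simp add: LI.G.map_zero)
      then show ?thesis using A.monic0[OF A.iso_monic[OF k(1)], of f] by simp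
    qed
    then show "Hom A X Y = {mzero A X Y}" by (auto simp: Hom_iff)
    show "Ext1 A X Y = {ext_zero A X Y}"
    proof (rule A.Ext1_singletonI)
      \<comment> \<open>Only the bijections are used: a set with one element that contains the zero
        class consists of it.\<close>
      have "card (Ext1 B (obmap L X) U) = 1" using B.Ext1_zero_left[OF z U(1)] by simp
      then have "card (Ext1 A X (obmap I U)) = 1" using bij_betw_same_card[OF LI.phi_bij[OF O U(1)]] by simp
      then have "card (Ext1 A X Y) = 1" using bij_betw_same_card[OF A.pushout_iso_bij[OF k(1,3,4)]] by simp
      then show "\<xi> = ext_zero A X Y" if "\<xi> \<in> Ext1 A X Y" for \<xi>
        using that A.ext_zero_Ext1[of X Y] by (auto simp: card_1_singleton_iff)
    qed auto
  qed
qed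

lemma right_perp_iff: "X \<in> right_perp A Im \<longleftrightarrow> X \<in> Obj A \<and> zero_obj B (obmap R X)"
proof (intro iffI conjI)
  assume X: "X \<in> right_perp A Im"
  then show O: "X \<in> Obj A" by (simp add: right_perp_def)
  note [simp] = O
  have "Hom A (obmap I (obmap R X)) X = {mzero A (obmap I (obmap R X)) X}"
    using X Im_I[of "obmap R X"] by (simp add: right_perp_def)
  then have "\<epsilon>' X = mzero A (obmap I (obmap R X)) X" using IR.counit_Hom[OF O] by simp
  then have "armap R (\<epsilon>' X) = mzero B (obmap R (obmap I (obmap R X))) (obmap R X)" by (simp add: IR.G.map_zero)
  then have "ident B (obmap R X) = mzero B (obmap R X) (obmap R X)"
    using IR.triangle2[OF O] by simp
  then show "zero_obj B (obmap R X)" by (simp add: B.zero_obj_iff)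
next
  assume "X \<in> Obj A \<and> zero_obj B (obmap R X)"
  then have O: "X \<in> Obj A" and z: "zero_obj B (obmap R X)" by auto
  note [simp] = O
  show "X \<in> right_perp A Im"
    unfolding right_perp_def
  proof (intro CollectI conjI ballI O)
    fix Y assume "Y \<in> Im"
    then obtain U where U: "U \<in> Obj B" "isomorphic A (obmap I U) Y" and [simp]: "Y \<in> Obj A" by
      (auto simp: ess_image_def)
    obtain k where k: "iso_arr A k" "k \<in> Arr A" "src A k = obmap I U" "tgt A k = Y"
      using U(2) by (rule A.isomorphicE)
    note [simp] = U(1) k(2-4)
    have "f = mzero A Y X" if f: "f \<in> Hom A Y X" for f
    proof -
      note [simp] = HomD[OF f]
      have "armap R (f \<cdot>\<^bsub>A\<^esub> k) \<cdot>\<^bsub>B\<^esub> \<eta>' U = mzero B U (obmap R X)"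
        using B.to_zero[OF z, of "armap R (f \<cdot>\<^bsub>A\<^esub> k) \<cdot>\<^bsub>B\<^esub> \<eta>' U"] by simp
      then have "\<epsilon>' X \<cdot>\<^bsub>A\<^esub> armap I (mzero B U (obmap R X)) = f \<cdot>\<^bsub>A\<^esub> k"
        using IR.transpose_left[of "f \<cdot>\<^bsub>A\<^esub> k" U X] by simp
      then have "f \<cdot>\<^bsub>A\<^esub> k = mzero A (obmap I U) X" by (simp add: LI.G.map_zero)
      then show ?thesis using A.epic0[OF A.iso_epic[OF k(1)], of f] by simp
    qed
    then show "Hom A Y X = {mzero A Y X}" by (auto simp: Hom_iff)
    show "Ext1 A Y X = {ext_zero A Y X}"
    proof (rule A.Ext1_singletonI)
      have "card (Ext1 B U (obmap R X)) = 1" using B.Ext1_zero_right[OF z U(1)] by simp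
      then have "card (Ext1 A (obmap I U) X) = 1" using bij_betw_same_card[OF IR.psi_bij[OF U(1) O]] by simp
      then have "card (Ext1 A Y X) = 1" using bij_betw_same_card[OF A.pullback_iso_bij[OF k(1,3,4)]] by simp
      then show "\<xi> = ext_zero A Y X" if "\<xi> \<in> Ext1 A Y X" for \<xi>
        using that A.ext_zero_Ext1[of Y X] by (auto simp: card_1_singleton_iff)
    qed auto
  qed
qed

lemma left_perp_map_zero:
  assumes X: "X \<in> left_perp A Im" and f: "f \<in> Arr A" "src A f = X" "tgt A f = obmap I U" and U: "U \<in> Obj B"
  shows "f = mzero A X (obmap I U)"
proof -
  have "Hom A X (obmap I U) = {mzero A X (obmap I U)}" using X Im_I[OF U] by (simp add: left_perp_def)
  moreover have "f \<in> Hom A X (obmap I U)" using f by (simp add: Hom_iff)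
  ultimately show ?thesis by blast
qed

lemma right_perp_map_zero:
  assumes X: "X \<in> right_perp A Im" and f: "f \<in> Arr A" "src A f = obmap I U" "tgt A f = X" and U: "U \<in> Obj B"
  shows "f = mzero A (obmap I U) X"
proof -
  have "Hom A (obmap I U) X = {mzero A (obmap I U) X}" using X Im_I[OF U] by (simp add: right_perp_def)
  moreover have "f \<in> Hom A (obmap I U) X" using f by (simp add: Hom_iff)
  ultimately show ?thesis by blast
qed

lemma left_perp_Ext1: "\<lbrakk>X \<in> left_perp A Im; U \<in> Obj B\<rbrakk> \<Longrightarrow> Ext1 A X (obmap I U) = {ext_zero A X (obmap I U)}"
  using Im_I[of U] by (simp add: left_perp_def)

lemma right_perp_Ext1: "\<lbrakk>X \<in> right_perp A Im; U \<in> Obj B\<rbrakk> \<Longrightarrow> Ext1 A (obmap I U) X = {ext_zero A (obmap I U) X}"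
  using Im_I[of U] by (simp add: right_perp_def)

lemma left_perp_sub: "\<lbrakk>monic A f; tgt A f \<in> left_perp A Im\<rbrakk> \<Longrightarrow> src A f \<in> left_perp A Im"
  using B.zero_of_monic[OF LI.F.map_monic, of f] A.monic_Arr[of f] by (simp add: left_perp_iff)

lemma left_perp_quot: "\<lbrakk>epic A f; src A f \<in> left_perp A Im\<rbrakk> \<Longrightarrow> tgt A f \<in> left_perp A Im"
  using B.zero_of_epic[OF LI.F.map_epic, of f] A.epic_Arr[of f] by (simp add: left_perp_iff)

lemma right_perp_sub: "\<lbrakk>monic A f; tgt A f \<in> right_perp A Im\<rbrakk> \<Longrightarrow> src A f \<in> right_perp A Im"
  using B.zero_of_monic[OF IR.G.map_monic, of f] A.monic_Arr[of f] by (simp add: right_perp_iff)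

lemma right_perp_quot: "\<lbrakk>epic A f; src A f \<in> right_perp A Im\<rbrakk> \<Longrightarrow> tgt A f \<in> right_perp A Im"
  using B.zero_of_epic[OF IR.G.map_epic, of f] A.epic_Arr[of f] by (simp add: right_perp_iff)

lemma I_reflects_iso:
  assumes f: "f \<in> Arr B" "iso_arr A (armap I f)"
  shows "iso_arr B f"
proof -
  obtain h where h: "h \<in> Arr A" "src A h = obmap I (tgt B f)" "tgt A h = obmap I (src B f)"
    "h \<cdot>\<^bsub>A\<^esub> armap I f = ident A (obmap I (src B f))" "armap I f \<cdot>\<^bsub>A\<^esub> h = ident A (obmap I (tgt B f))"
    using f by (auto elim: A.iso_arrE)
  obtain g where g: "g \<in> Arr B" "src B g = tgt B f" "tgt B g = src B f" "armap I g = h"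
    by (rule I_full[OF h(1-3)]) (use f in auto)
  have "g \<cdot>\<^bsub>B\<^esub> f = ident B (src B f)" "f \<cdot>\<^bsub>B\<^esub> g = ident B (tgt B f)"
    by (rule I_faithful; use f g h in \<open>simp add: LI.G.map_cmp LI.G.map_ident\<close>)+
  then show ?thesis using f g by (intro B.iso_arrI[of f g]) auto
qed

lemma I_reflects_isomorphic:
  assumes UV: "U \<in> Obj B" "V \<in> Obj B" and i: "isomorphic A (obmap I U) (obmap I V)"
  shows "isomorphic B U V"
proof -
  obtain f where f: "iso_arr A f" "f \<in> Arr A" "src A f = obmap I U" "tgt A f = obmap I V"
    using i by (rule A.isomorphicE)
  obtain g where "g \<in> Arr B" "src B g = U" "tgt B g = V" "armap I g = f"
    by (rule I_full[OF f(2-4) UV])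
  then show ?thesis using f(1) I_reflects_iso[of g] B.isomorphicI by blast
qed

text \<open>The unit being monic makes \<open>L\<close> injective on endomorphisms. An endomorphism
  \<open>g\<close> of \<open>obmap L X\<close> is attained when its transpose factors back through
  the unit, which is the assumption \<open>lift\<close>.\<close>

lemma L_End_bij:
  assumes X: "X \<in> Obj A" and m: "monic A (\<eta> X)"
    and lift: "\<And>g. \<lbrakk>g \<in> Arr B; src B g = obmap L X; tgt B g = obmap L X\<rbrakk> \<Longrightarrow>
      \<exists>r \<in> Hom A X X. armap I g \<cdot>\<^bsub>A\<^esub> \<eta> X = \<eta> X \<cdot>\<^bsub>A\<^esub> r"
  shows "bij_betw (armap L) (Hom A X X) (Hom B (obmap L X) (obmap L X))"
  unfolding bij_betw_def
proof (intro conjI inj_onI equalityI subsetI)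
  note [simp] = X
  fix r r' assume r: "r \<in> Hom A X X" "r' \<in> Hom A X X" "armap L r = armap L r'"
  note [simp] = HomD[OF r(1)] HomD[OF r(2)]
  have "\<eta> X \<cdot>\<^bsub>A\<^esub> r = \<eta> X \<cdot>\<^bsub>A\<^esub> r'" using LI.unitD(4)[of r] LI.unitD(4)[of r'] r(3) by simp
  then show "r = r'" by (rule A.monicD[OF m]) auto
next
  fix g assume "g \<in> armap L ` Hom A X X"
  then show "g \<in> Hom B (obmap L X) (obmap L X)" using LI.F.map_Hom by auto
next
  note [simp] = X
  fix g assume g: "g \<in> Hom B (obmap L X) (obmap L X)"
  note [simp] = HomD[OF g]
  obtain r where r: "r \<in> Hom A X X" "armap I g \<cdot>\<^bsub>A\<^esub> \<eta> X = \<eta> X \<cdot>\<^bsub>A\<^esub> r" using lift[of g] by auto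
  note [simp] = HomD[OF r(1)]
  have "armap L r = g"
    by (rule LI.unit_cancel[of _ X]) (use r(2) LI.unitD(4)[of r] in auto)
  then show "g \<in> armap L ` Hom A X X" using r(1) by blast
qed

lemma R_End_bij:
  assumes X: "X \<in> Obj A" and e: "epic A (\<epsilon>' X)"
    and lift: "\<And>g. \<lbrakk>g \<in> Arr B; src B g = obmap R X; tgt B g = obmap R X\<rbrakk> \<Longrightarrow>
      \<exists>s \<in> Hom A X X. \<epsilon>' X \<cdot>\<^bsub>A\<^esub> armap I g = s \<cdot>\<^bsub>A\<^esub> \<epsilon>' X"
  shows "bij_betw (armap R) (Hom A X X) (Hom B (obmap R X) (obmap R X))"
  unfolding bij_betw_def
proof (intro conjI inj_onI equalityI subsetI)
  note [simp] = X
  fix r r' assume r: "r \<in> Hom A X X" "r' \<in> Hom A X X" "armap R r = armap R r'"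
  note [simp] = HomD[OF r(1)] HomD[OF r(2)]
  have "r \<cdot>\<^bsub>A\<^esub> \<epsilon>' X = r' \<cdot>\<^bsub>A\<^esub> \<epsilon>' X" using IR.counitD(4)[of r] IR.counitD(4)[of r'] r(3) by simp
  then show "r = r'" by (rule A.epicD[OF e]) auto
next
  fix g assume "g \<in> armap R ` Hom A X X"
  then show "g \<in> Hom B (obmap R X) (obmap R X)" using IR.G.map_Hom by auto
next
  note [simp] = X
  fix g assume g: "g \<in> Hom B (obmap R X) (obmap R X)"
  note [simp] = HomD[OF g]
  obtain s where s: "s \<in> Hom A X X" "\<epsilon>' X \<cdot>\<^bsub>A\<^esub> armap I g = s \<cdot>\<^bsub>A\<^esub> \<epsilon>' X" using lift[of g] by auto
  note [simp] = HomD[OF s(1)]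
  have "armap R s = g"
    by (rule IR.counit_cancel[of X]) (use s(2) IR.counitD(4)[of s] in auto)
  then show "g \<in> armap R ` Hom A X X" using s(1) by blast
qed

text \<open>At an object of the image the unit is invertible, so every transpose factors back
  through it.\<close>

lemma L_End_bij_I:
  assumes U: "U \<in> Obj B"
  shows "bij_betw (armap L) (Hom A (obmap I U) (obmap I U)) (Hom B (obmap L (obmap I U)) (obmap L (obmap I U)))"
proof (rule L_End_bij)
  note [simp] = U
  show "obmap I U \<in> Obj A" by simp
  have t: "armap I (\<epsilon> U) \<cdot>\<^bsub>A\<^esub> \<eta> (obmap I U) = ident A (obmap I U)" by (rule LI.triangle2[OF U])
  then show m: "monic A (\<eta> (obmap I U))"
    by (intro A.split_monic[of _ "armap I (\<epsilon> U)"]) auto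
  have i: "iso_arr A (armap I (\<epsilon> U))" by (rule LI.G.map_iso[OF counit_iso[OF U]])
  have t': "\<eta> (obmap I U) \<cdot>\<^bsub>A\<^esub> armap I (\<epsilon> U) = ident A (obmap I (obmap L (obmap I U)))"
    by (rule A.monicD[OF A.iso_monic[OF i]]) (use A.reassoc[OF t, of "armap I (\<epsilon> U)"] in auto)
  fix g assume g: "g \<in> Arr B" "src B g = obmap L (obmap I U)" "tgt B g = obmap L (obmap I U)"
  note [simp] = g
  let ?r = "armap I (\<epsilon> U) \<cdot>\<^bsub>A\<^esub> (armap I g \<cdot>\<^bsub>A\<^esub> \<eta> (obmap I U))"
  show "\<exists>r \<in> Hom A (obmap I U) (obmap I U). armap I g \<cdot>\<^bsub>A\<^esub> \<eta> (obmap I U) = \<eta> (obmap I U) \<cdot>\<^bsub>A\<^esub> r"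
    by (intro bexI[of _ ?r]) (use A.reassoc[OF t', of "armap I g \<cdot>\<^bsub>A\<^esub> \<eta> (obmap I U)"] in \<open>auto simp: Hom_iff\<close>)
qed

end

locale semisimple_recollement = recollement A B L I R \<eta> \<epsilon> \<eta>' \<epsilon>'
  for A :: "('a, 'f, 'x) additive_category_scheme" and B :: "('b, 'g, 'y) additive_category_scheme"
    and L :: "('a, 'f, 'b, 'g) cat_functor" and I :: "('b, 'g, 'a, 'f) cat_functor" and R ::
      "('a, 'f, 'b, 'g) cat_functor"
    and \<eta> :: "'a \<Rightarrow> 'f" and \<epsilon> :: "'b \<Rightarrow> 'g" and \<eta>' :: "'b \<Rightarrow> 'g" and \<epsilon>' :: "'a \<Rightarrow> 'f" +
  assumes left_mod: "equivalent_to_mod (full_subcategory A (left_perp A (ess_image B A I)))"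
    and right_mod: "equivalent_to_mod (full_subcategory A (right_perp A (ess_image B A I)))"
begin

sublocale lp: semisimple_class A "left_perp A Im"
  by unfold_locales (use left_mod left_perp_iff left_perp_sub left_perp_quot in auto)

sublocale rp: semisimple_class A "right_perp A Im"
  by unfold_locales (use right_mod right_perp_iff right_perp_sub right_perp_quot in auto)

text \<open>Let \<open>X\<close> be right perpendicular with \<open>obmap L X\<close> non-zero. The
  image of its unit is a non-zero quotient of \<open>X\<close>, hence right perpendicular, so
  \<open>S\<close> maps to it non-trivially and thus into the image of \<open>I\<close>. That is
  impossible for a left perpendicular \<open>S\<close>. The other inclusion is dual.\<close>

lemma perps_eq:
  assumes S: "simple A S" "S \<in> left_perp A Im" "S \<in> right_perp A Im"
  shows "right_perp A Im = left_perp A Im"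
proof (intro equalityI subsetI)
  have SO: "S \<in> Obj A" "\<not> zero_obj A S" using A.simpleD[OF S(1)] by auto
  fix X assume X: "X \<in> right_perp A Im"
  then have O [simp]: "X \<in> Obj A" by (rule rp.P_Obj)
  show "X \<in> left_perp A Im"
  proof (rule ccontr)
    assume nX: "X \<notin> left_perp A Im"
    obtain m e where me: "monic A m" "epic A e" "src A m = tgt A e" "\<eta> X = m \<cdot>\<^bsub>A\<^esub> e"
      "src A e = src A (\<eta> X)" "tgt A m = tgt A (\<eta> X)"
      using A.image_factor[OF LI.unitD(1)[OF O]] by metis
    note [simp] = A.monic_Arr[OF me(1)] A.epic_Arr[OF me(2)] me(3,5,6)
    have Z: "tgt A e \<in> right_perp A Im" using right_perp_quot[OF me(2)] X by simp
    have "\<not> zero_obj A (tgt A e)"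
    proof
      assume z: "zero_obj A (tgt A e)"
      have "armap L (\<eta> X) = armap L m \<cdot>\<^bsub>B\<^esub> armap L e" by (simp add: me(4) LI.F.map_cmp)
      moreover have "zero_obj B (obmap L (tgt A e))" by (rule LI.F.map_zero_obj[OF z])
      then have "armap L e = mzero B (obmap L X) (obmap L (tgt A e))" using B.to_zero[of _ "armap L e"] by simp
      ultimately have "armap L (\<eta> X) = mzero B (obmap L X) (obmap L (obmap I (obmap L X)))" by simp
      then have "zero_obj B (obmap L X)" using B.monic_zero_map[OF B.iso_monic[OF L_unit_iso[OF O]]] by simp
      then show False using nX by (simp add: left_perp_iff)
    qed
    then obtain g where g: "g \<in> Arr A" "src A g = S" "tgt A g = tgt A e" "g \<noteq> mzero A S (tgt A e)"
      using rp.nonzero_map[OF S(3) Z SO(2)] by blast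
    have "m \<cdot>\<^bsub>A\<^esub> g = mzero A S (obmap I (obmap L X))"
      by (rule left_perp_map_zero[OF S(2)]) (use g in auto)
    then show False using A.monic0[OF me(1), of g] g by simp
  qed
next
  have SO: "S \<in> Obj A" "\<not> zero_obj A S" using A.simpleD[OF S(1)] by auto
  fix X assume X: "X \<in> left_perp A Im"
  then have O [simp]: "X \<in> Obj A" by (rule lp.P_Obj)
  show "X \<in> right_perp A Im"
  proof (rule ccontr)
    assume nX: "X \<notin> right_perp A Im"
    obtain m e where me: "monic A m" "epic A e" "src A m = tgt A e" "\<epsilon>' X = m \<cdot>\<^bsub>A\<^esub> e"
      "src A e = src A (\<epsilon>' X)" "tgt A m = tgt A (\<epsilon>' X)"
      using A.image_factor[OF IR.counitD(1)[OF O]] by metis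
    note [simp] = A.monic_Arr[OF me(1)] A.epic_Arr[OF me(2)] me(3,5,6)
    have Z: "tgt A e \<in> left_perp A Im" using left_perp_sub[OF me(1)] X by simp
    have "\<not> zero_obj A (tgt A e)"
    proof
      assume z: "zero_obj A (tgt A e)"
      have "armap R (\<epsilon>' X) = armap R m \<cdot>\<^bsub>B\<^esub> armap R e" by (simp add: me(4) IR.G.map_cmp)
      moreover have "zero_obj B (obmap R (tgt A e))" by (rule IR.G.map_zero_obj[OF z])
      then have "armap R e = mzero B (obmap R (obmap I (obmap R X))) (obmap R (tgt A e))"
        using B.to_zero[of _ "armap R e"] by simp
      ultimately have "armap R (\<epsilon>' X) = mzero B (obmap R (obmap I (obmap R X))) (obmap R X)" by simp
      then have "zero_obj B (obmap R X)" using B.epic_zero_map[OF B.iso_epic[OF R_counit_iso[OF O]]] by simp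
      then show False using nX by (simp add: right_perp_iff)
    qed
    then obtain g where g: "g \<in> Arr A" "src A g = tgt A e" "tgt A g = S" "g \<noteq> mzero A (tgt A e) S"
      using lp.nonzero_map[OF Z S(2) _ SO(2)] by blast
    have "g \<cdot>\<^bsub>A\<^esub> e = mzero A (obmap I (obmap R X)) S"
      by (rule right_perp_map_zero[OF S(3)]) (use g in auto)
    then show False using A.epic0[OF me(2), of g] g by simp
  qed
qed

end

text \<open>The vanishing of Ext^2 enters through the pair of \<open>S\<^sub>l\<close> with itself,
  where it makes \<open>pullback_h_surj\<close> work.\<close>

locale nonsplit_recollement = semisimple_recollement A B L I R \<eta> \<epsilon> \<eta>' \<epsilon>'
  for A :: "('a, 'f, 'x) additive_category_scheme" and B :: "('b, 'g, 'y) additive_category_scheme"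
    and L :: "('a, 'f, 'b, 'g) cat_functor" and I :: "('b, 'g, 'a, 'f) cat_functor" and R ::
      "('a, 'f, 'b, 'g) cat_functor"
    and \<eta> :: "'a \<Rightarrow> 'f" and \<epsilon> :: "'b \<Rightarrow> 'g" and \<eta>' :: "'b \<Rightarrow> 'g" and \<epsilon>' :: "'a \<Rightarrow> 'f" +
  fixes S\<^sub>l S\<^sub>r :: 'a
  assumes nonsplit: "right_perp A (ess_image B A I) \<noteq> left_perp A (ess_image B A I)"
    and S\<^sub>l: "S\<^sub>l \<in> left_perp A (ess_image B A I)" "indecomposable A S\<^sub>l"
    and S\<^sub>r: "S\<^sub>r \<in> right_perp A (ess_image B A I)" "indecomposable A S\<^sub>r"
    and Ext2_S\<^sub>l: "Ext2 A S\<^sub>l S\<^sub>l = {ext2_zero A S\<^sub>l S\<^sub>l}"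
begin

section \<open>The exact sequence joining the two perpendicular simple objects\<close>

abbreviation S' :: 'b where
  "S' \<equiv> obmap L S\<^sub>r"

abbreviation h :: 'f where
  "h \<equiv> \<eta> S\<^sub>r"

lemma simple_S\<^sub>l: "simple A S\<^sub>l" by (rule lp.indecomposable_simple[OF S\<^sub>l(2,1)])

lemma simple_S\<^sub>r: "simple A S\<^sub>r" by (rule rp.indecomposable_simple[OF S\<^sub>r(2,1)])

lemma Obj_S [simp]: "S\<^sub>l \<in> Obj A" "S\<^sub>r \<in> Obj A"
  using A.simpleD(1) simple_S\<^sub>l simple_S\<^sub>r by auto

lemma not_zero_S: "\<not> zero_obj A S\<^sub>l" "\<not> zero_obj A S\<^sub>r"
  using A.simpleD(2) simple_S\<^sub>l simple_S\<^sub>r by auto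

lemma S\<^sub>r_not_left: "S\<^sub>r \<notin> left_perp A Im"
  using perps_eq[OF simple_S\<^sub>r _ S\<^sub>r(1)] nonsplit by blast

lemma S\<^sub>l_not_right: "S\<^sub>l \<notin> right_perp A Im"
  using perps_eq[OF simple_S\<^sub>l S\<^sub>l(1)] nonsplit by blast

lemma not_zero_S': "\<not> zero_obj B S'"
  using S\<^sub>r_not_left by (simp add: left_perp_iff)

lemma h_monic: "monic A h"
proof (rule A.simple_monic[OF simple_S\<^sub>r])
  show "h \<noteq> mzero A S\<^sub>r (tgt A h)"
  proof
    assume "h = mzero A S\<^sub>r (tgt A h)"
    then have "h = mzero A S\<^sub>r (obmap I S')" by simp
    then have "armap L h = mzero B S' (obmap L (obmap I S'))" by (simp add: LI.F.map_zero)
    then show False using B.monic_zero_map[OF B.iso_monic[OF L_unit_iso[OF Obj_S(2)]]] not_zero_S' by simp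
  qed
qed auto

text \<open>A non-zero map out of the simple \<open>S\<^sub>r\<close> is monic and would make
  \<open>S\<^sub>r\<close> left perpendicular.\<close>

lemma map_to_left_perp_zero:
  assumes X: "X \<in> left_perp A Im" and f: "f \<in> Arr A" "src A f = S\<^sub>r" "tgt A f = X"
  shows "f = mzero A S\<^sub>r X"
proof (rule ccontr)
  assume "f \<noteq> mzero A S\<^sub>r X"
  then have "monic A f" using A.simple_monic[OF simple_S\<^sub>r f(1,2)] f(3) by simp
  then show False using left_perp_sub[of f] X f S\<^sub>r_not_left by simp
qed

lemma h_factor:
  assumes pi: "short_exact A h \<pi>" "tgt A \<pi> \<in> left_perp A Im" and g: "g \<in> Arr B" "src B g = S'" "tgt B g = S'"
  shows "\<exists>r \<in> Hom A S\<^sub>r S\<^sub>r. armap I g \<cdot>\<^bsub>A\<^esub> h = h \<cdot>\<^bsub>A\<^esub> r"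
proof -
  note [simp] = g A.short_exactD(1,2)[OF pi(1)]
  have [simp]: "src A \<pi> = obmap I S'" using A.short_exactD(3)[OF pi(1)] by simp
  have "\<pi> \<cdot>\<^bsub>A\<^esub> (armap I g \<cdot>\<^bsub>A\<^esub> h) = mzero A S\<^sub>r (tgt A \<pi>)"
    by (rule map_to_left_perp_zero[OF pi(2)]) auto
  then obtain r where "r \<in> Arr A" "src A r = S\<^sub>r" "tgt A r = S\<^sub>r" "h \<cdot>\<^bsub>A\<^esub> r = armap I g \<cdot>\<^bsub>A\<^esub> h"
    using A.short_exact_lift[OF pi(1), of "armap I g \<cdot>\<^bsub>A\<^esub> h"] by auto
  then show ?thesis by (intro bexI[of _ r]) (auto simp: Hom_iff)
qed

text \<open>Idempotents of the cokernel of \<open>h\<close> lift to endomorphisms of \<open>S'\<close>, which form a division ring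
  isomorphic to that of \<open>S\<^sub>r\<close>; hence the cokernel is indecomposable.\<close>

lemma ex_projection: "\<exists>p. short_exact A h p \<and> tgt A p = S\<^sub>l"
proof -
  obtain \<pi> where c: "is_cokernel A \<pi> h" using A.obtain_cokernel[of h] by auto
  have pi: "short_exact A h \<pi>" by (rule A.short_exact_monic[OF h_monic c])
  note [simp] = A.short_exactD(1,2)[OF pi]
  have src_pi [simp]: "src A \<pi> = obmap I S'" using A.short_exactD(3)[OF pi] by simp
  let ?C = "tgt A \<pi>"
  have pe: "epic A \<pi>" by (rule A.short_exactD(6)[OF pi])
  \<comment> \<open>\<open>L\<close> makes \<open>h\<close> invertible, so it kills
    \<open>\<pi>\<close>; being exact, it kills the cokernel, which is therefore left
    perpendicular.\<close>
  have "armap L \<pi> \<cdot>\<^bsub>B\<^esub> armap L h = mzero B S' (obmap L ?C)"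
    using LI.F.map_cmp[of h \<pi>] A.short_exactD(4)[OF pi] by (simp add: LI.F.map_zero)
  then have "armap L \<pi> = mzero B (obmap L (obmap I S')) (obmap L ?C)"
    using B.epic0[OF B.iso_epic[OF L_unit_iso[OF Obj_S(2)]], of "armap L \<pi>"] by simp
  then have "zero_obj B (obmap L ?C)" using B.epic_zero_map[OF LI.F.map_epic[OF pe]] by simp
  then have Cl: "?C \<in> left_perp A Im" by (simp add: left_perp_iff)
  have bij: "bij_betw (armap L) (Hom A S\<^sub>r S\<^sub>r) (Hom B S' S')"
    by (rule L_End_bij[OF Obj_S(2) h_monic]) (rule h_factor[OF pi Cl])
  have End: "g = mzero B S' S' \<or> iso_arr B g" if g: "g \<in> Arr B" "src B g = S'" "tgt B g = S'" for g
  proof -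
    have "g \<in> Hom B S' S'" using g by (simp add: Hom_iff)
    then obtain r where r: "r \<in> Hom A S\<^sub>r S\<^sub>r" "g = armap L r" using bij by (auto simp: bij_betw_def)
    show ?thesis
    proof (cases "r = mzero A S\<^sub>r S\<^sub>r")
      case True then show ?thesis using r(2) by (simp add: LI.F.map_zero)
    next
      case False
      then have "iso_arr A r" using A.schur[OF simple_S\<^sub>r simple_S\<^sub>r] HomD[OF r(1)] by auto
      then show ?thesis using r(2) LI.F.map_iso by simp
    qed
  qed
  \<comment> \<open>Otherwise \<open>h\<close> would be invertible, and its inverse a non-zero map
    from the image of \<open>I\<close> to the right perpendicular object
    \<open>S\<^sub>r\<close>.\<close>
  have "\<not> zero_obj A ?C"
  proof
    assume z: "zero_obj A ?C"
    have "epic A h" by (rule A.zero_cokernel_epic[OF c z])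
    then have "iso_arr A h" by (rule A.monic_epic_iso[OF h_monic])
    then obtain k where k: "iso_arr A k" "k \<in> Arr A" "src A k = obmap I S'" "tgt A k = S\<^sub>r"
      by (auto elim: A.iso_inv)
    have "k = mzero A (obmap I S') S\<^sub>r" by (rule right_perp_map_zero[OF S\<^sub>r(1) k(2-4)]) simp
    then show False using A.epic_zero_map[OF A.iso_epic[OF k(1)]] k not_zero_S by simp
  qed
  moreover have "zero_obj A X \<or> zero_obj A Y"
    if XY: "X \<in> Obj A" "Y \<in> Obj A" and bp: "biproduct A X Y (?C, i, j, p, q)" for X Y i j p q
  proof -
    note b = A.biproductD[OF bp]
    note [simp] = XY b(2-13)
    obtain f where f: "f \<in> Arr A" "src A f = obmap I S'" "tgt A f = src A \<pi>" "\<pi> \<cdot>\<^bsub>A\<^esub> f = i \<cdot>\<^bsub>A\<^esub> (p \<cdot>\<^bsub>A\<^esub> \<pi>)"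
      by (rule A.lift_through[OF pi, of "obmap I S'" "i \<cdot>\<^bsub>A\<^esub> (p \<cdot>\<^bsub>A\<^esub> \<pi>)"])
        (use right_perp_Ext1[OF S\<^sub>r(1), of S'] in auto)
    obtain g where g: "g \<in> Arr B" "src B g = S'" "tgt B g = S'" "armap I g = f"
      by (rule I_full[OF f(1,2), of S']) (use f in auto)
    from End[OF g(1-3)] show ?thesis
    proof
      assume "g = mzero B S' S'"
      then have "f = mzero A (obmap I S') (obmap I S')" using g by (simp add: LI.G.map_zero)
      then have "(i \<cdot>\<^bsub>A\<^esub> p) \<cdot>\<^bsub>A\<^esub> \<pi> = mzero A (obmap I S') ?C" using f(4) by simp
      then have ip: "i \<cdot>\<^bsub>A\<^esub> p = mzero A ?C ?C" using A.epic0[OF pe, of "i \<cdot>\<^bsub>A\<^esub> p"] by simp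
      have "(p \<cdot>\<^bsub>A\<^esub> (i \<cdot>\<^bsub>A\<^esub> p)) \<cdot>\<^bsub>A\<^esub> i = ident A X" using A.reassoc[OF b(14), of "p \<cdot>\<^bsub>A\<^esub> i"] b(14) by simp
      then have "ident A X = mzero A X X" unfolding ip by simp
      then show ?thesis using XY by (simp add: A.zero_obj_iff)
    next
      assume "iso_arr B g"
      then have "epic A f" using LI.G.map_iso[of g] g(4) A.iso_epic by simp
      then have "epic A (\<pi> \<cdot>\<^bsub>A\<^esub> f)" using pe f by (intro A.epic_cmp) auto
      then have "epic A (i \<cdot>\<^bsub>A\<^esub> (p \<cdot>\<^bsub>A\<^esub> \<pi>))" using f(4) by simp
      then have ie: "epic A i" by (rule A.epic_cancel) auto
      have "q = mzero A ?C Y" using A.epic0[OF ie, of q] b(16) by simp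
      then have "ident A Y = mzero A Y Y" using b(15) by simp
      then show ?thesis using XY by (simp add: A.zero_obj_iff)
    qed
  qed
  moreover have "?C \<in> Obj A" by simp
  ultimately have "indecomposable A ?C" unfolding indecomposable_def by blast
  \<comment> \<open>The left perpendicular category has only one simple object up to isomorphism, so
    \<open>\<pi>\<close> can be corrected by an isomorphism to end in
    \<open>S\<^sub>l\<close>.\<close>
  then have "isomorphic A ?C S\<^sub>l"
    using lp.simple_unique[OF lp.indecomposable_simple[OF _ Cl] simple_S\<^sub>l Cl S\<^sub>l(1)] by blast
  then obtain k where k: "iso_arr A k" "k \<in> Arr A" "src A k = ?C" "tgt A k = S\<^sub>l" by (rule A.isomorphicE)
  note [simp] = k(2-4)
  have "epic A (k \<cdot>\<^bsub>A\<^esub> \<pi>)" by (rule A.epic_cmp[OF pe A.iso_epic[OF k(1)]]) simp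
  moreover have "is_kernel A h (k \<cdot>\<^bsub>A\<^esub> \<pi>)"
  proof (rule A.kernelI[OF _ _ _ h_monic])
    show "(k \<cdot>\<^bsub>A\<^esub> \<pi>) \<cdot>\<^bsub>A\<^esub> h = mzero A (src A h) (tgt A (k \<cdot>\<^bsub>A\<^esub> \<pi>))" using A.short_exactD(4)[OF pi] by simp
    fix g assume g: "g \<in> Arr A" "tgt A g = src A (k \<cdot>\<^bsub>A\<^esub> \<pi>)"
      "(k \<cdot>\<^bsub>A\<^esub> \<pi>) \<cdot>\<^bsub>A\<^esub> g = mzero A (src A g) (tgt A (k \<cdot>\<^bsub>A\<^esub> \<pi>))"
    then have "\<pi> \<cdot>\<^bsub>A\<^esub> g = mzero A (src A g) ?C" using A.monic0[OF A.iso_monic[OF k(1)], of "\<pi> \<cdot>\<^bsub>A\<^esub> g"] by simp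
    then show "\<exists>u \<in> Arr A. src A u = src A g \<and> tgt A u = src A h \<and> h \<cdot>\<^bsub>A\<^esub> u = g"
      using A.short_exact_lift[OF pi, of g] g by auto
  qed auto
  ultimately have "short_exact A h (k \<cdot>\<^bsub>A\<^esub> \<pi>)" by (rule A.short_exact_epic)
  then show ?thesis by (intro exI[of _ "k \<cdot>\<^bsub>A\<^esub> \<pi>"]) simp
qed

definition p :: 'f where
  "p = (SOME p. short_exact A h p \<and> tgt A p = S\<^sub>l)"

lemma h_p: "short_exact A h p" and tgt_p [simp]: "tgt A p = S\<^sub>l"
  using someI_ex[OF ex_projection] by (auto simp: p_def)

lemma p_simps [simp]: "p \<in> Arr A" "src A p = obmap I S'"
  using A.short_exactD(2,3)[OF h_p] by auto

lemma p_h: "p \<cdot>\<^bsub>A\<^esub> h = mzero A S\<^sub>r S\<^sub>l"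
  using A.short_exactD(4)[OF h_p] by simp

lemma p_epic: "epic A p"
  by (rule A.short_exactD(6)[OF h_p])

lemma L_End_S\<^sub>r: "bij_betw (armap L) (Hom A S\<^sub>r S\<^sub>r) (Hom B S' S')"
  by (rule L_End_bij[OF Obj_S(2) h_monic]) (rule h_factor[OF h_p], use S\<^sub>l in auto)

text \<open>Let \<open>c\<close> be the cokernel of a subobject \<open>f\<close>. If
  \<open>armap I c\<close> kills \<open>h\<close>, adjunction makes \<open>c\<close> zero and
  \<open>f\<close> invertible. Otherwise it is monic on \<open>S\<^sub>r\<close>, so the subobject
  meets \<open>S\<^sub>r\<close> in zero and embeds into \<open>S\<^sub>l\<close>; it cannot be all
  of \<open>S\<^sub>l\<close>, which has no non-zero maps into the image of
  \<open>I\<close>.\<close>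

lemma simple_S': "simple B S'"
  unfolding simple_def
proof (intro conjI allI impI)
  show "S' \<in> Obj B" "\<not> zero_obj B S'" using not_zero_S' by auto
  fix f assume f: "monic B f \<and> tgt B f = S'"
  then have [simp]: "f \<in> Arr B" "tgt B f = S'" and fm: "monic B f" using B.monic_Arr by auto
  obtain c where c: "is_cokernel B c f" using B.obtain_cokernel[of f] by auto
  note [simp] = B.cokernelD(1,3)[OF c]
  note se = B.short_exact_monic[OF fm c]
  show "zero_obj B (src B f) \<or> iso_arr B f"
  proof (cases "armap I c \<cdot>\<^bsub>A\<^esub> h = mzero A S\<^sub>r (obmap I (tgt B c))")
    case True
    then have "armap I c \<cdot>\<^bsub>A\<^esub> h = armap I (mzero B S' (tgt B c)) \<cdot>\<^bsub>A\<^esub> h" by (simp add: LI.G.map_zero)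
    then have "c = mzero B S' (tgt B c)" by (rule LI.unit_cancel[of _ S\<^sub>r]) auto
    then have "zero_obj B (tgt B c)" using B.epic_zero_map[OF B.short_exactD(6)[OF se]] by simp
    then show ?thesis using B.zero_cokernel_epic[OF c] B.monic_epic_iso[OF fm] by simp
  next
    case False
    then have ch: "monic A (armap I c \<cdot>\<^bsub>A\<^esub> h)" by (intro A.simple_monic[OF simple_S\<^sub>r]) auto
    have cf: "armap I c \<cdot>\<^bsub>A\<^esub> armap I f = mzero A (obmap I (src B f)) (obmap I (tgt B c))"
      using B.cokernelD(4)[OF c] LI.G.map_cmp[of f c] LI.G.map_zero by simp
    have m: "monic A (p \<cdot>\<^bsub>A\<^esub> armap I f)"
      unfolding A.monic_iff
    proof (intro conjI ballI impI)
      fix x assume x: "x \<in> Arr A" "tgt A x = src A (p \<cdot>\<^bsub>A\<^esub> armap I f)"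
        "(p \<cdot>\<^bsub>A\<^esub> armap I f) \<cdot>\<^bsub>A\<^esub> x = mzero A (src A x) (tgt A (p \<cdot>\<^bsub>A\<^esub> armap I f))"
      note [simp] = x(1) x(2)[simplified]
      obtain y where y: "y \<in> Arr A" "src A y = src A x" "tgt A y = S\<^sub>r" "h \<cdot>\<^bsub>A\<^esub> y = armap I f \<cdot>\<^bsub>A\<^esub> x"
        using A.short_exact_lift[OF h_p, of "armap I f \<cdot>\<^bsub>A\<^esub> x"] x(3) by auto
      have "(armap I c \<cdot>\<^bsub>A\<^esub> h) \<cdot>\<^bsub>A\<^esub> y = mzero A (src A x) (obmap I (tgt B c))"
        using y A.reassoc[OF cf, of x] by simp
      then have "y = mzero A (src A x) S\<^sub>r" using A.monic0[OF ch, of y] y by simp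
      then have "armap I f \<cdot>\<^bsub>A\<^esub> x = mzero A (src A x) (obmap I S')" using y(4) by simp
      then show "x = mzero A (src A x) (src A (p \<cdot>\<^bsub>A\<^esub> armap I f))"
        using A.monic0[OF LI.G.map_monic[OF fm], of x] by simp
    qed simp
    have "zero_obj A (obmap I (src B f)) \<or> iso_arr A (p \<cdot>\<^bsub>A\<^esub> armap I f)"
      using A.simpleD(3)[OF simple_S\<^sub>l m] by simp
    moreover have "\<not> iso_arr A (p \<cdot>\<^bsub>A\<^esub> armap I f)"
    proof
      assume "iso_arr A (p \<cdot>\<^bsub>A\<^esub> armap I f)"
      then obtain k where k: "iso_arr A k" "k \<in> Arr A" "src A k = S\<^sub>l" "tgt A k = obmap I (src B f)"
        by (auto elim: A.iso_inv)
      have "k = mzero A S\<^sub>l (obmap I (src B f))" by (rule left_perp_map_zero[OF S\<^sub>l(1) k(2-4)]) simp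
      then show False using A.monic_zero_map[OF A.iso_monic[OF k(1)]] k not_zero_S by simp
    qed
    ultimately show ?thesis using I_reflects_zero by simp
  qed
qed

text \<open>\<open>R\<close> kills \<open>S\<^sub>r\<close>, so applied to the exact sequence it
  makes \<open>p\<close> invertible; and the unit at \<open>S'\<close> is invertible.\<close>

lemma R_S\<^sub>l: "isomorphic B S' (obmap R S\<^sub>l)"
proof -
  have se: "short_exact B (armap R h) (armap R p)" by (rule IR.G.map_short_exact[OF h_p])
  have "zero_obj B (src B (armap R h))" using S\<^sub>r(1) by (simp add: right_perp_iff)
  then have "iso_arr B (armap R p)" by (rule B.short_exact_zero_left[OF se])
  then have "iso_arr B (armap R p \<cdot>\<^bsub>B\<^esub> \<eta>' S')" by (intro B.iso_cmp[OF unit_iso]) auto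
  then show ?thesis by (rule B.isomorphicI) auto
qed

lemma simple_R_S\<^sub>l: "simple B (obmap R S\<^sub>l)"
  by (rule B.simple_iso[OF simple_S' R_S\<^sub>l])

lemma counit_S\<^sub>l_epic: "epic A (\<epsilon>' S\<^sub>l)"
proof (rule A.simple_epic[OF simple_S\<^sub>l])
  show "\<epsilon>' S\<^sub>l \<noteq> mzero A (src A (\<epsilon>' S\<^sub>l)) S\<^sub>l"
  proof
    assume "\<epsilon>' S\<^sub>l = mzero A (src A (\<epsilon>' S\<^sub>l)) S\<^sub>l"
    then have "\<epsilon>' S\<^sub>l = mzero A (obmap I (obmap R S\<^sub>l)) S\<^sub>l" by simp
    then have "armap R (\<epsilon>' S\<^sub>l) = mzero B (obmap R (obmap I (obmap R S\<^sub>l))) (obmap R S\<^sub>l)" by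
      (simp add: IR.G.map_zero)
    then show False
      using B.epic_zero_map[OF B.iso_epic[OF R_counit_iso[OF Obj_S(1)]]] S\<^sub>l_not_right by
        (simp add: right_perp_iff)
  qed
qed auto

text \<open>The kernel of the counit at \<open>S\<^sub>l\<close> is right perpendicular, since
  \<open>R\<close> makes the counit invertible. A non-zero map from it to \<open>S\<^sub>l\<close>
  would be epic and make \<open>S\<^sub>l\<close> right perpendicular. So endomorphisms of
  \<open>obmap R S\<^sub>l\<close> descend along the counit.\<close>

lemma R_End_S\<^sub>l: "bij_betw (armap R) (Hom A S\<^sub>l S\<^sub>l) (Hom B (obmap R S\<^sub>l) (obmap R S\<^sub>l))"
proof (rule R_End_bij[OF Obj_S(1) counit_S\<^sub>l_epic])
  fix g assume g: "g \<in> Arr B" "src B g = obmap R S\<^sub>l" "tgt B g = obmap R S\<^sub>l"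
  note [simp] = g
  obtain k where k: "is_kernel A k (\<epsilon>' S\<^sub>l)" using A.obtain_kernel[of "\<epsilon>' S\<^sub>l"] by auto
  note se = A.short_exact_epic[OF counit_S\<^sub>l_epic k]
  note [simp] = A.kernelD(1)[OF k]
  have [simp]: "tgt A k = obmap I (obmap R S\<^sub>l)" using A.kernelD(3)[OF k] by simp
  have "armap R (\<epsilon>' S\<^sub>l) \<cdot>\<^bsub>B\<^esub> armap R k = mzero B (obmap R (src A k)) (obmap R S\<^sub>l)"
    using IR.G.map_cmp[of k "\<epsilon>' S\<^sub>l"] A.kernelD(4)[OF k] by (simp add: IR.G.map_zero)
  then have "armap R k = mzero B (obmap R (src A k)) (obmap R (obmap I (obmap R S\<^sub>l)))"
    using B.monic0[OF B.iso_monic[OF R_counit_iso[OF Obj_S(1)]], of "armap R k"] by simp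
  then have "zero_obj B (obmap R (src A k))"
    using B.monic_zero_map[OF IR.G.map_monic[OF A.short_exactD(5)[OF se]]] by simp
  then have K: "src A k \<in> right_perp A Im" by (simp add: right_perp_iff)
  let ?f = "\<epsilon>' S\<^sub>l \<cdot>\<^bsub>A\<^esub> (armap I g \<cdot>\<^bsub>A\<^esub> k)"
  have "?f = mzero A (src A k) S\<^sub>l"
  proof (rule ccontr)
    assume "?f \<noteq> mzero A (src A k) S\<^sub>l"
    then have "epic A ?f" by (intro A.simple_epic[OF simple_S\<^sub>l]) auto
    then show False using right_perp_quot[of ?f] K S\<^sub>l_not_right by simp
  qed
  then obtain s where "s \<in> Arr A" "src A s = S\<^sub>l" "tgt A s = S\<^sub>l" "s \<cdot>\<^bsub>A\<^esub> \<epsilon>' S\<^sub>l = \<epsilon>' S\<^sub>l \<cdot>\<^bsub>A\<^esub> armap I g"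
    using A.short_exact_colift[OF se, of "\<epsilon>' S\<^sub>l \<cdot>\<^bsub>A\<^esub> armap I g"] by auto
  then show "\<exists>s \<in> Hom A S\<^sub>l S\<^sub>l. \<epsilon>' S\<^sub>l \<cdot>\<^bsub>A\<^esub> armap I g = s \<cdot>\<^bsub>A\<^esub> \<epsilon>' S\<^sub>l"
    by (intro bexI[of _ s]) (auto simp: Hom_iff)
qed

text \<open>\<open>L\<close> turns a subobject of \<open>obmap I U\<close> into one of
  \<open>U\<close>. If the result is zero, the subobject is left perpendicular and has no non-zero
  map to the image of \<open>I\<close>. If it is everything, the cokernel is left perpendicular;
  were it non-zero, it would map non-trivially to \<open>S\<^sub>l\<close>, and the transpose of the
  composite would identify \<open>U\<close> with \<open>obmap R S\<^sub>l\<close>, that is, with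
  \<open>S'\<close>.\<close>

lemma simple_I:
  assumes U: "simple B U" "\<not> isomorphic B U S'"
  shows "simple A (obmap I U)"
  unfolding simple_def
proof (intro conjI allI impI)
  note UO [simp] = B.simpleD(1)[OF U(1)]
  show "obmap I U \<in> Obj A" by simp
  show "\<not> zero_obj A (obmap I U)" using I_reflects_zero B.simpleD(2)[OF U(1)] by auto
  fix f assume f: "monic A f \<and> tgt A f = obmap I U"
  then have [simp]: "f \<in> Arr A" "tgt A f = obmap I U" and fm: "monic A f" using A.monic_Arr by auto
  have "monic B (\<epsilon> U \<cdot>\<^bsub>B\<^esub> armap L f)"
    by (rule B.monic_cmp[OF LI.F.map_monic[OF fm] B.iso_monic[OF counit_iso[OF UO]]]) simp
  with B.simpleD(3)[OF U(1) this]
  consider "zero_obj B (obmap L (src A f))" | "iso_arr B (\<epsilon> U \<cdot>\<^bsub>B\<^esub> armap L f)" by auto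
  then show "zero_obj A (src A f) \<or> iso_arr A f"
  proof cases
    case 1
    then have "src A f \<in> left_perp A Im" by (simp add: left_perp_iff)
    then have "f = mzero A (src A f) (obmap I U)" by (rule left_perp_map_zero) auto
    then show ?thesis using A.monic_zero_map[OF fm] by simp
  next
    case 2
    obtain e where e: "e \<in> Arr B" "iso_arr B e" "src B e = U" "tgt B e = obmap L (obmap I U)"
      "e \<cdot>\<^bsub>B\<^esub> \<epsilon> U = ident B (obmap L (obmap I U))"
      using B.iso_inv[OF counit_iso[OF UO]] by auto
    have "epic B (e \<cdot>\<^bsub>B\<^esub> (\<epsilon> U \<cdot>\<^bsub>B\<^esub> armap L f))"
      by (rule B.epic_cmp[OF B.iso_epic[OF 2] B.iso_epic[OF e(2)]]) (use e in simp)
    then have Lf: "epic B (armap L f)" using B.reassoc[OF e(5), of "armap L f"] e by simp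
    obtain c where c: "is_cokernel A c f" using A.obtain_cokernel[of f] by auto
    note [simp] = A.cokernelD(1,3)[OF c]
    have "armap L c \<cdot>\<^bsub>B\<^esub> armap L f = mzero B (obmap L (src A f)) (obmap L (tgt A c))"
      using LI.F.map_cmp[of f c] A.cokernelD(4)[OF c] by (simp add: LI.F.map_zero)
    then have "armap L c = mzero B (obmap L (obmap I U)) (obmap L (tgt A c))"
      using B.epic0[OF Lf, of "armap L c"] by simp
    then have "zero_obj B (obmap L (tgt A c))"
      using B.epic_zero_map[OF LI.F.map_epic[OF A.cokernel_epic[OF c]]] by simp
    then have Q: "tgt A c \<in> left_perp A Im" by (simp add: left_perp_iff)
    have "zero_obj A (tgt A c)"
    proof (rule ccontr)
      assume "\<not> zero_obj A (tgt A c)"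
      then obtain g where g: "g \<in> Arr A" "src A g = tgt A c" "tgt A g = S\<^sub>l" "g \<noteq> mzero A (tgt A c) S\<^sub>l"
        using lp.nonzero_map[OF Q S\<^sub>l(1) _ not_zero_S(1)] by blast
      note [simp] = g(1-3)
      have gc: "g \<cdot>\<^bsub>A\<^esub> c \<noteq> mzero A (obmap I U) S\<^sub>l"
        using A.epic0[OF A.cokernel_epic[OF c], of g] g(4) by auto
      let ?t = "armap R (g \<cdot>\<^bsub>A\<^esub> c) \<cdot>\<^bsub>B\<^esub> \<eta>' U"
      have "\<epsilon>' S\<^sub>l \<cdot>\<^bsub>A\<^esub> armap I ?t = g \<cdot>\<^bsub>A\<^esub> c" by (rule IR.transpose_left) auto
      then have "?t \<noteq> mzero B U (obmap R S\<^sub>l)" using gc by (auto simp: LI.G.map_zero)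
      then have "iso_arr B ?t" by (intro B.schur[OF U(1) simple_R_S\<^sub>l]) auto
      then have "isomorphic B U (obmap R S\<^sub>l)" by (rule B.isomorphicI) auto
      then show False using U(2) B.isomorphic_trans[OF _ B.isomorphic_sym[OF R_S\<^sub>l]] by blast
    qed
    then have "epic A f" by (rule A.zero_cokernel_epic[OF c])
    then show ?thesis using A.monic_epic_iso[OF fm] by simp
  qed
qed

lemma not_isomorphic_I_S:
  assumes U: "U \<in> Obj B"
  shows "\<not> isomorphic A (obmap I U) S\<^sub>l" "\<not> isomorphic A (obmap I U) S\<^sub>r"
proof -
  show "\<not> isomorphic A (obmap I U) S\<^sub>l"
  proof
    assume "isomorphic A (obmap I U) S\<^sub>l"
    then obtain k where k: "iso_arr A k" "k \<in> Arr A" "src A k = S\<^sub>l" "tgt A k = obmap I U"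
      using A.isomorphicE[OF A.isomorphic_sym] by blast
    have "k = mzero A S\<^sub>l (obmap I U)" by (rule left_perp_map_zero[OF S\<^sub>l(1) k(2-4) U])
    then show False using A.monic_zero_map[OF A.iso_monic[OF k(1)]] k not_zero_S by simp
  qed
  show "\<not> isomorphic A (obmap I U) S\<^sub>r"
  proof
    assume "isomorphic A (obmap I U) S\<^sub>r"
    then obtain k where k: "iso_arr A k" "k \<in> Arr A" "src A k = obmap I U" "tgt A k = S\<^sub>r"
      using A.isomorphicE by blast
    have "k = mzero A (obmap I U) S\<^sub>r" by (rule right_perp_map_zero[OF S\<^sub>r(1) k(2-4) U])
    then show False using A.epic_zero_map[OF A.iso_epic[OF k(1)]] k not_zero_S by simp
  qed
qed

text \<open>As \<open>T\<close> lies in neither perpendicular category, unit and counit at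
  \<open>T\<close> are non-zero, hence monic and epic by simplicity. So \<open>T\<close> is the
  image of their composite.\<close>

lemma simple_from_I:
  assumes T: "simple A T" "\<not> isomorphic A T S\<^sub>l" "\<not> isomorphic A T S\<^sub>r"
  obtains U where "simple B U" "\<not> isomorphic B U S'" "isomorphic A (obmap I U) T"
proof -
  note TO [simp] = A.simpleD(1)[OF T(1)]
  have "T \<notin> left_perp A Im" using lp.simple_unique[OF T(1) simple_S\<^sub>l _ S\<^sub>l(1)] T(2) by blast
  then have L: "\<not> zero_obj B (obmap L T)" by (simp add: left_perp_iff)
  have "T \<notin> right_perp A Im" using rp.simple_unique[OF T(1) simple_S\<^sub>r _ S\<^sub>r(1)] T(3) by blast
  then have R: "\<not> zero_obj B (obmap R T)" by (simp add: right_perp_iff)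
  have m: "monic A (\<eta> T)"
  proof (rule A.simple_monic[OF T(1)])
    show "\<eta> T \<noteq> mzero A T (tgt A (\<eta> T))"
    proof
      assume "\<eta> T = mzero A T (tgt A (\<eta> T))"
      then have "\<eta> T = mzero A T (obmap I (obmap L T))" by simp
      then have "armap L (\<eta> T) = mzero B (obmap L T) (obmap L (obmap I (obmap L T)))" by
        (simp add: LI.F.map_zero)
      then show False using B.monic_zero_map[OF B.iso_monic[OF L_unit_iso[OF TO]]] L by simp
    qed
  qed auto
  have e: "epic A (\<epsilon>' T)"
  proof (rule A.simple_epic[OF T(1)])
    show "\<epsilon>' T \<noteq> mzero A (src A (\<epsilon>' T)) T"
    proof
      assume "\<epsilon>' T = mzero A (src A (\<epsilon>' T)) T"
      then have "\<epsilon>' T = mzero A (obmap I (obmap R T)) T" by simp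
      then have "armap R (\<epsilon>' T) = mzero B (obmap R (obmap I (obmap R T))) (obmap R T)" by
        (simp add: IR.G.map_zero)
      then show False using B.epic_zero_map[OF B.iso_epic[OF R_counit_iso[OF TO]]] R by simp
    qed
  qed auto
  \<comment> \<open>Fullness writes the composite as \<open>armap I g\<close>. Its image is formed
    in \<open>B\<close> and preserved by the exact \<open>I\<close>, so uniqueness of images
    identifies \<open>T\<close> with an object of the essential image.\<close>
  obtain g where g: "g \<in> Arr B" "src B g = obmap R T" "tgt B g = obmap L T" "armap I g = \<eta> T \<cdot>\<^bsub>A\<^esub> \<epsilon>' T"
    by (rule I_full[of "\<eta> T \<cdot>\<^bsub>A\<^esub> \<epsilon>' T" "obmap R T" "obmap L T"]) auto
  obtain m' e' where me: "monic B m'" "epic B e'" "src B m' = tgt B e'" "g = m' \<cdot>\<^bsub>B\<^esub> e'"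
    "src B e' = src B g" "tgt B m' = tgt B g"
    using B.image_factor[OF g(1)] by metis
  note [simp] = B.monic_Arr[OF me(1)] B.epic_Arr[OF me(2)] me(3)
  let ?Z = "tgt B e'"
  have eq: "armap I m' \<cdot>\<^bsub>A\<^esub> armap I e' = \<eta> T \<cdot>\<^bsub>A\<^esub> \<epsilon>' T" using g(4) me(4) LI.G.map_cmp[of e' m'] by simp
  have "isomorphic A (tgt A (armap I e')) (tgt A (\<epsilon>' T))"
    by (rule A.image_unique[OF LI.G.map_monic[OF me(1)] m LI.G.map_epic[OF me(2)] e eq]) auto
  then have i: "isomorphic A (obmap I ?Z) T" by simp
  have sI: "simple A (obmap I ?Z)" by (rule A.simple_iso[OF T(1) A.isomorphic_sym[OF i]])
  have sZ: "simple B ?Z"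
    unfolding simple_def
  proof (intro conjI allI impI)
    show "\<not> zero_obj B ?Z" using LI.G.map_zero_obj A.simpleD(2)[OF sI] by blast
    fix f assume f: "monic B f \<and> tgt B f = ?Z"
    then have fA: "f \<in> Arr B" using B.monic_Arr by blast
    have "zero_obj A (obmap I (src B f)) \<or> iso_arr A (armap I f)"
      using A.simpleD(3)[OF sI LI.G.map_monic, of f] f fA by simp
    then show "zero_obj B (src B f) \<or> iso_arr B f" using I_reflects_zero I_reflects_iso fA by auto
  qed simp
  \<comment> \<open>\<open>obmap I S'\<close> is not simple: \<open>h\<close> embeds the non-zero
    \<open>S\<^sub>r\<close> with non-zero quotient \<open>S\<^sub>l\<close>.\<close>
  moreover have "\<not> isomorphic B ?Z S'"
  proof
    assume "isomorphic B ?Z S'"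
    then have "isomorphic A (obmap I ?Z) (obmap I S')" by (rule LI.G.map_isomorphic)
    then have sS: "simple A (obmap I S')" by (rule A.simple_iso[OF sI])
    have "iso_arr A h"
      using A.simpleD(3)[OF sS h_monic] not_zero_S by simp
    then have "p = mzero A (obmap I S') S\<^sub>l" using A.epic0[OF A.iso_epic, of h p] p_h by simp
    then show False using A.epic_zero_map[OF p_epic] not_zero_S by simp
  qed
  ultimately show thesis using that i by blast
qed

end

section \<open>Valuations\<close>

lemma (in div_module) singleton_basis:
  assumes x: "x \<in> carrier M" and gen: "\<And>v. v \<in> carrier M \<Longrightarrow> \<exists>r \<in> carrier R. v = r \<odot> x"
    and free: "\<And>r. \<lbrakk>r \<in> carrier R; r \<odot> x = \<zero>\<rbrakk> \<Longrightarrow> r = \<zero>\<^bsub>R\<^esub>"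
  shows "basis R M {x}"
proof -
  have sum: "(\<Oplus>y \<in> {x}. c y \<odot> y) = c x \<odot> x" if "c x \<in> carrier R" for c
    using x that by (subst finsum_insert) auto
  have "c x = \<zero>\<^bsub>R\<^esub>" if "c x \<in> carrier R" "(\<Oplus>y \<in> {x}. c y \<odot> y) = \<zero>" for c
    using free[of "c x"] sum[of c] that by simp
  then have "independent R M {x}"
    unfolding independent_def using x by (auto simp: subset_singleton_iff)
  moreover have "spans R M {x}"
    unfolding spans_def
  proof (intro conjI ballI)
    fix v assume "v \<in> carrier M"
    then obtain r where r: "r \<in> carrier R" "v = r \<odot> x" using gen by blast
    show "\<exists>F c. finite F \<and> F \<subseteq> {x} \<and> c \<in> F \<rightarrow> carrier R \<and> v = (\<Oplus>x \<in> F. c x \<odot> x)"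
    proof (intro exI[of _ "{x}"] exI[of _ "\<lambda>_. r"] conjI)
      show "v = (\<Oplus>x \<in> {x}. r \<odot> x)" using sum[of "\<lambda>_. r"] r by simp
    qed (use r in auto)
  qed (use x in simp)
  ultimately show ?thesis by (simp add: basis_def)
qed

lemma (in div_module) dim_one:
  assumes "basis R M {x}"
  shows "(dim R M, card_of {()}) \<in> ordIso"
proof -
  have "bij_betw (\<lambda>_. ()) {x} {()}" by (simp add: bij_betw_def)
  then show ?thesis using ordIso_transitive[OF dim_basis[OF assms] card_of_ordIsoI] by blast
qed

lemma (in abelian_category) Ext1_eqI:
  assumes x: "\<xi> \<in> Ext1 C X Y" and z: "\<zeta> \<in> Ext1 C X Y"
    and eq: "baer_sum C X Y \<xi> (ext_pushout C X Y (mneg (ident C Y)) \<zeta>) = ext_zero C X Y"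
  shows "\<xi> = \<zeta>"
proof -
  have O: "X \<in> Obj C" "Y \<in> Obj C" using Ext1_Obj[OF x] by auto
  have n: "ext_pushout C X Y (mneg (ident C Y)) \<zeta> \<in> Ext1 C X Y"
    by (rule ext_pushout_Ext1[OF z]) (use O in \<open>simp add: Hom_iff\<close>)
  have "\<xi> = baer_sum C X Y \<xi> (ext_zero C X Y)"
    using baer_sum_zero[OF x] baer_sum_comm[OF x ext_zero_Ext1[OF O]] by simp
  also have "\<dots> = baer_sum C X Y (ext_zero C X Y) \<zeta>"
    using baer_sum_assoc[OF x n z] baer_sum_neg[OF z] eq by simp
  also have "\<dots> = \<zeta>" by (rule baer_sum_zero[OF z])
  finally show ?thesis .
qed

context nonsplit_recollement
begin

section \<open>The valuations of a non-split expansion\<close>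

lemma L_I_isomorphic: "U \<in> Obj B \<Longrightarrow> isomorphic B (obmap L (obmap I U)) U"
  by (rule B.isomorphicI[OF counit_iso]) auto

lemma valuation_I_I:
  assumes U: "simple B U" "\<not> isomorphic B U S'" and V: "simple B V" "\<not> isomorphic B V S'"
  shows "same_valuation (valuation A (obmap I U) (obmap I V)) (valuation B U V)"
proof -
  note O = B.simpleD(1)[OF U(1)] B.simpleD(1)[OF V(1)]
  note i = L_I_isomorphic[OF O(1)]
  have sL: "simple B (obmap L (obmap I U))" by (rule B.simple_iso[OF U(1) B.isomorphic_sym[OF i]])
  have "same_valuation (valuation B (obmap L (obmap I U)) V) (valuation A (obmap I U) (obmap I V))"
    by (rule LI.valuation_adjunction[OF simple_I[OF U] sL V(1) simple_I[OF V] L_End_bij_I[OF O(1)]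
      I_End_bij[OF O(2)]])
  from same_valuation_trans[OF same_valuation_sym[OF this] B.valuation_iso_left[OF sL i V(1)]]
  show ?thesis .
qed

lemma valuation_I_S\<^sub>l:
  assumes U: "simple B U" "\<not> isomorphic B U S'"
  shows "same_valuation (valuation A (obmap I U) S\<^sub>l) (valuation B U S')"
proof -
  have "same_valuation (valuation A (obmap I U) S\<^sub>l) (valuation B U (obmap R S\<^sub>l))"
    by (rule IR.valuation_adjunction[OF U(1) simple_I[OF U] simple_S\<^sub>l simple_R_S\<^sub>l I_End_bij[OF
      B.simpleD(1)[OF U(1)]] R_End_S\<^sub>l])
  from same_valuation_trans[OF this B.valuation_iso_right[OF U(1) simple_R_S\<^sub>l B.isomorphic_sym[OF R_S\<^sub>l]]]
  show ?thesis .
qed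

lemma valuation_S\<^sub>r_I:
  assumes V: "simple B V" "\<not> isomorphic B V S'"
  shows "same_valuation (valuation A S\<^sub>r (obmap I V)) (valuation B S' V)"
  by (rule same_valuation_sym[OF LI.valuation_adjunction[OF simple_S\<^sub>r simple_S' V(1) simple_I[OF V]
    L_End_S\<^sub>r I_End_bij[OF B.simpleD(1)[OF V(1)]]]])

lemma h_Hom: "h \<in> Hom A S\<^sub>r (obmap I S')"
  by (simp add: Hom_iff)

text \<open>If \<open>h\<close> lifts to the middle term \<open>E\<close> of an extension of \<open>I S'\<close> by \<open>S\<^sub>l\<close>, then the quotient
  \<open>E / S\<^sub>r\<close> is an extension of \<open>S\<^sub>l\<close> by itself and therefore splits.\<close>

lemma pullback_h_zero:
  assumes x: "\<xi> \<in> Ext1 A (obmap I S') S\<^sub>l" and z: "ext_pullback A S\<^sub>r S\<^sub>l h \<xi> = ext_zero A S\<^sub>r S\<^sub>l"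
  shows "\<xi> = ext_zero A (obmap I S') S\<^sub>l"
proof -
  obtain i q where E: "(i, q) \<in> extensions A (obmap I S') S\<^sub>l" "\<xi> = A.ext_class (obmap I S') S\<^sub>l (i, q)"
    using A.Ext1_cases[OF x] by (metis surj_pair)
  have e: "short_exact A i q" "src A i = S\<^sub>l" "tgt A q = obmap I S'" "i \<in> Arr A" "q \<in> Arr A"
    "src A q = tgt A i" "q \<cdot>\<^bsub>A\<^esub> i = mzero A S\<^sub>l (obmap I S')"
    using A.extensionsE[OF E(1)] by auto
  note [simp] = e(2-7)
  obtain t where t: "t \<in> Arr A" "src A t = S\<^sub>r" "tgt A t = tgt A i" "q \<cdot>\<^bsub>A\<^esub> t = h"
    using A.ext_pullback_zero_iff[OF E(1) h_Hom] z E(2) by (auto simp: Hom_iff)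
  note [simp] = t(1-3)
  have tm: "monic A t" by (rule A.monic_cancel[of q]) (use h_monic t(4) in auto)
  obtain c where c: "is_cokernel A c t" using A.obtain_cokernel[of t] by auto
  note [simp] = A.cokernelD(1)[OF c]
  have [simp]: "src A c = tgt A i" using A.cokernelD(3)[OF c] by simp
  note se = A.short_exact_monic[OF tm c]
  \<comment> \<open>The subobjects \<open>S\<^sub>l\<close> and \<open>S\<^sub>r\<close> of the
    middle term meet in zero, since \<open>q\<close> kills the first and is monic on the
    second.\<close>
  have ci: "monic A (c \<cdot>\<^bsub>A\<^esub> i)"
    unfolding A.monic_iff
  proof (intro conjI ballI impI)
    fix g assume g: "g \<in> Arr A" "tgt A g = src A (c \<cdot>\<^bsub>A\<^esub> i)"
      "(c \<cdot>\<^bsub>A\<^esub> i) \<cdot>\<^bsub>A\<^esub> g = mzero A (src A g) (tgt A (c \<cdot>\<^bsub>A\<^esub> i))"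
    have [simp]: "g \<in> Arr A" "tgt A g = S\<^sub>l" using g by auto
    obtain y where y: "y \<in> Arr A" "src A y = src A g" "tgt A y = S\<^sub>r" "t \<cdot>\<^bsub>A\<^esub> y = i \<cdot>\<^bsub>A\<^esub> g"
      using A.short_exact_lift[OF se, of "i \<cdot>\<^bsub>A\<^esub> g"] g(3) by auto
    have "h \<cdot>\<^bsub>A\<^esub> y = q \<cdot>\<^bsub>A\<^esub> (t \<cdot>\<^bsub>A\<^esub> y)" using A.reassoc[OF t(4), of y] y by simp
    also have "\<dots> = mzero A (src A g) (obmap I S')" unfolding y(4) using A.reassoc[OF e(7), of g] by simp
    finally have "y = mzero A (src A g) S\<^sub>r" using A.monic0[OF h_monic, of y] y by simp
    then have "i \<cdot>\<^bsub>A\<^esub> g = mzero A (src A g) (tgt A i)" using y(4)[symmetric] by simp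
    then show "g = mzero A (src A g) (src A (c \<cdot>\<^bsub>A\<^esub> i))"
      using A.monic0[OF A.short_exactD(5)[OF e(1)], of g] by simp
  qed simp
  \<comment> \<open>\<open>L\<close> kills \<open>S\<^sub>l\<close>, so it inverts \<open>q\<close>.
    As it inverts \<open>h\<close> as well, it makes \<open>t\<close> epic and kills the quotient by
    \<open>S\<^sub>r\<close>, which is therefore left perpendicular.\<close>
  have "short_exact B (armap L i) (armap L q)" by (rule LI.F.map_short_exact[OF e(1)])
  then have Lq: "iso_arr B (armap L q)"
    using B.short_exact_zero_left S\<^sub>l(1) by (simp add: left_perp_iff)
  obtain k where k: "k \<in> Arr B" "iso_arr B k" "src B k = obmap L (obmap I S')" "tgt B k = obmap L (tgt A i)"
    "k \<cdot>\<^bsub>B\<^esub> armap L q = ident B (obmap L (tgt A i))"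
    using B.iso_inv[OF Lq] by auto
  have "armap L t = (k \<cdot>\<^bsub>B\<^esub> armap L q) \<cdot>\<^bsub>B\<^esub> armap L t" using k(5) by simp
  also have "\<dots> = k \<cdot>\<^bsub>B\<^esub> (armap L q \<cdot>\<^bsub>B\<^esub> armap L t)" by (rule B.assoc) (use k in auto)
  also have "armap L q \<cdot>\<^bsub>B\<^esub> armap L t = armap L h" using t(4) LI.F.map_cmp[of t q] by simp
  finally have "epic B (armap L t)"
    using B.epic_cmp[OF B.iso_epic[OF L_unit_iso[OF Obj_S(2)]] B.iso_epic[OF k(2)]] k by simp
  moreover have "armap L c \<cdot>\<^bsub>B\<^esub> armap L t = mzero B (obmap L S\<^sub>r) (obmap L (tgt A c))"
    using LI.F.map_cmp[of t c] A.cokernelD(4)[OF c] by (simp add: LI.F.map_zero)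
  ultimately have "armap L c = mzero B (obmap L (tgt A i)) (obmap L (tgt A c))"
    using B.epic0[of "armap L t" "armap L c"] by simp
  then have "zero_obj B (obmap L (tgt A c))"
    using B.epic_zero_map[OF LI.F.map_epic[OF A.short_exactD(6)[OF se]]] by simp
  then have "tgt A c \<in> left_perp A Im" by (simp add: left_perp_iff)
  then obtain r where r: "r \<in> Arr A" "src A r = tgt A c" "tgt A r = S\<^sub>l" "r \<cdot>\<^bsub>A\<^esub> (c \<cdot>\<^bsub>A\<^esub> i) = ident A S\<^sub>l"
    using A.perp_split[OF left_mod ci] S\<^sub>l(1) by auto
  have "\<exists>t \<in> Hom A (tgt A i) S\<^sub>l. t \<cdot>\<^bsub>A\<^esub> i = ident A S\<^sub>l"
    using r by (intro bexI[of _ "r \<cdot>\<^bsub>A\<^esub> c"]) (auto simp: Hom_iff)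
  then show ?thesis using A.ext_class_zero_iff(2)[OF E(1)] E(2) by simp
qed

lemma pullback_h_surj:
  assumes x: "\<xi> \<in> Ext1 A S\<^sub>r S\<^sub>l"
  shows "\<exists>\<zeta> \<in> Ext1 A (obmap I S') S\<^sub>l. ext_pullback A S\<^sub>r S\<^sub>l h \<zeta> = \<xi>"
proof -
  obtain i q where E: "(i, q) \<in> extensions A S\<^sub>r S\<^sub>l" "\<xi> = A.ext_class S\<^sub>r S\<^sub>l (i, q)"
    using A.Ext1_cases[OF x] by (metis surj_pair)
  have e: "short_exact A i q" "src A i = S\<^sub>l" "tgt A q = S\<^sub>r" "i \<in> Arr A" "q \<in> Arr A" "src A q = tgt A i"
    "q \<cdot>\<^bsub>A\<^esub> i = mzero A S\<^sub>l S\<^sub>r"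
    using A.extensionsE[OF E(1)] by auto
  note [simp] = e(2-7)
  have "is_kernel A i (h \<cdot>\<^bsub>A\<^esub> q)"
  proof (rule A.kernelI[OF _ _ _ A.short_exactD(5)[OF e(1)]])
    fix g assume g: "g \<in> Arr A" "tgt A g = src A (h \<cdot>\<^bsub>A\<^esub> q)"
      "(h \<cdot>\<^bsub>A\<^esub> q) \<cdot>\<^bsub>A\<^esub> g = mzero A (src A g) (tgt A (h \<cdot>\<^bsub>A\<^esub> q))"
    then have "q \<cdot>\<^bsub>A\<^esub> g = mzero A (src A g) S\<^sub>r" using A.monic0[OF h_monic, of "q \<cdot>\<^bsub>A\<^esub> g"] by simp
    then show "\<exists>u \<in> Arr A. src A u = src A g \<and> tgt A u = src A i \<and> i \<cdot>\<^bsub>A\<^esub> u = g"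
      using A.short_exact_lift[OF e(1), of g] g by auto
  qed auto
  moreover have "is_cokernel A p (h \<cdot>\<^bsub>A\<^esub> q)"
  proof (rule A.cokernelI[OF _ _ _ p_epic])
    show "p \<cdot>\<^bsub>A\<^esub> (h \<cdot>\<^bsub>A\<^esub> q) = mzero A (src A (h \<cdot>\<^bsub>A\<^esub> q)) (tgt A p)" using A.reassoc[OF p_h, of q] by simp
    fix g assume g: "g \<in> Arr A" "src A g = tgt A (h \<cdot>\<^bsub>A\<^esub> q)"
      "g \<cdot>\<^bsub>A\<^esub> (h \<cdot>\<^bsub>A\<^esub> q) = mzero A (src A (h \<cdot>\<^bsub>A\<^esub> q)) (tgt A g)"
    then have "g \<cdot>\<^bsub>A\<^esub> h = mzero A S\<^sub>r (tgt A g)"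
      using A.epic0[OF A.short_exactD(6)[OF e(1)], of "g \<cdot>\<^bsub>A\<^esub> h"] by simp
    then show "\<exists>u \<in> Arr A. tgt A u = tgt A g \<and> src A u = tgt A p \<and> u \<cdot>\<^bsub>A\<^esub> p = g"
      using A.short_exact_colift[OF h_p, of g] g by auto
  qed auto
  ultimately have "(i, h \<cdot>\<^bsub>A\<^esub> q, p) \<in> extensions2 A S\<^sub>l S\<^sub>l" by (simp add: extensions2_def)
  then have "A.unspliced i (h \<cdot>\<^bsub>A\<^esub> q)" by (rule A.Ext2_zero_unspliced[OF Ext2_S\<^sub>l])
  then obtain m r where m: "m \<in> Arr A" "r \<in> Arr A" "src A m = tgt A i" "tgt A m = src A r"
    "tgt A r = obmap I S'"
    "short_exact A (m \<cdot>\<^bsub>A\<^esub> i) r" "r \<cdot>\<^bsub>A\<^esub> m = h \<cdot>\<^bsub>A\<^esub> q"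
    unfolding A.unspliced_def by auto
  note [simp] = m(1-5)
  have E': "(m \<cdot>\<^bsub>A\<^esub> i, r) \<in> extensions A (obmap I S') S\<^sub>l" by (rule A.extensionsI[OF m(6)]) auto
  have "ext_morphism A (i, q) (m \<cdot>\<^bsub>A\<^esub> i, r) (ident A S\<^sub>l) h"
    by (rule A.ext_morphismI[of m]) (use m(7) in auto)
  then have "ext_pullback A S\<^sub>r S\<^sub>l h (A.ext_class (obmap I S') S\<^sub>l (m \<cdot>\<^bsub>A\<^esub> i, r)) = \<xi>"
    using A.ext_pullback_class[OF E(1) E' h_Hom] E(2) by simp
  then show ?thesis using A.ext_class_Ext1[OF E'] by blast
qed

text \<open>Injectivity is \<open>pullback_h_zero\<close> applied to the difference of two
  classes.\<close>

lemma pullback_h_bij: "bij_betw (ext_pullback A S\<^sub>r S\<^sub>l h) (Ext1 A (obmap I S') S\<^sub>l) (Ext1 A S\<^sub>r S\<^sub>l)"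
  unfolding bij_betw_def
proof (intro conjI inj_onI)
  fix \<xi> \<zeta> assume x: "\<xi> \<in> Ext1 A (obmap I S') S\<^sub>l" and z: "\<zeta> \<in> Ext1 A (obmap I S') S\<^sub>l"
    and eq: "ext_pullback A S\<^sub>r S\<^sub>l h \<xi> = ext_pullback A S\<^sub>r S\<^sub>l h \<zeta>"
  let ?n = "A.mneg (ident A S\<^sub>l)" and ?X = "obmap I S'"
  have nH: "?n \<in> Hom A S\<^sub>l S\<^sub>l" by (simp add: Hom_iff)
  note n = A.ext_pushout_Ext1[OF z nH]
  note hz = A.ext_pullback_Ext1[OF z h_Hom]
  have "ext_pullback A S\<^sub>r S\<^sub>l h (baer_sum A ?X S\<^sub>l \<xi> (ext_pushout A ?X S\<^sub>l ?n \<zeta>))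
    = baer_sum A S\<^sub>r S\<^sub>l (ext_pullback A S\<^sub>r S\<^sub>l h \<zeta>) (ext_pushout A S\<^sub>r S\<^sub>l ?n (ext_pullback A S\<^sub>r S\<^sub>l h \<zeta>))"
    using A.ext_pullback_baer[OF x n h_Hom] A.ext_pushout_pullback[OF z h_Hom nH] eq by simp
  also have "\<dots> = ext_zero A S\<^sub>r S\<^sub>l"
    using A.baer_sum_neg[OF hz] A.baer_sum_comm[OF hz A.ext_pushout_Ext1[OF hz nH]] by simp
  finally have "baer_sum A ?X S\<^sub>l \<xi> (ext_pushout A ?X S\<^sub>l ?n \<zeta>) = ext_zero A ?X S\<^sub>l"
    by (rule pullback_h_zero[OF A.baer_sum_Ext1[OF x n]])
  then show "\<xi> = \<zeta>" by (rule A.Ext1_eqI[OF x z])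
next
  show "ext_pullback A S\<^sub>r S\<^sub>l h ` Ext1 A (obmap I S') S\<^sub>l = Ext1 A S\<^sub>r S\<^sub>l"
    using A.ext_pullback_Ext1[OF _ h_Hom] pullback_h_surj by blast
qed

lemma valuation_S\<^sub>r_S\<^sub>l: "same_valuation (valuation A S\<^sub>r S\<^sub>l) (valuation B S' S')"
proof -
  note SO [simp] = B.simpleD(1)[OF simple_S'] B.simpleD(1)[OF simple_R_S\<^sub>l]
  note abel = A.abelian_category_axioms B.abelian_category_axioms
  let ?X = "obmap I S'" and ?T = "obmap R S\<^sub>l"
  have "same_valuation (valuation A S\<^sub>r S\<^sub>l) (valuation B S' ?T)"
  proof (rule same_valuationI)
    have "(dim (opposite_ring (End_ring A S\<^sub>l)) (Ext1_left A ?X S\<^sub>l),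
      dim (opposite_ring (End_ring A S\<^sub>l)) (Ext1_left A S\<^sub>r S\<^sub>l)) \<in> ordIso"
      by (rule dim_Ext1_left[OF abel(1,1) simple_S\<^sub>l simple_S\<^sub>l _ _ _ _ pullback_h_bij, where \<beta> = "\<lambda>r. r"])
        (use A.ext_pullback_baer h_Hom A.ext_pushout_pullback bij_betw_id[unfolded id_def] in auto)
    from ordIso_transitive[OF ordIso_symmetric[OF this] IR.dim_left_adjunction[OF simple_S\<^sub>l simple_R_S\<^sub>l
      SO(1) R_End_S\<^sub>l]]
    show "(dim (opposite_ring (End_ring A S\<^sub>l)) (Ext1_left A S\<^sub>r S\<^sub>l),
      dim (opposite_ring (End_ring B ?T)) (Ext1_left B S' ?T)) \<in> ordIso" .
    define \<theta> where "\<theta> \<zeta> = ext_pullback A S\<^sub>r S\<^sub>l h (IR.psi S' S\<^sub>l \<zeta>)" for \<zeta>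
    have bij: "bij_betw \<theta> (Ext1 B S' ?T) (Ext1 A S\<^sub>r S\<^sub>l)"
      using bij_betw_trans[OF IR.psi_bij[OF SO(1) Obj_S(1)] pullback_h_bij] by
        (simp add: \<theta>_def[abs_def] comp_def)
    have \<theta>_baer: "\<theta> (baer_sum B S' ?T \<xi> \<zeta>) = baer_sum A S\<^sub>r S\<^sub>l (\<theta> \<xi>) (\<theta> \<zeta>)"
      if "\<xi> \<in> Ext1 B S' ?T" "\<zeta> \<in> Ext1 B S' ?T" for \<xi> \<zeta>
      unfolding \<theta>_def IR.psi_baer[OF that Obj_S(1)]
      by (rule A.ext_pullback_baer[OF _ _ h_Hom]) (use that IR.psi_Ext1 in auto)
    have \<theta>_pullback: "\<theta> (ext_pullback B S' ?T (armap L r) \<zeta>) = ext_pullback A S\<^sub>r S\<^sub>l r (\<theta> \<zeta>)"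
      if z: "\<zeta> \<in> Ext1 B S' ?T" and r: "r \<in> Hom A S\<^sub>r S\<^sub>r" for \<zeta> r
    proof -
      note Lr = LI.F.map_Hom[OF r] and pz = IR.psi_Ext1[OF z Obj_S(1)]
      have "armap I (armap L r) \<cdot>\<^bsub>A\<^esub> h = h \<cdot>\<^bsub>A\<^esub> r" using LI.unitD(4)[of r] HomD[OF r] by simp
      then show ?thesis
        unfolding \<theta>_def IR.psi_pullback[OF z Obj_S(1) Lr] A.ext_pullback_cmp[OF pz h_Hom r]
          A.ext_pullback_cmp[OF pz LI.G.map_Hom[OF Lr] h_Hom] by simp
    qed
    \<comment> \<open>The inverse is needed because the scalars are compared by \<open>L\<close>,
      which goes from the endomorphisms of \<open>S\<^sub>r\<close> to those of \<open>S'\<close>,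
      opposite to \<open>\<theta>\<close>.\<close>
    let ?\<theta> = "inv_into (Ext1 B S' ?T) \<theta>"
    have inv: "?\<theta> \<xi> \<in> Ext1 B S' ?T" "\<theta> (?\<theta> \<xi>) = \<xi>" if "\<xi> \<in> Ext1 A S\<^sub>r S\<^sub>l" for \<xi>
      using that bij by (auto simp: bij_betw_def inv_into_into f_inv_into_f)
    have inv': "?\<theta> (\<theta> \<zeta>) = \<zeta>" if "\<zeta> \<in> Ext1 B S' ?T" for \<zeta>
      using that bij by (simp add: bij_betw_def)
    show "(dim (End_ring A S\<^sub>r) (Ext1_right A S\<^sub>r S\<^sub>l), dim (End_ring B S') (Ext1_right B S' ?T)) \<in> ordIso"
    proof (rule dim_Ext1_right[OF abel simple_S\<^sub>r simple_S' Obj_S(1) SO(2) L_End_S\<^sub>r])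
      show "armap L (mzero A S\<^sub>r S\<^sub>r) = mzero B S' S'" by (simp add: LI.F.map_zero)
      show "bij_betw ?\<theta> (Ext1 A S\<^sub>r S\<^sub>l) (Ext1 B S' ?T)" by (rule bij_betw_inv_into[OF bij])
      show "?\<theta> (baer_sum A S\<^sub>r S\<^sub>l \<xi> \<zeta>) = baer_sum B S' ?T (?\<theta> \<xi>) (?\<theta> \<zeta>)"
        if "\<xi> \<in> Ext1 A S\<^sub>r S\<^sub>l" "\<zeta> \<in> Ext1 A S\<^sub>r S\<^sub>l" for \<xi> \<zeta>
        using \<theta>_baer[of "?\<theta> \<xi>" "?\<theta> \<zeta>"] inv[OF that(1)] inv[OF that(2)]
          inv'[OF B.baer_sum_Ext1, of "?\<theta> \<xi>" "?\<theta> \<zeta>"] by simp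
      show "?\<theta> (ext_pullback A S\<^sub>r S\<^sub>l r \<xi>) = ext_pullback B S' ?T (armap L r) (?\<theta> \<xi>)"
        if "r \<in> Hom A S\<^sub>r S\<^sub>r" "\<xi> \<in> Ext1 A S\<^sub>r S\<^sub>l" for r \<xi>
        using \<theta>_pullback[of "?\<theta> \<xi>" r] inv[OF that(2)] that(1)
          inv'[OF B.ext_pullback_Ext1[OF inv(1)[OF that(2)] LI.F.map_Hom[OF that(1)]]] by simp
    qed
  qed
  from same_valuation_trans[OF this B.valuation_iso_right[OF simple_S' simple_R_S\<^sub>l B.isomorphic_sym[OF R_S\<^sub>l]]]
  show ?thesis .
qed

lemma h_p_extension: "(h, p) \<in> extensions A S\<^sub>l S\<^sub>r"
  by (rule A.extensionsI[OF h_p]) auto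

text \<open>The class of the sequence with middle term \<open>obmap I S'\<close> is a basis on both
  sides. It generates because Ext between \<open>obmap I S'\<close> and the two simple objects
  vanishes in the relevant directions, and it is free because the corresponding Hom groups
  vanish.\<close>

lemma valuation_S\<^sub>l_S\<^sub>r: "same_valuation (valuation A S\<^sub>l S\<^sub>r) (card_of {()}, card_of {()})"
proof -
  let ?z = "A.ext_class S\<^sub>l S\<^sub>r (h, p)" and ?X = "obmap I S'"
  note z = A.ext_class_Ext1[OF h_p_extension]
  interpret Mr: div_module "End_ring A S\<^sub>l" "Ext1_right A S\<^sub>l S\<^sub>r"
    by (intro div_module.intro r_module.intro div_module_axioms.intro A.Ext1_right_module Obj_S
      A.End_division_ring simple_S\<^sub>l)
  interpret Ml: div_module "opposite_ring (End_ring A S\<^sub>r)" "Ext1_left A S\<^sub>l S\<^sub>r"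
    by (intro div_module.intro r_module.intro div_module_axioms.intro A.Ext1_left_module Obj_S
      A.opposite_End_division_ring simple_S\<^sub>r)
  have gen: "(\<exists>s \<in> Hom A S\<^sub>l S\<^sub>l. \<xi> = ext_pullback A S\<^sub>l S\<^sub>r s ?z) \<and> (\<exists>r \<in> Hom A S\<^sub>r S\<^sub>r. \<xi> = ext_pushout
    A S\<^sub>l S\<^sub>r r ?z)"
    if x: "\<xi> \<in> Ext1 A S\<^sub>l S\<^sub>r" for \<xi>
  proof -
    obtain i q where E: "(i, q) \<in> extensions A S\<^sub>l S\<^sub>r" "\<xi> = A.ext_class S\<^sub>l S\<^sub>r (i, q)"
      using A.Ext1_cases[OF x] by (metis surj_pair)
    have e: "short_exact A i q" "src A i = S\<^sub>r" "tgt A q = S\<^sub>l" "i \<in> Arr A" "q \<in> Arr A" "src A q = tgt A i"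
      using A.extensionsE[OF E(1)] by auto
    note [simp] = e(2-6)
    \<comment> \<open>Extending \<open>h\<close> over the middle term of the given extension uses
      that Ext from \<open>S\<^sub>l\<close> to the image of \<open>I\<close> is zero. The map
      \<open>s\<close> induced on the quotients exhibits the given class as a pullback of
      \<open>?z\<close>.\<close>
    obtain t where t: "t \<in> Arr A" "src A t = tgt A i" "tgt A t = ?X" "t \<cdot>\<^bsub>A\<^esub> i = h"
      by (rule A.extend_through[OF e(1), of ?X h]) (use left_perp_Ext1[OF S\<^sub>l(1), of S'] in auto)
    note [simp] = t(1-3)
    obtain s where s: "s \<in> Arr A" "src A s = S\<^sub>l" "tgt A s = S\<^sub>l" "s \<cdot>\<^bsub>A\<^esub> q = p \<cdot>\<^bsub>A\<^esub> t"
      by (rule A.short_exact_colift[OF e(1), of "p \<cdot>\<^bsub>A\<^esub> t"]) (use t(4) p_h in auto)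
    have sH: "s \<in> Hom A S\<^sub>l S\<^sub>l" using s by (simp add: Hom_iff)
    have "ext_morphism A (i, q) (h, p) (ident A S\<^sub>r) s"
      by (rule A.ext_morphismI[of t]) (use t s in auto)
    then have 1: "\<xi> = ext_pullback A S\<^sub>l S\<^sub>r s ?z"
      using A.ext_pullback_class[OF E(1) h_p_extension sH] E(2) by simp
    \<comment> \<open>Dually, lifting \<open>p\<close> through \<open>q\<close> uses that Ext from
      the image of \<open>I\<close> to \<open>S\<^sub>r\<close> is zero, and the map
      \<open>r\<close> induced on the subobjects exhibits the class as a pushout of
      \<open>?z\<close>.\<close>
    obtain u where u: "u \<in> Arr A" "src A u = ?X" "tgt A u = tgt A i" "q \<cdot>\<^bsub>A\<^esub> u = p"
      by (rule A.lift_through[OF e(1), of ?X p]) (use right_perp_Ext1[OF S\<^sub>r(1), of S'] in auto)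
    note [simp] = u(1-3)
    obtain r where r: "r \<in> Arr A" "src A r = S\<^sub>r" "tgt A r = S\<^sub>r" "i \<cdot>\<^bsub>A\<^esub> r = u \<cdot>\<^bsub>A\<^esub> h"
      by (rule A.short_exact_lift[OF e(1), of "u \<cdot>\<^bsub>A\<^esub> h"]) (use A.reassoc[OF u(4), of h] p_h in auto)
    have rH: "r \<in> Hom A S\<^sub>r S\<^sub>r" using r by (simp add: Hom_iff)
    have "ext_morphism A (h, p) (i, q) r (ident A S\<^sub>l)"
      by (rule A.ext_morphismI[of u]) (use u r in auto)
    then have 2: "\<xi> = ext_pushout A S\<^sub>l S\<^sub>r r ?z"
      using A.ext_pushout_class[OF E(1) h_p_extension rH] E(2) by simp
    show ?thesis using 1 2 sH rH by blast
  qed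
  have free_right: "s = mzero A S\<^sub>l S\<^sub>l" if s: "s \<in> Hom A S\<^sub>l S\<^sub>l"
    "ext_pullback A S\<^sub>l S\<^sub>r s ?z = ext_zero A S\<^sub>l S\<^sub>r" for s
  proof -
    obtain t where t: "t \<in> Arr A" "src A t = S\<^sub>l" "tgt A t = ?X" "p \<cdot>\<^bsub>A\<^esub> t = s"
      using A.ext_pullback_zero_iff[OF h_p_extension s(1)] s(2) by (auto simp: Hom_iff)
    have "t = mzero A S\<^sub>l ?X" by (rule left_perp_map_zero[OF S\<^sub>l(1) t(1-3)]) simp
    then show ?thesis using t(4) by simp
  qed
  have free_left: "r = mzero A S\<^sub>r S\<^sub>r" if r: "r \<in> Hom A S\<^sub>r S\<^sub>r"
    "ext_pushout A S\<^sub>l S\<^sub>r r ?z = ext_zero A S\<^sub>l S\<^sub>r" for r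
  proof -
    obtain t where t: "t \<in> Arr A" "src A t = ?X" "tgt A t = S\<^sub>r" "t \<cdot>\<^bsub>A\<^esub> h = r"
      using A.ext_pushout_zero_iff[OF h_p_extension r(1)] r(2) by (auto simp: Hom_iff)
    have "t = mzero A ?X S\<^sub>r" by (rule right_perp_map_zero[OF S\<^sub>r(1) t(1-3)]) simp
    then show ?thesis using t(4) by simp
  qed
  have "basis (End_ring A S\<^sub>l) (Ext1_right A S\<^sub>l S\<^sub>r) {?z}"
    by (rule Mr.singleton_basis) (use z gen free_right in \<open>auto simp: End_ring_def Ext1_right_def\<close>)
  moreover have "basis (opposite_ring (End_ring A S\<^sub>r)) (Ext1_left A S\<^sub>l S\<^sub>r) {?z}"
    by (rule Ml.singleton_basis) (use z gen free_left in \<open>auto simp: End_ring_def opposite_ring_def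
      Ext1_left_def\<close>)
  ultimately show ?thesis
    unfolding same_valuation_def valuation_def using Mr.dim_one Ml.dim_one by simp
qed

end

section \<open>Representatives of simple objects and the final statement\<close>

lemma (in abelian_category) rep_props:
  assumes "simple_reps C \<Sigma>" "simple C S"
  shows "rep C \<Sigma> S \<in> \<Sigma>" "isomorphic C S (rep C \<Sigma> S)"
    "\<And>T. \<lbrakk>T \<in> \<Sigma>; isomorphic C S T\<rbrakk> \<Longrightarrow> rep C \<Sigma> S = T"
proof -
  have ex: "\<exists>!T. T \<in> \<Sigma> \<and> isomorphic C S T" using assms by (simp add: simple_reps_def)
  show "rep C \<Sigma> S \<in> \<Sigma>" "isomorphic C S (rep C \<Sigma> S)"
    using theI'[OF ex] by (simp_all add: rep_def)
  show "rep C \<Sigma> S = T" if "T \<in> \<Sigma>" "isomorphic C S T" for T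
    unfolding rep_def by (rule the1_equality[OF ex]) (use that in simp)
qed

text \<open>\<open>rep\<close> appears because \<open>S\<^sub>l\<close>, \<open>S\<^sub>r\<close>,
  \<open>S'\<close> and \<open>obmap I U\<close> need not be among the chosen representatives.
  Valuations are taken at \<open>obmap I U\<close> itself, which by
  \<open>valuation_iso_left\<close> and \<open>valuation_iso_right\<close> agrees with its
  representative. The pair of cardinals of a one-element set stands for (1,1).\<close>

theorem proposition3p5p1:
  fixes A :: "('a, 'f, 'x) additive_category_scheme"
    and B :: "('b, 'g, 'y) additive_category_scheme"
    and I :: "('b, 'g, 'a, 'f) cat_functor"
    and L :: "('a, 'f, 'b, 'g) cat_functor"
    and S\<^sub>l S\<^sub>r :: 'a and S' :: 'b
    and \<Sigma>\<^sub>A :: "'a set" and \<Sigma>\<^sub>B :: "'b set"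
  assumes "nonsplit_expansion B A I"
    and "adjoint A B L I"
    and "S\<^sub>l \<in> left_perp A (ess_image B A I)" and "indecomposable A S\<^sub>l"
    and "S\<^sub>r \<in> right_perp A (ess_image B A I)" and "indecomposable A S\<^sub>r"
    and "S' = obmap L S\<^sub>r"
    and "simple_reps A \<Sigma>\<^sub>A" and "simple_reps B \<Sigma>\<^sub>B"
  shows "(\<forall>U \<in> \<Sigma>\<^sub>B - {rep B \<Sigma>\<^sub>B S'}. simple A (obmap I U)) \<and>
    bij_betw (\<lambda>U. rep A \<Sigma>\<^sub>A (obmap I U))
      (\<Sigma>\<^sub>B - {rep B \<Sigma>\<^sub>B S'}) (\<Sigma>\<^sub>A - {rep A \<Sigma>\<^sub>A S\<^sub>l, rep A \<Sigma>\<^sub>A S\<^sub>r}) \<and>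
    (\<forall>U \<in> \<Sigma>\<^sub>B - {rep B \<Sigma>\<^sub>B S'}. \<forall>V \<in> \<Sigma>\<^sub>B - {rep B \<Sigma>\<^sub>B S'}.
      same_valuation (valuation A (obmap I U) (obmap I V)) (valuation B U V) \<and>
      same_valuation (valuation A (obmap I U) S\<^sub>l) (valuation B U S') \<and>
      same_valuation (valuation A S\<^sub>r (obmap I V)) (valuation B S' V)) \<and>
    same_valuation (valuation A S\<^sub>r S\<^sub>l) (valuation B S' S') \<and>
    same_valuation (valuation A S\<^sub>l S\<^sub>r) (card_of {()}, card_of {()})"
proof -
  have exp: "left_expansion B A I" "right_expansion B A I"
    and ns: "right_perp A (ess_image B A I) \<noteq> left_perp A (ess_image B A I)"
    using assms(1) by (auto simp: nonsplit_expansion_def split_expansion_def expansion_def)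
  have abel: "abelian_category A" "abelian_category B" and ff: "fully_faithful B A I" and exI:
    "exact_functor B A I"
    using exp(1) by (auto simp: left_expansion_def)
  interpret A: abelian_category A by (rule abel(1))
  interpret B: abelian_category B by (rule abel(2))
  note cat = A.category_axioms B.category_axioms
  obtain L0 where L0: "exact_functor A B L0" "adjoint A B L0 I"
    using exp(1) unfolding left_expansion_def by blast
  obtain R where R: "exact_functor A B R" "adjoint B A I R"
    using exp(2) unfolding right_expansion_def by blast
  obtain \<eta> \<epsilon> where LI: "adjunction A B L0 I \<eta> \<epsilon>" using adjoint_adjunction[OF cat L0(2)] .
  obtain \<eta>' \<epsilon>' where IR: "adjunction B A I R \<eta>' \<epsilon>'" using adjoint_adjunction[OF cat(2,1) R(2)] .
  have eL: "exact_func A B L0" and eI: "exact_func B A I" and eR: "exact_func A B R"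
    by (intro exact_func.intro exact_func_axioms.intro abel L0 exI R)+
  interpret N: nonsplit_recollement A B L0 I R \<eta> \<epsilon> \<eta>' \<epsilon>' S\<^sub>l S\<^sub>r
  proof (intro nonsplit_recollement.intro semisimple_recollement.intro recollement.intro
      recollement_axioms.intro semisimple_recollement_axioms.intro nonsplit_recollement_axioms.intro
      exact_adjunction.intro abel eL eI eR LI IR ff ns assms(3-6))
    show "equivalent_to_mod (full_subcategory A (left_perp A (ess_image B A I)))"
      "Ext2 A S\<^sub>l S\<^sub>l = {ext2_zero A S\<^sub>l S\<^sub>l}"
      using exp(1) assms(3) by (auto simp: left_expansion_def)
    show "equivalent_to_mod (full_subcategory A (right_perp A (ess_image B A I)))"
      using exp(2) by (simp add: right_expansion_def)
  qed
  \<comment> \<open>The locale is interpreted with the exact left adjoint \<open>L0\<close>, whereas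
    \<open>S'\<close> comes from the given \<open>L\<close>. This isomorphism moves every statement
    about \<open>N.S'\<close> to \<open>S'\<close>.\<close>
  have iS: "isomorphic B N.S' S'"
    unfolding assms(7) by (rule left_adjoint_unique[OF cat L0(2) assms(2) N.Obj_S(2)])
  have sS: "simple B S'" by (rule B.simple_iso[OF N.simple_S' iS])
  note repA = A.rep_props[OF assms(8)] and repB = B.rep_props[OF assms(9)]
  have other: "simple B U" "\<not> isomorphic B U N.S'" if U: "U \<in> \<Sigma>\<^sub>B - {rep B \<Sigma>\<^sub>B S'}" for U
  proof -
    show "simple B U" using U assms(9) by (simp add: simple_reps_def)
    show "\<not> isomorphic B U N.S'"
    proof
      assume "isomorphic B U N.S'"
      then have "isomorphic B S' U" using B.isomorphic_sym[OF B.isomorphic_trans[OF _ iS]] by blast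
      then have "rep B \<Sigma>\<^sub>B S' = U" using repB(3)[OF sS] U by blast
      then show False using U by simp
    qed
  qed
  note sI = N.simple_I[OF other]
  have bij: "bij_betw (\<lambda>U. rep A \<Sigma>\<^sub>A (obmap I U))
      (\<Sigma>\<^sub>B - {rep B \<Sigma>\<^sub>B S'}) (\<Sigma>\<^sub>A - {rep A \<Sigma>\<^sub>A S\<^sub>l, rep A \<Sigma>\<^sub>A S\<^sub>r})"
    unfolding bij_betw_def
  proof (intro conjI inj_onI equalityI subsetI)
    fix U V assume U: "U \<in> \<Sigma>\<^sub>B - {rep B \<Sigma>\<^sub>B S'}" and V: "V \<in> \<Sigma>\<^sub>B - {rep B \<Sigma>\<^sub>B S'}"
      and eq: "rep A \<Sigma>\<^sub>A (obmap I U) = rep A \<Sigma>\<^sub>A (obmap I V)"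
    have "isomorphic A (obmap I U) (obmap I V)"
      using A.isomorphic_trans[OF repA(2)[OF sI[OF U U]] A.isomorphic_sym] repA(2)[OF sI[OF V V]] eq by simp
    then have i: "isomorphic B U V"
      using N.I_reflects_isomorphic B.simpleD(1) other(1)[OF U] other(1)[OF V] by blast
    have "U \<in> Obj B" using B.simpleD(1)[OF other(1)[OF U]] .
    then show "U = V"
      using repB(3)[OF other(1)[OF U], of U] repB(3)[OF other(1)[OF U], of V] i U V B.isomorphic_refl by simp
  next
    fix T assume "T \<in> (\<lambda>U. rep A \<Sigma>\<^sub>A (obmap I U)) ` (\<Sigma>\<^sub>B - {rep B \<Sigma>\<^sub>B S'})"
    then obtain U where U: "U \<in> \<Sigma>\<^sub>B - {rep B \<Sigma>\<^sub>B S'}" and T: "T = rep A \<Sigma>\<^sub>A (obmap I U)" by blast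
    note r = repA(1,2)[OF sI[OF U U], folded T]
    have "T \<noteq> rep A \<Sigma>\<^sub>A S" if S: "simple A S" "\<not> isomorphic A (obmap I U) S" for S
    proof
      assume "T = rep A \<Sigma>\<^sub>A S"
      then have "isomorphic A (obmap I U) S"
        using A.isomorphic_trans[OF r(2) A.isomorphic_sym] repA(2)[OF S(1)] by simp
      then show False using S(2) by simp
    qed
    then show "T \<in> \<Sigma>\<^sub>A - {rep A \<Sigma>\<^sub>A S\<^sub>l, rep A \<Sigma>\<^sub>A S\<^sub>r}"
      using r(1) N.simple_S\<^sub>l N.simple_S\<^sub>r N.not_isomorphic_I_S[OF B.simpleD(1)[OF other(1)[OF U]]] by simp
  next
    fix T assume T: "T \<in> \<Sigma>\<^sub>A - {rep A \<Sigma>\<^sub>A S\<^sub>l, rep A \<Sigma>\<^sub>A S\<^sub>r}"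
    then have sT: "simple A T" using assms(8) by (simp add: simple_reps_def)
    have n: "\<not> isomorphic A T S" if S: "simple A S" "T \<noteq> rep A \<Sigma>\<^sub>A S" for S
      using repA(3)[OF S(1) _ A.isomorphic_sym] S(2) T by blast
    obtain Z where Z: "simple B Z" "\<not> isomorphic B Z N.S'" "isomorphic A (obmap I Z) T"
      using N.simple_from_I[OF sT n[OF N.simple_S\<^sub>l] n[OF N.simple_S\<^sub>r]] T by blast
    \<comment> \<open>The preimage object \<open>Z\<close> is only determined up to isomorphism and
      is replaced by its representative. That this is not the one of \<open>S'\<close> follows since
      \<open>Z\<close> is not isomorphic to \<open>N.S'\<close>.\<close>
    let ?U = "rep B \<Sigma>\<^sub>B Z"
    have "?U \<noteq> rep B \<Sigma>\<^sub>B S'"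
    proof
      assume "?U = rep B \<Sigma>\<^sub>B S'"
      then have "isomorphic B Z S'"
        using B.isomorphic_trans[OF repB(2)[OF Z(1)] B.isomorphic_sym] repB(2)[OF sS] by simp
      then show False using Z(2) B.isomorphic_trans[OF _ B.isomorphic_sym[OF iS]] by blast
    qed
    then have U: "?U \<in> \<Sigma>\<^sub>B - {rep B \<Sigma>\<^sub>B S'}" using repB(1)[OF Z(1)] by simp
    have "isomorphic A (obmap I ?U) (obmap I Z)"
      by (rule N.LI.G.map_isomorphic[OF B.isomorphic_sym[OF repB(2)[OF Z(1)]]])
    then have "isomorphic A (obmap I ?U) T" using A.isomorphic_trans Z(3) by blast
    then have "rep A \<Sigma>\<^sub>A (obmap I ?U) = T" using repA(3)[OF sI[OF U U]] T by blast
    then show "T \<in> (\<lambda>U. rep A \<Sigma>\<^sub>A (obmap I U)) ` (\<Sigma>\<^sub>B - {rep B \<Sigma>\<^sub>B S'})" using U by blast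
  qed
  have v1: "same_valuation (valuation A (obmap I U) (obmap I V)) (valuation B U V)"
    if "U \<in> \<Sigma>\<^sub>B - {rep B \<Sigma>\<^sub>B S'}" "V \<in> \<Sigma>\<^sub>B - {rep B \<Sigma>\<^sub>B S'}" for U V
    by (rule N.valuation_I_I) (use other that in auto)
  have v2: "same_valuation (valuation A (obmap I U) S\<^sub>l) (valuation B U S')"
    if U: "U \<in> \<Sigma>\<^sub>B - {rep B \<Sigma>\<^sub>B S'}" for U
    by (rule same_valuation_trans[OF N.valuation_I_S\<^sub>l[OF other[OF U]] B.valuation_iso_right[OF
      other(1)[OF U] N.simple_S' iS]])
  have v3: "same_valuation (valuation A S\<^sub>r (obmap I V)) (valuation B S' V)"
    if V: "V \<in> \<Sigma>\<^sub>B - {rep B \<Sigma>\<^sub>B S'}" for V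
    by (rule same_valuation_trans[OF N.valuation_S\<^sub>r_I[OF other[OF V]] B.valuation_iso_left[OF N.simple_S'
      iS other(1)[OF V]]])
  have v4: "same_valuation (valuation A S\<^sub>r S\<^sub>l) (valuation B S' S')"
    by (rule same_valuation_trans[OF N.valuation_S\<^sub>r_S\<^sub>l
        same_valuation_trans[OF B.valuation_iso_left[OF N.simple_S' iS N.simple_S']
          B.valuation_iso_right[OF sS N.simple_S' iS]]])
  show ?thesis using sI bij v1 v2 v3 v4 N.valuation_S\<^sub>l_S\<^sub>r by blast
qed

end
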